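(* Assume the Generalised Riemann Hypothesis. Let $f(X)\in\mathbb{Z}[X]$ be a polynomial whose derivative has the form $$f'(X)=g(X)^2(aX+b),\qquad g(X)\in\mathbb{Z}[X],\ a,b\in\mathbb{Z},\ a\neq 0,$$ and assume that $\gamma=-b/a$ is not a pre-periodic point of $f$. For $Q>0$ let $P_f(Q)$ denote the number of primes $p\in[Q,2Q]$ such that the reduction $f_p$ of $f$ modulo $p$ is dynamically irreducible over $\mathbb{F}_p$. Then for $Q\ge 3$, $$P_f(Q)=O\left(\frac{Q}{\log Q\,\log\log Q}\right),$$ where the implied constant depends only on $f$.
   Context: For a polynomial $f$ over a field $\mathbb{K}$, the iterates are $f^{(0)}(X)=X$ and $f^{(n)}(X)=f(f^{(n-1)}(X))$ for $n\ge 1$. A polynomial $f\in\mathbb{K}[X]$ is called dynamically irreducible over $\mathbb{K}$ if all iterates $f^{(n)}$, $n=1,2,\ldots$, are irreducible over $\mathbb{K}$. For a prime $p$, $f_p\in\mathbb{F}_p[X]$ denotes the reduction of $f$ modulo $p$. A point $\gamma$ is pre-periodic for $f$ if its forward orbit $\{f^{(n)}(\gamma): n\ge 0\}$ is finite. *)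

theory Defs
  imports
    "HOL-Complex_Analysis.Complex_Analysis"
    "Berlekamp_Zassenhaus.Poly_Mod"
begin

section \<open>The Generalised Riemann Hypothesis\<close>

definition dirichlet_character :: "nat \<Rightarrow> (nat \<Rightarrow> complex) \<Rightarrow> bool" where
  "dirichlet_character q \<psi> \<longleftrightarrow>
     q \<ge> 1 \<and>
     (\<forall>m n. \<psi> (m * n) = \<psi> m * \<psi> n) \<and>
     (\<forall>n. \<psi> (n + q) = \<psi> n) \<and>
     (\<forall>n. \<psi> n \<noteq> 0 \<longleftrightarrow> coprime n q)"

text \<open>
  The function \<open>L\<close> is the Dirichlet L-function of \<open>\<psi>\<close> on the half-plane \<open>Re s > 0\<close>, that is, the
  analytic continuation of the Dirichlet series of \<open>\<psi>\<close> from \<open>Re s > 1\<close>. This continuation exists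
  for every Dirichlet character and is unique on the connected set \<open>{s. Re s > 0} - {1}\<close>. The point
  1 is removed because of the pole that occurs for principal characters. The half-plane contains
  the critical strip, so no continuation to the whole plane is needed below.
\<close>
definition is_dirichlet_L :: "(nat \<Rightarrow> complex) \<Rightarrow> (complex \<Rightarrow> complex) \<Rightarrow> bool" where
  "is_dirichlet_L \<psi> L \<longleftrightarrow>
     L holomorphic_on ({s. Re s > 0} - {1}) \<and>
     (\<forall>s. Re s > 1 \<longrightarrow> (\<lambda>n. \<psi> (Suc n) / of_nat (Suc n) powr s) sums L s)"

text \<open>
  The characters are not assumed primitive: the additional zeros of the L-function of an imprimitive
  character lie on the line \<open>Re s = 0\<close>. The case \<open>q = 1\<close> is the classical Riemann Hypothesis.
\<close>
definition generalised_riemann_hypothesis :: bool where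
  "generalised_riemann_hypothesis \<longleftrightarrow>
     (\<forall>q \<psi> L s. dirichlet_character q \<psi> \<longrightarrow> is_dirichlet_L \<psi> L \<longrightarrow>
        0 < Re s \<longrightarrow> Re s < 1 \<longrightarrow> L s = 0 \<longrightarrow> Re s = 1 / 2)"

section \<open>Iteration of polynomials\<close>

primrec poly_iterate :: "nat \<Rightarrow> 'a::comm_ring_1 poly \<Rightarrow> 'a poly" where
  "poly_iterate 0 f = [:0, 1:]"
| "poly_iterate (Suc n) f = pcompose f (poly_iterate n f)"

definition pre_periodic :: "'a::comm_ring_1 poly \<Rightarrow> 'a \<Rightarrow> bool" where
  "pre_periodic f x \<longleftrightarrow> finite {poly (poly_iterate n f) x | n. True}"

text \<open>
  Since the prime varies, polynomials over \<open>\<int>/p\<close> are represented by integer polynomials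
  modulo \<open>p\<close>: \<open>poly_mod.Mp p f\<close> is the reduction of \<open>f\<close>, with coefficients in \<open>{0..<p}\<close>, and
  \<open>poly_mod.irreducible_m p\<close> is irreducibility in the ring of polynomials over \<open>\<int>/p\<close>.
\<close>
definition dynamically_irreducible_mod :: "nat \<Rightarrow> int poly \<Rightarrow> bool" where
  "dynamically_irreducible_mod p f \<longleftrightarrow>
     (\<forall>n\<ge>1. poly_mod.irreducible_m (int p) (poly_iterate n (poly_mod.Mp (int p) f)))"

definition dyn_irred_prime_count :: "int poly \<Rightarrow> real \<Rightarrow> nat" where
  "dyn_irred_prime_count f Q =
     card {p::nat. prime p \<and> Q \<le> real p \<and> real p \<le> 2 * Q \<and> dynamically_irreducible_mod p f}"

end

theory Submission
  imports Defs "HOL-Probability.Probability" "HOL-Number_Theory.Number_Theory" "HOL-Real_Asymp.Real_Asymp"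
    "HOL-Computational_Algebra.Nth_Powers"
begin

text \<open>
  Let \<open>\<gamma> = - b / a\<close> and \<open>D = degree f\<close>. By Stickelberger's theorem on the parity of the number of
  irreducible factors, \<open>f\<close> can only be dynamically irreducible modulo \<open>p\<close> if the integers \<open>u n\<close>,
  which are the values \<open>lead_coeff f * f\<^sup>n(\<gamma>)\<close> cleared of denominators, are all nonresidues modulo
  \<open>p\<close>. Hence for such \<open>p\<close> the sum of \<open>K\<close> of these Legendre symbols has square \<open>K\<^sup>2\<close>. Averaging the
  square over all primes near \<open>Q\<close> and expanding, a pair \<open>(m, n)\<close> for which \<open>u m * u n\<close> is not a square
  contributes little under GRH, namely the logarithm of the conductor, which is \<open>O(D\<^sup>n)\<close>. By Runge's
  method, for each \<open>m\<close> the product is a square for a bounded number of \<open>n\<close> only. Taking \<open>n\<close> up to a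
  small multiple of \<open>ln (ln Q)\<close> gives the bound.

  For the primes, a Gaussian weight in \<open>ln (p / Q)\<close> turns the character sum into an average of the
  second derivative of \<open>log L\<close> over a vertical line just to the right of 1, where Borel-Caratheodory
  bounds it by the logarithm of the conductor, because \<open>L\<close> has no zeros to the right of 1/2.
\<close>

text \<open>Stickelberger leaves a single critical value because \<open>f'\<close> is a square times
  a linear form. By the chain rule the derivative of f^n is a square times the product of a f^i + b
  over i < n. For i \<ge> 1 the element f^i(\<theta>), with \<theta> a root of f^n modulo p, lies in
  a subfield of even index, so the norm of that factor is a square in F_p. Only i = 0 survives, and
  its norm is a value of f^n at \<gamma>. Runge's method needs f f^(k+1) not to be a square up to a
  constant square, which is not among the hypotheses. It is extracted from dynamical irreducibility
  modulo one single prime; if no large prime has that property, nothing is left to count. As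
  \<gamma> is rational, its orbit consists of S-integers, S being infinity and the primes dividing
  \<open>a\<close>. A square root has a sign at each place of S, whence a bound 2^|S| for the number
  of partners. At gap k Runge's method needs an orbit point of index beyond 2k plus a constant. So
  the indices are taken from the last quarter of {1..N}, where gaps stay below N/4 and indices above
  3N/4.\<close>

hide_const (open) up_ring.coeff up_ring.monom Module.smult comm_monoid_mult_class.coprime

section \<open>Polynomials modulo a prime ideal\<close>

text \<open>The fields needed are Z[X]/(p, F) with varying p and F, so they cannot be types.
  Congruence modulo a prime ideal replaces equality in the quotient.\<close>

locale prime_ideal_mod =
  fixes I :: "'r::idom set"
  assumes zero_mem: "0 \<in> I"
    and add_mem: "x \<in> I \<Longrightarrow> y \<in> I \<Longrightarrow> x + y \<in> I"
    and mult_mem: "x \<in> I \<Longrightarrow> y * x \<in> I"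
    and one_not_mem: "1 \<notin> I"
    and prime_mem: "x * y \<in> I \<Longrightarrow> x \<in> I \<or> y \<in> I"
begin

definition eqv :: "'r \<Rightarrow> 'r \<Rightarrow> bool" (infix "\<simeq>" 50) where
  "x \<simeq> y \<longleftrightarrow> x - y \<in> I"

lemma mult_mem': "x \<in> I \<Longrightarrow> x * y \<in> I"
  using mult_mem[of x y] by (simp add: mult.commute)

lemma uminus_mem: "x \<in> I \<Longrightarrow> - x \<in> I"
  using mult_mem[of x "- 1"] by simp

lemma diff_mem: "x \<in> I \<Longrightarrow> y \<in> I \<Longrightarrow> x - y \<in> I"
  using add_mem[of x "- y"] uminus_mem[of y] by simp

lemma sum_mem: "(\<And>i. i \<in> A \<Longrightarrow> f i \<in> I) \<Longrightarrow> sum f A \<in> I"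
  by (induction A rule: infinite_finite_induct) (auto intro: zero_mem add_mem)

lemma eqv_refl [simp]: "x \<simeq> x"
  by (simp add: eqv_def zero_mem)

lemma eqv_sym: "x \<simeq> y \<Longrightarrow> y \<simeq> x"
  unfolding eqv_def using uminus_mem[of "x - y"] by simp

lemma eqv_trans [trans]: "x \<simeq> y \<Longrightarrow> y \<simeq> z \<Longrightarrow> x \<simeq> z"
  unfolding eqv_def using add_mem[of "x - y" "y - z"] by simp

lemma eqv_mult: "x \<simeq> y \<Longrightarrow> x' \<simeq> y' \<Longrightarrow> x * x' \<simeq> y * y'"
proof -
  assume a: "x \<simeq> y" "x' \<simeq> y'"
  have "x * x' - y * y' = x' * (x - y) + y * (x' - y')" by (simp add: algebra_simps)
  with a show ?thesis unfolding eqv_def by (auto intro: add_mem mult_mem)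
qed

lemma eqv_uminus: "x \<simeq> y \<Longrightarrow> - x \<simeq> - y"
  unfolding eqv_def using uminus_mem[of "x - y"] by simp

lemma eqv_add: "x \<simeq> y \<Longrightarrow> x' \<simeq> y' \<Longrightarrow> x + x' \<simeq> y + y'"
  unfolding eqv_def using add_mem[of "x - y" "x' - y'"] by (simp add: algebra_simps)

lemma eqv_diff: "x \<simeq> y \<Longrightarrow> x' \<simeq> y' \<Longrightarrow> x - x' \<simeq> y - y'"
  unfolding eqv_def using diff_mem[of "x - y" "x' - y'"] by (simp add: algebra_simps)

lemma eqv_prod: "(\<And>i. i \<in> A \<Longrightarrow> f i \<simeq> g i) \<Longrightarrow> prod f A \<simeq> prod g A"
  by (induction A rule: infinite_finite_induct) (auto intro: eqv_mult)

lemma eqv_power: "x \<simeq> y \<Longrightarrow> x ^ n \<simeq> y ^ n"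
  by (induction n) (auto intro: eqv_mult)

lemma eqv_mem: "x \<simeq> y \<Longrightarrow> x \<in> I \<longleftrightarrow> y \<in> I"
  unfolding eqv_def using diff_mem[of x "x - y"] add_mem[of "x - y" y] by auto

lemma prod_not_mem: "finite A \<Longrightarrow> (\<And>i. i \<in> A \<Longrightarrow> f i \<notin> I) \<Longrightarrow> prod f A \<notin> I"
  by (induction A rule: finite_induct) (use one_not_mem prime_mem in auto)

lemma power_mem: "x ^ n \<in> I \<Longrightarrow> x \<in> I"
  by (induction n) (use one_not_mem prime_mem in auto)

definition coeffs_in :: "'r poly \<Rightarrow> bool" where
  "coeffs_in H \<longleftrightarrow> (\<forall>i. coeff H i \<in> I)"

lemma poly_mem: "coeffs_in H \<Longrightarrow> poly H x \<in> I"
  unfolding poly_altdef by (intro sum_mem mult_mem') (simp add: coeffs_in_def)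

lemma coeffs_in_pderiv: "coeffs_in H \<Longrightarrow> coeffs_in (pderiv H)"
  unfolding coeffs_in_def coeff_pderiv by (auto intro: mult_mem)

text \<open>Roots are split off one at a time: the product of t - x over the earlier roots is
  outside \<open>I\<close>, so primality forces G(t) into \<open>I\<close> and G is divisible by X -
  t up to \<open>I\<close>. The degree bound uses truncated subtraction: with at least
  \<open>degree P\<close> roots, \<open>G\<close> is constant.\<close>

lemma root_factorization:
  assumes "finite S" "\<And>x y. x \<in> S \<Longrightarrow> y \<in> S \<Longrightarrow> x \<noteq> y \<Longrightarrow> x - y \<notin> I"
    and "\<And>x. x \<in> S \<Longrightarrow> poly P x \<in> I"
  shows "\<exists>G. coeffs_in (P - G * (\<Prod>x\<in>S. [:- x, 1:])) \<and> degree G \<le> degree P - card S"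
  using assms
proof (induction S rule: finite_induct)
  case empty
  show ?case by (intro exI[of _ P]) (auto simp: coeffs_in_def zero_mem)
next
  case (insert t S)
  then obtain G where G: "coeffs_in (P - G * (\<Prod>x\<in>S. [:- x, 1:]))" "degree G \<le> degree P - card S"
    by auto
  have "poly (P - G * (\<Prod>x\<in>S. [:- x, 1:])) t \<in> I" by (rule poly_mem[OF G(1)])
  moreover have "poly P t \<in> I" using insert by auto
  ultimately have "poly G t * (\<Prod>x\<in>S. t - x) \<in> I"
    using diff_mem[of "poly P t" "poly (P - G * (\<Prod>x\<in>S. [:- x, 1:])) t"]
    by (simp add: poly_prod)
  moreover have "(\<Prod>x\<in>S. t - x) \<notin> I"
    by (rule prod_not_mem) (use insert in auto)
  ultimately have Gt: "poly G t \<in> I" using prime_mem by blast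
  define G' where "G' = synthetic_div G t"
  have G'eq: "G = [:- t, 1:] * G' + [:poly G t:]"
    unfolding G'_def by (rule synthetic_div_correct'[symmetric])
  have eq: "P - G' * (\<Prod>x\<in>insert t S. [:- x, 1:])
        = (P - G * (\<Prod>x\<in>S. [:- x, 1:])) + smult (poly G t) (\<Prod>x\<in>S. [:- x, 1:])"
    using insert(1,2) by (subst G'eq) (simp add: algebra_simps)
  hence "coeffs_in (P - G' * (\<Prod>x\<in>insert t S. [:- x, 1:]))"
    using G(1) Gt unfolding coeffs_in_def eq coeff_add coeff_smult by (blast intro: add_mem mult_mem')
  moreover have "degree G' \<le> degree P - card (insert t S)"
    unfolding G'_def degree_synthetic_div using G(2) insert(1,2) by simp
  ultimately show ?case by blast
qed

lemma degree_lin_prod: "degree (\<Prod>x\<in>S. [:- x, 1::'r:]) = card S" "monic (\<Prod>x\<in>S. [:- x, 1::'r:])"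
proof -
  have *: "monic (\<Prod>x\<in>S. [:- x, 1::'r:]) \<and> degree (\<Prod>x\<in>S. [:- x, 1::'r:]) = card S"
  proof (induction S rule: infinite_finite_induct)
    case (insert t S)
    let ?M = "\<Prod>x\<in>S. [:- x, 1::'r:]"
    have m: "monic ([:- t, 1:] * ?M)" using insert by (intro monic_mult) auto
    have "degree ([:- t, 1:] * ?M) = degree [:- t, 1:] + degree ?M"
      using insert m by (intro degree_mult_eq) auto
    thus ?case using insert m by simp
  qed auto
  thus "degree (\<Prod>x\<in>S. [:- x, 1::'r:]) = card S" "monic (\<Prod>x\<in>S. [:- x, 1::'r:])" by auto
qed

text \<open>With too many roots the cofactor is a constant g. Comparing coefficients at
  \<open>card S\<close>, above the degree of \<open>P\<close>, puts g into \<open>I\<close>, and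
  then every coefficient of \<open>P\<close>.\<close>

lemma card_roots_le:
  assumes "finite S" "\<And>x y. x \<in> S \<Longrightarrow> y \<in> S \<Longrightarrow> x \<noteq> y \<Longrightarrow> x - y \<notin> I"
    and "\<And>x. x \<in> S \<Longrightarrow> poly P x \<in> I" and lc: "lead_coeff P \<notin> I"
  shows "card S \<le> degree P"
proof (rule ccontr)
  assume n: "\<not> ?thesis"
  obtain G where G: "coeffs_in (P - G * (\<Prod>x\<in>S. [:- x, 1:]))" "degree G \<le> degree P - card S"
    using root_factorization[OF assms(1-3)] by auto
  then obtain g where g: "G = [:g:]" using n by (metis degree_eq_zeroE diff_is_0_eq' le_zero_eq nat_le_linear)
  have "coeff (P - G * (\<Prod>x\<in>S. [:- x, 1:])) (card S) = - g"
    using n degree_lin_prod[of S] by (simp add: g coeff_eq_0)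
  hence gI: "g \<in> I" using G(1) uminus_mem[of "- g"] unfolding coeffs_in_def by (metis minus_minus)
  have "lead_coeff P = coeff (P - G * (\<Prod>x\<in>S. [:- x, 1:])) (degree P) + g * coeff (\<Prod>x\<in>S. [:- x, 1:]) (degree P)"
    by (simp add: g)
  also have "\<dots> \<in> I" using G(1) gI unfolding coeffs_in_def by (intro add_mem mult_mem') blast+
  finally show False using lc by simp
qed

lemma complete_factorization:
  assumes "finite S" "\<And>x y. x \<in> S \<Longrightarrow> y \<in> S \<Longrightarrow> x \<noteq> y \<Longrightarrow> x - y \<notin> I"
    and "\<And>x. x \<in> S \<Longrightarrow> poly P x \<in> I" and card: "card S = degree P"
  shows "coeffs_in (P - smult (lead_coeff P) (\<Prod>x\<in>S. [:- x, 1:]))"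
proof -
  obtain G where G: "coeffs_in (P - G * (\<Prod>x\<in>S. [:- x, 1:]))" "degree G \<le> degree P - card S"
    using root_factorization[OF assms(1-3)] by auto
  then obtain g where g: "G = [:g:]" using card by (metis degree_eq_zeroE diff_self_eq_0 le_zero_eq)
  let ?M = "\<Prod>x\<in>S. [:- x, 1:]"
  have "coeff (P - G * ?M) (card S) = lead_coeff P - g"
    using degree_lin_prod[of S] card by (simp add: g)
  hence gI: "lead_coeff P - g \<in> I" using G(1) unfolding coeffs_in_def by metis
  have eq: "P - smult (lead_coeff P) ?M = (P - G * ?M) - smult (lead_coeff P - g) ?M"
    by (simp add: g algebra_simps smult_diff_left)
  show ?thesis using G(1) gI unfolding coeffs_in_def eq coeff_diff[of "P - G * ?M"] coeff_smult
    by (blast intro: diff_mem mult_mem')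
qed

lemma eval_complete_factorization:
  assumes "finite S" "\<And>x y. x \<in> S \<Longrightarrow> y \<in> S \<Longrightarrow> x \<noteq> y \<Longrightarrow> x - y \<notin> I"
    and "\<And>x. x \<in> S \<Longrightarrow> poly P x \<in> I" and card: "card S = degree P"
  shows "poly P u \<simeq> lead_coeff P * (\<Prod>x\<in>S. u - x)"
    and "t \<in> S \<Longrightarrow> poly (pderiv P) t \<simeq> lead_coeff P * (\<Prod>x\<in>S-{t}. t - x)"
proof -
  let ?M = "\<Prod>x\<in>S. [:- x, 1:]"
  have *: "coeffs_in (P - smult (lead_coeff P) ?M)" by (rule complete_factorization[OF assms])
  show "poly P u \<simeq> lead_coeff P * (\<Prod>x\<in>S. u - x)"
    using poly_mem[OF *, of u] by (simp add: eqv_def poly_prod)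
  assume t: "t \<in> S"
  have M: "?M = [:- t, 1:] * (\<Prod>x\<in>S-{t}. [:- x, 1:])"
    using t assms(1) by (rule prod.remove[rotated])
  have "pderiv ?M = [:- t, 1:] * pderiv (\<Prod>x\<in>S-{t}. [:- x, 1:]) + (\<Prod>x\<in>S-{t}. [:- x, 1:])"
    unfolding M pderiv_mult by (simp add: pderiv_pCons)
  hence "poly (pderiv ?M) t = (\<Prod>x\<in>S-{t}. t - x)"
    by (simp add: poly_prod)
  thus "poly (pderiv P) t \<simeq> lead_coeff P * (\<Prod>x\<in>S-{t}. t - x)"
    using poly_mem[OF coeffs_in_pderiv[OF *], of t] by (simp add: eqv_def pderiv_diff pderiv_smult)
qed

end

section \<open>The ideal generated by a prime and an irreducible polynomial\<close>

text \<open>The ideal (p, F) of Z[X], written with one explicit cofactor so that membership unfolds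
  to a divisibility of coefficients.\<close>

definition mod_ideal :: "nat \<Rightarrow> int poly \<Rightarrow> int poly set" where
  "mod_ideal p F = {G. \<exists>A. of_nat p dvd G - A * F}"

lemma Mp_eq_iff_dvd: "poly_mod.Mp (int p) f = poly_mod.Mp (int p) g \<longleftrightarrow> of_nat p dvd f - g"
proof -
  have "(poly_mod.Mp (int p) f = poly_mod.Mp (int p) g) \<longleftrightarrow> (\<forall>n. int p dvd coeff (f - g) n)"
    by (auto simp: poly_eq_iff poly_mod.Mp_coeff poly_mod.M_def mod_eq_dvd_iff)
  also have "\<dots> \<longleftrightarrow> of_nat p dvd f - g"
    by (simp add: of_nat_poly const_poly_dvd_iff)
  finally show ?thesis .
qed

lemma of_nat_dvd_int_poly_iff: "(of_nat p :: int poly) dvd G \<longleftrightarrow> (\<forall>n. int p dvd coeff G n)"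
  by (simp add: of_nat_poly const_poly_dvd_iff)

lemma Mp_diff_dvd: "of_nat p dvd G - poly_mod.Mp (int p) G"
  unfolding Mp_eq_iff_dvd[symmetric] by (simp add: poly_mod.Mp_Mp)

lemma lead_coeff_Mp_not_dvd:
  assumes "p > 0" "\<not> of_nat p dvd G"
  shows "poly_mod.Mp (int p) G \<noteq> 0" "\<not> int p dvd lead_coeff (poly_mod.Mp (int p) G)"
proof -
  have "poly_mod.Mp (int p) G \<noteq> poly_mod.Mp (int p) 0"
    using assms unfolding Mp_eq_iff_dvd by simp
  thus n0: "poly_mod.Mp (int p) G \<noteq> 0" by (simp add: poly_mod.Mp_0)
  let ?l = "lead_coeff (poly_mod.Mp (int p) G)"
  have "?l mod int p = ?l" by (simp add: poly_mod.Mp_coeff poly_mod.M_def)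
  thus "\<not> int p dvd ?l" using n0 by (metis dvd_imp_mod_0 leading_coeff_0_iff)
qed

text \<open>Pseudo-division multiplies H by a power of the leading coefficient of d; an inverse of
  that power modulo p turns it into genuine division modulo p.\<close>

lemma division_mod_prime:
  fixes d H :: "int poly"
  assumes p: "prime p" and d: "\<not> int p dvd lead_coeff d"
  shows "\<exists>A R. of_nat p dvd H - (A * d + R) \<and> (R = 0 \<or> degree R < degree d)"
proof -
  have d0: "d \<noteq> 0" using d by auto
  obtain q r where qr: "pseudo_divmod H d = (q, r)" by force
  define k where "k = Suc (degree H) - degree d"
  have e: "smult (lead_coeff d ^ k) H = d * q + r" and r: "r = 0 \<or> degree r < degree d"
    using pseudo_divmod[OF d0 qr] by (auto simp: k_def)
  have "coprime (int p) (lead_coeff d)"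
    using p d by (simp add: prime_imp_coprime)
  hence "coprime (lead_coeff d ^ k) (int p)"
    by (simp add: ac_simps)
  then obtain v where "[lead_coeff d ^ k * v = 1] (mod int p)"
    using cong_solve_coprime_int by blast
  then obtain w where w: "lead_coeff d ^ k * v = 1 + int p * w"
    by (metis cong_iff_lin cong_sym)
  have "smult (lead_coeff d ^ k * v) H = smult v (d * q + r)"
    using e by (metis mult.commute smult_smult)
  hence "H - ((smult v q) * d + smult v r) = of_nat p * (- smult w H)"
    unfolding w by (simp add: algebra_simps smult_add_left smult_add_right of_nat_poly)
  moreover have "smult v r = 0 \<or> degree (smult v r) < degree d"
    using r by (metis degree_smult_le le_less_trans smult_0_right)
  ultimately show ?thesis by (metis dvd_triv_left)
qed

text \<open>Euclid modulo p: the ideal J = (p, F, G) is generated modulo p by one element d. Then F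
  is A d modulo p, and irreducibility makes d a unit, so that 1 lies in J, or A a unit, so that d
  and hence G are multiples of F.\<close>

lemma mod_ideal_maximal:
  assumes p: "prime p" and irr: "poly_mod.irreducible_m (int p) F" and G: "G \<notin> mod_ideal p F"
  shows "\<exists>U. U * G - 1 \<in> mod_ideal p F"
proof -
  define J where "J = {H. \<exists>A B. of_nat p dvd H - (A * F + B * G)}"
  have J_mod: "H' \<in> J" if "H \<in> J" "of_nat p dvd H - H'" for H H'
  proof -
    from that(1) obtain A B where "of_nat p dvd H - (A * F + B * G)" by (auto simp: J_def)
    from dvd_diff[OF this that(2)] have "of_nat p dvd H' - (A * F + B * G)"
      by (simp add: algebra_simps)
    thus ?thesis by (auto simp: J_def)
  qed
  have J_comb: "H - A * d \<in> J" if "H \<in> J" "d \<in> J" for H A d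
  proof -
    from that obtain A1 B1 A2 B2 where
      h: "of_nat p dvd H - (A1 * F + B1 * G)" "of_nat p dvd d - (A2 * F + B2 * G)"
      by (auto simp: J_def)
    have "of_nat p dvd (H - (A1 * F + B1 * G)) - A * (d - (A2 * F + B2 * G))"
      by (intro dvd_diff h dvd_mult)
    also have "\<dots> = (H - A * d) - ((A1 - A * A2) * F + (B1 - A * B2) * G)"
      by (simp add: algebra_simps)
    finally show ?thesis unfolding J_def by blast
  qed
  have FJ: "F \<in> J" unfolding J_def by (intro CollectI exI[of _ 1] exI[of _ 0]) simp
  have GJ: "G \<in> J" unfolding J_def by (intro CollectI exI[of _ 0] exI[of _ 1]) simp
  have F0: "\<not> of_nat p dvd F"
    using irr unfolding poly_mod.irreducible_m_def Mp_eq_iff_dvd by simp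
  \<comment> \<open>Since J contains all multiples of p, minimality of the degree is only meaningful
    among elements whose leading coefficient is a unit modulo p.\<close>
  define Q where "Q = (\<lambda>d. d \<in> J \<and> \<not> int p dvd lead_coeff d)"
  have "Q (poly_mod.Mp (int p) F)"
    unfolding Q_def using J_mod[OF FJ Mp_diff_dvd] lead_coeff_Mp_not_dvd(2)[OF _ F0] prime_gt_0_nat[OF p] by simp
  then obtain d where dQ: "Q d" and dmin: "\<And>d'. Q d' \<Longrightarrow> degree d \<le> degree d'"
    using ex_has_least_nat[of Q _ degree] by blast
  have mult: "\<exists>A. of_nat p dvd H - A * d" if H: "H \<in> J" for H
  proof -
    obtain A R where AR: "of_nat p dvd H - (A * d + R)" "R = 0 \<or> degree R < degree d"
      using division_mod_prime[OF p, of d H] dQ by (auto simp: Q_def)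
    have "R \<in> J"
      by (rule J_mod[OF J_comb[OF H, of d A]]) (use dQ AR in \<open>auto simp: Q_def algebra_simps\<close>)
    have "of_nat p dvd R"
    proof (rule ccontr)
      assume n: "\<not> of_nat p dvd R"
      have "Q (poly_mod.Mp (int p) R)"
        unfolding Q_def using J_mod[OF \<open>R \<in> J\<close> Mp_diff_dvd] lead_coeff_Mp_not_dvd(2)[OF _ n] prime_gt_0_nat[OF p] by simp
      from dmin[OF this] have "degree d \<le> degree R"
        using poly_mod.degree_m_le_degree[of "int p" R] by linarith
      with AR(2) n show False by auto
    qed
    with AR(1) have "of_nat p dvd (H - (A * d + R)) + R" by (rule dvd_add)
    thus ?thesis by (auto simp: algebra_simps)
  qed
  obtain A where A: "of_nat p dvd F - A * d" using mult[OF FJ] by blast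
  hence "poly_mod.dvdm (int p) A 1 \<or> poly_mod.dvdm (int p) d 1"
    using irr unfolding poly_mod.irreducible_m_def by (metis Mp_eq_iff_dvd)
  thus ?thesis
  proof
    assume "poly_mod.dvdm (int p) d 1"
    then obtain V where V: "of_nat p dvd 1 - d * V"
      unfolding poly_mod.dvdm_def Mp_eq_iff_dvd by blast
    have "0 - (- V) * d \<in> J" by (rule J_comb) (use dQ J_comb[OF FJ FJ, of 1] in \<open>auto simp: Q_def\<close>)
    moreover have "of_nat p dvd - (1 - d * V)" using V by (simp only: dvd_minus_iff)
    hence "of_nat p dvd (0 - (- V) * d) - 1" by (simp add: algebra_simps)
    ultimately have "1 \<in> J" by (rule J_mod)
    then obtain A B where "of_nat p dvd 1 - (A * F + B * G)" by (auto simp: J_def)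
    hence "of_nat p dvd - (1 - (A * F + B * G))" by (simp only: dvd_minus_iff)
    hence "of_nat p dvd (B * G - 1) - (- A) * F" by (simp add: algebra_simps)
    thus ?thesis unfolding mod_ideal_def by blast
  next
    assume "poly_mod.dvdm (int p) A 1"
    then obtain V where V: "of_nat p dvd 1 - A * V"
      unfolding poly_mod.dvdm_def Mp_eq_iff_dvd by blast
    obtain B where B: "of_nat p dvd G - B * d" using mult[OF GJ] by blast
    have "of_nat p dvd (G - B * d) + (B * d * (1 - A * V)) - B * V * (F - A * d)"
      by (intro dvd_add dvd_diff B V A dvd_mult)
    hence "of_nat p dvd G - (B * V) * F" by (simp add: algebra_simps)
    hence "G \<in> mod_ideal p F" unfolding mod_ideal_def by blast
    with G show ?thesis by simp
  qed
qed

lemma mod_ideal_prime: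
  assumes p: "prime p" and irr: "poly_mod.irreducible_m (int p) F"
  shows "prime_ideal_mod (mod_ideal p F)"
proof
  let ?I = "mod_ideal p F"
  show "0 \<in> ?I" unfolding mod_ideal_def by (auto intro: exI[of _ 0])
  show add: "x + y \<in> ?I" if "x \<in> ?I" "y \<in> ?I" for x y
  proof -
    from that obtain A B where "of_nat p dvd x - A * F" "of_nat p dvd y - B * F"
      by (auto simp: mod_ideal_def)
    hence "of_nat p dvd (x - A * F) + (y - B * F)" by (rule dvd_add)
    hence "of_nat p dvd (x + y) - (A + B) * F" by (simp add: algebra_simps)
    thus ?thesis by (auto simp: mod_ideal_def)
  qed
  show mul: "y * x \<in> ?I" if "x \<in> ?I" for x y
  proof -
    from that obtain A where "of_nat p dvd x - A * F" by (auto simp: mod_ideal_def)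
    hence "of_nat p dvd y * (x - A * F)" by (rule dvd_mult)
    hence "of_nat p dvd y * x - (y * A) * F" by (simp add: algebra_simps)
    thus ?thesis by (auto simp: mod_ideal_def)
  qed
  show "1 \<notin> ?I"
  proof
    assume "1 \<in> ?I"
    then obtain A where "of_nat p dvd 1 - F * A" by (auto simp: mod_ideal_def mult.commute)
    hence "poly_mod.dvdm (int p) F 1" unfolding poly_mod.dvdm_def Mp_eq_iff_dvd by blast
    with irr show False unfolding poly_mod.irreducible_m_def by blast
  qed
  show "x \<in> ?I \<or> y \<in> ?I" if "x * y \<in> ?I" for x y
  proof (rule disjCI)
    assume "y \<notin> ?I"
    then obtain U where U: "U * y - 1 \<in> ?I" using mod_ideal_maximal[OF p irr] by blast
    have "U * (x * y) + (- x) * (U * y - 1) \<in> ?I" by (intro add mul that U)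
    thus "x \<in> ?I" by (simp add: algebra_simps)
  qed
qed

text \<open>A multiple A F with A nonzero modulo p keeps degree at least \<open>degree F\<close>, as
  the product of the two leading coefficients is prime to p. Hence distinct remainders represent
  distinct classes.\<close>

lemma mod_ideal_degree_less:
  assumes p: "prime p" and lc: "\<not> int p dvd lead_coeff F"
    and G: "G \<in> mod_ideal p F" "G = 0 \<or> degree G < degree F"
  shows "of_nat p dvd G"
proof -
  from G obtain A where A: "of_nat p dvd G - A * F" by (auto simp: mod_ideal_def)
  have "of_nat p dvd A"
  proof (rule ccontr)
    assume n: "\<not> of_nat p dvd A"
    define A' where "A' = poly_mod.Mp (int p) A"
    have A': "A' \<noteq> 0" "\<not> int p dvd lead_coeff A'" "of_nat p dvd A - A'"
      unfolding A'_def using lead_coeff_Mp_not_dvd[OF _ n] prime_gt_0_nat[OF p] Mp_diff_dvd by auto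
    have "of_nat p dvd (G - A * F) + (A - A') * F" by (intro dvd_add A dvd_mult2 A')
    hence d: "of_nat p dvd G - A' * F" by (simp add: algebra_simps)
    have "coeff G (degree A' + degree F) = 0" using G(2) by (auto intro: coeff_eq_0)
    hence "int p dvd lead_coeff A' * lead_coeff F"
      using d[unfolded of_nat_dvd_int_poly_iff, rule_format, of "degree A' + degree F"]
      by (simp add: coeff_mult_degree_sum)
    thus False using A' lc p by (simp add: prime_dvd_mult_iff)
  qed
  hence "of_nat p dvd (G - A * F) + A * F" by (intro dvd_add A dvd_mult2)
  thus ?thesis by simp
qed

section \<open>Frobenius\<close>

lemma freshman_dvd:
  fixes x y :: "'a::comm_ring_1"
  assumes p: "prime p"
  shows "of_nat p dvd (x + y) ^ p - (x ^ p + y ^ p)"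
proof -
  have p1: "p > 1" using p prime_gt_1_nat by blast
  define t where "t = (\<lambda>k. of_nat (p choose k) * x ^ k * y ^ (p - k))"
  have "(x + y) ^ p = sum t {..p}" unfolding t_def by (rule binomial_ring)
  also have "{..p} = insert 0 (insert p {1..<p})" using p1 by auto
  also have "sum t \<dots> = y ^ p + x ^ p + sum t {1..<p}" using p1 by (simp add: t_def)
  finally have "(x + y) ^ p - (x ^ p + y ^ p) = sum t {1..<p}" by simp
  also have "of_nat p dvd sum t {1..<p}"
  proof (rule dvd_sum)
    fix k assume "k \<in> {1..<p}"
    hence "p dvd (p choose k)" using p by (intro dvd_choose_prime) auto
    then obtain m where "p choose k = p * m" by (elim dvdE)
    thus "of_nat p dvd t k" by (simp add: t_def mult.assoc)
  qed
  finally show ?thesis .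
qed

lemma fermat_int_dvd:
  assumes p: "prime p"
  shows "int p dvd a ^ p - a"
proof -
  have *: "int p dvd (int n) ^ p - int n" for n
  proof (induction n)
    case 0
    show ?case using prime_gt_0_nat[OF p] by (simp add: zero_power)
  next
    case (Suc n)
    have "int p dvd ((int n + 1) ^ p - ((int n) ^ p + 1 ^ p)) + ((int n) ^ p - int n)"
      using freshman_dvd[OF p, of "int n" 1] Suc by (intro dvd_add) auto
    thus ?case by (simp add: algebra_simps)
  qed
  define n where "n = nat (a mod int p)"
  have n: "[a = int n] (mod int p)"
    using prime_gt_0_nat[OF p] by (simp add: n_def cong_def)
  have "[a ^ p - a = int n ^ p - int n] (mod int p)"
    by (intro cong_diff cong_pow n)
  thus ?thesis using *[of n] cong_dvd_iff by blast
qed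

lemma dvd_power_diff: "(d::'a::comm_ring_1) dvd x - y \<Longrightarrow> d dvd x ^ n - y ^ n"
  unfolding power_diff_sumr2 by simp

text \<open>Fermat's little theorem fixes the coefficients, and the binomial theorem modulo p
  distributes the p-th power over the sum.\<close>

lemma pcompose_frobenius:
  fixes G :: "int poly"
  assumes p: "prime p"
  shows "of_nat p dvd pcompose G (monom 1 p) - G ^ p"
proof (induction G rule: pCons_induct)
  case 0
  show ?case using prime_gt_0_nat[OF p] by (simp add: zero_power)
next
  case (pCons a G)
  have 1: "of_nat p dvd ([:a:] :: int poly) ^ p - [:a:]"
    using fermat_int_dvd[OF p, of a] by (simp add: of_nat_dvd_int_poly_iff poly_const_pow coeff_pCons split: nat.split)
  have 2: "of_nat p dvd ([:a:] + [:0, 1:] * G) ^ p - ([:a:] ^ p + ([:0, 1:] * G) ^ p)"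
    by (rule freshman_dvd[OF p])
  have 3: "of_nat p dvd monom 1 p * (pcompose G (monom 1 p) - G ^ p)"
    using pCons.IH by (rule dvd_mult)
  have "of_nat p dvd monom 1 p * (pcompose G (monom 1 p) - G ^ p)
      - (([:a:] + [:0, 1:] * G) ^ p - ([:a:] ^ p + ([:0, 1:] * G) ^ p)) - ([:a:] ^ p - [:a:])"
    by (rule dvd_diff[OF dvd_diff[OF 3 2] 1])
  also have "\<dots> = pcompose (pCons a G) (monom 1 p) - (pCons a G) ^ p"
  proof -
    have 1: "([:0, 1:] * G) ^ p = monom 1 p * G ^ p"
      by (simp only: power_mult_distrib monom_altdef smult_1_left)
    have 2: "pCons a G = [:a:] + [:0, 1:] * G" by simp
    show ?thesis unfolding pcompose_pCons 1 unfolding 2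
      by (simp only: algebra_simps)
  qed
  finally show ?case .
qed

lemma pcompose_frobenius_iter:
  fixes G :: "int poly"
  assumes p: "prime p"
  shows "of_nat p dvd pcompose G (monom 1 (p ^ j)) - G ^ (p ^ j)"
proof (induction j)
  case 0
  have "monom 1 1 = [:0, 1::int:]" by (simp add: monom_altdef)
  thus ?case by (simp only: power_0 pcompose_idR power_one_right diff_self dvd_0_right)
next
  case (Suc j)
  have X: "monom 1 (p ^ Suc j) = pcompose (monom 1 (p ^ j)) (monom 1 p :: int poly)"
    by (simp add: monom_altdef pcompose_hom.hom_power pcompose_pCons flip: power_mult)
  have "of_nat p dvd pcompose (pcompose G (monom 1 (p ^ j))) (monom 1 p) - (pcompose G (monom 1 (p ^ j))) ^ p"
    by (rule pcompose_frobenius[OF p])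
  moreover have "of_nat p dvd (pcompose G (monom 1 (p ^ j))) ^ p - (G ^ (p ^ j)) ^ p"
    by (rule dvd_power_diff[OF Suc])
  ultimately have "of_nat p dvd (pcompose (pcompose G (monom 1 (p ^ j))) (monom 1 p) - (pcompose G (monom 1 (p ^ j))) ^ p)
     + ((pcompose G (monom 1 (p ^ j))) ^ p - (G ^ (p ^ j)) ^ p)"
    by (rule dvd_add)
  thus ?case unfolding X pcompose_assoc by (simp add: mult.commute flip: power_mult)
qed

text \<open>Each unordered pair contributes (t j - t i)(t i - t j), so the product of all ordered
  differences is the Vandermonde square with one sign for each pair.\<close>

lemma prod_differences:
  fixes t :: "nat \<Rightarrow> 'a::comm_ring_1"
  shows "(\<Prod>j<n. \<Prod>i\<in>{..<n}-{j}. t j - t i) = (-1) ^ (\<Sum>j<n. j) * (\<Prod>j<n. \<Prod>i<j. t j - t i) ^ 2"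
proof (induction n)
  case (Suc n)
  have "(\<Prod>j<n. \<Prod>i\<in>{..<Suc n}-{j}. t j - t i) = (\<Prod>j<n. (\<Prod>i\<in>{..<n}-{j}. t j - t i) * (t j - t n))"
  proof (rule prod.cong[OF refl])
    fix j assume "j \<in> {..<n}"
    hence "{..<Suc n} - {j} = insert n ({..<n} - {j})" by auto
    thus "(\<Prod>i\<in>{..<Suc n}-{j}. t j - t i) = (\<Prod>i\<in>{..<n}-{j}. t j - t i) * (t j - t n)"
      by (simp add: mult.commute)
  qed
  also have "\<dots> = (\<Prod>j<n. \<Prod>i\<in>{..<n}-{j}. t j - t i) * (\<Prod>j<n. - 1 * (t n - t j))"
    by (simp add: prod.distrib)
  also have "(\<Prod>j<n. - 1 * (t n - t j)) = (-1) ^ n * (\<Prod>j<n. t n - t j)"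
    unfolding prod.distrib by simp
  finally have *: "(\<Prod>j<n. \<Prod>i\<in>{..<Suc n}-{j}. t j - t i)
      = (-1) ^ (\<Sum>j<n. j) * (\<Prod>j<n. \<Prod>i<j. t j - t i) ^ 2 * ((-1) ^ n * (\<Prod>j<n. t n - t j))"
    using Suc by simp
  have "{..<Suc n} - {n} = {..<n}" by auto
  hence "(\<Prod>j<Suc n. \<Prod>i\<in>{..<Suc n}-{j}. t j - t i)
      = (\<Prod>j<n. \<Prod>i\<in>{..<Suc n}-{j}. t j - t i) * (\<Prod>i<n. t n - t i)"
    by simp
  thus ?case unfolding * by (simp add: power_add power2_eq_square algebra_simps)
qed simp

section \<open>The discriminant of an irreducible polynomial modulo a prime\<close>

text \<open>Z[X]/(p, F) is the field with p^e elements, e = \<open>degree F\<close>, and the class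
  of X is a root \<theta> of F in it.\<close>

locale irreducible_mod_prime =
  fixes p :: nat and F :: "int poly"
  assumes p: "prime p"
    and lc: "\<not> int p dvd lead_coeff F"
    and irr: "poly_mod.irreducible_m (int p) F"
    and deg: "degree F > 0"
begin

sublocale prime_ideal_mod "mod_ideal p F"
  by (rule mod_ideal_prime[OF p irr])

notation eqv (infix "\<simeq>" 50)

abbreviation "I \<equiv> mod_ideal p F"

text \<open>The conjugate of \<theta> under the j-th power of Frobenius; composing G with it applies
  that automorphism to the class of G.\<close>

definition gal :: "nat \<Rightarrow> int poly" where "gal j = monom 1 (p ^ j)"

lemma dvd_mem: "of_nat p dvd x \<Longrightarrow> x \<in> I"
  unfolding mod_ideal_def by (auto intro: exI[of _ 0])

lemma dvd_eqv: "of_nat p dvd x - y \<Longrightarrow> x \<simeq> y"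
  unfolding eqv_def by (rule dvd_mem)

lemma F_mem: "F \<in> I"
  unfolding mod_ideal_def by (auto intro: exI[of _ 1])

lemma const_not_mem: "\<not> int p dvd c \<Longrightarrow> [:c:] \<notin> I"
  using mod_ideal_degree_less[OF p lc, of "[:c:]"] deg by (auto simp: of_nat_dvd_int_poly_iff coeff_pCons split: nat.splits)

lemma const_eqv: "[a = b] (mod int p) \<Longrightarrow> [:a:] \<simeq> [:b:]"
  by (rule dvd_eqv) (auto simp: of_nat_dvd_int_poly_iff coeff_pCons cong_iff_dvd_diff split: nat.splits)

lemma gal_0: "gal 0 = [:0, 1:]"
  by (simp add: gal_def monom_altdef)

lemma gal_add: "gal (i + j) = gal i ^ (p ^ j)"
  by (simp add: gal_def monom_altdef power_add flip: power_mult)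

lemma pcompose_gal: "pcompose G (gal j) \<simeq> G ^ (p ^ j)"
  unfolding gal_def by (rule dvd_eqv[OF pcompose_frobenius_iter[OF p]])

lemma pcompose_eqv: "x \<simeq> y \<Longrightarrow> pcompose G x \<simeq> pcompose G y"
  by (induction G rule: pCons_induct) (auto simp: pcompose_pCons intro: eqv_add eqv_mult)

lemma pcompose_gal_Suc: "pcompose G (gal (Suc j)) \<simeq> (pcompose G (gal j)) ^ p"
proof -
  have "pcompose G (gal (Suc j)) \<simeq> (G ^ (p ^ j)) ^ p"
    using pcompose_gal[of G "Suc j"] by (simp add: mult.commute flip: power_mult)
  also have "(G ^ (p ^ j)) ^ p \<simeq> (pcompose G (gal j)) ^ p"
    by (rule eqv_power[OF eqv_sym[OF pcompose_gal]])
  finally show ?thesis .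
qed

text \<open>Frobenius is additive, and a prime ideal contains x - y as soon as it contains a power
  of it.\<close>

lemma frobenius_inj: "x ^ (p ^ j) \<simeq> y ^ (p ^ j) \<Longrightarrow> x \<simeq> y"
proof -
  assume a: "x ^ (p ^ j) \<simeq> y ^ (p ^ j)"
  have "(x - y) ^ (p ^ j) \<simeq> pcompose (x - y) (gal j)" by (rule eqv_sym[OF pcompose_gal])
  also have "pcompose (x - y) (gal j) \<simeq> x ^ (p ^ j) - y ^ (p ^ j)"
    unfolding pcompose_diff by (intro eqv_diff pcompose_gal)
  finally have "(x - y) ^ (p ^ j) \<in> I" using a eqv_mem unfolding eqv_def by blast
  thus ?thesis unfolding eqv_def by (rule power_mem)
qed

text \<open>If the k-th Frobenius fixed \<theta>, it would fix all p^e classes, which would then be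
  roots of T^(p^k) - T, a polynomial of degree p^k < p^e.\<close>

lemma gal_neq_gal_0:
  assumes k: "0 < k" "k < degree F"
  shows "\<not> gal k \<simeq> gal 0"
proof
  assume a: "gal k \<simeq> gal 0"
  have fixed: "G ^ (p ^ k) \<simeq> G" for G
  proof -
    have "G ^ (p ^ k) \<simeq> pcompose G (gal k)" by (rule eqv_sym[OF pcompose_gal])
    also have "pcompose G (gal k) \<simeq> pcompose G (gal 0)" by (rule pcompose_eqv[OF a])
    finally show ?thesis unfolding gal_0 pcompose_idR .
  qed
  have p1: "p > 1" using p prime_gt_1_nat by blast
  \<comment> \<open>Coefficient lists of length e with entries in {0..<p} enumerate the residue
    classes modulo (p, F).\<close>
  define X where "X = {xs. set xs \<subseteq> {0..<int p} \<and> length xs = degree F}"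
  have X: "finite X" "card X = p ^ degree F"
    unfolding X_def using card_lists_length_eq[of "{0..<int p}"] finite_lists_length_eq[of "{0..<int p}"] by auto
  have distinct: "xs = ys" if xy: "xs \<in> X" "ys \<in> X" "Poly xs - Poly ys \<in> I" for xs ys
  proof (rule nth_equalityI)
    show "length xs = length ys" using xy by (auto simp: X_def)
    fix i assume i: "i < length xs"
    have len: "length xs = degree F" "length ys = degree F" using xy by (auto simp: X_def)
    have "coeff (Poly xs - Poly ys) n = 0" if "n \<ge> degree F" for n
      using that len by (simp add: nth_default_def)
    hence "Poly xs - Poly ys = 0 \<or> degree (Poly xs - Poly ys) < degree F"
      by (metis leading_coeff_0_iff not_le)
    hence "of_nat p dvd Poly xs - Poly ys" using mod_ideal_degree_less[OF p lc xy(3)] by blast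
    hence dvd: "int p dvd xs ! i - ys ! i"
      using i len by (auto simp: of_nat_dvd_int_poly_iff nth_default_def dest: spec[of _ i])
    have "xs ! i \<in> set xs" "ys ! i \<in> set ys" using i len by auto
    hence "xs ! i \<in> {0..<int p}" "ys ! i \<in> {0..<int p}" using xy unfolding X_def by blast+
    moreover have "xs ! i mod int p = ys ! i mod int p" using dvd by (simp only: mod_eq_dvd_iff)
    ultimately show "xs ! i = ys ! i" by simp
  qed
  define S where "S = Poly ` X"
  have inj: "inj_on Poly X" by (rule inj_onI) (use distinct zero_mem in auto)
  define P where "P = monom (1 :: int poly) (p ^ k) - monom 1 1"
  have pk: "p ^ k > 1" using p1 k by (intro one_less_power)
  have dP: "degree P = p ^ k"
    unfolding P_def by (rule antisym, intro degree_diff_le) (use pk in \<open>auto simp: degree_monom_eq intro!: le_degree\<close>)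
  have lP: "lead_coeff P = 1" unfolding dP using pk by (simp add: P_def)
  have "card S \<le> degree P"
  proof (rule card_roots_le)
    show "finite S" using X by (simp add: S_def)
    show "x - y \<notin> I" if "x \<in> S" "y \<in> S" "x \<noteq> y" for x y
      using that distinct by (auto simp: S_def)
    show "poly P x \<in> I" for x
      using fixed[of x] by (simp add: P_def poly_monom eqv_def)
    show "lead_coeff P \<notin> I" unfolding lP by (rule one_not_mem)
  qed
  hence "p ^ degree F \<le> p ^ k" using X inj by (simp add: dP S_def card_image)
  thus False using k p1 by simp
qed

lemma gal_distinct:
  assumes ij: "i < degree F" "j < degree F" "i \<noteq> j"
  shows "gal i - gal j \<notin> I"
proof -
  have *: "\<not> gal j \<simeq> gal i" if "i < j" "j < degree F" for i j
  proof
    assume "gal j \<simeq> gal i"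
    hence "gal (j - i) ^ (p ^ i) \<simeq> gal 0 ^ (p ^ i)"
      using that gal_add[of "j - i" i] gal_add[of 0 i] by simp
    hence "gal (j - i) \<simeq> gal 0" by (rule frobenius_inj)
    thus False using gal_neq_gal_0[of "j - i"] that by simp
  qed
  show ?thesis
  proof (cases "i < j")
    case True
    thus ?thesis using *[of i j] ij eqv_sym unfolding eqv_def[symmetric] by blast
  next
    case False
    thus ?thesis using *[of j i] ij unfolding eqv_def[symmetric] by simp
  qed
qed

lemma inj_on_gal: "inj_on gal {..<degree F}"
  by (rule inj_onI) (use gal_distinct zero_mem in force)

text \<open>F with its coefficients regarded as constants of Z[X], so that \<open>poly\<close>
  evaluates it at elements of Z[X] and the root lemmas apply.\<close>

definition "FF = map_poly (\<lambda>c. [:c:]) F"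

lemma poly_FF: "poly FF u = pcompose F u" "poly (pderiv FF) u = pcompose (pderiv F) u"
  and degree_FF: "degree FF = degree F" and lead_coeff_FF: "lead_coeff FF = [:lead_coeff F:]"
proof -
  show "poly FF u = pcompose F u" by (simp add: FF_def pcompose_altdef)
  have "pderiv FF = map_poly (\<lambda>c. [:c:]) (pderiv F)"
    by (rule poly_eqI) (simp add: FF_def coeff_pderiv coeff_map_poly of_nat_poly)
  thus "poly (pderiv FF) u = pcompose (pderiv F) u" by (simp add: pcompose_altdef)
  show "degree FF = degree F" unfolding FF_def by (rule degree_map_poly) auto
  thus "lead_coeff FF = [:lead_coeff F:]" by (simp add: FF_def coeff_map_poly)
qed

lemma pcompose_F_gal_mem: "pcompose F (gal j) \<in> I"
proof -
  have "F ^ (p ^ j) \<in> I"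
    using F_mem prime_gt_0_nat[OF p] mult_mem'[of F "F ^ (p ^ j - 1)"]
    by (metis power_eq_if zero_less_power not_gr0)
  thus ?thesis using pcompose_gal eqv_mem by blast
qed

lemma gal_factorization:
  shows "pcompose F u \<simeq> [:lead_coeff F:] * (\<Prod>j<degree F. u - gal j)"
    and "j < degree F \<Longrightarrow> pcompose (pderiv F) (gal j) \<simeq> [:lead_coeff F:] * (\<Prod>i\<in>{..<degree F}-{j}. gal j - gal i)"
proof -
  let ?S = "gal ` {..<degree F}"
  have S: "finite ?S" "\<And>x y. x \<in> ?S \<Longrightarrow> y \<in> ?S \<Longrightarrow> x \<noteq> y \<Longrightarrow> x - y \<notin> I"
    "\<And>x. x \<in> ?S \<Longrightarrow> poly FF x \<in> I" "card ?S = degree FF"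
    using gal_distinct pcompose_F_gal_mem inj_on_gal by (auto simp: poly_FF degree_FF card_image)
  show "pcompose F u \<simeq> [:lead_coeff F:] * (\<Prod>j<degree F. u - gal j)"
    using eval_complete_factorization(1)[OF S, of u] inj_on_gal
    by (simp add: poly_FF lead_coeff_FF prod.reindex)
  assume j: "j < degree F"
  have "?S - {gal j} = gal ` ({..<degree F} - {j})"
    using j inj_on_gal by (auto simp: inj_on_def)
  moreover have "inj_on gal ({..<degree F} - {j})" using inj_on_gal by (rule inj_on_diff)
  ultimately show "pcompose (pderiv F) (gal j) \<simeq> [:lead_coeff F:] * (\<Prod>i\<in>{..<degree F}-{j}. gal j - gal i)"
    using eval_complete_factorization(2)[OF S, of "gal j"] j
    by (simp add: poly_FF lead_coeff_FF prod.reindex)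
qed

text \<open>Evaluating the factorization of F at this conjugate makes one factor vanish, so it
  equals some \<open>gal i\<close> with i < e. Undoing i Frobenius steps leaves
  \<open>gal (e - i)\<close> equal to \<open>gal 0\<close>, which forces i = 0.\<close>

lemma gal_degree: "gal (degree F) \<simeq> gal 0"
proof -
  have "[:lead_coeff F:] * (\<Prod>j<degree F. gal (degree F) - gal j) \<in> I"
    using gal_factorization(1) pcompose_F_gal_mem eqv_mem by blast
  hence "(\<Prod>j<degree F. gal (degree F) - gal j) \<in> I"
    using const_not_mem[OF lc] prime_mem by blast
  then obtain i where i: "i < degree F" "gal (degree F) \<simeq> gal i"
    using prod_not_mem[of "{..<degree F}" "\<lambda>j. gal (degree F) - gal j"] unfolding eqv_def by auto
  hence "gal (degree F - i) ^ (p ^ i) \<simeq> gal 0 ^ (p ^ i)"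
    using gal_add[of "degree F - i" i] gal_add[of 0 i] by simp
  hence "gal (degree F - i) \<simeq> gal 0" by (rule frobenius_inj)
  hence "i = 0" using gal_neq_gal_0[of "degree F - i"] i by (cases "i = 0") auto
  with i show ?thesis by simp
qed

text \<open>The norm from the field with p^e elements down to F_p.\<close>

definition nrm :: "int poly \<Rightarrow> int poly" where
  "nrm G = (\<Prod>j<degree F. pcompose G (gal j))"

lemma nrm_mult: "nrm (G * H) = nrm G * nrm H"
  by (simp add: nrm_def pcompose_mult prod.distrib)

lemma cyclic_prod_frobenius:
  assumes "x m \<simeq> x 0" "\<And>j. j < m \<Longrightarrow> x (Suc j) \<simeq> x j ^ p"
  shows "(\<Prod>j<m. x j) ^ p \<simeq> (\<Prod>j<m. x j)"
proof (cases m)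
  case (Suc m')
  have "(\<Prod>j<m. x j) ^ p = (\<Prod>j<m. x j ^ p)" by (rule prod_power_distrib)
  also have "\<dots> \<simeq> (\<Prod>j<m. x (Suc j))"
    by (rule eqv_prod) (use assms eqv_sym in auto)
  also have "(\<Prod>j<m. x (Suc j)) = (\<Prod>j<m'. x (Suc j)) * x m" by (simp add: Suc)
  also have "\<dots> \<simeq> (\<Prod>j<m'. x (Suc j)) * x 0" by (intro eqv_mult assms) simp
  also have "\<dots> = (\<Prod>j<m. x j)" unfolding Suc prod.lessThan_Suc_shift by (simp add: mult.commute)
  finally show ?thesis .
qed (simp)

lemma nrm_frobenius: "nrm G ^ p \<simeq> nrm G"
  unfolding nrm_def
  by (rule cyclic_prod_frobenius) (auto intro: pcompose_eqv gal_degree pcompose_gal_Suc)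

text \<open>The Vandermonde product of the roots, a square root of the discriminant up to a power of
  the leading coefficient.\<close>

definition delta :: "int poly" where
  "delta = (\<Prod>j<degree F. \<Prod>i<j. gal j - gal i)"

lemma delta_not_mem: "delta \<notin> I"
  unfolding delta_def by (intro prod_not_mem finite_lessThan gal_distinct) auto

text \<open>Frobenius permutes the e roots in a single cycle, whose sign is (-1)^(e - 1).\<close>

lemma delta_frobenius: "delta ^ p \<simeq> (- 1) ^ (degree F - 1) * delta"
proof -
  obtain m where m: "degree F = Suc m" using deg by (cases "degree F") auto
  have gal_diff: "(gal j - gal i) ^ p \<simeq> gal (Suc j) - gal (Suc i)" for i j
  proof -
    have "(gal j - gal i) ^ p \<simeq> pcompose (gal j - gal i) (gal 1)"
      using eqv_sym[OF pcompose_gal[of "gal j - gal i" 1]] by simp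
    also have "\<dots> \<simeq> gal j ^ p - gal i ^ p"
      unfolding pcompose_diff using pcompose_gal[of _ 1] by (intro eqv_diff) auto
    finally show ?thesis using gal_add[of j 1] gal_add[of i 1] by simp
  qed
  define B where "B = (\<Prod>j<m. \<Prod>i<j. gal (Suc j) - gal (Suc i))"
  have "delta ^ p = (\<Prod>j<Suc m. \<Prod>i<j. (gal j - gal i) ^ p)"
    unfolding delta_def m prod_power_distrib ..
  also have "\<dots> \<simeq> (\<Prod>j<Suc m. \<Prod>i<j. gal (Suc j) - gal (Suc i))"
    by (intro eqv_prod gal_diff)
  also have "\<dots> = B * (\<Prod>i<m. gal (degree F) - gal (Suc i))" by (simp add: B_def m)
  also have "\<dots> \<simeq> B * (\<Prod>i<m. gal 0 - gal (Suc i))"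
    by (intro eqv_mult eqv_prod eqv_diff gal_degree) auto
  also have "(\<Prod>i<m. gal 0 - gal (Suc i)) = (\<Prod>i<m. - 1 * (gal (Suc i) - gal 0))" by simp
  also have "\<dots> = (-1) ^ m * (\<Prod>i<m. gal (Suc i) - gal 0)" unfolding prod.distrib by simp
  also have "B * \<dots> = (-1) ^ m * (\<Prod>j<m. (gal (Suc j) - gal 0) * (\<Prod>i<j. gal (Suc j) - gal (Suc i)))"
    by (simp add: B_def prod.distrib)
  also have "\<dots> = (-1) ^ m * delta"
    unfolding delta_def m prod.lessThan_Suc_shift by simp
  finally show ?thesis by (simp add: m)
qed

text \<open>The norm of F'(\<theta>) is the discriminant up to normalisation. Divisibility of e by 4
  makes e (e - 1) / 2 even and removes the sign.\<close>

lemma nrm_pderiv: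
  assumes "4 dvd degree F"
  shows "nrm (pderiv F) \<simeq> [:lead_coeff F:] ^ degree F * delta ^ 2"
proof -
  have "nrm (pderiv F) \<simeq> (\<Prod>j<degree F. [:lead_coeff F:] * (\<Prod>i\<in>{..<degree F}-{j}. gal j - gal i))"
    unfolding nrm_def by (rule eqv_prod) (use gal_factorization(2) in auto)
  also have "\<dots> = [:lead_coeff F:] ^ degree F * ((-1) ^ (\<Sum>j<degree F. j) * delta ^ 2)"
    by (simp only: prod.distrib prod_constant card_lessThan prod_differences delta_def)
  also have "even (\<Sum>j<degree F. j)"
  proof -
    obtain m where m: "degree F = 4 * m" using assms by (elim dvdE)
    have "even (\<Sum>j<4 * m. j)"
    proof (induction m)
      case (Suc m)
      have "4 * Suc m = Suc (Suc (Suc (Suc (4 * m))))" by simp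
      thus ?case using Suc unfolding \<open>4 * Suc m = _\<close> sum.lessThan_Suc by simp
    qed simp
    thus ?thesis by (simp add: m)
  qed
  hence "(-1) ^ (\<Sum>j<degree F. j) = (1 :: int poly)" by simp
  finally show ?thesis by simp
qed

text \<open>This is Stickelberger's theorem for an irreducible polynomial of degree 2m. If the
  residue in question were a square y^2, then l^(m + 1) \<open>delta\<close> would equal V y or its
  negative, an element of F_p; but Frobenius negates \<open>delta\<close> because the degree is
  even.\<close>

lemma legendre_eq_minus_one:
  assumes odd: "odd p" and deg4: "4 dvd degree F" and V: "V ^ p \<simeq> V"
    and t: "[:lead_coeff F:] * nrm (pderiv F) \<simeq> V ^ 2 * [:t:]"
  shows "Legendre (lead_coeff F * t) (int p) = - 1"
proof (rule ccontr)
  assume "\<not> ?thesis"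
  hence "[lead_coeff F * t = 0] (mod int p) \<or> QuadRes (int p) (lead_coeff F * t)"
    unfolding Legendre_def by (auto split: if_splits)
  then obtain y where y: "[y ^ 2 = lead_coeff F * t] (mod int p)"
    unfolding QuadRes_def using cong_sym by (metis zero_power2)
  obtain m where m: "degree F = 2 * m" using deg4 by (metis dvd_def mult.assoc mult_2 numeral_Bit0 mult_2_right)
  define l where "l = [:lead_coeff F:]"
  define x where "x = l ^ (m + 1) * delta"
  define w where "w = V * [:y:]"
  have const_frob: "[:c:] ^ p \<simeq> [:c:]" for c
    using const_eqv[of "c ^ p" c] fermat_int_dvd[OF p, of c] by (simp add: poly_const_pow cong_iff_dvd_diff)
  have "x ^ 2 = l * (l * (l ^ degree F * delta ^ 2))"
    by (simp add: x_def m power_mult_distrib power2_eq_square algebra_simps power_add mult_2_right)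
  also have "\<dots> \<simeq> l * (l * nrm (pderiv F))"
    unfolding l_def by (intro eqv_mult eqv_refl eqv_sym[OF nrm_pderiv[OF deg4]])
  also have "\<dots> \<simeq> l * (V ^ 2 * [:t:])" unfolding l_def by (intro eqv_mult t eqv_refl)
  also have "\<dots> = V ^ 2 * [:lead_coeff F * t:]" by (simp add: l_def mult.commute)
  also have "\<dots> \<simeq> V ^ 2 * [:y ^ 2:]" by (intro eqv_mult const_eqv cong_sym[OF y] eqv_refl)
  also have "\<dots> = w ^ 2" by (simp only: w_def power_mult_distrib poly_const_pow)
  finally have "(x - w) * (x + w) \<in> I" unfolding eqv_def by (simp add: power2_eq_square algebra_simps)
  hence "x \<simeq> w \<or> x \<simeq> - w" using prime_mem unfolding eqv_def by fastforce
  then obtain w' where w': "x \<simeq> w'" "w' = w \<or> w' = - w" by blast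
  have "w ^ p \<simeq> w" unfolding w_def power_mult_distrib by (intro eqv_mult V const_frob)
  hence wp: "w' ^ p \<simeq> w'" using w'(2) odd eqv_uminus by auto
  have m1: "odd (degree F - 1)" using m deg by auto
  have "x ^ p = (l ^ p) ^ (m + 1) * delta ^ p"
    by (simp add: x_def power_mult_distrib mult.commute flip: power_mult)
  also have "\<dots> \<simeq> l ^ (m + 1) * (- delta)"
    using delta_frobenius m1 by (intro eqv_mult eqv_power) (auto simp: l_def const_frob)
  finally have "x ^ p \<simeq> - x" by (simp add: x_def)
  hence "- x \<simeq> x ^ p" by (rule eqv_sym)
  also have "x ^ p \<simeq> w' ^ p" by (rule eqv_power[OF w'(1)])
  also have "w' ^ p \<simeq> w'" by (rule wp)
  also have "w' \<simeq> x" by (rule eqv_sym[OF w'(1)])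
  finally have "- (x + x) \<in> I" by (simp add: eqv_def)
  hence "[:2:] * x \<in> I" using uminus_mem[of "- (x + x)"] by (simp add: numeral_poly mult_2 flip: smult_add_left)
  moreover have "[:2:] \<notin> I"
  proof (rule const_not_mem)
    show "\<not> int p dvd 2"
      using odd p by (metis even_iff_mod_2_eq_zero int_dvd_int_iff of_nat_numeral primes_dvd_imp_eq two_is_prime_nat dvd_refl)
  qed
  moreover have "x \<notin> I" unfolding x_def l_def
    using const_not_mem[OF lc] delta_not_mem prime_mem power_mem by blast
  ultimately show False using prime_mem by blast
qed

end

section \<open>Iterates\<close>

lemma poly_iterate_add:
  "poly_iterate (m + n) f = pcompose (poly_iterate m f) (poly_iterate n f)"
proof (induction m)
  case 0
  show ?case by (simp add: pcompose_pCons)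
qed (simp add: pcompose_assoc)

lemma degree_poly_iterate:
  fixes f :: "'a::idom poly"
  shows "degree (poly_iterate n f) = degree f ^ n"
  by (induction n) (auto simp: degree_pcompose)

lemma lead_coeff_poly_iterate_Suc:
  fixes f :: "'a::idom poly"
  assumes "degree f > 0"
  shows "lead_coeff (poly_iterate (Suc n) f) = lead_coeff f * lead_coeff (poly_iterate n f) ^ degree f"
  using assms lead_coeff_comp[of "poly_iterate n f" f] by (simp add: degree_poly_iterate)

lemma lead_coeff_poly_iterate_not_dvd:
  fixes f :: "int poly" and p :: int
  assumes p: "prime p" "\<not> p dvd lead_coeff f" and deg: "degree f > 0"
  shows "\<not> p dvd lead_coeff (poly_iterate n f)"
proof (induction n)
  case 0
  show ?case using prime_gt_1_int[OF p(1)] by simp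
next
  case (Suc n)
  thus ?case using p deg
    by (subst lead_coeff_poly_iterate_Suc) (auto simp: prime_dvd_mult_iff dest: prime_dvd_power)
qed

lemma pderiv_poly_iterate:
  fixes f :: "'a::idom poly"
  shows "pderiv (poly_iterate n f) = (\<Prod>i<n. pcompose (pderiv f) (poly_iterate i f))"
  by (induction n) (auto simp: pderiv_pcompose pderiv_pCons mult.commute)

lemma irreducible_m_cong:
  assumes "of_nat p dvd F - G"
  shows "poly_mod.irreducible_m (int p) F \<longleftrightarrow> poly_mod.irreducible_m (int p) G"
proof -
  have "poly_mod.Mp (int p) F = poly_mod.Mp (int p) G" using assms by (simp add: Mp_eq_iff_dvd)
  thus ?thesis unfolding poly_mod.irreducible_m_def by (metis poly_mod.Mp_dvdm)
qed

lemma dvd_pcompose_diff: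
  fixes G :: "'a::comm_ring_1 poly"
  shows "d dvd x - y \<Longrightarrow> d dvd pcompose G x - pcompose G y"
proof (induction G rule: pCons_induct)
  case (pCons a G)
  have "pcompose (pCons a G) x - pcompose (pCons a G) y = pcompose G x * (x - y) + y * (pcompose G x - pcompose G y)"
    by (simp add: pcompose_pCons algebra_simps)
  thus ?case using pCons by simp
qed simp

lemma of_nat_dvd_pcompose:
  assumes "of_nat p dvd (G :: int poly)"
  shows "of_nat p dvd pcompose G H"
proof -
  obtain B where "G = of_nat p * B" using assms by (elim dvdE)
  hence "pcompose G H = of_nat p * pcompose B H" by (simp add: of_nat_poly pcompose_smult)
  thus ?thesis by simp
qed

text \<open>The definition iterates the reduced polynomial, while the later arguments use the
  integral iterates; the two are congruent modulo p.\<close>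

lemma dynamically_irreducible_modD:
  assumes "dynamically_irreducible_mod p f" "n \<ge> 1"
  shows "poly_mod.irreducible_m (int p) (poly_iterate n f)"
proof -
  let ?g = "poly_mod.Mp (int p) f"
  have "of_nat p dvd poly_iterate n f - poly_iterate n ?g"
  proof (induction n)
    case (Suc n)
    have "of_nat p dvd (pcompose f (poly_iterate n f) - pcompose f (poly_iterate n ?g))
       + pcompose (f - ?g) (poly_iterate n ?g)"
      by (intro dvd_add dvd_pcompose_diff Suc of_nat_dvd_pcompose Mp_diff_dvd)
    thus ?case by (simp add: pcompose_diff)
  qed simp
  thus ?thesis using assms irreducible_m_cong unfolding dynamically_irreducible_mod_def by blast
qed

section \<open>Legendre symbols along the critical orbit\<close>

lemma prod_lessThan_add:
  fixes h k :: nat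
  shows "(\<Prod>j<h + k. x j) = (\<Prod>j<h. x j) * (\<Prod>j<k. x (h + j) :: 'a::comm_monoid_mult)"
  by (induction k) (auto simp: mult.assoc)

text \<open>The value at the fraction r/s with denominators cleared, s^d F(r/s) for d =
  \<open>degree F\<close>.\<close>

definition homogeneous_eval :: "int poly \<Rightarrow> int \<Rightarrow> int \<Rightarrow> int" where
  "homogeneous_eval F r s = (\<Sum>i\<le>degree F. coeff F i * r ^ i * s ^ (degree F - i))"

lemma homogeneous_eval_cong:
  assumes "[s * y = r] (mod m)"
  shows "[homogeneous_eval F r s = s ^ degree F * poly F y] (mod m)"
proof -
  have "[homogeneous_eval F r s = (\<Sum>i\<le>degree F. coeff F i * (s * y) ^ i * s ^ (degree F - i))] (mod m)"
    unfolding homogeneous_eval_def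
    by (intro cong_sum cong_mult cong_pow cong_sym[OF assms] cong_refl)
  also have "(\<Sum>i\<le>degree F. coeff F i * (s * y) ^ i * s ^ (degree F - i)) = s ^ degree F * poly F y"
    unfolding poly_altdef sum_distrib_left
  proof (rule sum.cong[OF refl])
    fix i assume "i \<in> {..degree F}"
    hence "s ^ degree F = s ^ i * s ^ (degree F - i)" by (simp flip: power_add)
    thus "coeff F i * (s * y) ^ i * s ^ (degree F - i) = s ^ degree F * (coeff F i * y ^ i)"
      by (simp add: power_mult_distrib)
  qed
  finally show ?thesis .
qed

lemma Legendre_mult_square:
  assumes "Legendre (x * s ^ 2) p = - 1"
  shows "Legendre x p = - 1"
proof (rule ccontr)
  assume "\<not> ?thesis"
  hence "[x = 0] (mod p) \<or> QuadRes p x" by (auto simp: Legendre_def split: if_splits)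
  then obtain y where "[y ^ 2 = x] (mod p)"
    unfolding QuadRes_def by (metis cong_sym zero_power2)
  hence "[(y * s) ^ 2 = x * s ^ 2] (mod p)"
    unfolding power_mult_distrib by (intro cong_mult cong_refl)
  hence "QuadRes p (x * s ^ 2)" unfolding QuadRes_def by blast
  thus False using assms by (auto simp: Legendre_def split: if_splits)
qed

text \<open>The derivative of the n-th iterate is W^2 times the product of the G i = a F_i + b. The
  norm of W lies in F_p, and for i \<ge> 1 the norm of G i is the square of an element of F_p. What
  remains is the norm of a \<theta> + b, which is F_n(-b/a) up to normalisation. The condition n
  \<ge> 2 makes the degree D^n divisible by 4.\<close>

theorem Legendre_iterate_critical_point:
  fixes f g :: "int poly" and a b :: int
  assumes deriv: "pderiv f = g ^ 2 * [:b, a:]" and even: "even (degree f)" "degree f > 0"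
    and p: "prime p" "odd p" and pa: "\<not> int p dvd a" and pc: "\<not> int p dvd lead_coeff f"
    and dyn: "dynamically_irreducible_mod p f" and n: "n \<ge> 2"
  shows "Legendre (lead_coeff f * homogeneous_eval (poly_iterate n f) (- b) a) (int p) = - 1"
proof -
  have oddp: "odd p" by (rule p(2))
  define D where "D = degree f"
  define F where "F = (\<lambda>n. poly_iterate n f)"
  have F_Suc: "F (Suc n) = pcompose f (F n)" for n by (simp add: F_def)
  have degF: "degree (F n) = D ^ n" for n by (simp add: F_def D_def degree_poly_iterate)
  have lcF: "\<not> int p dvd lead_coeff (F n)" for n
  proof (induction n)
    case 0
    show ?case using prime_gt_1_nat[OF p(1)] by (simp add: F_def)
  next
    case (Suc n)
    thus ?case using p(1) pc even(2) unfolding F_def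
      by (simp del: poly_iterate.simps add: lead_coeff_poly_iterate_Suc prime_dvd_mult_iff prime_dvd_power_iff)
  qed
  have irrF: "irreducible_mod_prime p (F n)" if "n \<ge> 1" for n
  proof
    show "poly_mod.irreducible_m (int p) (F n)"
      unfolding F_def by (rule dynamically_irreducible_modD[OF dyn that])
    show "degree (F n) > 0" using even by (simp add: degF D_def)
  qed (use p lcF in auto)
  define e where "e = D ^ n"
  define h where "h = e div 2"
  have D2: "even D" "D > 0" using even by (auto simp: D_def)
  have e4: "4 dvd e"
  proof -
    have "D ^ 2 dvd e" unfolding e_def by (rule le_imp_power_dvd[OF n])
    moreover have "4 dvd D ^ 2" using D2(1) by (auto elim!: evenE simp: power2_eq_square)
    ultimately show ?thesis by (rule dvd_trans[rotated])
  qed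
  have "even e" using e4 by (rule dvd_trans[rotated]) simp
  hence e2: "e = h + h" unfolding h_def by (elim evenE) simp
  interpret irreducible_mod_prime p "F n" by (rule irrF) (use n in simp)
  define L where "L = [:b, a:]"
  \<comment> \<open>F_i(\<theta>) is a root of F_(n-i), hence lies in the subfield of degree
    D^(n-i). Concretely, X^(p^e') = X modulo F_(n-i), and substituting F_i carries this over to
    F_n.\<close>
  have period: "F i ^ (p ^ h) \<simeq> F i" if i: "1 \<le> i" "i < n" for i
  proof -
    interpret E: irreducible_mod_prime p "F (n - i)" by (rule irrF) (use i in simp)
    define e' where "e' = D ^ (n - i)"
    have "gal e' - gal 0 \<in> mod_ideal p (F (n - i))"
      using E.gal_degree unfolding degF e'_def[symmetric] by (simp only: E.eqv_def)
    then obtain A where "of_nat p dvd (gal e' - gal 0) - A * F (n - i)"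
      unfolding mod_ideal_def by blast
    hence "of_nat p dvd pcompose ((gal e' - gal 0) - A * F (n - i)) (F i)"
      by (rule of_nat_dvd_pcompose)
    also have "pcompose ((gal e' - gal 0) - A * F (n - i)) (F i)
        = (F i ^ (p ^ e') - F i) - pcompose A (F i) * pcompose (F (n - i)) (F i)"
      by (simp add: gal_def monom_altdef pcompose_diff pcompose_mult pcompose_hom.hom_power pcompose_pCons)
    also have "pcompose (F (n - i)) (F i) = F n"
      using i unfolding F_def poly_iterate_add[symmetric] by simp
    finally have 1: "F i ^ (p ^ e') \<simeq> F i"
      by (simp only: eqv_def) (unfold mod_ideal_def, blast)
    have iter: "F i ^ (p ^ (e' * k)) \<simeq> F i" for k
    proof (induction k)
      case (Suc k)
      have "F i ^ (p ^ (e' * Suc k)) = (F i ^ (p ^ (e' * k))) ^ (p ^ e')"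
        by (simp add: power_add mult.commute flip: power_mult)
      also have "\<dots> \<simeq> F i ^ (p ^ e')" by (rule eqv_power[OF Suc])
      also have "\<dots> \<simeq> F i" by (rule 1)
      finally show ?case .
    qed simp
    \<comment> \<open>The subfield degree e' divides h = e/2 because the index D^i is even for i
      \<ge> 1.\<close>
    have "D ^ i = 2 * (D ^ i div 2)" using D2 i by (simp add: dvd_mult_div_cancel)
    moreover have "e = e' * D ^ i" unfolding e_def e'_def using i by (simp flip: power_add)
    ultimately have "e = 2 * (e' * (D ^ i div 2))" by (metis mult.left_commute)
    hence "h = e' * (D ^ i div 2)" unfolding h_def by simp
    thus ?thesis using iter by simp
  qed
  define G where "G = (\<lambda>i. pcompose L (F i))"
  \<comment> \<open>Half of the factors of the norm of G i. The other half repeats them, so the norm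
    is the square of Z i; and Z i is a complete Frobenius cycle of length h, hence an element of
    F_p.\<close>
  define Z where "Z = (\<lambda>i. \<Prod>j<h. pcompose (G i) (gal j))"
  have G_period: "pcompose (G i) (gal (h + j)) \<simeq> pcompose (G i) (gal j)" if i: "1 \<le> i" "i < n" for i j
  proof -
    have "pcompose (G i) (gal h) = pcompose L (pcompose (F i) (gal h))"
      by (simp add: G_def pcompose_assoc)
    also have "\<dots> \<simeq> pcompose L (F i ^ (p ^ h))" by (rule pcompose_eqv[OF pcompose_gal])
    also have "\<dots> \<simeq> G i" unfolding G_def by (rule pcompose_eqv[OF period[OF i]])
    finally have "G i ^ (p ^ h) \<simeq> G i" using pcompose_gal eqv_sym eqv_trans by blast
    hence "(G i ^ (p ^ h)) ^ (p ^ j) \<simeq> G i ^ (p ^ j)" by (rule eqv_power)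
    hence "G i ^ (p ^ (h + j)) \<simeq> G i ^ (p ^ j)" by (simp add: power_add flip: power_mult)
    thus ?thesis using pcompose_gal eqv_sym eqv_trans by blast
  qed
  have nrm_G: "nrm (G i) \<simeq> Z i ^ 2" if i: "1 \<le> i" "i < n" for i
  proof -
    have "nrm (G i) = Z i * (\<Prod>j<h. pcompose (G i) (gal (h + j)))"
      unfolding nrm_def degF Z_def using e2 by (simp add: e_def prod_lessThan_add)
    also have "\<dots> \<simeq> Z i * Z i"
      unfolding Z_def by (intro eqv_mult eqv_prod G_period[OF i] eqv_refl)
    finally show ?thesis by (simp add: power2_eq_square)
  qed
  have Z_frob: "Z i ^ p \<simeq> Z i" if i: "1 \<le> i" "i < n" for i
    unfolding Z_def
    by (rule cyclic_prod_frobenius) (use G_period[OF i, of 0] pcompose_gal_Suc in auto)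
  define W where "W = (\<Prod>i<n. pcompose g (F i))"
  define V where "V = nrm W * (\<Prod>i\<in>{1..<n}. Z i)"
  have V: "V ^ p \<simeq> V"
    unfolding V_def power_mult_distrib prod_power_distrib
    by (intro eqv_mult nrm_frobenius eqv_prod Z_frob) auto
  have deriv_F: "pderiv (F n) = W ^ 2 * (\<Prod>i<n. G i)"
  proof -
    have "pcompose (pderiv f) (F i) = pcompose g (F i) ^ 2 * G i" for i
      by (simp only: deriv G_def L_def pcompose_mult pcompose_hom.hom_power)
    thus ?thesis
      unfolding F_def pderiv_poly_iterate by (simp only: W_def F_def prod.distrib prod_power_distrib)
  qed
  have nrm_prod: "nrm (\<Prod>i\<in>S. X i) = (\<Prod>i\<in>S. nrm (X i))" for S :: "nat set" and X
    unfolding nrm_def pcompose_prod by (rule prod.swap)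
  have set_eq: "{..<n} = insert 0 {1..<n}" using n by auto
  have "nrm (pderiv (F n)) = nrm W ^ 2 * (nrm (G 0) * (\<Prod>i\<in>{1..<n}. nrm (G i)))"
    unfolding deriv_F nrm_mult nrm_prod power2_eq_square set_eq by simp
  also have "\<dots> \<simeq> nrm W ^ 2 * (nrm (G 0) * (\<Prod>i\<in>{1..<n}. Z i ^ 2))"
    by (intro eqv_mult eqv_prod nrm_G eqv_refl) auto
  also have "\<dots> = V ^ 2 * nrm (G 0)"
    by (simp add: V_def power_mult_distrib prod_power_distrib mult_ac)
  also have "G 0 = L" unfolding G_def F_def poly_iterate.simps pcompose_idR ..
  finally have nrm_deriv: "nrm (pderiv (F n)) \<simeq> V ^ 2 * nrm L" .
  have "coprime (int p) a" using pa p(1) by (intro prime_imp_coprime) auto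
  hence "coprime a (int p)" by (simp add: ac_simps)
  then obtain x where x: "[a * x = 1] (mod int p)" using cong_solve_coprime_int by blast
  \<comment> \<open>y represents \<gamma> = -b/a modulo p.\<close>
  define y where "y = x * - b"
  have ay: "[a * y = - b] (mod int p)"
    using cong_mult[OF x cong_refl[of "- b"]] by (simp add: y_def mult.assoc)
  define t where "t = a ^ e * poly (F n) y"
  have b: "[b = - (a * y)] (mod int p)"
    using ay by (metis cong_minus_minus_iff cong_sym minus_minus)
  have L_gal: "pcompose L (gal j) \<simeq> [:- a:] * ([:y:] - gal j)" for j
  proof -
    have "pcompose L (gal j) = [:b:] + [:a:] * gal j" by (simp add: L_def pcompose_pCons mult.commute)
    also have "\<dots> \<simeq> [:- (a * y):] + [:a:] * gal j"
      by (intro eqv_add const_eqv eqv_refl b)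
    also have "\<dots> = [:- a:] * ([:y:] - gal j)" by (simp add: smult_diff_right)
    finally show ?thesis .
  qed
  have "[:lead_coeff (F n):] * nrm L \<simeq> [:lead_coeff (F n):] * (\<Prod>j<e. [:- a:] * ([:y:] - gal j))"
    unfolding nrm_def degF e_def by (intro eqv_mult eqv_prod L_gal eqv_refl)
  also have "\<dots> = [:- a:] ^ e * ([:lead_coeff (F n):] * (\<Prod>j<e. [:y:] - gal j))"
    by (simp only: prod.distrib prod_constant card_lessThan mult_ac)
  also have "\<dots> \<simeq> [:- a:] ^ e * pcompose (F n) [:y:]"
    using gal_factorization(1)[of "[:y:]"] unfolding degF e_def[symmetric]
    by (intro eqv_mult[OF eqv_refl]) (rule eqv_sym)
  also have "\<dots> = [:t:]" using e2 by (simp add: t_def pcompose_pCons_0 poly_const_pow power_minus_even)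
  finally have "[:lead_coeff (F n):] * nrm L \<simeq> [:t:]" .
  hence t_eqv: "V ^ 2 * ([:lead_coeff (F n):] * nrm L) \<simeq> V ^ 2 * [:t:]"
    by (rule eqv_mult[OF eqv_refl])
  have "[:lead_coeff (F n):] * nrm (pderiv (F n)) \<simeq> [:lead_coeff (F n):] * (V ^ 2 * nrm L)"
    by (rule eqv_mult[OF eqv_refl nrm_deriv])
  also have "\<dots> = V ^ 2 * ([:lead_coeff (F n):] * nrm L)" by (rule mult.left_commute)
  also note t_eqv
  finally have "[:lead_coeff (F n):] * nrm (pderiv (F n)) \<simeq> V ^ 2 * [:t:]" .
  moreover have "4 dvd degree (F n)" using e4 unfolding degF e_def .
  ultimately have Leg: "Legendre (lead_coeff (F n) * t) (int p) = - 1"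
    using legendre_eq_minus_one[OF oddp _ V] by blast
  define u where "u = homogeneous_eval (F n) (- b) a"
  have "[lead_coeff (F n) * t = lead_coeff (F n) * u] (mod int p)"
    unfolding t_def u_def e_def degF[symmetric]
    by (intro cong_mult cong_refl cong_sym[OF homogeneous_eval_cong[OF ay]])
  hence "Legendre (lead_coeff (F n) * u) (int p) = - 1"
    using Leg unfolding Legendre_def QuadRes_def by (metis cong_sym cong_trans)
  moreover obtain m where m: "n = Suc m" using n by (cases n) auto
  \<comment> \<open>As D is even, the leading coefficient of the iterate is that of f times a
    square, which the Legendre symbol absorbs.\<close>
  have "lead_coeff (F n) = lead_coeff f * (lead_coeff (F m) ^ (D div 2)) ^ 2"
    using lead_coeff_poly_iterate_Suc[OF even(2), of m] D2
    unfolding F_def m D_def by (simp del: poly_iterate.simps flip: power_mult)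
  ultimately have "Legendre (lead_coeff f * u * (lead_coeff (F m) ^ (D div 2)) ^ 2) (int p) = - 1"
    by (simp add: mult_ac)
  thus ?thesis unfolding u_def F_def by (rule Legendre_mult_square)
qed

section \<open>Quadratic characters\<close>

text \<open>Integer values allow direct comparison with \<open>Legendre\<close>; the embedding into
  the complex numbers is a Dirichlet character.\<close>

definition real_character :: "nat \<Rightarrow> (nat \<Rightarrow> int) \<Rightarrow> bool" where
  "real_character q \<kappa> \<longleftrightarrow> q \<ge> 1 \<and> (\<forall>m n. \<kappa> (m * n) = \<kappa> m * \<kappa> n) \<and> (\<forall>n. \<kappa> (n + q) = \<kappa> n) \<and>
     (\<forall>n. \<kappa> n \<noteq> 0 \<longleftrightarrow> coprime n q) \<and> (\<forall>n. \<kappa> n \<in> {0, 1, -1})"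

lemma real_character_dirichlet:
  assumes "real_character q \<kappa>"
  shows "dirichlet_character q (\<lambda>n. of_int (\<kappa> n))"
  using assms unfolding real_character_def dirichlet_character_def by simp

lemma periodic_add_mult: "(\<And>n. f (n + q) = f n) \<Longrightarrow> f (n + k * q :: nat) = f n"
proof (induction k)
  case (Suc k)
  have "n + Suc k * q = (n + k * q) + q" by simp
  thus ?case using Suc by metis
qed simp

lemma real_character_cong:
  assumes "real_character q \<kappa>" "[m = n] (mod q)"
  shows "\<kappa> m = \<kappa> n"
proof -
  have *: "\<kappa> k = \<kappa> (k mod q)" for k
    using periodic_add_mult[of \<kappa> q "k mod q" "k div q"] assms(1)
    unfolding real_character_def by (metis mod_div_mult_eq)
  show ?thesis using *[of m] *[of n] assms(2) by (simp add: cong_def)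
qed

lemma real_character_1: "real_character q \<kappa> \<Longrightarrow> \<kappa> 1 = 1"
  unfolding real_character_def by (metis coprime_1_left mult_cancel_right1 nat_mult_1)

lemma real_characterI:
  assumes "q \<ge> 1" "\<And>m n. \<kappa> (m * n) = \<kappa> m * \<kappa> n" "\<And>n. \<kappa> (n + q) = \<kappa> n"
    "\<And>n. \<kappa> n \<noteq> 0 \<longleftrightarrow> coprime n q" "\<And>n. \<kappa> n \<in> {0, 1, -1}"
  shows "real_character q \<kappa>"
  using assms unfolding real_character_def by blast

lemma real_character_mult:
  assumes "real_character (8 * a) \<kappa>" "real_character (8 * b) \<psi>"
  shows "real_character (8 * (a * b)) (\<lambda>n. \<kappa> n * \<psi> n)"
proof (rule real_characterI)
  show "8 * (a * b) \<ge> 1" using assms unfolding real_character_def by (simp add: Suc_le_eq)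
  show "\<kappa> (n + 8 * (a * b)) * \<psi> (n + 8 * (a * b)) = \<kappa> n * \<psi> n" for n
    using periodic_add_mult[of \<kappa> "8 * a" n b] periodic_add_mult[of \<psi> "8 * b" n a] assms
    unfolding real_character_def by (simp add: mult_ac)
  have "\<kappa> n \<noteq> 0 \<longleftrightarrow> coprime n 8 \<and> coprime n a" "\<psi> n \<noteq> 0 \<longleftrightarrow> coprime n 8 \<and> coprime n b" for n
    using assms unfolding real_character_def by simp_all
  thus "\<kappa> n * \<psi> n \<noteq> 0 \<longleftrightarrow> coprime n (8 * (a * b))" for n by auto
  show "\<kappa> n * \<psi> n \<in> {0, 1, -1}" for n
  proof -
    have "\<kappa> n \<in> {0, 1, -1}" "\<psi> n \<in> {0, 1, -1}" using assms unfolding real_character_def by blast+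
    thus ?thesis by auto
  qed
qed (use assms in \<open>simp add: real_character_def mult_ac\<close>)

text \<open>The factor 8 gives every \<open>d\<close> room for the characters attached to its sign and to the prime 2.\<close>

definition quadratic_character :: "int \<Rightarrow> (nat \<Rightarrow> int) \<Rightarrow> bool" where
  "quadratic_character d \<kappa> \<longleftrightarrow> real_character (8 * nat \<bar>d\<bar>) \<kappa> \<and>
     (\<forall>p. prime p \<longrightarrow> odd p \<longrightarrow> \<not> int p dvd d \<longrightarrow> \<kappa> p = Legendre d (int p))"

lemma Legendre_values: "Legendre a p \<in> {0, 1, -1}"
  by (simp add: Legendre_def)

lemma Legendre_cong: "[a = b] (mod p) \<Longrightarrow> Legendre a p = Legendre b p"
  by (simp add: Legendre_def QuadRes_def cong_def)

lemma Legendre_0_iff: "Legendre a p = 0 \<longleftrightarrow> p dvd a"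
  by (auto simp: Legendre_def cong_0_iff)

lemma small_cong_eq:
  assumes "[x = y] (mod int p)" "p > 2" "x \<in> {0, 1, -1}" "y \<in> {0, 1, -1}"
  shows "x = y"
proof -
  have "int p dvd x - y" using assms by (simp add: cong_iff_dvd_diff)
  moreover have "\<bar>x - y\<bar> < int p" using assms by auto
  ultimately show ?thesis using zdvd_imp_le[of "int p" "\<bar>x - y\<bar>"] by fastforce
qed

lemma odd_prime_gt_2: "prime p \<Longrightarrow> odd p \<Longrightarrow> (p::nat) > 2"
  using prime_ge_2_nat[of p] by (cases "p = 2") auto

lemma Legendre_mult:
  assumes p: "prime p" "odd p"
  shows "Legendre (a * b) (int p) = Legendre a (int p) * Legendre b (int p)"
proof (rule small_cong_eq)
  have p2: "p > 2" using p by (rule odd_prime_gt_2)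
  have "[Legendre (a * b) (int p) = (a * b) ^ ((p - 1) div 2)] (mod int p)"
    by (rule euler_criterion[OF p(1) p2])
  moreover have "[a ^ ((p - 1) div 2) * b ^ ((p - 1) div 2) = Legendre a (int p) * Legendre b (int p)] (mod int p)"
    by (rule cong_sym) (intro cong_mult euler_criterion[OF p(1) p2])
  ultimately show "[Legendre (a * b) (int p) = Legendre a (int p) * Legendre b (int p)] (mod int p)"
    unfolding power_mult_distrib by (rule cong_trans)
  show "p > 2" by (rule p2)
  show "Legendre (a * b) (int p) \<in> {0, 1, -1}" by (rule Legendre_values)
  show "Legendre a (int p) * Legendre b (int p) \<in> {0, 1, -1}"
    using Legendre_values[of a "int p"] Legendre_values[of b "int p"] by auto
qed

lemma quadratic_character_mult:
  assumes "quadratic_character a \<kappa>" "quadratic_character b \<psi>"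
  shows "quadratic_character (a * b) (\<lambda>n. \<kappa> n * \<psi> n)"
proof -
  have "nat \<bar>a * b\<bar> = nat \<bar>a\<bar> * nat \<bar>b\<bar>" by (simp add: abs_mult nat_mult_distrib)
  hence "real_character (8 * nat \<bar>a * b\<bar>) (\<lambda>n. \<kappa> n * \<psi> n)"
    using assms real_character_mult unfolding quadratic_character_def by simp
  moreover have "\<kappa> p * \<psi> p = Legendre (a * b) (int p)" if "prime p" "odd p" "\<not> int p dvd a * b" for p
  proof -
    have "\<not> int p dvd a" "\<not> int p dvd b" using that(3) by auto
    hence "\<kappa> p = Legendre a (int p)" "\<psi> p = Legendre b (int p)"
      using that(1,2) assms unfolding quadratic_character_def by blast+
    thus ?thesis using Legendre_mult[OF that(1,2)] by simp
  qed
  ultimately show ?thesis unfolding quadratic_character_def by blast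
qed

lemma quadratic_character_power:
  assumes "quadratic_character a \<kappa>"
  shows "quadratic_character (a ^ Suc k) (\<lambda>n. \<kappa> n ^ Suc k)"
  by (induction k) (use assms quadratic_character_mult[OF assms] in auto)

lemma odd_mod_8:
  assumes "odd (n::nat)"
  shows "n mod 8 \<in> {1, 3, 5, 7}"
proof -
  have "n mod 8 = 1 \<or> n mod 8 = 3 \<or> n mod 8 = 5 \<or> n mod 8 = 7" using assms by presburger
  thus ?thesis by auto
qed

lemma coprime_two_power_iff: "coprime n ((2::nat) ^ Suc k) \<longleftrightarrow> odd n"
  unfolding coprime_power_right_iff by simp

lemma coprime_8_iff: "coprime n (8::nat) \<longleftrightarrow> odd n"
  using coprime_two_power_iff[of n 2] by simp

lemma quadratic_character_1: "quadratic_character 1 (\<lambda>n. if even n then 0 else 1)"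
proof -
  have "real_character 8 (\<lambda>n. if even n then 0 else 1)"
  proof (rule real_characterI)
    show "((if even n then 0 else 1 :: int) \<noteq> 0) = coprime n 8" for n :: nat
      unfolding coprime_8_iff by simp
  qed auto
  moreover have "Legendre 1 (int p) = 1" if "prime p" for p
  proof -
    have "QuadRes (int p) 1" unfolding QuadRes_def by (rule exI[of _ 1]) simp
    thus ?thesis using that prime_gt_1_nat[OF that] by (simp add: Legendre_def cong_0_iff)
  qed
  ultimately show ?thesis unfolding quadratic_character_def by (auto dest: prime_odd_nat)
qed

section \<open>The characters attached to -1 and 2\<close>

definition chi4 :: "nat \<Rightarrow> int" where
  "chi4 n = (if even n then 0 else if n mod 4 = 1 then 1 else -1)"

definition chi8 :: "nat \<Rightarrow> int" where
  "chi8 n = (if even n then 0 else if n mod 8 = 1 \<or> n mod 8 = 7 then 1 else -1)"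

lemma chi4_mult: "chi4 (m * n) = chi4 m * chi4 n"
proof (cases "even m \<or> even n")
  case False
  hence "m mod 4 = 1 \<or> m mod 4 = 3" "n mod 4 = 1 \<or> n mod 4 = 3" by presburger+
  thus ?thesis using False by (auto simp: chi4_def mod_mult_eq[of m 4 n, symmetric])
qed (auto simp: chi4_def)

lemma chi8_mult: "chi8 (m * n) = chi8 m * chi8 n"
proof (cases "even m \<or> even n")
  case False
  hence "m mod 8 \<in> {1, 3, 5, 7}" "n mod 8 \<in> {1, 3, 5, 7}" using odd_mod_8 by auto
  thus ?thesis using False by (auto simp: chi8_def mod_mult_eq[of m 8 n, symmetric])
qed (auto simp: chi8_def)

lemma chi4_eq_power: "odd n \<Longrightarrow> chi4 n = (-1) ^ ((n - 1) div 2)"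
proof -
  assume n: "odd n"
  show ?thesis
  proof (cases "n mod 4 = 1")
    case True
    hence "even ((n - 1) div 2)" by presburger
    thus ?thesis using n True by (simp add: chi4_def)
  next
    case False
    hence "odd ((n - 1) div 2)" using n by presburger
    thus ?thesis using n False by (simp add: chi4_def)
  qed
qed

lemma quadratic_character_minus_1: "quadratic_character (-1) chi4"
proof -
  have "real_character 8 chi4"
  proof (rule real_characterI)
    show "chi4 (n + 8) = chi4 n" for n
      using mod_add_right_eq[of n 8 4] by (simp add: chi4_def)
    show "chi4 (m * n) = chi4 m * chi4 n" for m n by (rule chi4_mult)
  qed (auto simp: coprime_8_iff chi4_def)
  moreover have "chi4 p = Legendre (- 1) (int p)" if p: "prime p" "odd p" for p
  proof (rule small_cong_eq[OF _ odd_prime_gt_2[OF p]])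
    show "[chi4 p = Legendre (- 1) (int p)] (mod int p)"
      using cong_sym[OF euler_criterion[OF p(1) odd_prime_gt_2[OF p]]] chi4_eq_power[OF p(2)] by metis
    show "chi4 p \<in> {0, 1, -1}" by (simp add: chi4_def)
  qed (rule Legendre_values)
  ultimately show ?thesis unfolding quadratic_character_def by auto
qed

text \<open>Gauss's lemma for the multiplier 2: the products exceeding (p - 1)/2 are the 2y with (p
  - 1)/4 < y \<le> (p - 1)/2, and the parity of their number depends only on p modulo 8.\<close>

lemma Legendre_2:
  assumes p: "prime p" "odd p"
  shows "Legendre 2 (int p) = chi8 p"
proof -
  have p2: "p > 2" using p by (rule odd_prime_gt_2)
  interpret GAUSS p 2
  proof
    show "[2 \<noteq> 0] (mod int p)" using p2 by (auto simp: cong_0_iff dest: zdvd_imp_le)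
  qed (use p p2 in auto)
  have "E = (\<lambda>x. x * 2) ` {(int p - 1) div 4 <.. (int p - 1) div 2}"
  proof (intro equalityI subsetI)
    fix x assume "x \<in> E"
    then obtain y where y: "y \<in> A" "x = (y * 2) mod int p" "x > (int p - 1) div 2"
      by (auto simp: E_def C_def B_def)
    hence "x = y * 2" by (auto simp: A_def)
    thus "x \<in> (\<lambda>x. x * 2) ` {(int p - 1) div 4 <.. (int p - 1) div 2}"
      using y p(2) by (auto simp: A_def intro!: image_eqI[of _ _ y])
  next
    fix x assume "x \<in> (\<lambda>x. x * 2) ` {(int p - 1) div 4 <.. (int p - 1) div 2}"
    then obtain y where y: "x = y * 2" "y > (int p - 1) div 4" "y \<le> (int p - 1) div 2" by auto
    hence "y \<in> A" using p2 by (auto simp: A_def)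
    hence "(y * 2) mod int p \<in> C" unfolding C_def B_def by blast
    moreover have "x = x mod int p" using y p2 by auto
    moreover have "x > (int p - 1) div 2"
    proof -
      obtain k where "p = 2 * k + 1" using p(2) by (elim oddE)
      thus ?thesis using y by auto
    qed
    ultimately show "x \<in> E" using y by (simp add: E_def)
  qed
  hence "card E = card {(int p - 1) div 4 <.. (int p - 1) div 2}"
    by (simp add: card_image inj_on_def)
  hence E: "card E = (p - 1) div 2 - (p - 1) div 4" using p2 by (simp add: nat_diff_distrib zdiv_int nat_div_distrib)
  have "Legendre 2 (int p) = (- 1) ^ ((p - 1) div 2 - (p - 1) div 4)"
    using gauss_lemma E by simp
  also have "\<dots> = chi8 p"
  proof -
    define q where "q = p div 8"
    have p8: "p = 8 * q + p mod 8" by (simp add: q_def)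
    consider "p mod 8 = 1" | "p mod 8 = 3" | "p mod 8 = 5" | "p mod 8 = 7"
      using odd_mod_8[OF p(2)] by auto
    thus ?thesis
    proof cases
      case 1
      hence "(p - 1) div 2 = 4 * q" "(p - 1) div 4 = 2 * q" using p8 by linarith+
      thus ?thesis using 1 p by (simp add: chi8_def)
    next
      case 2
      hence "(p - 1) div 2 = 4 * q + 1" "(p - 1) div 4 = 2 * q" using p8 by linarith+
      hence "(p - 1) div 2 - (p - 1) div 4 = 2 * q + 1" by simp
      thus ?thesis using 2 p by (simp add: chi8_def)
    next
      case 3
      hence "(p - 1) div 2 = 4 * q + 2" "(p - 1) div 4 = 2 * q + 1" using p8 by linarith+
      hence "(p - 1) div 2 - (p - 1) div 4 = 2 * q + 1" by simp
      thus ?thesis using 3 p by (simp add: chi8_def)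
    next
      case 4
      hence "(p - 1) div 2 = 4 * q + 3" "(p - 1) div 4 = 2 * q + 1" using p8 by linarith+
      hence "(p - 1) div 2 - (p - 1) div 4 = 2 * (q + 1)" by simp
      thus ?thesis using 4 p by (simp add: chi8_def)
    qed
  qed
  finally show ?thesis .
qed

lemma quadratic_character_2: "quadratic_character 2 chi8"
proof -
  have "real_character 16 chi8"
  proof (rule real_characterI)
    show "chi8 (n + 16) = chi8 n" for n
      using mod_add_right_eq[of n 16 8] by (simp add: chi8_def)
    show "chi8 n \<noteq> 0 \<longleftrightarrow> coprime n 16" for n
      using coprime_two_power_iff[of n 3] by (simp add: chi8_def)
    show "chi8 (m * n) = chi8 m * chi8 n" for m n by (rule chi8_mult)
  qed (auto simp: chi8_def)
  thus ?thesis unfolding quadratic_character_def by (auto simp: Legendre_2)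
qed

text \<open>The reciprocity law read as a character of the upper argument: for l = 3 modulo 4 the
  symbol (n/l) has to be twisted by \<open>chi4\<close> to give (l/n). Zero at even n fits the
  modulus 8l.\<close>

definition chi_prime :: "nat \<Rightarrow> nat \<Rightarrow> int" where
  "chi_prime l n = (if even n then 0 else (if l mod 4 = 1 then 1 else chi4 n) * Legendre (int n) (int l))"

lemma quadratic_character_odd_prime:
  assumes l: "prime l" "odd l"
  shows "quadratic_character (int l) (chi_prime l)"
proof -
  have "real_character (8 * l) (chi_prime l)"
  proof (rule real_characterI)
    show "8 * l \<ge> 1" using prime_gt_0_nat[OF l(1)] by simp
    show "chi_prime l (m * n) = chi_prime l m * chi_prime l n" for m n
      using Legendre_mult[OF l, of "int m" "int n"] by (simp add: chi_prime_def chi4_mult)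
    have "chi4 (n + 8 * l) = chi4 n" for n
    proof -
      have "(n + 8 * l) mod 4 = n mod 4" by presburger
      thus ?thesis by (simp add: chi4_def)
    qed
    moreover have "Legendre (int (n + 8 * l)) (int l) = Legendre (int n) (int l)" for n
      by (rule Legendre_cong) (simp add: cong_def)
    ultimately show "chi_prime l (n + 8 * l) = chi_prime l n" for n by (simp add: chi_prime_def)
    show "chi_prime l n \<noteq> 0 \<longleftrightarrow> coprime n (8 * l)" for n
    proof -
      have "coprime n l \<longleftrightarrow> \<not> l dvd n"
      proof (cases "l dvd n")
        case True
        hence "coprime l n \<longleftrightarrow> is_unit l" by (rule coprime_absorb_left)
        thus ?thesis using True l(1) by (auto simp: ac_simps)
      next
        case False
        hence "coprime l n" using l(1) by (intro prime_imp_coprime) auto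
        thus ?thesis using False by (simp add: ac_simps)
      qed
      thus ?thesis unfolding chi_prime_def coprime_mult_right_iff coprime_8_iff
        by (auto simp: chi4_def Legendre_0_iff)
    qed
    show "chi_prime l n \<in> {0, 1, -1}" for n
      using Legendre_values[of "int n" "int l"] by (auto simp: chi_prime_def chi4_def)
  qed
  moreover have "chi_prime l p = Legendre (int l) (int p)" if p: "prime p" "odd p" "\<not> int p dvd int l" for p
  proof -
    have neq: "p \<noteq> l" using p by auto
    have "Legendre (int p) (int l) * Legendre (int l) (int p) = (- 1) ^ ((p - 1) div 2 * ((l - 1) div 2))"
      by (rule Quadratic_Reciprocity) (use p l neq odd_prime_gt_2 in auto)
    moreover have "(- 1) ^ ((p - 1) div 2 * ((l - 1) div 2)) = (if l mod 4 = 1 then 1 else chi4 p)"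
    proof (cases "l mod 4 = 1")
      case True
      hence "even ((l - 1) div 2)" by presburger
      thus ?thesis using True by simp
    next
      case False
      hence "odd ((l - 1) div 2)" using l by presburger
      hence "(- 1 :: int) ^ ((p - 1) div 2 * ((l - 1) div 2)) = (- 1) ^ ((p - 1) div 2)"
        by (cases "even ((p - 1) div 2)") auto
      thus ?thesis using False p by (simp add: chi4_eq_power)
    qed
    moreover have "Legendre (int p) (int l) * Legendre (int p) (int l) = 1"
    proof -
      have "\<not> int l dvd int p" using p l neq primes_dvd_imp_eq by auto
      hence "Legendre (int p) (int l) \<noteq> 0" by (simp add: Legendre_0_iff)
      thus ?thesis using Legendre_values[of "int p" "int l"] by auto
    qed
    ultimately show ?thesis using p
      by (simp add: chi_prime_def) (metis mult.assoc mult.commute mult_1)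
  qed
  ultimately show ?thesis unfolding quadratic_character_def by auto
qed

section \<open>Quadratic characters of arbitrary integers, and when they are nonprincipal\<close>

lemma quadratic_character_exists:
  assumes "d \<noteq> 0"
  shows "\<exists>\<kappa>. quadratic_character d \<kappa>"
  using assms
proof (induction d rule: prime_divisors_induct)
  case (unit x)
  hence "x = 1 \<or> x = -1" by auto
  thus ?case using quadratic_character_1 quadratic_character_minus_1 by blast
next
  case (factor p x)
  hence "x \<noteq> 0" by simp
  then obtain \<kappa> where \<kappa>: "quadratic_character x \<kappa>" using factor(2) by blast
  have pn: "int (nat p) = p" using prime_ge_0_int[OF factor(1)] by (rule int_nat_eq[THEN trans, OF if_P])
  have p: "prime (nat p)" using factor(1) unfolding prime_int_nat_transfer by blast
  have "\<exists>\<psi>. quadratic_character p \<psi>"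
  proof (cases "nat p = 2")
    case True
    hence "p = 2" using pn by simp
    thus ?thesis using quadratic_character_2 by blast
  next
    case False
    hence "odd (nat p)" using primes_dvd_imp_eq[OF two_is_prime_nat p] by auto
    thus ?thesis using quadratic_character_odd_prime[OF p] unfolding pn by blast
  qed
  thus ?case using quadratic_character_mult \<kappa> by blast
qed auto

text \<open>The residues z and p - z have the same square, so the nonzero squares come from {1..(p -
  1)/2} and cannot fill all p - 1 classes.\<close>

lemma quadratic_nonresidue_exists:
  assumes p: "prime p" "odd p"
  shows "\<exists>r. Legendre r (int p) = - 1"
proof (rule ccontr)
  assume n: "\<not> ?thesis"
  have p2: "p > 2" using p by (rule odd_prime_gt_2)
  define h where "h = (int p - 1) div 2"
  have "{1..<int p} \<subseteq> (\<lambda>y. y ^ 2 mod int p) ` {1..h}"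
  proof
    fix r assume r: "r \<in> {1..<int p}"
    have "\<not> [r = 0] (mod int p)" using r by (auto simp: cong_0_iff dest: zdvd_imp_le)
    hence "QuadRes (int p) r" using n by (auto simp: Legendre_def split: if_splits)
    then obtain y where y: "[y ^ 2 = r] (mod int p)" by (auto simp: QuadRes_def)
    define z where "z = y mod int p"
    have zr: "z ^ 2 mod int p = r" using y r by (simp add: z_def cong_def power_mod)
    have "z \<noteq> 0" using zr r by auto
    moreover have "0 \<le> z" "z < int p" using p2 by (auto simp: z_def)
    ultimately have z: "1 \<le> z" "z < int p" by auto
    show "r \<in> (\<lambda>y. y ^ 2 mod int p) ` {1..h}"
    proof (cases "z \<le> h")
      case True
      thus ?thesis using z zr by auto
    next
      case False
      have "(int p - z) ^ 2 = z ^ 2 + int p * (int p - 2 * z)" by (simp add: power2_eq_square algebra_simps)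
      hence "(int p - z) ^ 2 mod int p = r" using zr by simp
      moreover have "int p - z \<in> {1..h}"
      proof -
        obtain k where "p = 2 * k + 1" using p(2) by (elim oddE)
        thus ?thesis using False z unfolding h_def by auto
      qed
      ultimately show ?thesis by blast
    qed
  qed

  hence "card {1..<int p} \<le> card ((\<lambda>y. y ^ 2 mod int p) ` {1..h})" by (intro card_mono) auto
  also have "\<dots> \<le> card {1..h}" by (rule card_image_le) simp
  finally show False using p2 by (simp add: h_def)
qed

text \<open>Either an odd prime l occurs in d to an odd power, and the value -1 is produced at l
  alone by the Chinese remainder theorem; or |d| = 2^v w^2 with w odd, and then d being a nonsquare
  means d < 0 or v odd, which is detected modulo 8.\<close>

theorem nonprincipal_quadratic_character:
  fixes d :: int
  assumes d0: "d \<noteq> 0" and nonsquare: "\<not> (\<exists>y. d = y ^ 2)"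
  shows "\<exists>\<kappa> n. quadratic_character d \<kappa> \<and> \<kappa> n = - 1"
proof (cases "\<exists>l. prime l \<and> odd l \<and> odd (multiplicity l (nat \<bar>d\<bar>))")
  case True
  then obtain l where l: "prime l" "odd l" "odd (multiplicity l (nat \<bar>d\<bar>))" by blast
  obtain k where k: "multiplicity l (nat \<bar>d\<bar>) = Suc k" using l(3) by (cases "multiplicity l (nat \<bar>d\<bar>)") auto
  have "nat \<bar>d\<bar> \<noteq> 0" "\<not> is_unit l" using d0 l(1) not_prime_unit by auto
  from multiplicity_decompose'[OF this] obtain m where m: "nat \<bar>d\<bar> = l ^ Suc k * m" "\<not> l dvd m"
    unfolding k by blast
  define d' where "d' = sgn d * int m"
  have "d = sgn d * int (nat \<bar>d\<bar>)" by (simp add: mult_sgn_abs)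
  hence d: "d = int l ^ Suc k * d'" unfolding m(1) d'_def by (simp add: mult_ac)
  hence "d' \<noteq> 0" using d0 by auto
  then obtain \<psi> where \<psi>: "quadratic_character d' \<psi>" using quadratic_character_exists by blast
  have char: "quadratic_character d (\<lambda>n. chi_prime l n ^ Suc k * \<psi> n)"
    unfolding d by (intro quadratic_character_mult quadratic_character_power quadratic_character_odd_prime l \<psi>)
  obtain r where r: "Legendre r (int l) = - 1" using quadratic_nonresidue_exists l by blast
  have d'm: "nat \<bar>d'\<bar> = m" using d0 by (simp add: d'_def abs_mult abs_sgn_eq)
  have "coprime l m" using l(1) m(2) by (intro prime_imp_coprime) auto
  moreover have "coprime l 8" using l(2) by (simp add: coprime_8_iff)
  ultimately have "coprime (8 * m) l" by (simp add: ac_simps)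
  \<comment> \<open>Being 1 modulo 8m neutralises the characters of all other factors and the
    \<open>chi4\<close> twist of \<open>chi_prime l\<close>; modulo l the number n is a
    nonresidue.\<close>
  then obtain n where n: "[n = 1] (mod (8 * m))" "[n = nat (r mod int l)] (mod l)"
    using binary_chinese_remainder_nat by blast
  have rc: "real_character (8 * m) \<psi>" using \<psi> unfolding quadratic_character_def d'm by simp
  have "\<psi> n = 1" using real_character_cong[OF rc n(1)] real_character_1[OF rc] by simp
  moreover have "n mod 4 = 1"
  proof -
    have "[n = 1] (mod 4)" by (rule cong_modulus_mult_nat[of _ _ _ "2 * m"]) (use n(1) in simp)
    thus ?thesis by (simp add: cong_def)
  qed
  moreover have "Legendre (int n) (int l) = - 1"
  proof -
    have "[int n = int (nat (r mod int l))] (mod int l)" using n(2) by (simp only: cong_int_iff)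
    hence "[int n = r] (mod int l)" using prime_gt_0_nat[OF l(1)] by (simp add: cong_def)
    thus ?thesis using r Legendre_cong by metis
  qed
  moreover have "odd n" using \<open>n mod 4 = 1\<close> by presburger
  ultimately have "chi_prime l n ^ Suc k * \<psi> n = - 1"
    using l(3) k by (simp add: chi_prime_def chi4_def)
  thus ?thesis using char by blast
next
  case False
  define m where "m = nat \<bar>d\<bar>"
  define v where "v = multiplicity 2 m"
  have m0: "m \<noteq> 0" using d0 by (simp add: m_def)
  have "\<not> is_unit (2::nat)" by simp
  from multiplicity_decompose'[OF m0 this] obtain k where k: "m = 2 ^ v * k" "odd k"
    unfolding v_def by blast
  have "is_nth_power 2 k"
    unfolding is_nth_power_conv_multiplicity_nat[of 2 k, simplified]
  proof (intro allI impI)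
    fix l :: nat assume l: "prime l"
    show "even (multiplicity l k)"
    proof (cases "l = 2")
      case True
      thus ?thesis using k(2) by (simp add: not_dvd_imp_multiplicity_0)
    next
      case l2: False
      hence "multiplicity l ((2::nat) ^ v) = 0"
        using l2 prime_dvd_power[OF l, of 2 v] primes_dvd_imp_eq[OF l two_is_prime_nat]
        by (intro not_dvd_imp_multiplicity_0) auto
      hence "multiplicity l m = multiplicity l k"
        using l k m0 by (simp add: prime_elem_multiplicity_mult_distrib)
      moreover have "odd l" using l2 primes_dvd_imp_eq[OF two_is_prime_nat l] by auto
      ultimately show ?thesis using False l by (auto simp: m_def)
    qed
  qed
  then obtain w where w: "k = w ^ 2" by (auto elim: is_nth_powerE)
  have wodd: "odd w" using k w by simp
  have w0: "w > 0" using wodd by (cases w) auto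
  define \<epsilon> where "\<epsilon> = sgn d"
  have \<epsilon>: "\<epsilon> = 1 \<or> \<epsilon> = -1" using d0 by (auto simp: \<epsilon>_def sgn_if)
  have "d = \<epsilon> * int m" by (simp add: m_def \<epsilon>_def mult_sgn_abs)
  hence d: "d = \<epsilon> * (2 ^ v * int w ^ 2)" by (simp add: k w)
  obtain \<phi> where \<phi>: "quadratic_character (int w) \<phi>"
    using quadratic_character_exists[of "int w"] w0 by auto
  have \<psi>: "\<exists>\<psi>. quadratic_character (2 ^ j) \<psi> \<and> (\<forall>n. odd n \<longrightarrow> \<psi> n = chi8 n ^ j)" for j
  proof (induction j)
    case 0
    thus ?case using quadratic_character_1 by (intro exI[of _ "\<lambda>n. if even n then 0 else 1"]) auto
  next
    case (Suc j)
    then obtain \<psi> where "quadratic_character (2 ^ j) \<psi>" "\<forall>n. odd n \<longrightarrow> \<psi> n = chi8 n ^ j" by blast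
    thus ?case using quadratic_character_mult[OF quadratic_character_2]
      by (intro exI[of _ "\<lambda>n. chi8 n * \<psi> n"]) auto
  qed
  then obtain \<psi> where \<psi>: "quadratic_character (2 ^ v) \<psi>" "\<And>n. odd n \<Longrightarrow> \<psi> n = chi8 n ^ v" by blast
  obtain \<epsilon>c where \<epsilon>c: "quadratic_character \<epsilon> \<epsilon>c" "\<And>n. odd n \<Longrightarrow> \<epsilon>c n = (if \<epsilon> = 1 then 1 else chi4 n)"
  proof (cases "\<epsilon> = 1")
    case True
    thus ?thesis using that[OF _ ] quadratic_character_1 by fastforce
  next
    case False
    thus ?thesis using that[of chi4] quadratic_character_minus_1 \<epsilon> by auto
  qed
  define \<kappa> where "\<kappa> = (\<lambda>n. \<epsilon>c n * (\<psi> n * \<phi> n ^ Suc 1))"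
  have char: "quadratic_character d \<kappa>"
    unfolding d \<kappa>_def numeral_2_eq_2 One_nat_def
    by (intro quadratic_character_mult quadratic_character_power \<phi> \<psi> \<epsilon>c)
  \<comment> \<open>For d > 0 the exponent v is odd and \<open>chi8 3\<close> = -1; for d < 0 one
    has \<open>chi4 7\<close> = -1 while \<open>chi8 7\<close> = 1.\<close>
  have "\<exists>s\<in>{3, 7}. (if \<epsilon> = 1 then 1 else chi4 s) * chi8 s ^ v = - 1"
  proof (cases "\<epsilon> = 1")
    case True
    have "odd v"
    proof
      assume "even v"
      hence "d = (2 ^ (v div 2) * int w) ^ 2" using True by (simp add: d power_mult_distrib flip: power_mult)
      thus False using nonsquare by blast
    qed
    thus ?thesis using True by (intro bexI[of _ 3]) (auto simp: chi8_def)
  next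
    case False
    thus ?thesis by (intro bexI[of _ 7]) (auto simp: chi8_def chi4_def)
  qed
  then obtain s where s: "s \<in> {3, 7}" "(if \<epsilon> = 1 then 1 else chi4 s) * chi8 s ^ v = - 1" by blast
  have "coprime w 8" using wodd by (simp add: coprime_8_iff)
  hence "coprime 8 w" by (simp only: ac_simps)
  then obtain n where n: "[n = s] (mod 8)" "[n = 1] (mod w)"
    using binary_chinese_remainder_nat by blast
  have n8: "n mod 8 = s" using n(1) s(1) by (auto simp: cong_def)
  have nodd: "odd n" using n8 s(1) by auto presburger+
  have "chi8 n = chi8 s" "chi4 n = chi4 s"
    using n8 s(1) nodd by (auto simp: chi8_def chi4_def) presburger+
  moreover have "\<phi> n ^ Suc 1 = 1"
  proof -
    have "coprime n w" using n(2) by (metis cong_imp_coprime coprime_1_left cong_sym)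
    hence "coprime n (8 * w)" using nodd by (simp add: coprime_8_iff)
    hence "\<phi> n \<noteq> 0" "\<phi> n \<in> {0, 1, -1}" using \<phi> unfolding quadratic_character_def real_character_def by auto
    thus ?thesis by auto
  qed
  ultimately have "\<kappa> n = - 1"
    unfolding \<kappa>_def using s(2) \<psi>(2)[OF nodd] \<epsilon>c(2)[OF nodd] by (auto split: if_splits)
  thus ?thesis using char by blast
qed

section \<open>Dirichlet series\<close>

lemma norm_of_nat_powr: "cmod (of_nat n powr s) = real n powr Re s"
  using norm_powr_real_powr[of "of_nat n" s] by simp

lemma of_nat_mult_powr: "(of_nat (m * n) :: complex) powr s = of_nat m powr s * of_nat n powr s"
  using powr_times_real[of "of_nat m" "of_nat n" s] by simp

lemma powr_diff_bound:
  assumes "Re s > 0" "m > 0"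
  shows "cmod (of_nat m powr (- s) - of_nat (Suc m) powr (- s)) \<le> cmod s * real m powr (- Re s - 1)"
proof -
  define S where "S = closed_segment (of_nat m :: complex) (of_nat (Suc m))"
  have S: "\<exists>t. z = complex_of_real t \<and> real m \<le> t" if "z \<in> S" for z
  proof -
    from that obtain u where "z = (1 - u) *\<^sub>R of_nat m + u *\<^sub>R of_nat (Suc m)" "0 \<le> u"
      unfolding S_def closed_segment_def by auto
    hence "z = complex_of_real (real m + u)" by (simp add: scaleR_conv_of_real algebra_simps)
    with \<open>0 \<le> u\<close> show ?thesis by (metis le_add_same_cancel1)
  qed
  have "cmod (of_nat m powr (- s) - of_nat (Suc m) powr (- s))
      \<le> (cmod s * real m powr (- Re s - 1)) * cmod (of_nat m - of_nat (Suc m))"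
  proof (rule field_differentiable_bound[where S = S and f' = "\<lambda>z. - s * z powr (- s - 1)"])
    show "convex S" unfolding S_def by (rule convex_closed_segment)
    fix z assume "z \<in> S"
    then obtain t where t: "z = complex_of_real t" "real m \<le> t" using S by blast
    have "z \<notin> \<real>\<^sub>\<le>\<^sub>0" using t assms(2) by (auto simp: complex_nonpos_Reals_iff)
    thus "((\<lambda>z. z powr - s) has_field_derivative - s * z powr (- s - 1)) (at z within S)"
      by (rule has_field_derivative_at_within[OF has_field_derivative_powr])
    have "cmod (z powr (- s - 1)) = t powr (- Re s - 1)"
      using norm_powr_real_powr[of z "- s - 1"] t by simp
    also have "\<dots> \<le> real m powr (- Re s - 1)"
      using t assms by (intro powr_mono2') auto
    finally show "cmod (- s * z powr (- s - 1)) \<le> cmod s * real m powr (- Re s - 1)"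
      by (simp add: norm_mult mult_left_mono)
  qed (auto simp: S_def)
  thus ?thesis by simp
qed

text \<open>The Dirichlet series with partial sums A after summation by parts. For bounded A it
  converges absolutely on Re s > 0, so it serves as the analytic continuation.\<close>

definition abel_series :: "(nat \<Rightarrow> complex) \<Rightarrow> complex \<Rightarrow> complex" where
  "abel_series A s = (\<Sum>n. A n * (of_nat n powr (- s) - of_nat (Suc n) powr (- s)))"

locale bounded_partial_sums =
  fixes a A :: "nat \<Rightarrow> complex" and B :: real
  assumes A_def: "\<And>n. A n = (\<Sum>k\<in>{1..n}. a k)"
    and A_bound: "\<And>n. cmod (A n) \<le> B"
    and a_0: "a 0 = 0"
begin

lemma B_nonneg: "B \<ge> 0"
  using A_bound[of 0] norm_ge_zero order_trans by blast

lemma term_bound: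
  assumes "Re s > 0"
  shows "cmod (A n * (of_nat n powr (- s) - of_nat (Suc n) powr (- s))) \<le> B * cmod s * real n powr (- Re s - 1)"
proof (cases "n = 0")
  case True
  thus ?thesis by (simp add: A_def)
next
  case False
  have "cmod (A n) * cmod (of_nat n powr (- s) - of_nat (Suc n) powr (- s)) \<le> B * (cmod s * real n powr (- Re s - 1))"
    using False assms by (intro mult_mono A_bound powr_diff_bound B_nonneg) auto
  thus ?thesis by (simp add: norm_mult mult.assoc)
qed

lemma summable_majorant: "Re s > 0 \<Longrightarrow> summable (\<lambda>n. B * cmod s * real n powr (- Re s - 1))"
  by (intro summable_mult) (simp add: summable_real_powr_iff)

lemma abel_series_sums:
  assumes "Re s > 0"
  shows "(\<lambda>n. A n * (of_nat n powr (- s) - of_nat (Suc n) powr (- s))) sums abel_series A s"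
  unfolding abel_series_def
  by (rule summable_sums, rule summable_comparison_test'[OF summable_majorant[OF assms]]) (rule term_bound[OF assms])

text \<open>The bound is linear in B and in |s|; after taking logarithms, only ln B and ln |s| enter
  the estimate for log L.\<close>

lemma abel_series_bound:
  assumes "Re s \<ge> \<sigma>" "\<sigma> > 0"
  shows "cmod (abel_series A s) \<le> B * cmod s * (\<Sum>n. real n powr (- \<sigma> - 1))"
proof -
  have s: "Re s > 0" using assms by simp
  have sm: "summable (\<lambda>n. real n powr (- \<sigma> - 1))" using assms by (simp add: summable_real_powr_iff)
  have "cmod (abel_series A s) \<le> (\<Sum>n. B * cmod s * real n powr (- \<sigma> - 1))"
    unfolding abel_series_def
  proof (rule norm_suminf_le)
    fix n
    have "real n powr (- Re s - 1) \<le> real n powr (- \<sigma> - 1)"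
      using assms by (cases "n = 0") (auto intro: powr_mono)
    thus "cmod (A n * (of_nat n powr (- s) - of_nat (Suc n) powr (- s))) \<le> B * cmod s * real n powr (- \<sigma> - 1)"
      using term_bound[OF s, of n] B_nonneg by (smt (verit) mult_left_mono mult_nonneg_nonneg norm_ge_zero)
  qed (use sm in \<open>rule summable_mult\<close>)
  thus ?thesis by (simp add: suminf_mult[OF sm])
qed

lemma abel_series_holomorphic: "abel_series A holomorphic_on {s. Re s > 0}"
proof -
  let ?S = "{s. Re s > (0::real)}"
  let ?f = "\<lambda>n s. A n * (of_nat n powr (- s) - of_nat (Suc n) powr (- s))"
  have op: "open ?S" by (rule open_halfspace_Re_gt)
  have diff: "?f n field_differentiable at x" for n x
  proof (cases "n = 0")
    case True
    thus ?thesis by (simp add: A_def)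
  next
    case False
    hence "(of_nat n :: complex) \<noteq> 0" "(of_nat (Suc n) :: complex) \<noteq> 0" by (simp_all del: of_nat_Suc)
    thus ?thesis unfolding field_differentiable_def
      by (intro exI) (auto intro!: derivative_eq_intros simp del: of_nat_Suc simp: powr_def)
  qed
  obtain g where g: "\<forall>x \<in> ?S. (\<lambda>n. ?f n x) sums g x \<and> g field_differentiable (at x)"
  proof (rule series_differentiable_comparison_complex[OF op, of ?f])
    fix x assume x: "x \<in> ?S"
    define d where "d = Re x / 2"
    define h where "h = (\<lambda>n. complex_of_real (B * (cmod x + d) * real n powr (- d - 1)))"
    have d: "d > 0" using x by (simp add: d_def)
    have h: "summable h" unfolding h_def using d
      by (intro summable_of_real summable_mult) (simp add: summable_real_powr_iff)
    have bound: "cmod (?f n y) \<le> cmod (h n)" if y: "y \<in> ball x d" for n y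
    proof -
      have "\<bar>Re x - Re y\<bar> < d" using y abs_Re_le_cmod[of "x - y"] by (simp add: dist_norm)
      hence Re: "Re y > d" by (simp add: d_def abs_if split: if_splits)
      have "cmod y \<le> cmod x + d"
        using y norm_triangle_ineq2[of y x] by (simp add: dist_norm norm_minus_commute)
      moreover have "real n powr (- Re y - 1) \<le> real n powr (- d - 1)"
        using Re by (cases "n = 0") (auto intro: powr_mono)
      ultimately have "B * cmod y * real n powr (- Re y - 1) \<le> B * (cmod x + d) * real n powr (- d - 1)"
        using B_nonneg d by (intro mult_mono mult_nonneg_nonneg) auto
      thus ?thesis using term_bound[of y n] Re d B_nonneg
        by (simp add: h_def norm_mult abs_mult flip: of_real_mult)
    qed
    have "range h \<subseteq> \<real>\<^sub>\<ge>\<^sub>0" using B_nonneg d by (auto simp: h_def simp del: of_real_mult)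
    thus "\<exists>d h. 0 < d \<and> summable h \<and> range h \<subseteq> \<real>\<^sub>\<ge>\<^sub>0 \<and>
        (\<forall>\<^sub>F n in sequentially. \<forall>y\<in>ball x d \<inter> ?S. cmod (?f n y) \<le> cmod (h n))"
      by (intro exI[of _ d] exI[of _ h] conjI always_eventually allI ballI) (use d h bound in auto)
  qed (use diff in blast)+
  have "abel_series A x = g x" if "x \<in> ?S" for x
    using g that sums_unique2 abel_series_sums by blast
  moreover have "g holomorphic_on ?S" unfolding holomorphic_on_def using g
    by (auto intro: field_differentiable_at_within)
  ultimately show ?thesis by (metis (no_types, lifting) holomorphic_transform)
qed

text \<open>The boundary term of the summation by parts tends to 0. Convergence at s = 1 itself is
  what the nonvanishing argument there uses.\<close>

lemma dirichlet_series_sums: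
  assumes s: "Re s > 0"
  shows "(\<lambda>n. a n * of_nat n powr (- s)) sums abel_series A s"
proof -
  have partial: "(\<Sum>n<Suc N. a n * of_nat n powr (- s))
      = (\<Sum>n<Suc N. A n * (of_nat n powr (- s) - of_nat (Suc n) powr (- s))) + A N * of_nat (Suc N) powr (- s)" for N
  proof (induction N)
    case 0
    thus ?case by (simp add: A_def a_0)
  next
    case (Suc N)
    have "A (Suc N) = A N + a (Suc N)" by (simp add: A_def)
    thus ?case using Suc by (simp add: algebra_simps)
  qed
  have "(\<lambda>N. A N * of_nat (Suc N) powr (- s)) \<longlonglongrightarrow> 0"
  proof (rule Lim_null_comparison)
    show "\<forall>\<^sub>F N in sequentially. cmod (A N * of_nat (Suc N) powr (- s)) \<le> B * real (Suc N) powr (- Re s)"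
      using A_bound by (intro always_eventually allI)
        (simp add: norm_mult norm_of_nat_powr mult_right_mono del: of_nat_Suc)
    have "(\<lambda>N. real N powr (- Re s)) \<longlonglongrightarrow> 0"
      using s by (intro tendsto_neg_powr filterlim_real_sequentially) auto
    thus "(\<lambda>N. B * real (Suc N) powr (- Re s)) \<longlonglongrightarrow> 0"
      using LIMSEQ_Suc tendsto_mult_right_zero by blast
  qed
  moreover have "(\<lambda>N. \<Sum>n<Suc N. A n * (of_nat n powr (- s) - of_nat (Suc n) powr (- s))) \<longlonglongrightarrow> abel_series A s"
    using abel_series_sums[OF s] unfolding sums_def by (rule LIMSEQ_Suc)
  ultimately have "(\<lambda>N. \<Sum>n<Suc N. a n * of_nat n powr (- s)) \<longlonglongrightarrow> abel_series A s"
    unfolding partial using tendsto_add by fastforce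
  thus ?thesis unfolding sums_def by (rule LIMSEQ_imp_Suc)
qed

end

lemma dirichlet_series_has_derivative:
  fixes c :: "nat \<Rightarrow> complex"
  assumes sm: "\<And>x. x > x0 \<Longrightarrow> summable (\<lambda>n. cmod (c n) * real n powr (- x))" and s: "Re s > x0" and c0: "c 0 = 0"
  shows "((\<lambda>s. \<Sum>n. c n * of_nat n powr (- s)) has_field_derivative
           (\<Sum>n. - of_real (ln (real n)) * c n * of_nat n powr (- s))) (at s)"
    and "summable (\<lambda>n. - of_real (ln (real n)) * c n * of_nat n powr (- s))"
proof -
  let ?S = "{s. Re s > x0}"
  let ?f = "\<lambda>n s. c n * of_nat n powr (- s)"
  let ?f' = "\<lambda>n s. - of_real (ln (real n)) * c n * of_nat n powr (- s)"
  have op: "open ?S" by (rule open_halfspace_Re_gt)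
  have der: "(?f n has_field_derivative ?f' n x) (at x)" for n x
  proof (cases "n = 0")
    case False
    have "((\<lambda>s. of_nat n powr (- s)) has_field_derivative (of_nat n powr (- x) * (- Ln (of_nat n)))) (at x)"
      using False by (auto intro!: derivative_eq_intros simp: powr_def)
    hence "(?f n has_field_derivative c n * (of_nat n powr (- x) * (- Ln (of_nat n)))) (at x)"
      by (rule DERIV_cmult)
    moreover have "Ln (of_nat n) = of_real (ln (real n))" using False Ln_of_real[of "real n"] by simp
    ultimately show ?thesis by (simp add: mult_ac)
  qed (simp add: c0)
  have "\<exists>g g'. \<forall>x \<in> ?S. (\<lambda>n. ?f n x) sums g x \<and> (\<lambda>n. ?f' n x) sums g' x \<and> (g has_field_derivative g' x) (at x)"
  proof (rule series_and_derivative_comparison_complex[OF op der])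
    fix x assume x: "x \<in> ?S"
    define d where "d = (Re x - x0) / 2"
    define h where "h = (\<lambda>n. complex_of_real (cmod (c n) * real n powr (- (x0 + d))))"
    have d: "d > 0" using x by (simp add: d_def)
    have h: "summable h" unfolding h_def using d by (intro summable_of_real sm) simp
    have bound: "cmod (?f n y) \<le> cmod (h n)" if y: "y \<in> ball x d" for n y
    proof -
      have "\<bar>Re x - Re y\<bar> < d" using y abs_Re_le_cmod[of "x - y"] by (simp add: dist_norm)
      hence Re: "Re y > x0 + d" by (simp add: d_def abs_if field_simps split: if_splits)
      have "real n powr (- Re y) \<le> real n powr (- (x0 + d))"
        using Re by (cases "n = 0") (auto intro: powr_mono)
      thus ?thesis by (simp add: h_def norm_mult norm_of_nat_powr mult_left_mono)
    qed
    have "range h \<subseteq> \<real>\<^sub>\<ge>\<^sub>0" by (auto simp: h_def simp del: of_real_mult)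
    thus "\<exists>d h. 0 < d \<and> summable h \<and> range h \<subseteq> \<real>\<^sub>\<ge>\<^sub>0 \<and>
        (\<forall>\<^sub>F n in sequentially. \<forall>y\<in>ball x d \<inter> ?S. cmod (?f n y) \<le> cmod (h n))"
      by (intro exI[of _ d] exI[of _ h] conjI always_eventually allI ballI) (use d h bound in auto)
  qed
  then obtain g g' where g: "\<And>x. x \<in> ?S \<Longrightarrow> (\<lambda>n. ?f n x) sums g x"
      "\<And>x. x \<in> ?S \<Longrightarrow> (\<lambda>n. ?f' n x) sums g' x" "\<And>x. x \<in> ?S \<Longrightarrow> (g has_field_derivative g' x) (at x)"
    by blast
  have sS: "s \<in> ?S" using s by simp
  have g's: "g' s = (\<Sum>n. ?f' n s)" using g(2)[OF sS] sums_unique by blast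
  show "summable (\<lambda>n. ?f' n s)" using g(2)[OF sS] sums_summable by blast
  show "((\<lambda>s. \<Sum>n. ?f n s) has_field_derivative (\<Sum>n. ?f' n s)) (at s)"
    unfolding g's[symmetric]
  proof (rule has_field_derivative_transform_within_open[OF g(3)[OF sS] op sS])
    show "g x = (\<Sum>n. ?f n x)" if "x \<in> ?S" for x using g(1)[OF that] sums_unique by blast
  qed
qed

lemma summable_ln_power_powr:
  assumes "x > 1"
  shows "summable (\<lambda>n. ln (real n) ^ k * real n powr (- x))"
proof -
  define e where "e = (x - 1) / 2"
  have e: "e > 0" using assms by (simp add: e_def)
  have "((\<lambda>y. ln y ^ k / y powr e) \<longlongrightarrow> 0) at_top"
    using e by real_asymp
  hence "((\<lambda>n. ln (real n) ^ k / real n powr e) \<longlongrightarrow> 0) sequentially"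
    by (rule filterlim_compose) (rule filterlim_real_sequentially)
  hence "\<forall>\<^sub>F n in sequentially. norm (ln (real n) ^ k / real n powr e) < 1"
    unfolding tendsto_iff by (auto simp: dist_norm)
  hence "\<forall>\<^sub>F n in sequentially. norm (ln (real n) ^ k * real n powr (- x)) \<le> real n powr (- (1 + e))"
    using eventually_gt_at_top[of 0]
  proof eventually_elim
    case (elim n)
    have "- x = - e + - (1 + e)" by (simp add: e_def field_simps)
    hence "real n powr (- x) = real n powr (- e) * real n powr (- (1 + e))" by (simp only: powr_add)
    hence eq: "ln (real n) ^ k * real n powr (- x) = (ln (real n) ^ k / real n powr e) * real n powr (- (1 + e))"
      by (simp add: powr_minus_divide[of _ e])
    have "norm (ln (real n) ^ k * real n powr (- x)) = norm (ln (real n) ^ k / real n powr e) * real n powr (- (1 + e))"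
      unfolding eq norm_mult by simp
    also have "\<dots> \<le> 1 * real n powr (- (1 + e))" using elim by (intro mult_right_mono) auto
    finally show ?case by simp
  qed
  moreover have "summable (\<lambda>n. real n powr (- (1 + e)))" using e by (simp add: summable_real_powr_iff)
  ultimately show ?thesis by (rule summable_comparison_test_ev)
qed

section \<open>Euler products\<close>

lemma holomorphic_on_suminf:
  fixes f :: "nat \<Rightarrow> complex \<Rightarrow> complex"
  assumes op: "open S" and hol: "\<And>n. f n holomorphic_on S"
    and bound: "\<And>n x. x \<in> S \<Longrightarrow> cmod (f n x) \<le> h n" and sm: "summable h"
  shows "(\<lambda>x. \<Sum>n. f n x) holomorphic_on S"
proof -
  have h0: "S \<noteq> {} \<Longrightarrow> h n \<ge> 0" for n using bound norm_ge_zero order_trans by blast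
  obtain g where g: "\<forall>x \<in> S. (\<lambda>n. f n x) sums g x \<and> g field_differentiable (at x)"
  proof (rule series_differentiable_comparison_complex[OF op, of f])
    show "f n field_differentiable at x" if "x \<in> S" for n x
      using hol op that holomorphic_on_imp_differentiable_at by blast
    fix x assume x: "x \<in> S"
    have h1: "h n \<ge> 0" for n using h0 x by blast
    have "summable (\<lambda>n. complex_of_real (h n))" using sm by (rule summable_of_real)
    moreover have "range (\<lambda>n. complex_of_real (h n)) \<subseteq> \<real>\<^sub>\<ge>\<^sub>0" using h1 by auto
    ultimately show "\<exists>d h. 0 < d \<and> summable h \<and> range h \<subseteq> \<real>\<^sub>\<ge>\<^sub>0 \<and>
        (\<forall>\<^sub>F n in sequentially. \<forall>y\<in>ball x d \<inter> S. cmod (f n y) \<le> cmod (h n))"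
      by (intro exI[of _ 1] exI[of _ "\<lambda>n. complex_of_real (h n)"] conjI always_eventually allI ballI)
        (use bound h1 in auto)
  qed blast
  have "(\<Sum>n. f n x) = g x" if "x \<in> S" for x using g that sums_unique by metis
  moreover have "g holomorphic_on S" unfolding holomorphic_on_def using g
    by (auto intro: field_differentiable_at_within)
  ultimately show ?thesis by (metis (no_types, lifting) holomorphic_transform)
qed

text \<open>Majorant, on Re s \<ge> 3/4, for the part of log L that comes from higher prime
  powers.\<close>

definition "error_const = (\<Sum>n. 3 * real n powr (- (3 / 2)))"

text \<open>The value \<zeta>(2), as a majorant for the prime series on the line Re s = 2.\<close>

definition "zeta2_const = (\<Sum>n. real n powr (- 2))"

locale completely_multiplicative =
  fixes \<kappa> :: "nat \<Rightarrow> int"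
  assumes mult: "\<And>m n. \<kappa> (m * n) = \<kappa> m * \<kappa> n" and one: "\<kappa> 1 = 1"
    and vals: "\<And>n. \<kappa> n \<in> {0, 1, -1}"
begin

definition trm :: "complex \<Rightarrow> nat \<Rightarrow> complex" where
  "trm s n = of_int (\<kappa> n) * of_nat n powr (- s)"

definition dirichlet :: "complex \<Rightarrow> complex" where
  "dirichlet s = (\<Sum>n. trm s n)"

definition prime_coeff :: "nat \<Rightarrow> complex" where
  "prime_coeff n = (if prime n then of_int (\<kappa> n) else 0)"

definition prime_series :: "complex \<Rightarrow> complex" where
  "prime_series s = (\<Sum>n. prime_coeff n * of_nat n powr (- s))"

text \<open>The logarithm of an Euler factor without its linear term. It is of second order, so the
  sum over the primes still converges to the left of the line Re s = 1.\<close>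

definition err :: "nat \<Rightarrow> complex \<Rightarrow> complex" where
  "err n s = (if prime n then - Ln (1 - trm s n) - trm s n else 0)"

definition euler_error :: "complex \<Rightarrow> complex" where
  "euler_error s = (\<Sum>n. err n s)"

lemma abs_kappa: "cmod (of_int (\<kappa> n)) \<le> 1"
  using vals[of n] by auto

lemma norm_trm: "cmod (trm s n) \<le> real n powr (- Re s)"
  using mult_right_mono[OF abs_kappa, of "real n powr (- Re s)" n]
  by (simp add: trm_def norm_mult norm_of_nat_powr)

lemma trm_mult: "trm s (m * n) = trm s m * trm s n"
  unfolding trm_def of_nat_mult_powr mult by simp

lemma trm_0: "trm s 0 = 0" and trm_1: "trm s 1 = 1"
  using one by (simp_all add: trm_def)

lemma norm_prime_coeff: "cmod (prime_coeff n) \<le> 1"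
  using abs_kappa by (simp add: prime_coeff_def)

lemma summable_norm_trm: "Re s > 1 \<Longrightarrow> summable (\<lambda>n. cmod (trm s n))"
  by (rule summable_comparison_test'[of "\<lambda>n. real n powr (- Re s)" 0])
     (use norm_trm in \<open>auto simp: summable_real_powr_iff\<close>)

text \<open>2^(-3/4) \<le> 2/3 because 1/8 \<le> 16/81. The distance 1/3 to 1 keeps the principal
  logarithm defined and gives the factor 3 in \<open>error_const\<close>.\<close>

lemma norm_trm_le: "Re s \<ge> 3 / 4 \<Longrightarrow> n \<ge> 2 \<Longrightarrow> cmod (trm s n) \<le> 2 / 3"
proof -
  assume s: "Re s \<ge> 3 / 4" and n: "n \<ge> 2"
  have "real n powr (- Re s) \<le> real n powr (- (3 / 4))" using s n by (intro powr_mono) auto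
  also have "\<dots> \<le> 2 powr (- (3 / 4))" using n by (intro powr_mono2') auto
  also have "\<dots> \<le> 2 / 3"
  proof -
    have "(2 powr (- (3 / 4))) ^ 4 = (2 powr (- 3) :: real)"
      by (simp add: powr_powr flip: powr_realpow)
    also have "\<dots> \<le> (2 / 3 :: real) ^ 4" by (simp add: powr_minus powr_numeral power_divide)
    finally show ?thesis by (rule power_le_imp_le_base[of _ 3, simplified]) simp
  qed
  finally show ?thesis using norm_trm order_trans by blast
qed

lemma norm_err:
  assumes s: "Re s \<ge> 3 / 4"
  shows "cmod (err n s) \<le> 3 * real n powr (- (3 / 2))"
proof (cases "prime n")
  case True
  hence n: "n \<ge> 2" by (rule prime_ge_2_nat)
  define z where "z = - trm s n"
  have z: "cmod z \<le> 2 / 3" using norm_trm_le[OF s n] by (simp add: z_def)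
  have "cmod z \<le> real n powr (- (3 / 4))"
  proof -
    have "real n powr (- Re s) \<le> real n powr (- (3 / 4))" using s n by (intro powr_mono) auto
    thus ?thesis using norm_trm[of s n] by (simp add: z_def)
  qed
  hence "cmod z ^ 2 \<le> (real n powr (- (3 / 4))) ^ 2" by (intro power_mono) auto
  also have "\<dots> = real n powr (- (3 / 2))"
    by (simp add: power2_eq_square flip: powr_add)
  finally have z2: "cmod z ^ 2 \<le> real n powr (- (3 / 2))" .
  have "cmod (err n s) = cmod (- (Ln (1 + z) - z))"
    using True by (simp add: err_def z_def)
  also have "\<dots> = cmod (Ln (1 + z) - z)" by (rule norm_minus_cancel)
  also have "\<dots> \<le> cmod z ^ 2 / (1 - cmod z)" using z by (intro Ln_approx_linear) auto
  also have "\<dots> \<le> cmod z ^ 2 / (1 / 3)" using z by (intro divide_left_mono) auto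
  also have "\<dots> \<le> 3 * real n powr (- (3 / 2))" using z2 by simp
  finally show ?thesis .
qed (simp add: err_def)

lemma summable_error_const: "summable (\<lambda>n. 3 * real n powr (- (3 / 2)))"
  by (intro summable_mult) (simp add: summable_real_powr_iff)

lemma err_sums: "Re s \<ge> 3 / 4 \<Longrightarrow> (\<lambda>n. err n s) sums euler_error s"
  unfolding euler_error_def
  by (rule summable_sums, rule summable_comparison_test'[OF summable_error_const, of 0])
     (rule norm_err)

lemma euler_error_bound: "Re s \<ge> 3 / 4 \<Longrightarrow> cmod (euler_error s) \<le> error_const"
  unfolding euler_error_def error_const_def
  by (rule norm_suminf_le[OF _ summable_error_const]) (rule norm_err)

lemma euler_error_holomorphic: "euler_error holomorphic_on {s. Re s > 3 / 4}"
  unfolding euler_error_def[abs_def]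
proof (rule holomorphic_on_suminf[OF open_halfspace_Re_gt _ _ summable_error_const])
  fix n
  show "err n holomorphic_on {s. 3 / 4 < Re s}"
  proof (cases "prime n")
    case True
    hence n: "n \<ge> 2" by (rule prime_ge_2_nat)
    have t: "(\<lambda>s. trm s n) holomorphic_on {s. 3 / 4 < Re s}"
      unfolding trm_def using n by (intro holomorphic_intros) auto
    have "1 - trm s n \<notin> \<real>\<^sub>\<le>\<^sub>0" if "s \<in> {s. 3 / 4 < Re s}" for s
    proof -
      have "cmod (trm s n) \<le> 2 / 3" using that n by (intro norm_trm_le) auto
      hence "Re (trm s n) \<le> 2 / 3" using complex_Re_le_cmod order_trans by blast
      thus ?thesis by (auto simp: complex_nonpos_Reals_iff)
    qed
    hence "(\<lambda>s. - Ln (1 - trm s n) - trm s n) holomorphic_on {s. 3 / 4 < Re s}"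
      using t by (intro holomorphic_intros) auto
    thus ?thesis using True unfolding err_def by simp
  qed (simp add: err_def[abs_def])
qed (rule norm_err, simp)

lemma prime_series_sums:
  assumes "Re s > 1"
  shows "(\<lambda>n. prime_coeff n * of_nat n powr (- s)) sums prime_series s"
  unfolding prime_series_def
proof (rule summable_sums, rule summable_comparison_test'[of "\<lambda>n. real n powr (- Re s)" 0])
  show "cmod (prime_coeff n * of_nat n powr (- s)) \<le> real n powr (- Re s)" for n
    using mult_right_mono[OF norm_prime_coeff, of "real n powr (- Re s)" n]
    by (simp add: norm_mult norm_of_nat_powr)
qed (use assms in \<open>simp add: summable_real_powr_iff\<close>)

lemma norm_prime_series_2:
  assumes "Re s = 2"
  shows "cmod (prime_series s) \<le> zeta2_const"
  unfolding prime_series_def zeta2_const_def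
proof (rule norm_suminf_le)
  show "cmod (prime_coeff n * of_nat n powr (- s)) \<le> real n powr - 2" for n
    using mult_right_mono[OF norm_prime_coeff, of "real n powr (- Re s)" n] assms
    by (simp add: norm_mult norm_of_nat_powr)
qed (simp add: summable_real_powr_iff)

text \<open>The terms of the series at integers without prime factors up to N, as in the sieve of
  Eratosthenes.\<close>

definition rough :: "complex \<Rightarrow> nat \<Rightarrow> nat \<Rightarrow> complex" where
  "rough s N n = (if \<forall>p. prime p \<longrightarrow> p \<le> N \<longrightarrow> \<not> p dvd n then trm s n else 0)"

lemma summable_rough:
  assumes "Re s > 1"
  shows "summable (\<lambda>n. if P n then rough s N n else 0)"
  by (rule summable_comparison_test'[OF summable_norm_trm[OF assms], of 0]) (simp add: rough_def)

text \<open>Multiplying by the factor of a new prime q subtracts, by complete multiplicativity,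
  exactly the terms at multiples of q.\<close>

lemma euler_partial:
  assumes s: "Re s > 1"
  shows "(\<Prod>n\<le>N. if prime n then 1 - trm s n else 1) * dirichlet s = (\<Sum>n. rough s N n)"
proof (induction N)
  case 0
  have "rough s 0 n = trm s n" for n using prime_gt_0_nat by (auto simp: rough_def)
  thus ?case by (simp add: dirichlet_def)
next
  case (Suc N)
  show ?case
  proof (cases "prime (Suc N)")
    case False
    hence "rough s (Suc N) n = rough s N n" for n unfolding rough_def by (metis le_Suc_eq)
    thus ?thesis using Suc False by simp
  next
    case True
    define q where "q = Suc N"
    have q: "prime q" "q > 0" using True by (auto simp: q_def)
    let ?k = "\<lambda>n. if q dvd n then rough s N n else 0"
    have sm: "summable (rough s N)" using summable_rough[OF s, of "\<lambda>_. True" N] by simp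
    have rough_q: "trm s q * rough s N n = ?k (q * n)" for n
    proof -
      have "p dvd q * n \<longleftrightarrow> p dvd n" if "prime p" "p \<le> N" for p
      proof -
        have "\<not> p dvd q" using that primes_dvd_imp_eq[OF that(1) q(1)] by (auto simp: q_def)
        thus ?thesis using prime_dvd_mult_iff[OF that(1)] by blast
      qed
      thus ?thesis by (auto simp: rough_def trm_mult)
    qed
    have "trm s q * (\<Sum>n. rough s N n) = (\<Sum>n. ?k (q * n))"
      using suminf_mult[OF sm, of "trm s q"] by (simp only: rough_q)
    also have "\<dots> = (\<Sum>n. ?k n)"
      by (rule suminf_mono_reindex) (use q in \<open>auto simp: strict_mono_def\<close>)
    finally have "(1 - trm s q) * (\<Sum>n. rough s N n) = (\<Sum>n. rough s N n) - (\<Sum>n. ?k n)"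
      by (simp add: algebra_simps)
    also have "\<dots> = (\<Sum>n. rough s N n - ?k n)"
      by (rule suminf_diff[OF sm summable_rough[OF s]])
    also have "(\<lambda>n. rough s N n - ?k n) = rough s (Suc N)"
    proof
      fix n
      have "(\<forall>p. prime p \<longrightarrow> p \<le> Suc N \<longrightarrow> \<not> p dvd n) \<longleftrightarrow> (\<forall>p. prime p \<longrightarrow> p \<le> N \<longrightarrow> \<not> p dvd n) \<and> \<not> q dvd n"
        using q by (auto simp: q_def le_Suc_eq)
      thus "rough s N n - ?k n = rough s (Suc N) n" unfolding rough_def by auto
    qed
    finally have "(1 - trm s q) * ((\<Prod>n\<le>N. if prime n then 1 - trm s n else 1) * dirichlet s) = (\<Sum>n. rough s (Suc N) n)"
      unfolding Suc .
    thus ?thesis using True by (simp add: q_def mult_ac)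
  qed
qed

text \<open>For each n \<ge> 2 the term disappears once N reaches a prime factor of n; dominated
  convergence then leaves only n = 1.\<close>

lemma rough_limit:
  assumes s: "Re s > 1"
  shows "(\<lambda>N. \<Sum>n. rough s N n) \<longlonglongrightarrow> 1"
proof -
  have "(\<lambda>N. rough s N n) \<longlonglongrightarrow> (if n = 1 then 1 else 0)" for n
  proof (rule tendsto_eventually, rule eventually_sequentiallyI[of n])
    fix N assume N: "N \<ge> n"
    consider "n = 0" | "n = 1" | "n \<ge> 2" by linarith
    thus "rough s N n = (if n = 1 then 1 else 0)"
    proof cases
      case 1
      thus ?thesis by (simp add: rough_def trm_0)
    next
      case 2
      have "\<not> p dvd 1" if "prime p" for p :: nat using that not_prime_unit by blast
      thus ?thesis using 2 trm_1 by (simp add: rough_def)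
    next
      case 3
      then obtain p where "prime p" "p dvd n" using prime_factor_nat[of n] by auto
      moreover have "p \<le> N" using \<open>p dvd n\<close> dvd_imp_le[of p n] 3 N by simp
      ultimately show ?thesis using 3 by (auto simp: rough_def)
    qed
  qed
  hence "(\<lambda>N. \<Sum>n. rough s N n) \<longlonglongrightarrow> (\<Sum>n. if n = 1 then 1 else 0)"
    by (intro tannerys_theorem[THEN conjunct2, THEN conjunct2, OF _ _ summable_norm_trm[OF s]])
       (auto intro!: always_eventually simp: rough_def)
  also have "(\<Sum>n::nat. if n = 1 then 1 else 0 :: complex) = 1"
    using sums_unique[OF sums_single[of 1 "\<lambda>_. 1::complex"]] by simp
  finally show ?thesis .
qed

text \<open>The sum of the principal logarithms is taken as the definition of log L on Re s > 1,
  split into the sum over primes and a remainder that continues further to the left.\<close>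

theorem euler_product:
  assumes s: "Re s > 1"
  shows "dirichlet s = exp (prime_series s + euler_error s)"
proof -
  have trm_neq: "1 - trm s n \<noteq> 0" if "prime n" for n
    using norm_trm_le[of s n] prime_ge_2_nat[OF that] s by auto
  have "(\<lambda>n. if prime n then Ln (1 - trm s n) else 0) sums (- (prime_series s + euler_error s))"
  proof -
    have "(\<lambda>n. - (prime_coeff n * of_nat n powr (- s) + err n s)) sums (- (prime_series s + euler_error s))"
      using s by (intro sums_minus sums_add prime_series_sums err_sums) auto
    moreover have "- (prime_coeff n * of_nat n powr (- s) + err n s) = (if prime n then Ln (1 - trm s n) else 0)" for n
      by (simp add: prime_coeff_def err_def trm_def)
    ultimately show ?thesis by simp
  qed
  hence "(\<lambda>N. exp (\<Sum>n\<le>N. if prime n then Ln (1 - trm s n) else 0)) \<longlonglongrightarrow> exp (- (prime_series s + euler_error s))"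
    unfolding sums_def_le by (rule tendsto_exp)
  moreover have "exp (\<Sum>n\<le>N. if prime n then Ln (1 - trm s n) else 0) = (\<Prod>n\<le>N. if prime n then 1 - trm s n else 1)" for N
    unfolding exp_sum[OF finite_atMost] by (rule prod.cong[OF refl]) (use trm_neq in auto)
  ultimately have "(\<lambda>N. \<Prod>n\<le>N. if prime n then 1 - trm s n else 1) \<longlonglongrightarrow> exp (- (prime_series s + euler_error s))"
    by simp
  hence "(\<lambda>N. (\<Prod>n\<le>N. if prime n then 1 - trm s n else 1) * dirichlet s)
      \<longlonglongrightarrow> exp (- (prime_series s + euler_error s)) * dirichlet s"
    by (intro tendsto_mult tendsto_const)
  hence "exp (- (prime_series s + euler_error s)) * dirichlet s = 1"
    unfolding euler_partial[OF s] using rough_limit[OF s] LIMSEQ_unique by blast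
  thus ?thesis unfolding exp_minus by (simp add: field_simps)
qed

lemma prime_series_derivs:
  assumes "Re s > 1"
  shows "(prime_series has_field_derivative (\<Sum>n. - of_real (ln (real n)) * prime_coeff n * of_nat n powr (- s))) (at s)"
    and "((\<lambda>s. \<Sum>n. - of_real (ln (real n)) * prime_coeff n * of_nat n powr (- s)) has_field_derivative
          (\<Sum>n. of_real (ln (real n) ^ 2) * prime_coeff n * of_nat n powr (- s))) (at s)"
    and "summable (\<lambda>n. of_real (ln (real n) ^ 2) * prime_coeff n * of_nat n powr (- s))"
proof -
  have sm: "summable (\<lambda>n. cmod (of_real ((- ln (real n)) ^ k) * prime_coeff n) * real n powr (- x))" if "x > 1" for k x
  proof (rule summable_comparison_test'[OF summable_ln_power_powr[OF that, of k], of 1])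
    fix n :: nat assume "n \<ge> 1"
    hence "\<bar>ln (real n) ^ k\<bar> * cmod (prime_coeff n) * real n powr (- x) \<le> ln (real n) ^ k * 1 * real n powr (- x)"
      by (intro mult_mono norm_prime_coeff) auto
    thus "norm (cmod (of_real ((- ln (real n)) ^ k) * prime_coeff n) * real n powr (- x)) \<le> ln (real n) ^ k * real n powr (- x)"
      by (simp add: norm_mult norm_power power_abs)
  qed
  show "(prime_series has_field_derivative (\<Sum>n. - of_real (ln (real n)) * prime_coeff n * of_nat n powr (- s))) (at s)"
    unfolding prime_series_def[abs_def]
    by (rule dirichlet_series_has_derivative(1)) (use sm[of _ 0] assms in \<open>auto simp: prime_coeff_def\<close>)
  have eq: "- of_real (ln (real n)) * (- of_real (ln (real n)) * prime_coeff n) = of_real (ln (real n) ^ 2) * prime_coeff n" for n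
    by (simp add: power2_eq_square)
  show "((\<lambda>s. \<Sum>n. - of_real (ln (real n)) * prime_coeff n * of_nat n powr (- s)) has_field_derivative
          (\<Sum>n. of_real (ln (real n) ^ 2) * prime_coeff n * of_nat n powr (- s))) (at s)"
    unfolding eq[symmetric]
    by (rule dirichlet_series_has_derivative(1)) (use sm[of _ 1] assms in auto)
  show "summable (\<lambda>n. of_real (ln (real n) ^ 2) * prime_coeff n * of_nat n powr (- s))"
    unfolding eq[symmetric]
    by (rule dirichlet_series_has_derivative(2)) (use sm[of _ 1] assms in auto)
qed

end

section \<open>Real nonprincipal characters\<close>

lemma gcd_mult_coprime_divisors:
  assumes "coprime a b" "d dvd a" "e dvd (b::nat)"
  shows "gcd (d * e) a = d" "gcd (d * e) b = e"
proof -
  have "coprime d b" "coprime a e"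
    by (rule coprime_divisors[OF assms(2) dvd_refl assms(1)], rule coprime_divisors[OF dvd_refl assms(3,1)])
  hence "coprime d b" "coprime e a" "coprime b d" "coprime a e" by (simp_all add: ac_simps)
  thus "gcd (d * e) a = d" "gcd (d * e) b = e"
    using assms by (simp_all add: gcd_mult_left_right_cancel gcd_mult_left_left_cancel gcd_proj1_if_dvd_nat)
qed

lemma sum_divisors_coprime:
  fixes f :: "nat \<Rightarrow> 'a::comm_monoid_add"
  assumes "coprime a b"
  shows "(\<Sum>d | d dvd a * b. f d) = (\<Sum>d | d dvd a. \<Sum>e | e dvd b. f (d * e))"
proof -
  have "(\<Sum>d | d dvd a. \<Sum>e | e dvd b. f (d * e)) = (\<Sum>(d, e)\<in>{d. d dvd a} \<times> {e. e dvd b}. f (d * e))"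
    by (rule sum.cartesian_product)
  also have "\<dots> = (\<Sum>d | d dvd a * b. f d)"
  proof (rule sum.reindex_bij_witness[of _ "\<lambda>d. (gcd d a, gcd d b)" "\<lambda>(d, e). d * e"])
    fix x assume "x \<in> {d. d dvd a} \<times> {e. e dvd b}"
    then obtain d e where x: "x = (d, e)" "d dvd a" "e dvd b" by auto
    show "(gcd (case x of (d, e) \<Rightarrow> d * e) a, gcd (case x of (d, e) \<Rightarrow> d * e) b) = x"
      using x gcd_mult_coprime_divisors[OF assms x(2,3)] by simp
    show "(case x of (d, e) \<Rightarrow> d * e) \<in> {d. d dvd a * b}" using x by (auto intro: mult_dvd_mono)
    show "f (case x of (d, e) \<Rightarrow> d * e) = (case x of (d, e) \<Rightarrow> f (d * e))" using x by simp
  next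
    fix d assume "d \<in> {d. d dvd a * b}"
    then obtain x y where "d = x * y" "x dvd a" "y dvd b" using division_decomp[of d a b] by auto
    thus "(case (gcd d a, gcd d b) of (d, e) \<Rightarrow> d * e) = d"
      using gcd_mult_coprime_divisors[OF assms] by simp
    show "(gcd d a, gcd d b) \<in> {d. d dvd a} \<times> {e. e dvd b}" by simp
  qed
  finally show ?thesis ..
qed

section \<open>The convolution of a real character with 1\<close>

context completely_multiplicative
begin

lemma kappa_power: "\<kappa> (n ^ k) = \<kappa> n ^ k"
  using one by (induction k) (auto simp: mult)

definition divisor_sum :: "nat \<Rightarrow> int" where
  "divisor_sum m = (\<Sum>d | d dvd m. \<kappa> d)"

lemma geometric_sum_nonneg:
  assumes "x \<in> {0, 1, -1 :: int}"
  shows "(\<Sum>i\<le>v. x ^ i) \<ge> 0" "even v \<Longrightarrow> (\<Sum>i\<le>v. x ^ i) \<ge> 1"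
proof -
  have m1: "(\<Sum>i\<le>v. (- 1 :: int) ^ i) = (if even v then 1 else 0)" by (induction v) auto
  have z: "(\<Sum>i\<le>v. (0 :: int) ^ i) = 1" by (induction v) auto
  show "(\<Sum>i\<le>v. x ^ i) \<ge> 0" using assms m1 z by auto
  show "even v \<Longrightarrow> (\<Sum>i\<le>v. x ^ i) \<ge> 1" using assms m1 z by auto
qed

lemma divisor_sum_prime_power_mult:
  assumes p: "prime p" and m: "\<not> p dvd m" "m > 0"
  shows "divisor_sum (p ^ v * m) = (\<Sum>i\<le>v. \<kappa> p ^ i) * divisor_sum m"
proof -
  have "coprime p m" using p m(1) by (intro prime_imp_coprime) auto
  hence "divisor_sum (p ^ v * m) = (\<Sum>d | d dvd p ^ v. \<Sum>e | e dvd m. \<kappa> (d * e))"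
    unfolding divisor_sum_def by (intro sum_divisors_coprime) simp
  also have "\<dots> = (\<Sum>d | d dvd p ^ v. \<kappa> d) * divisor_sum m"
    unfolding divisor_sum_def sum_product mult ..
  also have "{d. d dvd p ^ v} = (\<lambda>i. p ^ i) ` {..v}"
    using divides_primepow_nat[OF p] by auto
  also have "(\<Sum>d\<in>(\<lambda>i. p ^ i) ` {..v}. \<kappa> d) = (\<Sum>i\<le>v. \<kappa> p ^ i)"
    using prime_gt_1_nat[OF p] by (subst sum.reindex) (auto simp: inj_on_def kappa_power)
  finally show ?thesis .
qed

text \<open>The local factor at p^v is 1, v + 1, or the parity indicator of v, according to the
  value of \<kappa> at p. Even exponents, that is squares, make every local factor at least
  1.\<close>

lemma divisor_sum_nonneg:
  assumes "m > 0"
  shows "divisor_sum m \<ge> 0 \<and> ((\<forall>p. prime p \<longrightarrow> even (multiplicity p m)) \<longrightarrow> divisor_sum m \<ge> 1)"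
  using assms
proof (induction m rule: less_induct)
  case (less m)
  show ?case
  proof (cases "m = 1")
    case True
    have "{d::nat. d dvd 1} = {1}" by auto
    thus ?thesis using True one by (simp add: divisor_sum_def)
  next
    case False
    then obtain p where p: "prime p" "p dvd m" using prime_factor_nat by blast
    define v where "v = multiplicity p m"
    have "m \<noteq> 0" "\<not> is_unit p" using less.prems p(1) not_prime_unit by auto
    from multiplicity_decompose'[OF this] obtain m' where m': "m = p ^ v * m'" "\<not> p dvd m'"
      unfolding v_def by blast
    have m'0: "m' > 0" using m' less.prems by (cases m') auto
    have "v > 0" using p \<open>m \<noteq> 0\<close> by (simp add: v_def prime_multiplicity_gt_zero_iff prime_imp_prime_elem)
    hence "p ^ v > 1" using prime_gt_1_nat[OF p(1)] by (intro one_less_power)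
    hence "m' < m" using m'(1) m'0 by simp
    note IH = less.IH[OF this m'0]
    have eq: "divisor_sum m = (\<Sum>i\<le>v. \<kappa> p ^ i) * divisor_sum m'"
      unfolding m'(1) by (rule divisor_sum_prime_power_mult[OF p(1) m'(2) m'0])
    note geo = geometric_sum_nonneg[OF vals[of p], of v]
    show ?thesis
    proof (intro conjI impI)
      show "divisor_sum m \<ge> 0" unfolding eq using geo(1) IH by (intro mult_nonneg_nonneg) auto
      assume sq: "\<forall>p. prime p \<longrightarrow> even (multiplicity p m)"
      have "even (multiplicity l m')" if l: "prime l" for l
      proof (cases "l = p")
        case True
        thus ?thesis using m'(2) by (simp add: not_dvd_imp_multiplicity_0)
      next
        case False
        have "multiplicity l (p ^ v) = 0"
          using False primes_dvd_imp_eq[OF l p(1)] prime_dvd_power[OF l, of p v]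
          by (intro not_dvd_imp_multiplicity_0) auto
        hence "multiplicity l m = multiplicity l m'"
          using l m'0 p(1) unfolding m'(1) by (subst prime_elem_multiplicity_mult_distrib) auto
        with sq[rule_format, OF l] show ?thesis by (simp only:)
      qed
      hence "divisor_sum m' \<ge> 1" using IH by blast
      moreover have "(\<Sum>i\<le>v. \<kappa> p ^ i) \<ge> 1" using geo(2) sq p(1) by (simp add: v_def)
      ultimately show "divisor_sum m \<ge> 1" unfolding eq
        using mult_mono[of 1 "(\<Sum>i\<le>v. \<kappa> p ^ i)" 1 "divisor_sum m'"] by simp
    qed
  qed
qed

end

locale nonprincipal_real_character =
  fixes q :: nat and \<kappa> :: "nat \<Rightarrow> int"
  assumes char: "real_character q \<kappa>" and nonprincipal: "\<exists>n. \<kappa> n = - 1"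
begin

sublocale completely_multiplicative \<kappa>
  using char real_character_1[OF char] unfolding real_character_def by unfold_locales blast+

lemma q_pos: "q > 0"
  using char unfolding real_character_def by simp

lemma kappa_0: "\<kappa> 0 = 0"
proof (rule ccontr)
  assume "\<kappa> 0 \<noteq> 0"
  hence "coprime 0 q" using char unfolding real_character_def by blast
  hence "q = 1" by simp
  moreover obtain n where "\<kappa> n = - 1" using nonprincipal by blast
  ultimately show False using real_character_cong[OF char, of n 1] one by simp
qed

text \<open>Multiplication by an n with \<kappa> n = -1 permutes the residues and negates the
  sum.\<close>

lemma sum_period: "(\<Sum>k<q. \<kappa> k) = 0"
proof -
  obtain n where n: "\<kappa> n = - 1" using nonprincipal by blast
  hence "\<kappa> n \<noteq> 0" by simp
  hence cop: "coprime n q" using char unfolding real_character_def by blast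
  have inj: "inj_on (\<lambda>k. n * k mod q) {..<q}"
  proof (rule inj_onI)
    fix x y assume xy: "x \<in> {..<q}" "y \<in> {..<q}" "n * x mod q = n * y mod q"
    hence "[x = y] (mod q)" using cop cong_mult_lcancel_nat[of n q x y] by (simp add: cong_def coprime_commute)
    thus "x = y" using xy by (simp add: cong_def)
  qed
  have im: "(\<lambda>k. n * k mod q) ` {..<q} = {..<q}"
    by (rule card_subset_eq) (use q_pos inj in \<open>auto simp: card_image\<close>)
  have "(\<Sum>k<q. \<kappa> k) = (\<Sum>k\<in>(\<lambda>k. n * k mod q) ` {..<q}. \<kappa> k)" by (simp only: im)
  also have "\<dots> = (\<Sum>k<q. \<kappa> (n * k mod q))" by (simp add: sum.reindex[OF inj])
  also have "\<dots> = (\<Sum>k<q. \<kappa> n * \<kappa> k)"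
    using real_character_cong[OF char, of "n * _ mod q" "n * _"] by (intro sum.cong) (auto simp: mult[symmetric])
  also have "\<dots> = - (\<Sum>k<q. \<kappa> k)" by (simp add: n sum_negf)
  finally show ?thesis by simp
qed

lemma partial_sum_lessThan: "\<bar>\<Sum>k<n. \<kappa> k\<bar> \<le> int q"
proof (induction n rule: less_induct)
  case (less n)
  show ?case
  proof (cases "n < q")
    case True
    have "\<bar>\<Sum>k<n. \<kappa> k\<bar> \<le> (\<Sum>k<n. \<bar>\<kappa> k\<bar>)" by (rule sum_abs)
    also have "\<dots> \<le> (\<Sum>k<n. 1)"
    proof (rule sum_mono)
      fix k
      show "\<bar>\<kappa> k\<bar> \<le> 1" using vals[of k] by auto
    qed
    finally show ?thesis using True by simp
  next
    case False
    define m where "m = n - q"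
    have n: "n = q + m" using False by (simp add: m_def)
    have "(\<Sum>k<q + m. \<kappa> k) = (\<Sum>k<q. \<kappa> k) + (\<Sum>k<m. \<kappa> (q + k))"
      by (induction m) auto
    also have "(\<Sum>k<m. \<kappa> (q + k)) = (\<Sum>k<m. \<kappa> k)"
      by (rule sum.cong) (use char in \<open>auto simp: real_character_def add.commute\<close>)
    finally show ?thesis using less[of m] q_pos by (simp add: n sum_period)
  qed
qed

definition partial_sum :: "nat \<Rightarrow> int" where
  "partial_sum n = (\<Sum>k\<in>{1..n}. \<kappa> k)"

lemma abs_partial_sum: "\<bar>partial_sum n\<bar> \<le> int q"
proof -
  have "{..<Suc n} = insert 0 {1..n}" by auto
  hence "(\<Sum>k<Suc n. \<kappa> k) = partial_sum n" by (simp add: partial_sum_def kappa_0)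
  thus ?thesis using partial_sum_lessThan[of "Suc n"] by simp
qed

sublocale bounded_partial_sums "\<lambda>n. of_int (\<kappa> n)" "\<lambda>n. of_int (partial_sum n)" "real q"
proof
  show "cmod (of_int (partial_sum n)) \<le> real q" for n
    using abs_partial_sum[of n] by (simp add: norm_of_int)
qed (simp_all add: partial_sum_def kappa_0)

definition L :: "complex \<Rightarrow> complex" where
  "L = abel_series (\<lambda>n. of_int (partial_sum n))"

lemma L_eq_dirichlet: "Re s > 1 \<Longrightarrow> L s = dirichlet s"
  unfolding L_def dirichlet_def trm_def using dirichlet_series_sums[of s] by (simp add: sums_iff)

text \<open>This weight makes summation by parts possible for the Lambert series minus the series
  for L(1)/(1 - x). After multiplication by 1 - x it equals 1/n - x^n/S n, where S n = 1 + ... +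
  x^(n-1), and it decreases because n (n + 1) x^n \<le> S n S (n + 1).\<close>

lemma lambert_weight:
  fixes x :: real
  assumes x: "0 < x" "x < 1"
  defines "b \<equiv> \<lambda>n. 1 / (real n * (1 - x)) - x ^ n / (1 - x ^ n)"
  shows "n \<ge> 1 \<Longrightarrow> b (Suc n) \<le> b n" "n \<ge> 1 \<Longrightarrow> b n \<ge> 0" "b 1 = 1"
proof -
  define S where "S = (\<lambda>n. \<Sum>i<n. x ^ i)"
  have S: "1 - x ^ n = (1 - x) * S n" for n
    unfolding S_def by (rule one_diff_power_eq)
  have S_pos: "S n > 0" if "n \<ge> 1" for n
    unfolding S_def using x that by (intro sum_pos) (auto simp: lessThan_empty_iff)
  have S_Suc: "S (Suc n) = 1 + x * S n" for n
    unfolding S_def by (subst sum.lessThan_Suc_shift) (simp add: sum_distrib_left)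
  have b: "(1 - x) * b n = 1 / real n - x ^ n / S n" for n
  proof -
    have "(1 - x) * (1 / (real n * (1 - x))) = 1 / real n" "(1 - x) * (x ^ n / ((1 - x) * S n)) = x ^ n / S n"
      using x by simp_all
    thus ?thesis unfolding b_def S
      by (simp only: right_diff_distrib[of "1 - x" "1 / (real n * (1 - x))"])
  qed
  \<comment> \<open>The two exponents add up to 2n - 1 rather than 2n; as x < 1, this only increases
    the arithmetic mean.\<close>
  have amgm: "2 * x ^ n \<le> x ^ a + x ^ (2 * n - 1 - a)" if "a \<le> 2 * n - 1" "n \<ge> 1" for a n
  proof (cases "a \<le> n")
    case True
    have "x ^ (2 * n - a) \<le> x ^ (2 * n - 1 - a)" using x by (intro power_decreasing) auto
    moreover have "x ^ n = x ^ a * x ^ (n - a)" "x ^ (2 * n - a) = x ^ a * (x ^ (n - a) * x ^ (n - a))"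
      using True by (simp_all add: mult_2 flip: power_add)
    moreover have "0 \<le> x ^ a * (1 - x ^ (n - a)) ^ 2" using x by simp
    ultimately show ?thesis by (simp add: power2_eq_square algebra_simps)
  next
    case False
    define a' where "a' = 2 * n - 1 - a"
    have a': "a' \<le> n" "2 * n - 1 - a' = a" using False that by (auto simp: a'_def)
    have "x ^ (2 * n - a') \<le> x ^ a" using x a' by (intro power_decreasing) auto
    moreover have "x ^ n = x ^ a' * x ^ (n - a')" "x ^ (2 * n - a') = x ^ a' * (x ^ (n - a') * x ^ (n - a'))"
      using a' by (simp_all add: mult_2 flip: power_add)
    moreover have "0 \<le> x ^ a' * (1 - x ^ (n - a')) ^ 2" using x by simp
    ultimately have "2 * x ^ n \<le> x ^ a + x ^ a'" by (simp add: power2_eq_square algebra_simps)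
    thus ?thesis by (simp add: a'_def)
  qed
  \<comment> \<open>The product S n S (n + 1) consists of n (n + 1) monomials. The reflection (i, j)
    to (n - 1 - i, n - j) exchanges the exponents i + j and 2n - 1 - (i + j), so the mean inequality
    applies to each pair.\<close>
  have key: "real n * real (Suc n) * x ^ n \<le> S n * S (Suc n)" if n: "n \<ge> 1" for n
  proof -
    have "S n * S (Suc n) = (\<Sum>i<n. \<Sum>j<Suc n. x ^ (i + j))"
      unfolding S_def sum_product power_add ..
    moreover have "S n * S (Suc n) = (\<Sum>i<n. \<Sum>j<Suc n. x ^ (2 * n - 1 - (i + j)))"
    proof -
      have "S n = (\<Sum>i<n. x ^ (n - Suc i))" "S (Suc n) = (\<Sum>j<Suc n. x ^ (Suc n - Suc j))"
        unfolding S_def by (rule sum.nat_diff_reindex[symmetric])+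
      hence "S n * S (Suc n) = (\<Sum>i<n. \<Sum>j<Suc n. x ^ (n - Suc i) * x ^ (Suc n - Suc j))"
        by (simp only: sum_product)
      also have "\<dots> = (\<Sum>i<n. \<Sum>j<Suc n. x ^ (2 * n - 1 - (i + j)))"
      proof (intro sum.cong refl)
        fix i j assume "i \<in> {..<n}" "j \<in> {..<Suc n}"
        hence "2 * n - 1 - (i + j) = (n - Suc i) + (Suc n - Suc j)" by simp
        thus "x ^ (n - Suc i) * x ^ (Suc n - Suc j) = x ^ (2 * n - 1 - (i + j))" by (simp only: power_add)
      qed
      finally show ?thesis .
    qed
    ultimately have "2 * (S n * S (Suc n)) = (\<Sum>i<n. \<Sum>j<Suc n. x ^ (i + j) + x ^ (2 * n - 1 - (i + j)))"
      by (simp only: sum.distrib mult_2)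
    also have "\<dots> \<ge> (\<Sum>i<n. \<Sum>j<Suc n. 2 * x ^ n)"
      by (intro sum_mono amgm) (use n in auto)
    finally show ?thesis by simp
  qed
  show "b (Suc n) \<le> b n" if n: "n \<ge> 1"
  proof -
    have "x ^ n / S n - x ^ Suc n / S (Suc n) = x ^ n * (S (Suc n) - x * S n) / (S n * S (Suc n))"
      using S_pos[OF n] S_pos[of "Suc n"] by (simp add: field_simps)
    also have "\<dots> = x ^ n / (S n * S (Suc n))" by (simp add: S_Suc)
    also have "\<dots> \<le> 1 / (real n * real (Suc n))"
    proof -
      have "y / A \<le> 1 / N" if "N * y \<le> A" "0 < N" "0 < A" for y A N :: real
        using that by (simp add: field_simps)
      thus ?thesis using key[OF n] S_pos[OF n] S_pos[of "Suc n"] n by simp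
    qed
    also have "\<dots> = 1 / real n - 1 / real (Suc n)" using n by (simp add: field_simps)
    finally have "(1 - x) * b (Suc n) \<le> (1 - x) * b n" unfolding b by simp
    thus ?thesis using x by simp
  qed
  show "b n \<ge> 0" if n: "n \<ge> 1"
  proof -
    have "real n * x ^ n = (\<Sum>i<n. x ^ n)" by simp
    also have "\<dots> \<le> S n" unfolding S_def using x by (intro sum_mono power_decreasing) auto
    finally have "x ^ n / S n \<le> 1 / real n" using S_pos[OF n] n by (simp add: field_simps)
    hence "0 \<le> (1 - x) * b n" unfolding b by simp
    thus ?thesis using x by (simp add: zero_le_mult_iff)
  qed
  show "b 1 = 1" using x by (simp add: b_def field_simps)
qed

lemma abel_bound:
  fixes b :: "nat \<Rightarrow> real"
  assumes "\<And>n. n \<ge> 1 \<Longrightarrow> b (Suc n) \<le> b n" "\<And>n. n \<ge> 1 \<Longrightarrow> b n \<ge> 0"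
  shows "\<bar>\<Sum>n\<in>{1..M}. of_int (\<kappa> n) * b n\<bar> \<le> real q * b 1"
proof -
  have parts: "(\<Sum>n\<in>{1..M}. of_int (\<kappa> n) * b n)
      = (\<Sum>n\<in>{1..M}. of_int (partial_sum n) * (b n - b (Suc n))) + of_int (partial_sum M) * b (Suc M)" for M
    by (induction M) (auto simp: partial_sum_def algebra_simps)
  have tele: "(\<Sum>n\<in>{1..M}. b n - b (Suc n)) = b 1 - b (Suc M)" for M
    by (induction M) auto
  have ps: "\<bar>of_int (partial_sum n) :: real\<bar> \<le> real q" for n
    using abs_partial_sum[of n] by linarith
  have "\<bar>\<Sum>n\<in>{1..M}. of_int (\<kappa> n) * b n\<bar>
      \<le> (\<Sum>n\<in>{1..M}. \<bar>of_int (partial_sum n) * (b n - b (Suc n))\<bar>) + \<bar>of_int (partial_sum M) * b (Suc M)\<bar>"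
    unfolding parts by (rule order_trans[OF abs_triangle_ineq add_right_mono[OF sum_abs]])
  also have "\<dots> \<le> (\<Sum>n\<in>{1..M}. real q * (b n - b (Suc n))) + real q * b (Suc M)"
    unfolding abs_mult using ps assms by (intro add_mono sum_mono mult_mono) auto
  also have "\<dots> = real q * b 1"
    unfolding sum_distrib_left[symmetric] tele by (simp add: algebra_simps)
  finally show ?thesis .
qed

text \<open>Expanding x^n/(1 - x^n) and collecting exponents gives the divisor sums. Working with
  the truncation at M avoids rearranging infinite double series; each of the M geometric tails is at
  most x^M/(1 - x).\<close>

lemma lambert_series_error:
  fixes x :: real
  assumes x: "0 < x" "x < 1"
  shows "\<bar>(\<Sum>n\<in>{1..M}. of_int (\<kappa> n) * (x ^ n / (1 - x ^ n))) - (\<Sum>m\<in>{1..M}. of_int (divisor_sum m) * x ^ m)\<bar>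
      \<le> real M * x ^ M / (1 - x)"
proof -
  have "(\<Sum>m\<in>{1..M}. of_int (divisor_sum m) * x ^ m) = (\<Sum>m\<in>{1..M}. \<Sum>d | d dvd m. of_int (\<kappa> d) * x ^ m)"
    by (simp add: divisor_sum_def sum_distrib_right)
  also have "\<dots> = (\<Sum>(m, d)\<in>Sigma {1..M} (\<lambda>m. {d. d dvd m}). of_int (\<kappa> d) * x ^ m)"
    by (rule sum.Sigma) auto
  also have "\<dots> = (\<Sum>(n, j)\<in>Sigma {1..M} (\<lambda>n. {1..M div n}). of_int (\<kappa> n) * x ^ (n * j))"
  proof (rule sum.reindex_bij_witness[of _ "\<lambda>(n, j). (n * j, n)" "\<lambda>(m, d). (d, m div d)"])
    fix a assume "a \<in> Sigma {1..M} (\<lambda>m. {d. d dvd m})"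
    then obtain m d where a: "a = (m, d)" "1 \<le> m" "m \<le> M" "d dvd m" by auto
    obtain j where j: "m = d * j" using a by (elim dvdE)
    have "d > 0" "j > 0" using j a by (auto intro: Nat.gr0I)
    thus "(case case a of (m, d) \<Rightarrow> (d, m div d) of (n, j) \<Rightarrow> (n * j, n)) = a"
      "(case case a of (m, d) \<Rightarrow> (d, m div d) of (n, j) \<Rightarrow> of_int (\<kappa> n) * x ^ (n * j)) = (case a of (m, d) \<Rightarrow> of_int (\<kappa> d) * x ^ m)"
      by (simp_all add: a j)
    have "d \<le> M" using a dvd_imp_le[of d m] by simp
    moreover have "j \<le> M div d" using a(3) \<open>d > 0\<close> unfolding j by (simp add: less_eq_div_iff_mult_less_eq mult.commute)
    ultimately show "(case a of (m, d) \<Rightarrow> (d, m div d)) \<in> Sigma {1..M} (\<lambda>n. {1..M div n})"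
      using \<open>d > 0\<close> \<open>j > 0\<close> by (simp add: a j Suc_le_eq)
  next
    fix a assume "a \<in> Sigma {1..M} (\<lambda>n. {1..M div n})"
    then obtain n j where a: "a = (n, j)" "1 \<le> n" "n \<le> M" "1 \<le> j" "j \<le> M div n" by auto
    have "n * j \<le> M" using a by (simp add: less_eq_div_iff_mult_less_eq mult.commute)
    thus "(case a of (n, j) \<Rightarrow> (n * j, n)) \<in> Sigma {1..M} (\<lambda>m. {d. d dvd m})" using a by simp
    show "(case case a of (n, j) \<Rightarrow> (n * j, n) of (m, d) \<Rightarrow> (d, m div d)) = a" using a by simp
  qed
  also have "\<dots> = (\<Sum>n\<in>{1..M}. \<Sum>j\<in>{1..M div n}. of_int (\<kappa> n) * x ^ (n * j))"
    by (rule sum.Sigma[symmetric]) auto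
  finally have r: "(\<Sum>m\<in>{1..M}. of_int (divisor_sum m) * x ^ m) = (\<Sum>n\<in>{1..M}. of_int (\<kappa> n) * (\<Sum>j\<in>{1..M div n}. x ^ (n * j)))"
    by (simp add: sum_distrib_left)
  have "\<bar>(\<Sum>n\<in>{1..M}. of_int (\<kappa> n) * (x ^ n / (1 - x ^ n))) - (\<Sum>m\<in>{1..M}. of_int (divisor_sum m) * x ^ m)\<bar>
      \<le> (\<Sum>n\<in>{1..M}. \<bar>of_int (\<kappa> n) * (x ^ n / (1 - x ^ n) - (\<Sum>j\<in>{1..M div n}. x ^ (n * j)))\<bar>)"
    unfolding r sum_subtractf[symmetric] right_diff_distrib[symmetric] by (rule sum_abs)
  also have "\<dots> \<le> (\<Sum>n\<in>{1..M}. x ^ M / (1 - x))"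
  proof (rule sum_mono)
    fix n assume n: "n \<in> {1..M}"
    define J where "J = M div n"
    have xn: "0 < x ^ n" "x ^ n < 1" using x n power_Suc_less_one[of x "n - 1"] by (auto simp: power_strict_decreasing[of 0 n x, simplified])
    have "(\<Sum>j\<in>{1..J}. y ^ j) * (1 - y) = y - y ^ Suc J" for y :: real
    proof (induction J)
      case (Suc J)
      have "(\<Sum>j\<in>{1..Suc J}. y ^ j) * (1 - y) = (\<Sum>j\<in>{1..J}. y ^ j) * (1 - y) + y ^ Suc J * (1 - y)"
        by (simp add: distrib_right)
      also have "\<dots> = y - y ^ Suc (Suc J)" unfolding Suc by (simp add: algebra_simps)
      finally show ?case .
    qed simp
    from this[of "x ^ n"] have "(\<Sum>j\<in>{1..J}. x ^ (n * j)) * (1 - x ^ n) = x ^ n - x ^ (n * Suc J)"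
      by (simp only: power_mult)
    hence eq: "x ^ n / (1 - x ^ n) - (\<Sum>j\<in>{1..J}. x ^ (n * j)) = x ^ (n * Suc J) / (1 - x ^ n)"
      using xn by (simp add: field_simps)
    have "M < n * Suc J" using n unfolding J_def by (simp add: dividend_less_times_div)
    hence "x ^ (n * Suc J) \<le> x ^ M" using x by (intro power_decreasing) auto
    moreover have "1 - x \<le> 1 - x ^ n" using x n power_decreasing[of 1 n x] by simp
    ultimately have "x ^ (n * Suc J) / (1 - x ^ n) \<le> x ^ M / (1 - x)"
      using x by (intro frac_le) auto
    moreover have nn: "0 \<le> x ^ (n * Suc J) / (1 - x ^ n)" using xn x by (intro divide_nonneg_pos) auto
    moreover have "\<bar>of_int (\<kappa> n) :: real\<bar> \<le> 1" using vals[of n] by auto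
    ultimately have "\<bar>of_int (\<kappa> n) :: real\<bar> * (x ^ (n * Suc J) / (1 - x ^ n)) \<le> 1 * (x ^ M / (1 - x))"
      by (intro mult_mono) auto
    thus "\<bar>of_int (\<kappa> n) * (x ^ n / (1 - x ^ n) - (\<Sum>j\<in>{1..M div n}. x ^ (n * j)))\<bar> \<le> x ^ M / (1 - x)"
      unfolding J_def[symmetric] eq abs_mult abs_of_nonneg[OF nn] by simp
  qed
  finally show ?thesis by simp
qed

text \<open>Monsky's argument: if \<open>L 1 = 0\<close>, the Lambert series of \<open>\<kappa>\<close> stays bounded near 1, whereas its
  coefficients are nonnegative and at least 1 at squares.\<close>

theorem L_1_neq_0: "L 1 \<noteq> 0"
proof
  assume L0: "L 1 = 0"
  have "(\<lambda>n. complex_of_real (of_int (\<kappa> n) / real n)) sums 0"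
  proof -
    have "(\<lambda>n. of_int (\<kappa> n) * of_nat n powr (- 1)) sums (0 :: complex)"
      using dirichlet_series_sums[of 1] L0 by (simp add: L_def)
    moreover have "of_int (\<kappa> n) * of_nat n powr (- 1) = complex_of_real (of_int (\<kappa> n) / real n)" for n
      by (cases "n = 0") (simp_all add: powr_minus_divide)
    ultimately show ?thesis by simp
  qed
  hence "(\<lambda>n. of_int (\<kappa> n) / real n) sums 0" using sums_of_real_iff[of _ 0] by (metis of_real_0)
  hence "(\<lambda>M. \<Sum>n<Suc M. of_int (\<kappa> n) / real n) \<longlonglongrightarrow> 0" unfolding sums_def by (rule LIMSEQ_Suc)
  moreover have "(\<Sum>n<Suc M. of_int (\<kappa> n) / real n) = (\<Sum>n\<in>{1..M}. of_int (\<kappa> n) / real n)" for M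
    by (rule sum.mono_neutral_right) auto
  ultimately have lim0: "(\<lambda>M. \<Sum>n\<in>{1..M}. of_int (\<kappa> n) / real n) \<longlonglongrightarrow> 0" by simp
  \<comment> \<open>The bound is independent of both x and K, so x can be sent to 1 with K
    fixed.\<close>
  have bound: "(\<Sum>k\<in>{1..K}. x ^ (k ^ 2)) \<le> real q" if x: "0 < x" "x < 1" for x :: real and K :: nat
  proof -
    define R where "R = (\<lambda>M. \<Sum>m\<in>{1..M}. of_int (divisor_sum m) * x ^ m)"
    \<comment> \<open>Collects the partial sum of \<kappa>(n)/n, which tends to L(1) = 0, and the
      truncation error of the Lambert series.\<close>
    define e where "e = (\<lambda>M. \<bar>\<Sum>n\<in>{1..M}. of_int (\<kappa> n) / real n\<bar> / (1 - x) + real M * x ^ M / (1 - x))"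
    have R: "R M \<le> real q + e M" for M
    proof -
      define b where "b = (\<lambda>n. 1 / (real n * (1 - x)) - x ^ n / (1 - x ^ n))"
      have b: "n \<ge> 1 \<Longrightarrow> b (Suc n) \<le> b n" "n \<ge> 1 \<Longrightarrow> b n \<ge> 0" "b 1 = 1" for n
        unfolding b_def using lambert_weight[OF x] by blast+
      define P where "P = (\<Sum>n\<in>{1..M}. of_int (\<kappa> n) / real n)"
      define Y where "Y = (\<Sum>n\<in>{1..M}. of_int (\<kappa> n) * (x ^ n / (1 - x ^ n)))"
      have "\<bar>\<Sum>n\<in>{1..M}. of_int (\<kappa> n) * b n\<bar> \<le> real q * b 1" by (rule abel_bound[where b = b]) (erule b)+
      moreover have "(\<Sum>n\<in>{1..M}. of_int (\<kappa> n) * b n) = P / (1 - x) - Y"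
        unfolding b_def P_def Y_def by (simp add: right_diff_distrib sum_subtractf sum_divide_distrib)
      ultimately have "\<bar>P / (1 - x) - Y\<bar> \<le> real q" using b(3) by simp
      moreover have "\<bar>P / (1 - x)\<bar> = \<bar>P\<bar> / (1 - x)"
        using x by (simp add: abs_divide)
      moreover have "\<bar>Y - R M\<bar> \<le> real M * x ^ M / (1 - x)"
        using lambert_series_error[OF x, of M] unfolding R_def Y_def .
      ultimately show ?thesis unfolding e_def P_def[symmetric] by linarith
    qed
    have elim: "e \<longlonglongrightarrow> 0"
    proof -
      have "(\<lambda>M. real M * x ^ M) \<longlonglongrightarrow> 0" using x by real_asymp
      hence "(\<lambda>M. real M * x ^ M / (1 - x)) \<longlonglongrightarrow> 0 / (1 - x)" using x by (intro tendsto_divide) auto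
      moreover have "(\<lambda>M. \<bar>\<Sum>n\<in>{1..M}. of_int (\<kappa> n) / real n\<bar> / (1 - x)) \<longlonglongrightarrow> \<bar>0\<bar> / (1 - x)"
        using x by (intro tendsto_divide tendsto_rabs lim0) auto
      ultimately show ?thesis unfolding e_def using tendsto_add by fastforce
    qed
    have lower: "(\<Sum>k\<in>{1..K}. x ^ (k ^ 2)) \<le> R M" if M: "M \<ge> K ^ 2" for M
    proof -
      have inj: "inj_on (\<lambda>k::nat. k ^ 2) {1..K}" by (auto simp: inj_on_def power2_eq_iff)
      have "(\<Sum>k\<in>{1..K}. x ^ (k ^ 2)) = (\<Sum>m\<in>(\<lambda>k. k ^ 2) ` {1..K}. x ^ m)"
        by (subst sum.reindex[OF inj]) simp
      also have "\<dots> \<le> (\<Sum>m\<in>(\<lambda>k. k ^ 2) ` {1..K}. of_int (divisor_sum m) * x ^ m)"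
      proof (rule sum_mono)
        fix m assume "m \<in> (\<lambda>k. k ^ 2) ` {1..K}"
        then obtain k where k: "m = k ^ 2" "k \<ge> 1" by auto
        have "even (multiplicity p m)" if "prime p" for p
          using that k by (simp add: prime_elem_multiplicity_power_distrib prime_imp_prime_elem)
        hence "divisor_sum m \<ge> 1" using divisor_sum_nonneg[of m] k by auto
        thus "x ^ m \<le> of_int (divisor_sum m) * x ^ m" using x by (simp add: mult_le_cancel_right1)
      qed
      also have "\<dots> \<le> R M" unfolding R_def
      proof (rule sum_mono2)
        have "k ^ 2 \<le> M" if "k \<le> K" for k
          using power_mono[OF that le0, of 2] M by (rule order_trans)
        thus "(\<lambda>k. k ^ 2) ` {1..K} \<subseteq> {1..M}" by auto
        show "0 \<le> of_int (divisor_sum m) * x ^ m" if "m \<in> {1..M} - (\<lambda>k. k ^ 2) ` {1..K}" for m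
          using that x divisor_sum_nonneg[of m] by (intro mult_nonneg_nonneg) auto
      qed simp
      finally show ?thesis .
    qed
    have "(\<lambda>M. real q + e M) \<longlonglongrightarrow> real q + 0" by (intro tendsto_add tendsto_const elim)
    moreover have "\<forall>\<^sub>F M in sequentially. (\<Sum>k\<in>{1..K}. x ^ (k ^ 2)) \<le> real q + e M"
      by (rule eventually_sequentiallyI[of "K ^ 2"]) (use lower R order_trans in blast)
    ultimately show ?thesis using tendsto_lowerbound[of "\<lambda>M. real q + e M"] by simp
  qed
  \<comment> \<open>With K = q + 1 the limit would give q + 1 \<le> q.\<close>
  have "((\<lambda>x::real. \<Sum>k\<in>{1..Suc q}. x ^ (k ^ 2)) \<longlongrightarrow> (\<Sum>k\<in>{1..Suc q}. 1 ^ (k ^ 2))) (at_left 1)"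
    by (intro tendsto_intros)
  moreover have "\<forall>\<^sub>F x in at_left (1::real). x \<in> {0<..<1}" by (rule eventually_at_left_real) simp
  hence "\<forall>\<^sub>F x::real in at_left 1. (\<Sum>k\<in>{1..Suc q}. x ^ (k ^ 2)) \<le> real q"
    by eventually_elim (rule bound, auto)
  ultimately have "(\<Sum>k\<in>{1..Suc q}. 1 ^ (k ^ 2)) \<le> real q"
    by (rule tendsto_upperbound) simp
  thus False by simp
qed

end

section \<open>The zeta function near the line Re s = 1\<close>

interpretation zeta: completely_multiplicative "\<lambda>_. 1"
  by unfold_locales auto

text \<open>The Dirichlet series with coefficients \<open>1 - m\<close> at multiples of \<open>m\<close> and 1 elsewhere continues
  \<open>(1 - m powr (1 - s)) * \<zeta> s\<close> to \<open>Re s > 0\<close>.\<close>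

locale eta_function =
  fixes m :: nat
  assumes m: "m \<ge> 2"
begin

definition coeff_eta :: "nat \<Rightarrow> complex" where
  "coeff_eta n = (if n = 0 then 0 else if m dvd n then 1 - of_nat m else 1)"

lemma partial_sum_eta: "(\<Sum>k\<in>{1..n}. coeff_eta k) = of_nat (n mod m)"
proof (induction n)
  case (Suc n)
  show ?case
  proof (cases "m dvd Suc n")
    case True
    hence "Suc (n mod m) = m" using m by (metis dvd_eq_mod_eq_0 mod_Suc nat.distinct(1))
    hence "of_nat (n mod m) = (of_nat m - 1 :: complex)" by (metis add_diff_cancel_left' of_nat_Suc)
    thus ?thesis using Suc True by (simp add: coeff_eta_def dvd_eq_mod_eq_0)
  next
    case False
    hence "Suc n mod m = Suc (n mod m)" using m by (simp add: mod_Suc dvd_eq_mod_eq_0 split: if_splits)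
    thus ?thesis using Suc False by (simp add: coeff_eta_def)
  qed
qed simp

sublocale bounded_partial_sums coeff_eta "\<lambda>n. of_nat (n mod m)" "real m"
proof
  show "cmod (of_nat (n mod m)) \<le> real m" for n
    using mod_less_divisor[of m n] m by (simp add: less_imp_le)
qed (simp_all add: partial_sum_eta[symmetric] coeff_eta_def)

definition eta :: "complex \<Rightarrow> complex" where
  "eta = abel_series (\<lambda>n. of_nat (n mod m))"

lemma eta_eq:
  assumes s: "Re s > 1"
  shows "eta s = (1 - of_nat m * of_nat m powr (- s)) * zeta.dirichlet s"
proof -
  define t where "t = zeta.trm s"
  have t: "t n = of_nat n powr (- s)" for n by (simp add: t_def zeta.trm_def)
  have smt: "summable t" unfolding t_def by (rule summable_norm_cancel[OF zeta.summable_norm_trm[OF s]])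
  let ?k = "\<lambda>n. if m dvd n then t n else 0"
  have smk: "summable ?k"
    by (rule summable_comparison_test'[OF zeta.summable_norm_trm[OF s], of 0]) (simp add: t_def)
  have "(\<Sum>n. t (m * n)) = (\<Sum>n. ?k (m * n))" by simp
  also have "\<dots> = (\<Sum>n. ?k n)"
    by (rule suminf_mono_reindex) (use m in \<open>auto simp: strict_mono_def\<close>)
  finally have "t m * (\<Sum>n. t n) = (\<Sum>n. ?k n)"
    using suminf_mult[OF smt, of "t m"] by (simp add: t_def zeta.trm_mult)
  moreover have "coeff_eta n * of_nat n powr (- s) = t n - of_nat m * ?k n" for n
    by (simp add: coeff_eta_def t algebra_simps)
  hence "eta s = (\<Sum>n. t n - of_nat m * ?k n)"
    using dirichlet_series_sums[of s] s unfolding eta_def by (simp add: sums_iff)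
  hence "eta s = (\<Sum>n. t n) - of_nat m * (\<Sum>n. ?k n)"
    using suminf_diff[OF smt summable_mult[OF smk]] suminf_mult[OF smk] by simp
  ultimately show ?thesis by (simp add: zeta.dirichlet_def t_def[symmetric] t algebra_simps)
qed

end

interpretation eta2: eta_function 2 by unfold_locales simp
interpretation eta3: eta_function 3 by unfold_locales simp

text \<open>Division by 1 - m^(1 - s) continues \<zeta> unless that factor vanishes at 1 + it. It
  cannot vanish for m = 2 and m = 3 at once, as ln 2 / ln 3 is irrational.\<close>

lemma zeta_bounded_near:
  fixes t :: real
  assumes t: "t \<noteq> 0"
  shows "\<exists>K. \<forall>\<^sub>F \<sigma> in at_right 1. cmod (zeta.dirichlet (Complex \<sigma> t)) \<le> K"
proof -
  have reduction: "\<exists>K. \<forall>\<^sub>F \<sigma> in at_right 1. cmod (zeta.dirichlet (Complex \<sigma> t)) \<le> K"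
    if "eta_function m" "of_nat m * of_nat m powr (- Complex 1 t) \<noteq> (1 :: complex)" for m
  proof -
    interpret eta_function m by fact
    define F where "F = (\<lambda>s. eta s / (1 - of_nat m * of_nat m powr (- s)))"
    have "isCont eta (Complex 1 t)"
      using abel_series_holomorphic unfolding eta_def
      by (intro holomorphic_on_imp_continuous_on[THEN continuous_on_interior, of _ "{s. 0 < Re s}"])
         (auto simp: interior_open open_halfspace_Re_gt)
    moreover have "isCont (\<lambda>s. of_nat m powr (- s)) (Complex 1 t)"
      using m by (intro continuous_intros isCont_powr_complex) auto
    ultimately have "isCont F (Complex 1 t)"
      unfolding F_def using that(2) m by (intro continuous_intros) auto
    moreover have "((\<lambda>\<sigma>. Complex \<sigma> t) \<longlongrightarrow> Complex 1 t) (at_right 1)"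
      by (intro tendsto_intros)
    ultimately have "((\<lambda>\<sigma>. F (Complex \<sigma> t)) \<longlongrightarrow> F (Complex 1 t)) (at_right 1)"
      by (rule isCont_tendsto_compose)
    hence "\<forall>\<^sub>F \<sigma> in at_right 1. dist (F (Complex \<sigma> t)) (F (Complex 1 t)) < 1"
      by (rule tendstoD) simp
    moreover have "\<forall>\<^sub>F \<sigma> in at_right (1::real). \<sigma> > 1" by (simp add: eventually_at_right_less)
    ultimately have "\<forall>\<^sub>F \<sigma> in at_right 1. cmod (zeta.dirichlet (Complex \<sigma> t)) \<le> cmod (F (Complex 1 t)) + 1"
    proof eventually_elim
      case (elim \<sigma>)
      have "cmod (of_nat m * of_nat m powr (- Complex \<sigma> t)) = real m * real m powr (- \<sigma>)"
        unfolding norm_mult norm_of_nat_powr by simp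
      also have "\<dots> = real m powr (1 - \<sigma>)" using m by (simp add: powr_diff powr_minus field_simps)
      also have "\<dots> < real m powr 0" using m elim by (intro powr_less_mono) auto
      finally have "of_nat m * of_nat m powr (- Complex \<sigma> t) \<noteq> (1 :: complex)" using m by auto
      hence "zeta.dirichlet (Complex \<sigma> t) = F (Complex \<sigma> t)"
        using eta_eq[of "Complex \<sigma> t"] elim by (simp add: F_def)
      thus ?case using elim(1) norm_triangle_ineq2[of "F (Complex \<sigma> t)" "F (Complex 1 t)"]
        by (simp add: dist_norm)
    qed
    thus ?thesis by blast
  qed
  have one: "\<exists>k::int. t * ln (real m) = 2 * pi * k" if m: "m \<ge> 2" "of_nat m * of_nat m powr (- Complex 1 t) = (1 :: complex)" for m :: nat
  proof -
    have "of_nat m * of_nat m powr (- Complex 1 t) = of_nat m powr (1 + - Complex 1 t)"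
      using m(1) by (simp only: powr_add powr_one) simp
    also have "1 + - Complex 1 t = - (\<i> * of_real t)" by (simp add: complex_eq_iff)
    finally have "exp (- (\<i> * of_real t) * of_real (ln (real m))) = 1"
      using m Ln_of_real[of "real m"] by (simp add: powr_def mult.commute)
    then obtain n :: int where "Im (- (\<i> * of_real t) * of_real (ln (real m))) = of_int (2 * n) * pi"
      unfolding exp_eq_1 by blast
    hence "- (t * ln (real m)) = 2 * of_int n * pi" by simp
    hence "t * ln (real m) = - (2 * of_int n * pi)" by linarith
    hence "t * ln (real m) = 2 * pi * of_int (- n)" by (simp add: mult_ac)
    thus ?thesis by blast
  qed
  show ?thesis
  proof (cases "of_nat 2 * of_nat 2 powr (- Complex 1 t) \<noteq> (1 :: complex)")
    case True
    thus ?thesis using reduction eta2.eta_function_axioms by blast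
  next
    case two: False
    show ?thesis
    proof (cases "of_nat 3 * of_nat 3 powr (- Complex 1 t) \<noteq> (1 :: complex)")
      case True
      thus ?thesis using reduction eta3.eta_function_axioms by blast
    next
      case False
      obtain k l :: int where kl: "t * ln 2 = 2 * pi * k" "t * ln 3 = 2 * pi * l"
        using one[of 2] one[of 3] two False by auto
      have "k \<noteq> 0" "l \<noteq> 0" using kl t by auto
      \<comment> \<open>Eliminating t yields 2^|l| = 3^|k| with l nonzero, which parity
        excludes.\<close>
      have "(2 * pi * l) * (t * ln 2) = (2 * pi * k) * (t * ln 3)" using kl by simp
      hence "of_int l * ln 2 = of_int k * ln (3 :: real)" using t by simp
      hence "\<bar>of_int l * ln 2\<bar> = \<bar>of_int k * ln (3 :: real)\<bar>" by simp
      hence "real (nat \<bar>l\<bar>) * ln 2 = real (nat \<bar>k\<bar>) * ln (3 :: real)" by (simp add: abs_mult)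
      hence "ln (2 ^ nat \<bar>l\<bar>) = ln ((3::real) ^ nat \<bar>k\<bar>)" by (simp add: ln_realpow)
      hence "(2::real) ^ nat \<bar>l\<bar> = 3 ^ nat \<bar>k\<bar>" by simp
      hence "real (2 ^ nat \<bar>l\<bar>) = real (3 ^ nat \<bar>k\<bar>)" by simp
      hence "(2::nat) ^ nat \<bar>l\<bar> = 3 ^ nat \<bar>k\<bar>" by (simp only: of_nat_eq_iff)
      moreover have "even ((2::nat) ^ nat \<bar>l\<bar>)" using \<open>l \<noteq> 0\<close> by simp
      moreover have "odd ((3::nat) ^ nat \<bar>k\<bar>)" by simp
      ultimately show ?thesis by simp
    qed
  qed
qed

lemma zeta2_const_nonneg: "zeta2_const \<ge> 0"
  unfolding zeta2_const_def by (intro suminf_nonneg) (auto simp: summable_real_powr_iff)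

text \<open>By convexity of exp the factor 1 - 2^(1 - \<sigma>) is at least (\<sigma> - 1)/2, while
  the continued product with \<zeta> stays bounded on (1, 2].\<close>

lemma zeta_pole_bound:
  assumes "1 < \<sigma>" "\<sigma> \<le> 2"
  shows "cmod (zeta.dirichlet (of_real \<sigma>)) * (\<sigma> - 1) \<le> 8 * zeta2_const"
proof -
  define x where "x = \<sigma> - 1"
  have x: "0 < x" "x \<le> 1" using assms by (auto simp: x_def)
  have convex: "2 powr (- x) \<le> 1 - x / 2"
  proof -
    have "exp ((1 - x) *\<^sub>R 0 + x *\<^sub>R (- ln 2)) \<le> (1 - x) * exp 0 + x * exp (- ln (2::real))"
      using x by (intro convex_onD[OF exp_convex]) auto
    thus ?thesis by (simp add: powr_def exp_minus algebra_simps)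
  qed
  have "(2::complex) powr (- of_real \<sigma>) = of_real (2 powr (- \<sigma>))"
    using powr_of_real[of 2 "- \<sigma>"] by simp
  moreover have "2 powr (- x) = 2 * 2 powr (- \<sigma>)"
    by (simp add: x_def powr_diff powr_minus field_simps)
  ultimately have e2: "(2::complex) * 2 powr (- of_real \<sigma>) = of_real (2 powr (- x))" by simp
  have "eta2.eta (of_real \<sigma>) = of_real (1 - 2 powr (- x)) * zeta.dirichlet (of_real \<sigma>)"
    using eta2.eta_eq[of "of_real \<sigma>"] assms e2 by simp
  hence "cmod (eta2.eta (of_real \<sigma>)) = \<bar>1 - 2 powr (- x)\<bar> * cmod (zeta.dirichlet (of_real \<sigma>))"
    by (simp only: norm_mult norm_of_real)
  moreover have "\<bar>1 - 2 powr (- x)\<bar> \<ge> x / 2" using convex x by linarith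
  hence "x / 2 * cmod (zeta.dirichlet (of_real \<sigma>)) \<le> \<bar>1 - 2 powr (- x)\<bar> * cmod (zeta.dirichlet (of_real \<sigma>))"
    by (intro mult_right_mono) auto
  moreover have "cmod (eta2.eta (of_real \<sigma>)) \<le> 2 * \<sigma> * zeta2_const"
    unfolding eta2.eta_def zeta2_const_def using eta2.abel_series_bound[of 1 "of_real \<sigma>"] assms by simp
  moreover have "2 * \<sigma> * zeta2_const \<le> 2 * 2 * zeta2_const"
    using assms zeta2_const_nonneg by (intro mult_right_mono) auto
  ultimately show ?thesis unfolding x_def[symmetric] by (simp add: mult.commute)
qed

lemma Re_of_nat_powr:
  assumes "n > 0"
  shows "Re (of_nat n powr (- Complex \<sigma> t)) = real n powr (- \<sigma>) * cos (t * ln (real n))"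
proof -
  have "of_nat n powr (- Complex \<sigma> t) = exp (- Complex \<sigma> t * of_real (ln (real n)))"
    using assms Ln_of_real[of "real n"] by (simp add: powr_def)
  also have "Re \<dots> = exp (- \<sigma> * ln (real n)) * cos (t * ln (real n))"
    by (simp add: Re_exp)
  finally show ?thesis using assms by (simp add: powr_def)
qed

section \<open>Nonvanishing to the right of the critical line\<close>

context nonprincipal_real_character
begin

text \<open>The inequality 3 + 4 cos x + cos 2x \<ge> 0 applied at every prime. Since \<kappa>^2 is
  at most the trivial character, \<zeta> can be used at both \<sigma> and \<sigma> + 2it; a prime
  with \<kappa> = 0 contributes 2 + 2c^2.\<close>

lemma three_four_one:
  assumes "\<sigma> > 1"
  shows "0 \<le> 3 * Re (zeta.prime_series (Complex \<sigma> 0)) + 4 * Re (prime_series (Complex \<sigma> t))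
       + Re (zeta.prime_series (Complex \<sigma> (2 * t)))"
proof -
  let ?a = "\<lambda>n s. zeta.prime_coeff n * of_nat n powr (- s)"
  let ?b = "\<lambda>n s. prime_coeff n * of_nat n powr (- s)"
  have "(\<lambda>n. 3 * Re (?a n (Complex \<sigma> 0)) + 4 * Re (?b n (Complex \<sigma> t)) + Re (?a n (Complex \<sigma> (2 * t)))) sums
     (3 * Re (zeta.prime_series (Complex \<sigma> 0)) + 4 * Re (prime_series (Complex \<sigma> t)) + Re (zeta.prime_series (Complex \<sigma> (2 * t))))"
    using assms by (intro sums_add sums_mult sums_Re zeta.prime_series_sums prime_series_sums) auto
  moreover have "0 \<le> 3 * Re (?a n (Complex \<sigma> 0)) + 4 * Re (?b n (Complex \<sigma> t)) + Re (?a n (Complex \<sigma> (2 * t)))" for n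
  proof (cases "prime n")
    case True
    hence n: "n > 0" by (rule prime_gt_0_nat)
    define c where "c = cos (t * ln (real n))"
    have c2: "cos (2 * t * ln (real n)) = 2 * c ^ 2 - 1"
      using cos_double_cos[of "t * ln (real n)"] by (simp add: c_def mult.assoc)
    have eq: "3 * Re (?a n (Complex \<sigma> 0)) + 4 * Re (?b n (Complex \<sigma> t)) + Re (?a n (Complex \<sigma> (2 * t)))
        = real n powr (- \<sigma>) * (2 + 4 * of_int (\<kappa> n) * c + 2 * c ^ 2)"
      using True by (simp add: zeta.prime_coeff_def prime_coeff_def Re_of_nat_powr[OF n] c2 flip: c_def)
        (simp add: algebra_simps)
    have "0 \<le> 2 + 4 * of_int (\<kappa> n) * c + 2 * c ^ 2"
    proof -
      have "0 \<le> 2 * (1 + c) ^ 2" "0 \<le> 2 * (1 - c) ^ 2" "0 \<le> c ^ 2" by simp_all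
      thus ?thesis using vals[of n] by (auto simp: power2_eq_square algebra_simps)
    qed
    thus ?thesis unfolding eq by (intro mult_nonneg_nonneg) auto
  qed (simp add: zeta.prime_coeff_def prime_coeff_def)
  ultimately show ?thesis by (metis (no_types, lifting) sums_le sums_zero)
qed

lemma L_differentiable:
  assumes "Re s > 0"
  shows "L field_differentiable at s"
  using holomorphic_on_imp_differentiable_at[OF abel_series_holomorphic open_halfspace_Re_gt] assms
  by (simp add: L_def)

text \<open>A zero at 1 + it would make |\<zeta>(\<sigma>)^3 L(\<sigma> + it)^4 \<zeta>(\<sigma> +
  2it)| of order \<sigma> - 1, since four zeros outweigh three poles. The 3-4-1 inequality keeps it
  away from 0.\<close>

lemma L_1_line_neq_0:
  assumes t: "t \<noteq> 0"
  shows "L (Complex 1 t) \<noteq> 0"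
proof
  assume L0: "L (Complex 1 t) = 0"
  have diff: "(L has_field_derivative deriv L (Complex 1 t)) (at (Complex 1 t))"
    using L_differentiable[of "Complex 1 t"] by (intro field_differentiable_derivI) simp
  have "filterlim (\<lambda>\<sigma>. Complex \<sigma> t) (at (Complex 1 t)) (at_right 1)"
    unfolding filterlim_at
    by (intro conjI tendsto_intros) (auto simp: eventually_at_right_less elim!: eventually_mono[rotated] intro: eventually_mono[OF eventually_at_right_less])
  hence "((\<lambda>\<sigma>. (L (Complex \<sigma> t) - L (Complex 1 t)) / (Complex \<sigma> t - Complex 1 t)) \<longlongrightarrow> deriv L (Complex 1 t)) (at_right 1)"
    using diff unfolding has_field_derivative_iff by (rule filterlim_compose[rotated])
  hence "\<forall>\<^sub>F \<sigma> in at_right 1. dist ((L (Complex \<sigma> t) - L (Complex 1 t)) / (Complex \<sigma> t - Complex 1 t)) (deriv L (Complex 1 t)) < 1"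
    by (rule tendstoD) simp
  moreover have t2: "2 * t \<noteq> 0" using t by simp
  from zeta_bounded_near[OF t2] obtain K' where
    "\<forall>\<^sub>F \<sigma> in at_right 1. cmod (zeta.dirichlet (Complex \<sigma> (2 * t))) \<le> K'" by blast
  moreover define K where "K = cmod (deriv L (Complex 1 t)) + 1"
  \<comment> \<open>The three factors bound \<zeta>(\<sigma>)(\<sigma> - 1) cubed, the difference
    quotient of L to the fourth power, and \<zeta>(\<sigma> + 2it). The contradiction comes from A
    (\<sigma> - 1) falling below exp(-8 \<open>error_const\<close>), where 8 = 3 + 4 + 1 counts the
    Euler remainders.\<close>
  define A where "A = (8 * zeta2_const) ^ 3 * K ^ 4 * max K' 0"
  have A: "A \<ge> 0" unfolding A_def K_def
    by (intro mult_nonneg_nonneg zero_le_power) (auto simp: zeta2_const_nonneg)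
  have "((\<lambda>\<sigma>. A * (\<sigma> - 1)) \<longlongrightarrow> A * (1 - 1)) (at_right 1)" by (intro tendsto_intros)
  hence "\<forall>\<^sub>F \<sigma> in at_right 1. A * (\<sigma> - 1) < exp (- 8 * error_const)"
    by (intro order_tendstoD) auto
  moreover have "\<forall>\<^sub>F \<sigma> in at_right (1::real). \<sigma> \<in> {1<..<2}" by (rule eventually_at_right_real) simp
  ultimately have "\<forall>\<^sub>F \<sigma> in at_right (1::real). False"
  proof eventually_elim
    case (elim \<sigma>)
    have s1: "\<sigma> > 1" "\<sigma> < 2" using elim(4) by auto
    let ?s = "Complex \<sigma> t" and ?w = "Complex \<sigma> (2 * t)" and ?r = "Complex \<sigma> 0"
    have diff_eq: "?s - Complex 1 t = of_real (\<sigma> - 1)" unfolding complex_diff by (simp add: complex_of_real_def)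
    define D where "D = L ?s / of_real (\<sigma> - 1)"
    have D_le: "cmod D \<le> K"
      using elim(1) L0 norm_triangle_ineq2[of D "deriv L (Complex 1 t)"]
      unfolding diff_eq D_def K_def dist_norm by simp
    have L_eq: "cmod (L ?s) = cmod D * (\<sigma> - 1)" unfolding D_def norm_divide norm_of_real using s1 by simp
    have zeta_le: "cmod (zeta.dirichlet ?r) * (\<sigma> - 1) \<le> 8 * zeta2_const"
      using zeta_pole_bound[of \<sigma>] s1 by (simp add: complex_of_real_def)
    have "(cmod (zeta.dirichlet ?r) * (\<sigma> - 1)) ^ 3 * cmod D ^ 4 * cmod (zeta.dirichlet ?w) \<le> A"
    proof -
      have gen: "a ^ 3 * d ^ 4 * z \<le> A"
        if "0 \<le> a" "a \<le> 8 * zeta2_const" "0 \<le> d" "d \<le> K" "0 \<le> z" "z \<le> K'" for a d z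
        unfolding A_def using that zeta2_const_nonneg
        by (intro mult_mono power_mono mult_nonneg_nonneg zero_le_power) auto
      show ?thesis by (rule gen) (use D_le zeta_le elim(2) s1 in \<open>auto intro: mult_nonneg_nonneg\<close>)
    qed
    hence h1: "(cmod (zeta.dirichlet ?r) * (\<sigma> - 1)) ^ 3 * cmod D ^ 4 * cmod (zeta.dirichlet ?w) * (\<sigma> - 1) \<le> A * (\<sigma> - 1)"
      using s1 by (intro mult_right_mono) auto
    have h2: "(cmod (zeta.dirichlet ?r) * (\<sigma> - 1)) ^ 3 * cmod D ^ 4 * cmod (zeta.dirichlet ?w) * (\<sigma> - 1)
        = cmod (zeta.dirichlet ?r) ^ 3 * cmod (L ?s) ^ 4 * cmod (zeta.dirichlet ?w)"
      unfolding L_eq by (simp add: power_mult_distrib eval_nat_numeral mult_ac)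
    have h3: "cmod (zeta.dirichlet ?r) ^ 3 * cmod (L ?s) ^ 4 * cmod (zeta.dirichlet ?w)
        = exp (3 * Re (zeta.prime_series ?r + zeta.euler_error ?r) + 4 * Re (prime_series ?s + euler_error ?s)
             + Re (zeta.prime_series ?w + zeta.euler_error ?w))"
    proof -
      have "cmod (zeta.dirichlet ?r) = exp (Re (zeta.prime_series ?r + zeta.euler_error ?r))"
        "cmod (L ?s) = exp (Re (prime_series ?s + euler_error ?s))"
        "cmod (zeta.dirichlet ?w) = exp (Re (zeta.prime_series ?w + zeta.euler_error ?w))"
        using s1 zeta.euler_product[of ?r] zeta.euler_product[of ?w] euler_product[of ?s] L_eq_dirichlet[of ?s]
        by (simp_all only: complex.sel norm_exp_eq_Re)
      moreover have "exp x ^ 3 * exp y ^ 4 * exp z = exp (3 * x + 4 * y + z)" for x y z :: real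
        using exp_of_nat_mult[of 3 x] exp_of_nat_mult[of 4 y] by (simp add: exp_add)
      ultimately show ?thesis by simp
    qed
    have h4: "3 * Re (zeta.prime_series ?r + zeta.euler_error ?r) + 4 * Re (prime_series ?s + euler_error ?s)
             + Re (zeta.prime_series ?w + zeta.euler_error ?w) \<ge> - 8 * error_const"
    proof -
      have "\<bar>Re (zeta.euler_error ?r)\<bar> \<le> error_const" "\<bar>Re (euler_error ?s)\<bar> \<le> error_const"
        "\<bar>Re (zeta.euler_error ?w)\<bar> \<le> error_const"
        by (rule order_trans[OF abs_Re_le_cmod zeta.euler_error_bound], use s1 in simp)
           (rule order_trans[OF abs_Re_le_cmod euler_error_bound], use s1 in simp,
            rule order_trans[OF abs_Re_le_cmod zeta.euler_error_bound], use s1 in simp)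
      thus ?thesis using three_four_one[OF s1(1), of t] by (simp add: abs_le_iff)
    qed
    have "exp (- 8 * error_const) \<le> exp (3 * Re (zeta.prime_series ?r + zeta.euler_error ?r)
        + 4 * Re (prime_series ?s + euler_error ?s) + Re (zeta.prime_series ?w + zeta.euler_error ?w))"
      using h4 by (simp only: exp_le_cancel_iff)
    also have "\<dots> \<le> A * (\<sigma> - 1)" using h1 unfolding h2 h3 .
    finally have "exp (- 8 * error_const) \<le> A * (\<sigma> - 1)" .
    thus ?case using elim(3) by simp
  qed
  thus False by simp
qed

lemma L_is_dirichlet_L: "is_dirichlet_L (\<lambda>n. of_int (\<kappa> n)) L"
  unfolding is_dirichlet_L_def
proof (intro conjI allI impI)
  show "L holomorphic_on {s. 0 < Re s} - {1}"
    unfolding L_def by (rule holomorphic_on_subset[OF abel_series_holomorphic]) auto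
  fix s assume s: "Re s > 1"
  have "(\<lambda>n. of_int (\<kappa> (Suc n)) * of_nat (Suc n) powr (- s)) sums L s"
    using dirichlet_series_sums[of s] s sums_Suc_iff[of "\<lambda>n. of_int (\<kappa> n) * of_nat n powr (- s)" "L s"]
    by (simp add: L_def)
  thus "(\<lambda>n. of_int (\<kappa> (Suc n)) / of_nat (Suc n) powr s) sums L s"
    by (simp add: powr_minus_divide del: of_nat_Suc)
qed

text \<open>The hypothesis covers only the open critical strip. The point 1, the rest of the line Re
  s = 1 and the half-plane of absolute convergence need the unconditional results.\<close>

lemma L_neq_0:
  assumes GRH: generalised_riemann_hypothesis and s: "Re s > 1 / 2"
  shows "L s \<noteq> 0"
proof -
  consider "Re s < 1" | "s = 1" | "Re s = 1" "Im s \<noteq> 0" | "Re s > 1"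
    by (cases "Re s" "1 :: real" rule: linorder_cases) (auto simp: complex_eq_iff)
  thus ?thesis
  proof cases
    case 1
    thus ?thesis using GRH real_character_dirichlet[OF char] L_is_dirichlet_L s
      unfolding generalised_riemann_hypothesis_def by (metis less_trans less_irrefl zero_less_divide_1_iff zero_less_numeral)
  next
    case 2
    thus ?thesis using L_1_neq_0 by simp
  next
    case 3
    thus ?thesis using L_1_line_neq_0[of "Im s"] complex_surj[of s] by simp
  next
    case 4
    thus ?thesis by (simp add: L_eq_dirichlet euler_product)
  qed
qed

end

section \<open>Character sums over primes\<close>

text \<open>The map f/(2M - f) sends the half-plane Re < M into the unit disc and fixes 0, so
  Schwarz's lemma applies.\<close>

lemma borel_caratheodory:
  assumes hol: "f holomorphic_on ball 0 1" and f0: "f 0 = 0" and M: "M > 0"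
    and Re: "\<And>z. cmod z < 1 \<Longrightarrow> Re (f z) < M" and z: "cmod z < 1"
  shows "cmod (f z) \<le> 2 * M * cmod z / (1 - cmod z)"
proof -
  define g where "g = (\<lambda>z. f z / (of_real (2 * M) - f z))"
  have ne: "of_real (2 * M) - f w \<noteq> 0" if "cmod w < 1" for w
  proof
    assume "of_real (2 * M) - f w = 0"
    hence "Re (f w) = 2 * M" by (metis Re_complex_of_real eq_iff_diff_eq_0)
    thus False using Re[OF that] M by simp
  qed
  have less: "cmod (f w) < cmod (of_real (2 * M) - f w)" if "cmod w < 1" for w
  proof -
    have "0 < M * (M - Re (f w))" using Re[OF that] M by simp
    hence "(Re (f w))\<^sup>2 + (Im (f w))\<^sup>2 < (2 * M - Re (f w))\<^sup>2 + (Im (f w))\<^sup>2"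
      by (simp add: power2_eq_square algebra_simps)
    hence "cmod (f w) ^ 2 < cmod (of_real (2 * M) - f w) ^ 2" by (simp add: cmod_power2)
    thus ?thesis by (rule power_less_imp_less_base) simp
  qed
  have "cmod (g z) \<le> cmod z"
  proof (rule Schwarz_Lemma(1))
    show "g holomorphic_on ball 0 1"
      unfolding g_def using hol ne by (intro holomorphic_intros) auto
    show "cmod (g w) < 1" if "cmod w < 1" for w
      using less[OF that] ne[OF that] by (simp add: g_def norm_divide)
  qed (use f0 z in \<open>auto simp: g_def\<close>)
  hence "cmod (f z) \<le> cmod z * cmod (of_real (2 * M) - f z)"
    using ne[OF z] by (simp add: g_def norm_divide field_simps)
  also have "\<dots> \<le> cmod z * (2 * M + cmod (f z))"
    using norm_triangle_ineq4[of "of_real (2 * M)" "f z"] M by (intro mult_left_mono) (auto simp: norm_mult)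
  finally show ?thesis using z by (simp add: field_simps)
qed

text \<open>Everything in the upper bound for log L that depends neither on the modulus nor on the
  height: the sum is the one from \<open>abel_series_bound\<close> at 3/4, and 5 leaves room for
  additive constants.\<close>

definition "analytic_const = 5 + (\<Sum>n. real n powr (- (3 / 4) - 1)) + error_const + zeta2_const"

text \<open>The factor (ln n)^2 comes from two derivatives of log L, the exponent from the line Re s
  = 1 + 1/ln Q, and the Gaussian is the characteristic function of the normal distribution at ln
  (n/Q).\<close>

definition prime_weight :: "real \<Rightarrow> nat \<Rightarrow> real" where
  "prime_weight Q n = (if prime n then ln (real n) ^ 2 * real n powr (- (1 + 1 / ln Q)) * exp (- (ln (real n / Q) ^ 2) / 2) else 0)"

lemma ln_ge_1: "Q \<ge> 3 \<Longrightarrow> ln Q \<ge> (1::real)"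
  using exp_le by (subst ln_ge_iff) auto

lemma prime_weight_nonneg: "prime_weight Q n \<ge> 0"
  by (simp add: prime_weight_def)

lemma summable_prime_weight:
  assumes "Q \<ge> 3"
  shows "summable (prime_weight Q)"
proof -
  have "1 / ln Q > 0" using ln_ge_1[OF assms] by simp
  hence "summable (\<lambda>n. ln (real n) ^ 2 * real n powr (- (1 + 1 / ln Q)))"
    by (intro summable_ln_power_powr) simp
  thus ?thesis
  proof (rule summable_comparison_test'[of _ 0])
    fix n
    have "exp (- (ln (real n / Q) ^ 2) / 2) \<le> 1" by simp
    hence "ln (real n) ^ 2 * real n powr (- (1 + 1 / ln Q)) * exp (- (ln (real n / Q) ^ 2) / 2)
        \<le> ln (real n) ^ 2 * real n powr (- (1 + 1 / ln Q)) * 1"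
      by (intro mult_left_mono) auto
    thus "norm (prime_weight Q n) \<le> ln (real n) ^ 2 * real n powr (- (1 + 1 / ln Q))"
      by (simp add: prime_weight_def)
  qed
qed

section \<open>The second derivative of log L and the smoothed sum over primes\<close>

context nonprincipal_real_character
begin

definition P2 :: "complex \<Rightarrow> complex" where
  "P2 s = (\<Sum>n. of_real (ln (real n) ^ 2) * prime_coeff n * of_nat n powr (- s))"

text \<open>On a simply connected region without zeros L has a holomorphic logarithm, determined
  only up to multiples of 2 \<pi> i. So P is compared with the prime series only through derivatives
  and real parts.\<close>

lemma log_L_exists:
  assumes GRH: generalised_riemann_hypothesis
  obtains P where "P holomorphic_on {s. Re s > 3 / 4}"
    and "\<And>s. Re s > 3 / 4 \<Longrightarrow> L s = exp (P s + euler_error s)"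
    and "\<And>s. Re s > 1 \<Longrightarrow> (deriv ^^ 2) P s = P2 s"
    and "\<And>s. Re s > 1 \<Longrightarrow> Re (P s) = Re (prime_series s)"
proof -
  let ?S = "{s. Re s > (3 / 4 :: real)}"
  have op: "open ?S" by (rule open_halfspace_Re_gt)
  have "L holomorphic_on ?S"
    unfolding L_def by (rule holomorphic_on_subset[OF abel_series_holomorphic]) auto
  moreover have "contractible ?S" by (intro convex_imp_contractible convex_halfspace_Re_gt)
  moreover have "L s \<noteq> 0" if "s \<in> ?S" for s using L_neq_0[OF GRH, of s] that by simp
  ultimately obtain h where h: "h holomorphic_on ?S" "\<And>s. s \<in> ?S \<Longrightarrow> L s = exp (h s)"
    using contractible_imp_holomorphic_log by metis
  define P where "P = (\<lambda>s. h s - euler_error s)"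
  have P_hol: "P holomorphic_on ?S"
    unfolding P_def using h(1) euler_error_holomorphic by (intro holomorphic_intros)
  have LP: "L s = exp (P s + euler_error s)" if "Re s > 3 / 4" for s
    using h(2)[of s] that by (simp add: P_def)
  have expP: "exp (P s) = exp (prime_series s)" if "Re s > 1" for s
  proof -
    have "exp (P s + euler_error s) = exp (prime_series s + euler_error s)"
      using LP[of s] euler_product[OF that] L_eq_dirichlet[OF that] that by simp
    thus ?thesis by (simp add: exp_add)
  qed
  define P1 where "P1 = (\<lambda>s. \<Sum>n. - of_real (ln (real n)) * prime_coeff n * of_nat n powr (- s))"
  have dP: "deriv P s = P1 s" if s: "Re s > 1" for s
  proof -
    have "P field_differentiable at s"
      using holomorphic_on_imp_differentiable_at[OF P_hol op, of s] s by simp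
    hence "(P has_field_derivative deriv P s) (at s)" by (rule field_differentiable_derivI)
    hence "((\<lambda>s. exp (P s)) has_field_derivative exp (P s) * deriv P s) (at s)"
      by (rule DERIV_fun_exp)
    hence "((\<lambda>s. exp (prime_series s)) has_field_derivative exp (P s) * deriv P s) (at s)"
      by (rule has_field_derivative_transform_within_open[of _ _ _ "{s. Re s > 1}"])
         (use s expP open_halfspace_Re_gt in auto)
    moreover have "((\<lambda>s. exp (prime_series s)) has_field_derivative exp (prime_series s) * P1 s) (at s)"
      using prime_series_derivs(1)[OF s] unfolding P1_def by (rule DERIV_fun_exp)
    ultimately have "exp (P s) * deriv P s = exp (prime_series s) * P1 s" by (rule DERIV_unique)
    thus ?thesis using expP[OF s] by simp
  qed
  have ddP: "(deriv ^^ 2) P s = P2 s" if s: "Re s > 1" for s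
  proof -
    have "(P1 has_field_derivative P2 s) (at s)"
      using prime_series_derivs(2)[OF s] unfolding P1_def P2_def .
    hence "(deriv P has_field_derivative P2 s) (at s)"
      by (rule has_field_derivative_transform_within_open[of _ _ _ "{s. Re s > 1}"])
         (use s dP open_halfspace_Re_gt in auto)
    thus ?thesis by (simp add: numeral_2_eq_2 DERIV_imp_deriv)
  qed
  have ReP: "Re (P s) = Re (prime_series s)" if "Re s > 1" for s
    using arg_cong[OF expP[OF that], of cmod] by (simp add: norm_exp_eq_Re)
  show ?thesis by (rule that[OF P_hol LP ddP ReP])
qed

text \<open>GRH gives log L a disc around 2 + it that reaches beyond Re s = 1. There the real part
  is bounded above by the logarithm of the conductor, Borel-Caratheodory turns this into a bound for
  the modulus, and Cauchy's estimate into one for the second derivative.\<close>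

lemma P2_bound:
  assumes GRH: generalised_riemann_hypothesis and \<sigma>: "1 < \<sigma>" "\<sigma> \<le> 2"
  shows "cmod (P2 (Complex \<sigma> t)) \<le> 2432 * (ln (real q) + \<bar>t\<bar> + analytic_const)"
proof -
  obtain P where P: "P holomorphic_on {s. Re s > 3 / 4}"
     "\<And>s. Re s > 3 / 4 \<Longrightarrow> L s = exp (P s + euler_error s)"
     "\<And>s. Re s > 1 \<Longrightarrow> (deriv ^^ 2) P s = P2 s"
     "\<And>s. Re s > 1 \<Longrightarrow> Re (P s) = Re (prime_series s)"
    using log_L_exists[OF GRH] by metis
  define c where "c = Complex 2 t"
  define K where "K = (\<Sum>n. real n powr (- (3 / 4) - 1))"
  define M where "M = ln (real q) + \<bar>t\<bar> + analytic_const"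
  have K0: "K \<ge> 0" unfolding K_def by (intro suminf_nonneg) (auto simp: summable_real_powr_iff)
  have E0: "error_const \<ge> 0" "zeta2_const \<ge> 0"
    using order_trans[OF norm_ge_zero euler_error_bound[of 1]] zeta2_const_nonneg by simp_all
  have q1: "ln (real q) \<ge> 0" using q_pos by simp
  have M: "M > 0" unfolding M_def analytic_const_def K_def[symmetric] using q1 K0 E0 by simp
  \<comment> \<open>Radius 5/4 around 2 + it touches the line Re s = 3/4, where the Euler remainder
    is still controlled.\<close>
  have Re_ball: "Re w > 3 / 4" if "w \<in> ball c (5 / 4)" for w
    using that abs_Re_le_cmod[of "c - w"] by (simp add: c_def dist_norm)
  have Re_P: "Re (P w) - Re (P c) < M" if w: "w \<in> ball c (5 / 4)" for w
  proof -
    have Rw: "Re w > 3 / 4" by (rule Re_ball[OF w])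
    have w0: "w \<noteq> 0" using Rw by auto
    have Lw: "L w \<noteq> 0" using P(2)[OF Rw] by simp
    have "cmod (L w) \<le> real q * cmod w * K"
      unfolding L_def K_def by (rule abel_series_bound) (use Rw in auto)
    moreover have "cmod (L w) > 0" using Lw by simp
    ultimately have Kpos: "K > 0" using K0 q_pos w0 by (cases "K = 0") auto
    have "Re (P w) + Re (euler_error w) = ln (cmod (L w))"
      using P(2)[OF Rw] by (simp add: norm_exp_eq_Re)
    also have "\<dots> \<le> ln (real q * cmod w * K)"
      using \<open>cmod (L w) \<le> _\<close> \<open>cmod (L w) > 0\<close> by (simp add: ln_mono)
    also have "\<dots> = ln (real q) + ln (cmod w) + ln K"
      using q_pos w0 Kpos by (simp add: ln_mult)
    also have "ln (cmod w) \<le> cmod w - 1" using w0 by (intro ln_le_minus_one) simp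
    also have "ln K \<le> K - 1" using Kpos by (rule ln_le_minus_one)
    also have "cmod w \<le> cmod c + 5 / 4"
      using w norm_triangle_ineq2[of w c] by (simp add: dist_norm norm_minus_commute)
    also have "cmod c \<le> 2 + \<bar>t\<bar>" using cmod_le[of c] by (simp add: c_def)
    finally have "Re (P w) + Re (euler_error w) \<le> ln (real q) + \<bar>t\<bar> + K + 2" by simp
    moreover have "\<bar>Re (euler_error w)\<bar> \<le> error_const"
      by (rule order_trans[OF abs_Re_le_cmod euler_error_bound]) (use Rw in simp)
    moreover have "\<bar>Re (P c)\<bar> \<le> zeta2_const"
    proof -
      have "Re (P c) = Re (prime_series c)" by (rule P(4)) (simp add: c_def)
      thus ?thesis using order_trans[OF abs_Re_le_cmod norm_prime_series_2[of c]] by (simp add: c_def)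
    qed
    ultimately show ?thesis unfolding M_def analytic_const_def K_def[symmetric] by linarith
  qed
  \<comment> \<open>9/8 is 9/10 of the radius 5/4, so Borel-Caratheodory gives 2 M (9/10)/(1/10) =
    18 M.\<close>
  have bound: "cmod (P w - P c) \<le> 18 * M" if w: "w \<in> ball c (9 / 8)" for w
  proof -
    define f where "f = (\<lambda>z. P (c + of_real (5 / 4) * z) - P c)"
    define z where "z = (w - c) / of_real (5 / 4)"
    have in_ball: "c + of_real (5 / 4) * z \<in> ball c (5 / 4)" if "cmod z < 1" for z
      using that by (simp add: dist_norm norm_mult)
    have z: "cmod z < 9 / 10"
      using w unfolding z_def norm_divide norm_of_real by (simp add: dist_norm norm_minus_commute)
    have "cmod (f z) \<le> 2 * M * cmod z / (1 - cmod z)"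
    proof (rule borel_caratheodory)
      have im: "(\<lambda>z. c + of_real (5 / 4) * z) ` ball 0 1 \<subseteq> {s. Re s > 3 / 4}"
      proof (rule image_subsetI)
        fix z :: complex assume "z \<in> ball 0 1"
        hence "cmod z < 1" by simp
        from Re_ball[OF in_ball[OF this]] show "c + of_real (5 / 4) * z \<in> {s. Re s > 3 / 4}"
          by (simp only: mem_Collect_eq)
      qed
      have "(\<lambda>z. P (c + of_real (5 / 4) * z)) holomorphic_on ball 0 1"
        by (rule holomorphic_on_compose_gen[OF _ P(1) im, unfolded o_def]) (intro holomorphic_intros)
      thus "f holomorphic_on ball 0 1" unfolding f_def by (intro holomorphic_intros)
      show "Re (f z) < M" if "cmod z < 1" for z using Re_P[OF in_ball[OF that]] by (simp add: f_def)
    qed (use M z in \<open>auto simp: f_def\<close>)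
    also have "\<dots> \<le> 2 * M * (9 / 10) / (1 / 10)"
      using z M by (intro frac_le mult_left_mono) auto
    finally have "cmod (f z) \<le> 18 * M" by simp
    moreover have "f z = P w - P c" by (simp add: f_def z_def)
    ultimately show ?thesis by simp
  qed
  define s where "s = Complex \<sigma> t"
  have sub: "cball s (1 / 8) \<subseteq> ball c (9 / 8)"
  proof
    fix w assume "w \<in> cball s (1 / 8)"
    hence "dist s w \<le> 1 / 8" by simp
    moreover have "dist c s = 2 - \<sigma>"
      using \<sigma> by (simp add: c_def s_def dist_norm complex_diff cmod_def)
    moreover have "dist c w \<le> dist c s + dist s w" by (rule dist_triangle)
    ultimately show "w \<in> ball c (9 / 8)" using \<sigma> by simp
  qed
  have sub': "cball s (1 / 8) \<subseteq> {s. Re s > 3 / 4}" using sub Re_ball by fastforce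
  \<comment> \<open>The closed disc of radius 1/8 around s stays inside the one of radius 9/8, as 2
    - \<sigma> < 1. The bound 18 M becomes 19 M to reach an open ball, and 2 * 19 * 64 =
    2432.\<close>
  have "cmod ((deriv ^^ 2) P s) \<le> fact 2 * (19 * M) / (1 / 8) ^ 2"
  proof (rule Cauchy_higher_deriv_bound[where y = "P c"])
    show "P holomorphic_on ball s (1 / 8)"
      by (rule holomorphic_on_subset[OF P(1)]) (use sub' ball_subset_cball in blast)
    show "continuous_on (cball s (1 / 8)) P"
      by (rule holomorphic_on_imp_continuous_on[OF holomorphic_on_subset[OF P(1) sub']])
    show "P w \<in> ball (P c) (19 * M)" if "w \<in> ball s (1 / 8)" for w
    proof -
      have "w \<in> ball c (9 / 8)" using that sub by (auto simp: subset_iff less_imp_le)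
      thus ?thesis using bound[of w] M by (simp add: dist_norm norm_minus_commute)
    qed
  qed auto
  also have "(deriv ^^ 2) P s = P2 s" by (rule P(3)) (use \<sigma> in \<open>simp add: s_def\<close>)
  finally show ?thesis unfolding s_def M_def by (simp add: fact_numeral power2_eq_square)
qed

text \<open>Averaging the second derivative at height -\<tau>, twisted by Q^(-i\<tau>), over a
  normally distributed \<tau> multiplies the n-th term by the Gaussian in ln (n/Q). The bound on the
  line grows only linearly in \<tau>, so it survives the average.\<close>

theorem weighted_character_sum_bound:
  assumes GRH: generalised_riemann_hypothesis and Q: "Q \<ge> 3"
  shows "\<bar>\<Sum>n. of_int (\<kappa> n) * prime_weight Q n\<bar> \<le> 2432 * (ln (real q) + analytic_const + 2)"
proof -
  define \<sigma> where "\<sigma> = 1 + 1 / ln Q"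
  have \<sigma>: "1 < \<sigma>" "\<sigma> \<le> 2" using ln_ge_1[OF Q] by (auto simp: \<sigma>_def)
  let ?M = "std_normal_distribution"
  interpret M: real_distribution ?M by (rule real_dist_normal_dist)
  define c where "c = (\<lambda>n. of_real (ln (real n) ^ 2) * prime_coeff n * of_nat n powr (- of_real \<sigma>))"
  define u where "u = (\<lambda>n. ln (real n / Q))"
  define F where "F = (\<lambda>n \<tau>. c n * iexp (u n * \<tau>))"
  have norm_c: "cmod (c n) \<le> ln (real n) ^ 2 * real n powr (- \<sigma>)" for n
    using mult_mono[OF mult_left_mono[OF norm_prime_coeff, of "ln (real n) ^ 2" n] order_refl, of "real n powr (- \<sigma>)"]
    by (simp add: c_def norm_mult norm_power norm_of_nat_powr)
  have sm_c: "summable (\<lambda>n. cmod (c n))"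
    by (rule summable_comparison_test'[OF summable_ln_power_powr[OF \<sigma>(1), of 2], of 0]) (use norm_c in simp)
  have norm_F: "cmod (F n \<tau>) = cmod (c n)" for n \<tau> by (simp add: F_def norm_mult)
  have int_F: "integrable ?M (F n)" for n
  proof (rule M.integrable_const_bound[where B = "cmod (c n)"])
    show "AE \<tau> in ?M. cmod (F n \<tau>) \<le> cmod (c n)" by (simp add: norm_F)
    show "F n \<in> borel_measurable ?M" unfolding F_def by simp
  qed
  have LINT_F: "(CLINT \<tau>|?M. F n \<tau>) = of_real (of_int (\<kappa> n) * prime_weight Q n)" for n
  proof -
    have "(CLINT \<tau>|?M. F n \<tau>) = c n * char ?M (u n)"
      unfolding F_def char_def by simp
    also have "\<dots> = c n * of_real (exp (- (u n ^ 2) / 2))" by (simp add: char_std_normal_distribution)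
    also have "c n = (if prime n then of_real (of_int (\<kappa> n) * ln (real n) ^ 2 * real n powr (- \<sigma>)) else 0)"
    proof (cases "prime n")
      case True
      hence "n > 0" by (rule prime_gt_0_nat)
      hence "of_nat n powr (- of_real \<sigma>) = (of_real (real n powr (- \<sigma>)) :: complex)"
        using powr_of_real[of "real n" "- \<sigma>"] by simp
      thus ?thesis using True by (simp add: c_def prime_coeff_def)
    qed (simp add: c_def prime_coeff_def)
    finally show ?thesis by (simp add: prime_weight_def u_def \<sigma>_def)
  qed
  have sum_F: "(\<Sum>n. F n \<tau>) = iexp (- (\<tau> * ln Q)) * P2 (Complex \<sigma> (- \<tau>))" for \<tau>
  proof -
    have "F n \<tau> = iexp (- (\<tau> * ln Q)) * (of_real (ln (real n) ^ 2) * prime_coeff n * of_nat n powr (- Complex \<sigma> (- \<tau>)))" for n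
    proof (cases "prime n")
      case True
      hence n: "n > 0" by (rule prime_gt_0_nat)
      have split: "F n \<tau> = of_real (ln (real n) ^ 2) * prime_coeff n * (of_nat n powr (- of_real \<sigma>) * iexp (u n * \<tau>))"
        by (simp only: F_def c_def mult.assoc)
      have "of_nat n powr (- of_real \<sigma>) * iexp (u n * \<tau>) = exp (- of_real \<sigma> * of_real (ln (real n)) + \<i> * of_real (u n * \<tau>))"
        unfolding exp_add using n Ln_of_real[of "real n"] by (simp add: powr_def)
      also have "- of_real \<sigma> * of_real (ln (real n)) + \<i> * of_real (u n * \<tau>)
          = \<i> * of_real (- (\<tau> * ln Q)) + (- Complex \<sigma> (- \<tau>)) * of_real (ln (real n))"
        using n Q by (simp add: u_def ln_div complex_eq_iff algebra_simps)
      also have "exp \<dots> = iexp (- (\<tau> * ln Q)) * of_nat n powr (- Complex \<sigma> (- \<tau>))"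
        using n Ln_of_real[of "real n"] by (simp only: exp_add powr_def) simp
      finally show ?thesis unfolding split by (simp only: mult_ac)
    qed (simp add: F_def c_def prime_coeff_def)
    thus ?thesis unfolding P2_def using suminf_mult[OF prime_series_derivs(3)[of "Complex \<sigma> (- \<tau>)"]] \<sigma> by simp
  qed
  have AE_sm: "AE \<tau> in ?M. summable (\<lambda>n. norm (F n \<tau>))" unfolding norm_F using sm_c by simp
  have sm_int: "summable (\<lambda>n. LINT \<tau>|?M. norm (F n \<tau>))" unfolding norm_F using sm_c M.prob_space by simp
  have int_sum: "integrable ?M (\<lambda>\<tau>. \<Sum>n. F n \<tau>)" by (rule integrable_suminf[OF int_F AE_sm sm_int])
  have "of_real (\<Sum>n. of_int (\<kappa> n) * prime_weight Q n) = (\<Sum>n. CLINT \<tau>|?M. F n \<tau>)"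
  proof -
    have "summable (\<lambda>n. of_int (\<kappa> n) * prime_weight Q n)"
    proof (rule summable_comparison_test'[OF summable_prime_weight[OF Q], of 0])
      fix n
      have "\<bar>of_int (\<kappa> n) :: real\<bar> \<le> 1" using vals[of n] by auto
      from mult_right_mono[OF this prime_weight_nonneg[of Q n]]
      show "norm (of_int (\<kappa> n) * prime_weight Q n) \<le> prime_weight Q n"
        using prime_weight_nonneg[of Q n] by (simp add: abs_mult)
    qed
    thus ?thesis unfolding LINT_F by (rule suminf_of_real)
  qed
  also have "\<dots> = (CLINT \<tau>|?M. (\<Sum>n. F n \<tau>))"
    by (rule integral_suminf[OF int_F AE_sm sm_int, symmetric])
  finally have eq: "complex_of_real (\<Sum>n. of_int (\<kappa> n) * prime_weight Q n) = (CLINT \<tau>|?M. (\<Sum>n. F n \<tau>))" .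
  \<comment> \<open>|\<tau>| is replaced by 1 + \<tau>^2, whose mean is 2; this is the final summand
    2.\<close>
  define g where "g = (\<lambda>\<tau>::real. 2432 * (ln (real q) + analytic_const + 1) + 2432 * \<tau> ^ 2)"
  have int_sq: "integrable ?M (\<lambda>\<tau>. \<tau> ^ 2)" by (rule integrable_std_normal_distribution_moment)
  have int_g: "integrable ?M g" unfolding g_def using int_sq by auto
  have bound_F: "cmod (\<Sum>n. F n \<tau>) \<le> g \<tau>" for \<tau>
  proof -
    have "cmod (\<Sum>n. F n \<tau>) = cmod (P2 (Complex \<sigma> (- \<tau>)))" unfolding sum_F by (simp add: norm_mult)
    also have "\<dots> \<le> 2432 * (ln (real q) + \<bar>- \<tau>\<bar> + analytic_const)" by (rule P2_bound[OF GRH \<sigma>])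
    also have "\<bar>- \<tau>\<bar> \<le> 1 + \<tau> ^ 2"
    proof -
      have "0 \<le> (\<bar>\<tau>\<bar> - 1) ^ 2" by simp
      hence "2 * \<bar>\<tau>\<bar> \<le> 1 + \<tau> ^ 2" by (simp add: power2_diff)
      thus ?thesis by simp
    qed
    finally show ?thesis by (simp add: g_def algebra_simps)
  qed
  have "\<bar>\<Sum>n. of_int (\<kappa> n) * prime_weight Q n\<bar> = cmod (CLINT \<tau>|?M. (\<Sum>n. F n \<tau>))"
    unfolding eq[symmetric] by simp
  also have "\<dots> \<le> (LINT \<tau>|?M. g \<tau>)"
    by (rule order_trans[OF Bochner_Integration.integral_norm_bound
          Bochner_Integration.integral_mono[OF integrable_norm[OF int_sum] int_g bound_F]])
  also have "\<dots> = 2432 * (ln (real q) + analytic_const + 1) + 2432 * (LINT \<tau>|?M. \<tau> ^ 2)"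
    unfolding g_def using int_sq M.prob_space by simp
  also have "(LINT \<tau>|?M. \<tau> ^ 2) = 1"
    using std_normal_distribution_even_moments(1)[of 1] by simp
  finally show ?thesis by simp
qed

end

section \<open>Chebyshev's upper bound\<close>

definition log_prime :: "nat \<Rightarrow> real" where
  "log_prime n = (if prime n then ln (real n) else 0)"

lemma log_prime_nonneg: "log_prime n \<ge> 0"
  using prime_ge_1_nat by (auto simp: log_prime_def)

lemma prod_coprime_dvd:
  assumes "finite S" "\<And>p. p \<in> S \<Longrightarrow> f p dvd (m::nat)"
    and "\<And>p r. p \<in> S \<Longrightarrow> r \<in> S \<Longrightarrow> p \<noteq> r \<Longrightarrow> coprime (f p) (f r)"
  shows "prod f S dvd m"
  using assms
proof (induction S rule: finite_induct)
  case (insert p S)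
  have "coprime (f p) (prod f S)"
    by (rule prod_coprime_right) (use insert in auto)
  thus ?case using insert by (simp add: divides_mult)
qed simp

text \<open>All primes in (n, 2n] divide the central binomial coefficient, which is at most
  4^n.\<close>

lemma sum_log_prime_dyadic: "(\<Sum>p\<in>{n<..2 * n}. log_prime p) \<le> real n * ln 4"
proof -
  define S where "S = {p \<in> {n<..2 * n}. prime p}"
  have "(\<Prod>p\<in>S. p) dvd (2 * n) choose n"
  proof (rule prod_coprime_dvd)
    fix p assume "p \<in> S"
    hence p: "prime p" "n < p" "p \<le> 2 * n" by (auto simp: S_def)
    have "(2 * n choose n) * (fact n * fact n) = fact (2 * n)"
      using binomial_fact_lemma[of n "2 * n"] by (simp add: mult_ac)
    moreover have "p dvd fact (2 * n)" using p by (simp add: prime_dvd_fact_iff)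
    moreover have "\<not> p dvd fact n" using p by (simp add: prime_dvd_fact_iff)
    ultimately show "p dvd (2 * n) choose n" using p(1) by (metis prime_dvd_mult_iff)
  qed (auto simp: S_def intro: primes_coprime)
  moreover have "(2 * n) choose n > 0" by simp
  ultimately have "\<Prod>S \<le> (2 * n) choose n" by (intro dvd_imp_le)
  also have "\<dots> \<le> 2 ^ (2 * n)" by (rule binomial_le_pow2)
  also have "\<dots> = 4 ^ n" by (simp add: power_mult)
  finally have "real (\<Prod>S) \<le> 4 ^ n" by (metis of_nat_le_iff of_nat_numeral of_nat_power)
  moreover have pos: "0 < p" if "p \<in> S" for p using that prime_gt_0_nat by (auto simp: S_def)
  hence "0 < real (\<Prod>S)" by (simp add: prod_pos)
  ultimately have "ln (real (\<Prod>S)) \<le> ln (4 ^ n)" by (simp add: ln_mono)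
  moreover have "finite S" by (simp add: S_def)
  hence "ln (real (\<Prod>S)) = (\<Sum>p\<in>S. ln (real p))"
    using pos by (simp add: of_nat_prod ln_prod)
  moreover have "(\<Sum>p\<in>S. ln (real p)) = (\<Sum>p\<in>{n<..2 * n}. log_prime p)"
    unfolding S_def log_prime_def by (rule sum.inter_filter) simp
  ultimately show ?thesis by (simp add: ln_realpow)
qed

text \<open>Halving n to m = (n + 1) div 2 costs m ln 4, and 3m \<le> 2n closes the induction for n
  = 2 and for every n \<ge> 3.\<close>

lemma chebyshev_upper: "(\<Sum>p\<le>n. log_prime p) \<le> 2 * ln 4 * real n"
proof (induction n rule: less_induct)
  case (less n)
  show ?case
  proof (cases "n \<ge> 2")
    case False
    hence "n = 0 \<or> n = 1" by auto
    thus ?thesis by (auto simp: log_prime_def)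
  next
    case True
    define m where "m = (n + 1) div 2"
    have m: "m < n" "n \<le> 2 * m" "2 * m \<le> n + 1" using True by (auto simp: m_def)
    have "(\<Sum>p\<le>n. log_prime p) \<le> (\<Sum>p\<in>{..m} \<union> {m<..2 * m}. log_prime p)"
      by (rule sum_mono2) (use m log_prime_nonneg in auto)
    also have "\<dots> = (\<Sum>p\<le>m. log_prime p) + (\<Sum>p\<in>{m<..2 * m}. log_prime p)"
      by (rule sum.union_disjoint) auto
    also have "\<dots> \<le> 2 * ln 4 * real m + real m * ln 4"
      by (intro add_mono less m(1) sum_log_prime_dyadic)
    also have "\<dots> = ln 4 * (3 * real m)" by simp
    also have "\<dots> \<le> ln 4 * (2 * real n)"
    proof -
      have "n = 2 \<or> n \<ge> 3" using True by linarith
      hence "3 * m \<le> 2 * n" using m by (elim disjE) linarith+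
      hence "3 * real m \<le> 2 * real n" by linarith
      thus ?thesis by (intro mult_left_mono) auto
    qed
    finally show ?thesis by simp
  qed
qed

lemma abel_sum_bound:
  fixes a g :: "nat \<Rightarrow> real"
  assumes a: "\<And>n. (\<Sum>k\<le>n. a k) \<le> C * real n" and C: "C \<ge> 0"
    and mono: "\<And>n. n \<ge> 1 \<Longrightarrow> g (Suc n) \<le> g n" and nonneg: "\<And>n. n \<ge> 1 \<Longrightarrow> g n \<ge> 0" and a0: "a 0 = 0"
  shows "(\<Sum>n\<in>{1..N}. a n * g n) \<le> C * (\<Sum>n\<in>{1..N}. g n)"
proof -
  define A where "A = (\<lambda>n. \<Sum>k\<le>n. a k)"
  have parts: "(\<Sum>n\<in>{1..N}. a n * g n) = (\<Sum>n\<in>{1..N}. A n * (g n - g (Suc n))) + A N * g (Suc N)" for N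
    by (induction N) (auto simp: A_def a0 algebra_simps)
  have parts': "(\<Sum>n\<in>{1..N}. g n) = (\<Sum>n\<in>{1..N}. real n * (g n - g (Suc n))) + real N * g (Suc N)" for N
    by (induction N) (auto simp: algebra_simps)
  have "(\<Sum>n\<in>{1..N}. a n * g n) \<le> (\<Sum>n\<in>{1..N}. (C * real n) * (g n - g (Suc n))) + (C * real N) * g (Suc N)"
    unfolding parts A_def using mono nonneg
    by (intro add_mono sum_mono mult_right_mono a) auto
  also have "\<dots> = C * (\<Sum>n\<in>{1..N}. g n)"
    unfolding parts' by (simp add: sum_distrib_left algebra_simps)
  finally show ?thesis .
qed

text \<open>Up to ln Q the weight is dominated by the kernel 2Q/(x^2 + Q^2), which is decreasing
  from the start and has an elementary primitive. In terms of u = |ln (x/Q)| one has ln x \<le> ln Q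
  e^u, and e^(-2u) is the square of the smaller of x/Q and Q/x.\<close>

lemma weight_kernel_bound:
  fixes x Q :: real
  assumes x: "x \<ge> 1" and Q: "Q \<ge> 3"
  shows "ln x * exp (- (ln (x / Q) ^ 2) / 2) / x \<le> ln Q * (exp (9 / 2) * (2 * Q / (x ^ 2 + Q ^ 2)))"
proof -
  define u where "u = \<bar>ln (x / Q)\<bar>"
  have u0: "u \<ge> 0" by (simp add: u_def)
  have Q0: "Q > 0" "x > 0" using Q x by auto
  have lnQ: "ln Q \<ge> 1" by (rule ln_ge_1[OF Q])
  have "ln x \<le> ln Q + u" using Q0 by (simp add: u_def ln_div)
  also have "\<dots> \<le> ln Q * (1 + u)" using lnQ u0 mult_right_mono[of 1 "ln Q" u] by (simp add: algebra_simps)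
  also have "\<dots> \<le> ln Q * exp u" using lnQ by (intro mult_left_mono) auto
  finally have 1: "ln x \<le> ln Q * exp u" .
  \<comment> \<open>Completing the square in u - u^2/2 \<le> 9/2 - 2u is the origin of the constant
    e^(9/2).\<close>
  have "0 \<le> (u - 3) ^ 2" by simp
  hence "u + - (u ^ 2) / 2 \<le> 9 / 2 + - (2 * u)" by (simp add: power2_eq_square algebra_simps)
  hence "exp u * exp (- (u ^ 2) / 2) \<le> exp (9 / 2) * exp (- (2 * u))"
    unfolding exp_add[symmetric] by (simp only: exp_le_cancel_iff)
  hence 2: "exp u * exp (- (ln (x / Q) ^ 2) / 2) \<le> exp (9 / 2) * exp (- (2 * u))"
    by (simp add: u_def)
  have 3: "exp (- (2 * u)) / x \<le> 2 * Q / (x ^ 2 + Q ^ 2)"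
  proof (cases "x \<le> Q")
    case True
    have "ln (x / Q) \<le> 0" using True Q0 by simp
    hence "exp (- (2 * u)) = exp (ln (x / Q) + ln (x / Q))" by (simp add: u_def)
    also have "\<dots> = (x / Q) * (x / Q)" using Q0 unfolding exp_add by simp
    finally have "exp (- (2 * u)) / x = x / Q ^ 2" using Q0 by (simp add: power2_eq_square)
    also have "\<dots> \<le> 2 * Q / (x ^ 2 + Q ^ 2)"
    proof -
      have "x * x ^ 2 \<le> Q * Q ^ 2" using True Q0 by (intro mult_mono power_mono) auto
      moreover have "x * Q ^ 2 \<le> Q * Q ^ 2" using True Q0 by (intro mult_right_mono) auto
      ultimately have "x * (x ^ 2 + Q ^ 2) \<le> 2 * Q * Q ^ 2" by (simp add: algebra_simps)
      thus ?thesis using Q0 by (simp add: divide_le_eq le_divide_eq add_pos_pos mult_ac)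
    qed
    finally show ?thesis .
  next
    case False
    have "ln (x / Q) \<ge> 0" using False Q0 by simp
    hence "- (2 * u) = ln (Q / x) + ln (Q / x)" using Q0 by (simp add: u_def ln_div)
    hence "exp (- (2 * u)) = exp (ln (Q / x) + ln (Q / x))" by (simp only:)
    also have "\<dots> = (Q / x) * (Q / x)" unfolding exp_add using Q0 by simp
    finally have "exp (- (2 * u)) / x = Q * Q / (x * x ^ 2)" by (simp add: power2_eq_square)
    also have "\<dots> \<le> Q / x ^ 2" using False Q0 by (simp add: field_simps)
    also have "\<dots> \<le> 2 * Q / (x ^ 2 + Q ^ 2)"
    proof -
      have "Q ^ 2 \<le> x ^ 2" using False Q0 by (intro power_mono) auto
      hence "Q * (x ^ 2 + Q ^ 2) \<le> 2 * Q * x ^ 2" using Q0 mult_left_mono[of "Q ^ 2" "x ^ 2" Q] by (simp add: algebra_simps)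
      thus ?thesis using Q0 by (simp add: divide_le_eq le_divide_eq add_pos_pos mult_ac)
    qed
    finally show ?thesis .
  qed
  have "ln x * exp (- (ln (x / Q) ^ 2) / 2) / x \<le> ln Q * exp u * exp (- (ln (x / Q) ^ 2) / 2) / x"
    using 1 Q0 by (intro divide_right_mono mult_right_mono) auto
  also have "\<dots> = ln Q * (exp u * exp (- (ln (x / Q) ^ 2) / 2)) / x" by simp
  also have "\<dots> \<le> ln Q * (exp (9 / 2) * exp (- (2 * u))) / x"
    using 2 lnQ Q0 Q by (intro divide_right_mono mult_left_mono) auto
  also have "\<dots> = ln Q * (exp (9 / 2) * (exp (- (2 * u)) / x))" by simp
  also have "\<dots> \<le> ln Q * (exp (9 / 2) * (2 * Q / (x ^ 2 + Q ^ 2)))"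
    using 3 lnQ Q by (intro mult_left_mono) auto
  finally show ?thesis .
qed

text \<open>The kernel is the derivative of 2 arctan (x/Q) and decreases, so the sum is at most the
  total increase \<pi>.\<close>

lemma sum_kernel_bound:
  assumes Q: "(Q::real) > 0"
  shows "(\<Sum>n\<in>{1..N}. 2 * Q / (real n ^ 2 + Q ^ 2)) \<le> pi"
proof -
  have "2 * Q / (real (Suc n) ^ 2 + Q ^ 2) \<le> 2 * arctan (real (Suc n) / Q) - 2 * arctan (real n / Q)" for n
  proof -
    have der: "((\<lambda>x. 2 * arctan (x / Q)) has_real_derivative 2 * Q / (x ^ 2 + Q ^ 2)) (at x)" for x
    proof -
      have "((\<lambda>x. 2 * arctan (x / Q)) has_real_derivative 2 * (inverse (1 + (x / Q) ^ 2) * (1 / Q))) (at x)"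
        using Q by (auto intro!: derivative_eq_intros)
      also have "2 * (inverse (1 + (x / Q) ^ 2) * (1 / Q)) = 2 * Q / (x ^ 2 + Q ^ 2)"
        using Q by (simp add: field_simps power2_eq_square add_pos_pos)
      finally show ?thesis .
    qed
    obtain z where z: "real n < z" "z < real (Suc n)"
      "2 * arctan (real (Suc n) / Q) - 2 * arctan (real n / Q) = (real (Suc n) - real n) * (2 * Q / (z ^ 2 + Q ^ 2))"
      using MVT2[of "real n" "real (Suc n)" "\<lambda>x. 2 * arctan (x / Q)" "\<lambda>x. 2 * Q / (x ^ 2 + Q ^ 2)"] der by auto
    have "z ^ 2 \<le> real (Suc n) ^ 2" using z by (intro power_mono) auto
    moreover have "0 < z ^ 2 + Q ^ 2" using Q by (intro add_nonneg_pos) auto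
    ultimately have "2 * Q / (real (Suc n) ^ 2 + Q ^ 2) \<le> 2 * Q / (z ^ 2 + Q ^ 2)"
      using Q by (intro divide_left_mono mult_pos_pos add_nonneg_pos) auto
    thus ?thesis unfolding z(3) by simp
  qed
  hence "(\<Sum>n<N. 2 * Q / (real (Suc n) ^ 2 + Q ^ 2)) \<le> (\<Sum>n<N. 2 * arctan (real (Suc n) / Q) - 2 * arctan (real n / Q))"
    by (rule sum_mono)
  also have "\<dots> = 2 * arctan (real N / Q) - 2 * arctan (real 0 / Q)" by (rule sum_lessThan_telescope)
  also have "\<dots> \<le> pi" using arctan_ubound[of "real N / Q"] by simp
  also have "(\<Sum>n<N. 2 * Q / (real (Suc n) ^ 2 + Q ^ 2)) = (\<Sum>n\<in>{1..N}. 2 * Q / (real n ^ 2 + Q ^ 2))"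
    by (rule sum.reindex_bij_witness[of _ "\<lambda>n. n - 1" Suc]) auto
  finally show ?thesis .
qed

definition "diagonal_const = exp (9 / 2) * (2 * ln 4 * pi)"

text \<open>This bounds the diagonal. Only Chebyshev's estimate is put in, by partial summation
  against the decreasing kernel; the factor n^(-1/ln Q) is bounded by 1.\<close>

theorem prime_weight_sum_bound:
  assumes Q: "Q \<ge> 3"
  shows "(\<Sum>n. prime_weight Q n) \<le> diagonal_const * ln Q"
proof (rule suminf_le_const[OF summable_prime_weight[OF Q]])
  fix N
  define g where "g = (\<lambda>n. 2 * Q / (real n ^ 2 + Q ^ 2))"
  have g: "g (Suc n) \<le> g n" "g n \<ge> 0" for n
    unfolding g_def using Q by (auto intro!: divide_left_mono add_right_mono power_mono mult_pos_pos add_nonneg_pos)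
  have le: "prime_weight Q n \<le> ln Q * exp (9 / 2) * (log_prime n * g n)" for n
  proof (cases "prime n")
    case True
    hence n: "real n \<ge> 1" using prime_ge_1_nat by simp
    have "real n powr (- (1 + 1 / ln Q)) \<le> real n powr (- 1)"
      using n ln_ge_1[OF Q] by (intro powr_mono) auto
    hence "real n powr (- (1 + 1 / ln Q)) \<le> 1 / real n" using n by (simp add: powr_minus_divide)
    hence "prime_weight Q n \<le> ln (real n) ^ 2 * (1 / real n) * exp (- (ln (real n / Q) ^ 2) / 2)"
      using True by (simp add: prime_weight_def mult_left_mono mult_right_mono del: times_divide_eq_right)
    also have "\<dots> = ln (real n) * (ln (real n) * exp (- (ln (real n / Q) ^ 2) / 2) / real n)"
      by (simp add: power2_eq_square)
    also have "\<dots> \<le> ln (real n) * (ln Q * (exp (9 / 2) * g n))"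
      unfolding g_def using n by (intro mult_left_mono weight_kernel_bound Q) auto
    also have "\<dots> = ln Q * exp (9 / 2) * (log_prime n * g n)" using True by (simp add: log_prime_def)
    finally show ?thesis .
  qed (simp add: prime_weight_def log_prime_def)
  have "(\<Sum>n<N. prime_weight Q n) \<le> (\<Sum>n<N. ln Q * exp (9 / 2) * (log_prime n * g n))"
    by (rule sum_mono) (rule le)
  also have "\<dots> = ln Q * exp (9 / 2) * (\<Sum>n<N. log_prime n * g n)" by (simp add: sum_distrib_left)
  also have "(\<Sum>n<N. log_prime n * g n) \<le> (\<Sum>n\<in>insert 0 {1..N}. log_prime n * g n)"
    by (rule sum_mono2) (use log_prime_nonneg g in \<open>auto intro: mult_nonneg_nonneg\<close>)
  also have "\<dots> = (\<Sum>n\<in>{1..N}. log_prime n * g n)" by (simp add: log_prime_def)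
  also have "\<dots> \<le> 2 * ln 4 * (\<Sum>n\<in>{1..N}. g n)"
    by (rule abel_sum_bound[OF chebyshev_upper]) (use g in \<open>auto simp: log_prime_def\<close>)
  also have "(\<Sum>n\<in>{1..N}. g n) \<le> pi" unfolding g_def by (rule sum_kernel_bound) (use Q in simp)
  finally show "(\<Sum>n<N. prime_weight Q n) \<le> diagonal_const * ln Q"
    using ln_ge_1[OF Q] by (simp add: diagonal_const_def mult_ac)
qed

text \<open>On [Q, 2Q] the power is at least e^(-5/2)/Q, because 1 + 2 ln 2 \<le> 5/2 and ln Q \<ge>
  1, and the Gaussian is at least e^(-1/2).\<close>

lemma prime_weight_lower:
  assumes Q: "Q \<ge> 3" and p: "prime p" "Q \<le> real p" "real p \<le> 2 * Q"
  shows "prime_weight Q p \<ge> exp (- 3) * (ln Q ^ 2 / Q)"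
proof -
  have Q0: "Q > 0" "real p > 0" using Q p by auto
  have lnQ: "ln Q \<ge> 1" by (rule ln_ge_1[OF Q])
  have ln2: "ln 2 \<le> (1::real)" using ln_le_minus_one[of 2] by simp
  have "ln (real p) \<ge> ln Q" using p Q0 by (simp add: ln_mono)
  hence 1: "ln (real p) ^ 2 \<ge> ln Q ^ 2" using lnQ by (intro power_mono) auto
  have "ln (real p) \<le> ln (2 * Q)" using p Q0 by (intro ln_mono) auto
  hence lnp: "ln (real p) \<le> ln Q + 1" using Q0 ln2 by (simp add: ln_mult)
  have "0 \<le> 1 + 1 / ln Q" using lnQ by (intro add_nonneg_nonneg) auto
  hence "(1 + 1 / ln Q) * ln (real p) \<le> (1 + 1 / ln Q) * (ln Q + ln 2)"
    using \<open>ln (real p) \<le> ln (2 * Q)\<close> lnQ Q0 by (intro mult_left_mono) (auto simp: ln_mult)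
  also have "\<dots> = ln Q + 1 + ln 2 + ln 2 / ln Q"
  proof -
    have "(1 + 1 / ln Q) * (ln Q + ln 2) = (ln Q + ln 2) + (ln Q + ln 2) / ln Q"
      by (simp only: distrib_right[of 1] mult_1 times_divide_eq_left)
    also have "(ln Q + ln 2) / ln Q = 1 + ln 2 / ln Q"
      using lnQ by (simp only: add_divide_distrib) simp
    finally show ?thesis by simp
  qed
  finally have "(1 + 1 / ln Q) * ln (real p) \<le> ln Q + 1 + ln 2 + ln 2 / ln Q" .
  moreover have "ln 2 / ln Q \<le> ln 2 / 1" using lnQ by (intro divide_left_mono) auto
  ultimately have "(1 + 1 / ln Q) * ln (real p) \<le> ln Q + 5 / 2" using ln2_le_25_over_36 by linarith
  hence "- (ln Q + 5 / 2) \<le> - (1 + 1 / ln Q) * ln (real p)" unfolding mult_minus_left by linarith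
  hence "exp (- (ln Q + 5 / 2)) \<le> real p powr (- (1 + 1 / ln Q))"
    unfolding powr_def using Q0 by simp
  moreover have "- (ln Q + 5 / 2) = - (5 / 2) - ln Q" by simp
  hence "exp (- (ln Q + 5 / 2)) = exp (- (5 / 2)) / Q" using Q0 by (simp only: exp_diff exp_ln)
  ultimately have 2: "exp (- (5 / 2)) / Q \<le> real p powr (- (1 + 1 / ln Q))" by simp
  have "0 \<le> ln (real p / Q)" "ln (real p / Q) \<le> 1"
    using p Q0 \<open>ln (real p) \<ge> ln Q\<close> lnp by (auto simp: ln_div)
  hence "ln (real p / Q) ^ 2 \<le> 1" by (simp add: power_le_one)
  hence 3: "exp (- (1 / 2)) \<le> exp (- (ln (real p / Q) ^ 2) / 2)" by simp
  have "ln Q ^ 2 * (exp (- (5 / 2)) / Q) * exp (- (1 / 2)) \<le> prime_weight Q p"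
    unfolding prime_weight_def if_P[OF p(1)] using 1 2 3 Q0
    by (intro mult_mono mult_nonneg_nonneg) auto
  moreover have "exp (- 3) = exp (- (5 / 2)) * exp (- (1 / 2) :: real)" by (simp flip: exp_add)
  hence "exp (- 3) * (ln Q ^ 2 / Q) = ln Q ^ 2 * (exp (- (5 / 2)) / Q) * exp (- (1 / 2))" by simp
  ultimately show ?thesis by (simp only:)
qed

section \<open>Absolute values on the rationals\<close>

text \<open>A common interface for the real and the p-adic absolute values. The crude comparison of
  an integer n with |n| and 1/|n| lets coefficient bounds be used at every place alike.\<close>

locale absval =
  fixes N :: "rat \<Rightarrow> real"
  assumes N_mult: "N (x * y) = N x * N y" and N_add: "N (x + y) \<le> N x + N y" and N_0: "N 0 = 0"
    and N_int_le: "N (of_int n) \<le> \<bar>of_int n\<bar>" and N_int_ge: "n \<noteq> 0 \<Longrightarrow> N (of_int n) \<ge> 1 / \<bar>of_int n\<bar>"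
begin

lemma N_int_pos: "n \<noteq> 0 \<Longrightarrow> N (of_int n) > 0"
  using N_int_ge[of n] less_le_trans[of 0 "1 / \<bar>of_int n\<bar> :: real" "N (of_int n)"] by simp

lemma N_pos: "x \<noteq> 0 \<Longrightarrow> N x > 0"
proof -
  assume x: "x \<noteq> 0"
  obtain p q where pq: "quotient_of x = (p, q)" by force
  hence q: "q > 0" and xe: "x = of_int p / of_int q" by (auto simp: quotient_of_denom_pos quotient_of_div)
  have p: "p \<noteq> 0" using x xe by auto
  have "N (of_int p) = N x * N (of_int q)" using q by (simp add: xe flip: N_mult)
  thus "N x > 0" using N_int_pos[OF p] N_int_pos[of q] q by (simp add: zero_less_mult_iff)
qed

lemma N_nonneg: "N x \<ge> 0"
  using N_pos[of x] N_0 by (cases "x = 0") auto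

lemma N_1: "N 1 = 1"
  using N_mult[of 1 1] N_pos[of 1] by simp

lemma N_minus_1: "N (- 1) = 1"
  using N_int_le[of "- 1"] N_int_ge[of "- 1"] by simp

lemma N_minus: "N (- x) = N x"
  using N_mult[of "- 1" x] N_minus_1 by simp

lemma N_diff: "N (x - y) \<le> N x + N y"
  using N_add[of x "- y"] by (simp add: N_minus)

lemma N_power: "N (x ^ n) = N x ^ n"
  by (induction n) (auto simp: N_1 N_mult)

lemma N_divide: "N (x / y) = N x / N y"
proof (cases "y = 0")
  case False
  have "N x = N (x / y) * N y" using False by (simp flip: N_mult)
  thus ?thesis using N_pos[OF False] by simp
qed (simp add: N_0)

lemma N_2: "N 2 \<ge> 1 / 2"
  using N_int_ge[of 2] by simp

lemma N_lower: "N y \<ge> N x - N (x - y)"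
  using N_add[of "x - y" y] by simp

end

section \<open>The p-adic absolute values\<close>

definition int_padic :: "nat \<Rightarrow> int \<Rightarrow> real" where
  "int_padic p n = (if n = 0 then 0 else 1 / real p ^ multiplicity (int p) n)"

definition padic :: "nat \<Rightarrow> rat \<Rightarrow> real" where
  "padic p x = int_padic p (fst (quotient_of x)) / int_padic p (snd (quotient_of x))"

context
  fixes p :: nat assumes p: "prime p"
begin

lemma int_padic_mult: "int_padic p (m * n) = int_padic p m * int_padic p n"
  using p by (auto simp: int_padic_def prime_elem_multiplicity_mult_distrib power_add)

lemma int_padic_pos: "n \<noteq> 0 \<Longrightarrow> int_padic p n > 0"
  using prime_gt_0_nat[OF p] by (simp add: int_padic_def)

lemma int_padic_le: "n \<noteq> 0 \<Longrightarrow> int p ^ k dvd n \<Longrightarrow> int_padic p n \<le> 1 / real p ^ k"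
proof -
  assume n: "n \<noteq> 0" "int p ^ k dvd n"
  have "\<not> is_unit (int p)" using prime_gt_1_nat[OF p] by simp
  hence "k \<le> multiplicity (int p) n" using n by (intro multiplicity_geI) auto
  hence "real p ^ k \<le> real p ^ multiplicity (int p) n"
    using prime_gt_0_nat[OF p] by (intro power_increasing) auto
  thus ?thesis using n prime_gt_0_nat[OF p] by (simp add: int_padic_def frac_le)
qed

lemma int_padic_add: "int_padic p (m + n) \<le> int_padic p m + int_padic p n"
proof (cases "m = 0 \<or> n = 0 \<or> m + n = 0")
  case True
  thus ?thesis using int_padic_pos[of m] int_padic_pos[of n] by (auto simp: int_padic_def)
next
  case False
  define k where "k = min (multiplicity (int p) m) (multiplicity (int p) n)"
  have "int p ^ k dvd m" "int p ^ k dvd n"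
    by (rule multiplicity_dvd', simp add: k_def)+
  hence "int_padic p (m + n) \<le> 1 / real p ^ k" using False by (intro int_padic_le) auto
  also have "\<dots> \<le> int_padic p m + int_padic p n"
    using False int_padic_pos[of m] int_padic_pos[of n] by (auto simp: k_def min_def int_padic_def)
  finally show ?thesis .
qed

text \<open>Multiplicativity makes the value independent of the representing fraction, so sums and
  products need no reduction to lowest terms.\<close>

lemma padic_quotient:
  assumes "b \<noteq> 0"
  shows "padic p (of_int a / of_int b) = int_padic p a / int_padic p b"
proof -
  define x :: rat where "x = of_int a / of_int b"
  obtain u v where uv: "quotient_of x = (u, v)" by force
  hence v: "v > 0" and xe: "x = of_int u / of_int v" by (auto simp: quotient_of_denom_pos quotient_of_div)
  have "of_int a * of_int v = (of_int u * of_int b :: rat)"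
    using xe v assms by (simp add: x_def field_simps)
  hence "a * v = u * b" by (metis of_int_eq_iff of_int_mult)
  hence "int_padic p a * int_padic p v = int_padic p u * int_padic p b" by (simp flip: int_padic_mult)
  thus ?thesis using int_padic_pos[OF assms] int_padic_pos[of v] v uv
    unfolding x_def[symmetric] by (simp add: padic_def field_simps)
qed

lemma rat_cases: obtains a b where "(x::rat) = of_int a / of_int b" "b \<noteq> 0"
  using quotient_of_denom_pos[of x] quotient_of_div[of x] by (metis less_irrefl prod.exhaust)

lemma padic_of_int: "padic p (of_int n) = int_padic p n"
  using padic_quotient[of 1 n] by (simp add: int_padic_def)

lemma absval_padic: "absval (padic p)"
proof
  fix x y :: rat and n :: int
  obtain a b where x: "x = of_int a / of_int b" "b \<noteq> 0" by (rule rat_cases)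
  obtain c d where y: "y = of_int c / of_int d" "d \<noteq> 0" by (rule rat_cases)
  have xy: "x * y = of_int (a * c) / of_int (b * d)" "x + y = of_int (a * d + c * b) / of_int (b * d)"
    using x y by (simp_all add: field_simps)
  have "padic p (x * y) = int_padic p (a * c) / int_padic p (b * d)"
    unfolding xy(1) using x y by (intro padic_quotient) simp
  thus "padic p (x * y) = padic p x * padic p y"
    using x y by (simp add: int_padic_mult padic_quotient)
  have pos: "int_padic p b > 0" "int_padic p d > 0" using x y int_padic_pos by auto
  have "padic p (x + y) = int_padic p (a * d + c * b) / int_padic p (b * d)"
    unfolding xy(2) using x y by (intro padic_quotient) simp
  also have "\<dots> \<le> (int_padic p (a * d) + int_padic p (c * b)) / int_padic p (b * d)"
    using pos by (intro divide_right_mono int_padic_add) (simp add: int_padic_mult)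
  also have "\<dots> = padic p x + padic p y"
  proof -
    have "padic p x = int_padic p a / int_padic p b" "padic p y = int_padic p c / int_padic p d"
      using x y padic_quotient by simp_all
    thus ?thesis unfolding int_padic_mult using pos by (simp only:) (rule add_frac_eq[symmetric]; simp)
  qed
  finally show "padic p (x + y) \<le> padic p x + padic p y" .
  show p0: "padic p 0 = 0" using padic_of_int[of 0] by (simp add: int_padic_def)
  show "padic p (of_int n) \<le> \<bar>of_int n\<bar>"
  proof (cases "n = 0")
    case False
    have "int_padic p n \<le> 1" using int_padic_le[of n 0] False by simp
    also have "1 \<le> \<bar>of_int n :: real\<bar>" using False by linarith
    finally show ?thesis by (simp add: padic_of_int)
  qed (simp add: p0)
  assume n: "n \<noteq> 0"
  have "int p ^ multiplicity (int p) n \<le> \<bar>n\<bar>"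
    using n by (intro zdvd_imp_le) (auto intro: multiplicity_dvd)
  hence "real p ^ multiplicity (int p) n \<le> \<bar>of_int n\<bar>" by (metis of_int_abs of_int_le_iff of_int_of_nat_eq of_int_power)
  thus "padic p (of_int n) \<ge> 1 / \<bar>of_int n\<bar>"
    using n prime_gt_0_nat[OF p] by (simp add: padic_of_int int_padic_def frac_le)
qed

end

text \<open>Index 0 stands for the archimedean place.\<close>

definition place :: "nat \<Rightarrow> rat \<Rightarrow> real" where
  "place v = (if v = 0 then (\<lambda>x. \<bar>of_rat x\<bar>) else padic v)"

definition places :: "int \<Rightarrow> nat set" where
  "places a = insert 0 (prime_factors (nat \<bar>a\<bar>))"

lemma absval_arch: "absval (\<lambda>x. \<bar>of_rat x\<bar>)"
proof
  fix n :: int assume "n \<noteq> 0"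
  hence "1 \<le> \<bar>of_int n :: real\<bar>" by linarith
  moreover from this have "1 / \<bar>of_int n :: real\<bar> \<le> 1" by (simp add: divide_le_eq_1)
  ultimately have "1 / \<bar>of_int n :: real\<bar> \<le> \<bar>of_int n\<bar>" by linarith
  thus "\<bar>of_rat (of_int n)\<bar> \<ge> 1 / \<bar>of_int n :: real\<bar>" by (simp only: of_rat_of_int_eq)
next
  fix x y :: rat and n :: int
  show "\<bar>of_rat (x * y)\<bar> = \<bar>of_rat x\<bar> * \<bar>of_rat y :: real\<bar>" by (simp only: of_rat_mult abs_mult)
  show "\<bar>of_rat (x + y)\<bar> \<le> \<bar>of_rat x\<bar> + \<bar>of_rat y :: real\<bar>" unfolding of_rat_add by (rule abs_triangle_ineq)
  show "\<bar>of_rat (of_int n)\<bar> \<le> \<bar>of_int n :: real\<bar>" by (simp only: of_rat_of_int_eq)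
qed simp

lemma absval_place: "v \<in> places a \<Longrightarrow> absval (place v)"
  unfolding place_def places_def using absval_arch absval_padic
  by (auto dest: in_prime_factors_imp_prime)

lemma finite_places: "finite (places a)"
  by (simp add: places_def)

lemma place_of_int:
  assumes "p \<in> prime_factors (nat \<bar>a\<bar>)" "n \<noteq> 0"
  shows "place p (of_int n) = 1 / real (p ^ multiplicity p (nat \<bar>n\<bar>))"
proof -
  have p: "prime p" using assms(1) by (rule in_prime_factors_imp_prime)
  have "multiplicity (int p) n = multiplicity (int p) (int (nat \<bar>n\<bar>))"
    using multiplicity_normalize_right[of "int p" n] by simp
  also have "\<dots> = multiplicity p (nat \<bar>n\<bar>)"
  proof (rule multiplicity_eqI)
    have "nat \<bar>n\<bar> \<noteq> 0" "\<not> is_unit p" using assms(2) p not_prime_unit by auto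
    note iff = power_dvd_iff_le_multiplicity[OF this]
    have *: "int p ^ k dvd int (nat \<bar>n\<bar>) \<longleftrightarrow> p ^ k dvd nat \<bar>n\<bar>" for k
      by (simp only: of_nat_power[symmetric] int_dvd_int_iff)
    show "int p ^ multiplicity p (nat \<bar>n\<bar>) dvd int (nat \<bar>n\<bar>)" unfolding * iff by simp
    show "\<not> int p ^ Suc (multiplicity p (nat \<bar>n\<bar>)) dvd int (nat \<bar>n\<bar>)" unfolding * iff by simp
  qed
  finally show ?thesis
    using p assms(2) prime_gt_0_nat[OF p] by (simp add: place_def padic_of_int int_padic_def)
qed

text \<open>The product over the chosen places is the part of n prime to \<open>a\<close>. It is
  thus a positive integer, and equals 1 for \<open>a\<close> itself.\<close>

lemma prod_places:
  assumes "n \<noteq> 0"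
  shows "(\<Prod>v\<in>places a. place v (of_int n)) = \<bar>of_int n\<bar> / real (\<Prod>p\<in>prime_factors (nat \<bar>a\<bar>). p ^ multiplicity p (nat \<bar>n\<bar>))"
proof -
  have "0 \<notin> prime_factors (nat \<bar>a\<bar>)" by (auto dest: in_prime_factors_imp_prime)
  moreover have "place 0 (of_int n) = \<bar>of_int n\<bar>"
    by (simp only: place_def if_True simp_thms of_rat_of_int_eq)
  ultimately have "(\<Prod>v\<in>places a. place v (of_int n)) = \<bar>of_int n\<bar> * (\<Prod>p\<in>prime_factors (nat \<bar>a\<bar>). place p (of_int n))"
    unfolding places_def by simp
  also have "(\<Prod>p\<in>prime_factors (nat \<bar>a\<bar>). place p (of_int n))
      = (\<Prod>p\<in>prime_factors (nat \<bar>a\<bar>). 1 / real (p ^ multiplicity p (nat \<bar>n\<bar>)))"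
    using assms by (intro prod.cong refl place_of_int) auto
  also have "\<dots> = 1 / real (\<Prod>p\<in>prime_factors (nat \<bar>a\<bar>). p ^ multiplicity p (nat \<bar>n\<bar>))"
    by (simp add: prod_dividef)
  finally show ?thesis by simp
qed

lemma prod_places_ge_1:
  assumes "n \<noteq> 0"
  shows "(\<Prod>v\<in>places a. place v (of_int n)) \<ge> 1"
proof -
  let ?P = "\<Prod>p\<in>prime_factors (nat \<bar>a\<bar>). p ^ multiplicity p (nat \<bar>n\<bar>)"
  have "?P dvd nat \<bar>n\<bar>"
  proof (rule prod_coprime_dvd)
    show "coprime (p ^ multiplicity p (nat \<bar>n\<bar>)) (r ^ multiplicity r (nat \<bar>n\<bar>))"
      if "p \<in> prime_factors (nat \<bar>a\<bar>)" "r \<in> prime_factors (nat \<bar>a\<bar>)" "p \<noteq> r" for p r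
      using that primes_coprime[of p r] by (auto dest: in_prime_factors_imp_prime)
    show "p ^ multiplicity p (nat \<bar>n\<bar>) dvd nat \<bar>n\<bar>" for p by (rule multiplicity_dvd)
  qed simp
  hence "?P \<le> nat \<bar>n\<bar>" using assms by (intro dvd_imp_le) auto
  hence "real ?P \<le> real (nat \<bar>n\<bar>)" by (simp only: of_nat_le_iff)
  hence "real ?P \<le> \<bar>of_int n\<bar>" by simp
  moreover have "?P > 0" by (intro prod_pos) (auto dest: in_prime_factors_imp_prime simp: prime_gt_0_nat)
  hence "real ?P > 0" by (simp only: of_nat_0_less_iff)
  ultimately show ?thesis unfolding prod_places[OF assms] by (simp only: le_divide_eq_1_pos)
qed

lemma prod_places_self:
  assumes "a \<noteq> 0"
  shows "(\<Prod>v\<in>places a. place v (of_int a)) = 1"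
proof -
  have "(\<Prod>p\<in>prime_factors (nat \<bar>a\<bar>). p ^ multiplicity p (nat \<bar>a\<bar>)) = nat \<bar>a\<bar>"
    using prod_prime_factors[of "nat \<bar>a\<bar>"] assms by simp
  thus ?thesis unfolding prod_places[OF assms] using assms by simp
qed

section \<open>Coefficient bounds for integer polynomials\<close>

text \<open>This norm is submultiplicative and dominates evaluation at every place
  simultaneously.\<close>

definition l1_norm :: "int poly \<Rightarrow> real" where
  "l1_norm P = (\<Sum>c\<leftarrow>coeffs P. \<bar>of_int c\<bar>)"

abbreviation eval_rat :: "int poly \<Rightarrow> rat \<Rightarrow> rat" where
  "eval_rat P x \<equiv> poly (map_poly of_int P) x"

lemma l1_norm_0 [simp]: "l1_norm 0 = 0"
  by (simp add: l1_norm_def)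

lemma l1_norm_pCons [simp]: "l1_norm (pCons a P) = \<bar>of_int a\<bar> + l1_norm P"
  by (simp add: l1_norm_def cCons_def)

lemma l1_norm_nonneg: "l1_norm P \<ge> 0"
  by (induction P) auto

lemma l1_norm_add: "l1_norm (P + Q) \<le> l1_norm P + l1_norm Q"
proof (induction P arbitrary: Q)
  case (pCons a P)
  show ?case
  proof (cases Q)
    case (pCons b R)
    have "\<bar>of_int a + of_int b :: real\<bar> \<le> \<bar>of_int a\<bar> + \<bar>of_int b\<bar>" by (rule abs_triangle_ineq)
    thus ?thesis using pCons.IH[of R] pCons by simp
  qed
qed simp

lemma l1_norm_minus: "l1_norm (- P) = l1_norm P"
  by (induction P) auto

lemma l1_norm_diff: "l1_norm (P - Q) \<le> l1_norm P + l1_norm Q"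
  using l1_norm_add[of P "- Q"] by (simp add: l1_norm_minus)

lemma l1_norm_smult: "l1_norm (smult a P) = \<bar>of_int a\<bar> * l1_norm P"
  by (induction P) (auto simp: abs_mult algebra_simps)

lemma l1_norm_mult: "l1_norm (P * Q) \<le> l1_norm P * l1_norm Q"
proof (induction P)
  case (pCons a P)
  have "l1_norm (pCons a P * Q) \<le> l1_norm (smult a Q) + l1_norm (pCons 0 (P * Q))"
    unfolding mult_pCons_left by (rule l1_norm_add)
  also have "\<dots> \<le> l1_norm (pCons a P) * l1_norm Q"
    using pCons.IH by (simp add: l1_norm_smult algebra_simps)
  finally show ?case .
qed simp

lemma l1_norm_power: "l1_norm (P ^ n) \<le> l1_norm P ^ n"
proof (induction n)
  case (Suc n)
  have "l1_norm (P ^ Suc n) \<le> l1_norm P * l1_norm (P ^ n)" by (simp add: l1_norm_mult)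
  also have "\<dots> \<le> l1_norm P * l1_norm P ^ n" using Suc l1_norm_nonneg by (intro mult_left_mono)
  finally show ?case by simp
qed (simp add: l1_norm_def)

lemma l1_norm_monom: "l1_norm (monom a n) = \<bar>of_int a\<bar>"
  by (induction n) (auto simp: monom_0 monom_Suc)

lemma l1_norm_sum: "l1_norm (sum f A) \<le> (\<Sum>i\<in>A. l1_norm (f i))"
  by (induction A rule: infinite_finite_induct) (auto intro: order_trans[OF l1_norm_add])

lemma abs_coeff_le_l1_norm: "\<bar>of_int (coeff P i)\<bar> \<le> l1_norm P"
proof (induction P arbitrary: i)
  case (pCons a P)
  show ?case
  proof (cases i)
    case 0
    thus ?thesis using l1_norm_nonneg[of P] by simp
  next
    case (Suc j)
    thus ?thesis using pCons.IH[of j] by (simp add: order_trans[OF _ abs_ge_zero[THEN add_increasing]])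
  qed
qed simp

lemma l1_norm_pcompose:
  assumes "l1_norm Q \<le> B" "B \<ge> 1"
  shows "l1_norm (pcompose P Q) \<le> l1_norm P * B ^ degree P"
proof (induction P)
  case (pCons a P)
  show ?case
  proof (cases "P = 0")
    case False
    have "l1_norm (pcompose (pCons a P) Q) \<le> l1_norm [:a:] + l1_norm (Q * pcompose P Q)"
      unfolding pcompose_pCons by (rule l1_norm_add)
    also have "l1_norm (Q * pcompose P Q) \<le> l1_norm Q * l1_norm (pcompose P Q)" by (rule l1_norm_mult)
    also have "\<dots> \<le> B * (l1_norm P * B ^ degree P)"
      using assms pCons.IH l1_norm_nonneg by (intro mult_mono) auto
    also have "l1_norm [:a:] \<le> \<bar>of_int a\<bar> * B ^ Suc (degree P)"
      using mult_left_mono[OF one_le_power[OF assms(2)], of "\<bar>of_int a\<bar>" "Suc (degree P)"] by simp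
    finally show ?thesis using False by (simp add: algebra_simps)
  qed simp
qed simp

section \<open>Size of polynomial values at a place\<close>

context absval
begin

lemma N_eval_le:
  assumes "N x \<le> B" "B \<ge> 1" "degree P \<le> d"
  shows "N (eval_rat P x) \<le> l1_norm P * B ^ d"
  using assms(3)
proof (induction P arbitrary: d)
  case (pCons a P)
  have eq: "eval_rat (pCons a P) x = of_int a + x * eval_rat P x"
    by (simp add: of_int_hom.map_poly_pCons_hom)
  show ?case
  proof (cases "P = 0")
    case True
    have "N (of_int a) \<le> \<bar>of_int a\<bar> * 1" using N_int_le by simp
    also have "\<dots> \<le> \<bar>of_int a\<bar> * B ^ d" using assms by (intro mult_left_mono) auto
    finally show ?thesis unfolding eq using True by simp
  next
    case False
    then obtain d' where d: "d = Suc d'" "degree P \<le> d'" using pCons.prems by (cases d) auto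
    have "N (eval_rat (pCons a P) x) \<le> N (of_int a) + N x * N (eval_rat P x)"
      unfolding eq using N_add N_mult by metis
    also have "\<dots> \<le> \<bar>of_int a\<bar> * B ^ d + B * (l1_norm P * B ^ d')"
    proof (rule add_mono)
      show "N x * N (eval_rat P x) \<le> B * (l1_norm P * B ^ d')"
        using assms pCons.IH[OF d(2)] N_nonneg by (intro mult_mono) auto
      have "N (of_int a) \<le> \<bar>of_int a\<bar> * 1" using N_int_le by simp
      also have "\<dots> \<le> \<bar>of_int a\<bar> * B ^ d" using assms by (intro mult_left_mono) auto
      finally show "N (of_int a) \<le> \<bar>of_int a\<bar> * B ^ d" .
    qed
    also have "\<dots> = l1_norm (pCons a P) * B ^ d" by (simp add: d algebra_simps)
    finally show ?thesis .
  qed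
qed (simp add: N_0)

text \<open>The lower terms have norm at most 2 \<open>l1_norm P\<close> and one degree less. The
  second factor \<open>l1_norm P\<close> pays for dividing by the leading coefficient, whose
  absolute value may be as small as 1/|lc|.\<close>

lemma N_leading_term:
  assumes P: "P \<noteq> 0" and x: "N x \<ge> 1"
  shows "N (eval_rat P x / (of_int (lead_coeff P) * x ^ degree P) - 1) \<le> 2 * l1_norm P ^ 2 / N x"
proof (cases "degree P")
  case 0
  then obtain c where "P = [:c:]" "c \<noteq> 0" using P by (metis degree_eq_zeroE pCons_0_0)
  thus ?thesis using x by (simp add: map_poly_pCons N_0)
next
  case (Suc d)
  define c where "c = lead_coeff P"
  define R where "R = P - monom c (degree P)"
  have x0: "x \<noteq> 0" using x N_0 by auto
  have c: "c \<noteq> 0" using P by (simp add: c_def)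
  have "degree R \<le> d"
  proof (rule degree_le, intro allI impI)
    fix i assume "i > d"
    thus "coeff R i = 0" by (cases "i = degree P") (auto simp: R_def c_def Suc coeff_eq_0)
  qed
  hence "N (eval_rat R x) \<le> l1_norm R * N x ^ d" by (intro N_eval_le x order_refl)
  also have "l1_norm R \<le> l1_norm P + \<bar>of_int c\<bar>"
    using l1_norm_diff[of P "monom c (degree P)"] by (simp add: R_def l1_norm_monom)
  also have "\<bar>of_int c\<bar> \<le> l1_norm P" unfolding c_def by (rule abs_coeff_le_l1_norm)
  finally have R: "N (eval_rat R x) \<le> 2 * l1_norm P * N x ^ d" using x by (simp add: mult_right_mono)
  have "eval_rat R x = eval_rat P x - of_int c * x ^ degree P"
    unfolding R_def by (simp add: of_int_poly_hom.hom_minus of_int_hom.map_poly_hom_monom poly_monom)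
  hence "eval_rat P x / (of_int c * x ^ degree P) - 1 = eval_rat R x / (of_int c * x ^ degree P)"
    using c x0 by (simp add: field_simps)
  hence "N (eval_rat P x / (of_int c * x ^ degree P) - 1) = N (eval_rat R x) / (N (of_int c) * N x ^ Suc d)"
    by (simp only: N_divide N_mult N_power Suc)
  also have "\<dots> \<le> (2 * l1_norm P * N x ^ d) / ((1 / \<bar>of_int c\<bar>) * N x ^ Suc d)"
    using R x c N_int_ge[OF c] l1_norm_nonneg[of P] by (intro frac_le mult_right_mono mult_nonneg_nonneg mult_pos_pos) auto
  also have "\<dots> = 2 * l1_norm P * \<bar>of_int c\<bar> / N x" using x c by (simp add: field_simps)
  also have "\<dots> \<le> 2 * l1_norm P * l1_norm P / N x"
    using \<open>\<bar>of_int c\<bar> \<le> l1_norm P\<close> x l1_norm_nonneg[of P] by (intro divide_right_mono mult_left_mono) auto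
  finally show ?thesis unfolding c_def by (simp add: power2_eq_square)
qed

end

section \<open>Truncated square roots of polynomials\<close>

text \<open>If a polynomial has leading coefficient e0^2 and e = 2 e0, its square root at infinity
  has the coefficients \<open>sqrt_coeff e g j\<close> / e^(2j - 1) for j \<ge> 1, with g j the
  coefficient j places below the top. The recursion is the square-root recursion with these
  denominators cleared.\<close>

fun sqrt_coeff :: "int \<Rightarrow> (nat \<Rightarrow> int) \<Rightarrow> nat \<Rightarrow> int" where
  "sqrt_coeff e g j = e ^ (2 * (j - 1)) * g j - (\<Sum>i\<in>{1..<j}. sqrt_coeff e g i * sqrt_coeff e g (j - i))"

declare sqrt_coeff.simps [simp del]

lemma sqrt_coeff_bound:
  assumes K: "real h + C \<le> K" and C: "\<bar>of_int e\<bar> \<le> C" "\<And>j. \<bar>of_int (g j)\<bar> \<le> C" "C \<ge> 1"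
    and j: "1 \<le> j" "j \<le> h"
  shows "\<bar>of_int (sqrt_coeff e g j)\<bar> \<le> K ^ (2 * j - 1)"
  using j
proof (induction j rule: less_induct)
  case (less j)
  have CK: "C \<le> K" "K \<ge> 1" using K C(3) by auto
  have "\<bar>of_int (sqrt_coeff e g j)\<bar>
      \<le> \<bar>of_int (e ^ (2 * (j - 1)) * g j)\<bar> + \<bar>\<Sum>i\<in>{1..<j}. of_int (sqrt_coeff e g i * sqrt_coeff e g (j - i)) :: real\<bar>"
    by (subst sqrt_coeff.simps) (simp add: abs_triangle_ineq4)
  also have "\<bar>of_int (e ^ (2 * (j - 1)) * g j)\<bar> \<le> K ^ (2 * (j - 1)) * C"
    unfolding of_int_mult of_int_power abs_mult power_abs
    using CK C by (intro mult_mono power_mono) auto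
  also have "\<bar>\<Sum>i\<in>{1..<j}. of_int (sqrt_coeff e g i * sqrt_coeff e g (j - i)) :: real\<bar> \<le> (\<Sum>i\<in>{1..<j}. K ^ (2 * (j - 1)))"
  proof (rule order_trans[OF sum_abs sum_mono])
    fix i assume i: "i \<in> {1..<j}"
    have "\<bar>of_int (sqrt_coeff e g i)\<bar> * \<bar>of_int (sqrt_coeff e g (j - i))\<bar> \<le> K ^ (2 * i - 1) * K ^ (2 * (j - i) - 1)"
      using i less.prems CK by (intro mult_mono less.IH) auto
    also have "\<dots> = K ^ (2 * (j - 1))"
    proof -
      have "2 * i - 1 + (2 * (j - i) - 1) = 2 * (j - 1)" using i by auto
      thus ?thesis by (simp only: power_add[symmetric])
    qed
    finally show "\<bar>of_int (sqrt_coeff e g i * sqrt_coeff e g (j - i)) :: real\<bar> \<le> K ^ (2 * (j - 1))" by (simp add: abs_mult)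
  qed
  also have "(\<Sum>i\<in>{1..<j}. K ^ (2 * (j - 1))) \<le> real h * K ^ (2 * (j - 1))"
    using less.prems CK by (simp add: mult_right_mono)
  also have "K ^ (2 * (j - 1)) * C + real h * K ^ (2 * (j - 1)) = (real h + C) * K ^ (2 * (j - 1))"
    by (simp add: algebra_simps)
  also have "\<dots> \<le> K * K ^ (2 * (j - 1))" using K CK by (intro mult_right_mono) auto
  also have "\<dots> = K ^ (2 * j - 1)"
  proof -
    have "2 * j - 1 = Suc (2 * (j - 1))" using less.prems by auto
    thus ?thesis by simp
  qed
  finally show ?case by simp
qed

text \<open>T is the polynomial part of M sqrt H. The bounds are explicit, of the form K^(O(h)),
  because Runge's method has to be uniform in the degree of H.\<close>

lemma polynomial_square_root:
  fixes H :: "int poly" and e0 :: int and K :: real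
  assumes deg: "degree H \<le> 2 * h" and lc: "coeff H (2 * h) = e0 ^ 2" and e0: "e0 \<noteq> 0"
    and K: "real h + 1 + max \<bar>of_int (2 * e0)\<bar> (l1_norm H) \<le> K"
  defines "M \<equiv> (2 * e0) ^ (2 * h)"
  obtains T R where "smult (M ^ 2) H = T ^ 2 + R" "\<And>i. i \<ge> h \<Longrightarrow> coeff R i = 0"
    "degree T = h" "lead_coeff T = M * e0" "l1_norm T \<le> K ^ (2 * h + 2)" "l1_norm R \<le> K ^ (4 * h + 5)"
proof -
  define E where "E = 2 * e0"
  define g where "g = (\<lambda>j. coeff H (2 * h - j))"
  define t where "t = sqrt_coeff E g"
  \<comment> \<open>M = E^(2h) clears the denominators E^(2j - 1) for all j \<le> h, leaving E^(2h +
    1 - 2j).\<close>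
  define c where "c = (\<lambda>j. if j = 0 then M * e0 else t j * E ^ (2 * h + 1 - 2 * j))"
  define T where "T = (\<Sum>j\<le>h. monom (c j) (h - j))"
  define R where "R = smult (M ^ 2) H - T ^ 2"
  have M: "M = E ^ (2 * h)" by (simp add: M_def E_def)
  have M0: "M \<noteq> 0" using e0 by (simp add: M_def)
  define C where "C = max \<bar>of_int E\<bar> (l1_norm H)"
  have E1: "\<bar>of_int E :: real\<bar> \<ge> 1" using e0 unfolding E_def by linarith
  have C: "\<bar>of_int E\<bar> \<le> C" "\<And>j. \<bar>of_int (g j)\<bar> \<le> C" "C \<ge> 1" "l1_norm H \<le> C"
    using E1 by (auto simp: C_def g_def intro: order_trans[OF abs_coeff_le_l1_norm])
  have K': "real h + C \<le> K" "real h + 1 + C \<le> K" using K by (auto simp: C_def E_def)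
  have K1: "K \<ge> 1" "C \<le> K" "real h + 1 \<le> K" using K' C(3) by auto
  have coeff_T: "coeff T i = (if i \<le> h then c (h - i) else 0)" for i
  proof -
    have "coeff T i = (\<Sum>j\<le>h. if i = h - j then c j else 0)"
      unfolding T_def coeff_sum coeff_monom by (intro sum.cong) auto
    also have "\<dots> = (\<Sum>j\<in>{..h}. if i \<le> h \<and> j = h - i then c j else 0)"
      by (intro sum.cong) auto
    also have "\<dots> = (if i \<le> h then c (h - i) else 0)" by (simp add: sum.delta)
    finally show ?thesis .
  qed
  have conv: "(\<Sum>l\<le>j. c l * c (j - l)) = M ^ 2 * g j" if j: "j \<le> h" for j
  proof (cases "j = 0")
    case True
    thus ?thesis by (simp add: c_def g_def lc power2_eq_square)
  next
    case False
    define X where "X = E ^ (4 * h + 2 - 2 * j)"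
    have set: "{..j} = insert 0 (insert j {1..<j})" using False by auto
    have "(\<Sum>l\<le>j. c l * c (j - l)) = 2 * (c 0 * c j) + (\<Sum>l\<in>{1..<j}. c l * c (j - l))"
      unfolding set using False by simp
    also have "2 * (c 0 * c j) = X * t j"
    proof -
      have "2 * (c 0 * c j) = E ^ (2 * h) * E ^ 1 * E ^ (2 * h + 1 - 2 * j) * t j"
        using False by (simp add: c_def M E_def)
      also have "E ^ (2 * h) * E ^ 1 * E ^ (2 * h + 1 - 2 * j) = E ^ (2 * h + 1 + (2 * h + 1 - 2 * j))"
        by (simp only: power_add)
      also have "2 * h + 1 + (2 * h + 1 - 2 * j) = 4 * h + 2 - 2 * j" using j by simp
      finally show ?thesis by (simp add: X_def)
    qed
    also have "(\<Sum>l\<in>{1..<j}. c l * c (j - l)) = (\<Sum>l\<in>{1..<j}. X * (t l * t (j - l)))"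
    proof (rule sum.cong[OF refl])
      fix l assume l: "l \<in> {1..<j}"
      have "c l * c (j - l) = E ^ (2 * h + 1 - 2 * l) * E ^ (2 * h + 1 - 2 * (j - l)) * (t l * t (j - l))"
        using l by (simp add: c_def)
      also have "E ^ (2 * h + 1 - 2 * l) * E ^ (2 * h + 1 - 2 * (j - l)) = E ^ (2 * h + 1 - 2 * l + (2 * h + 1 - 2 * (j - l)))"
        by (simp only: power_add)
      also have "2 * h + 1 - 2 * l + (2 * h + 1 - 2 * (j - l)) = 4 * h + 2 - 2 * j" using l j by auto
      finally show "c l * c (j - l) = X * (t l * t (j - l))" by (simp add: X_def)
    qed
    also have "X * t j + (\<Sum>l\<in>{1..<j}. X * (t l * t (j - l))) = X * (t j + (\<Sum>l\<in>{1..<j}. t l * t (j - l)))"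
      by (simp add: sum_distrib_left distrib_left)
    also have "t j + (\<Sum>l\<in>{1..<j}. t l * t (j - l)) = E ^ (2 * (j - 1)) * g j"
      unfolding t_def by (subst sqrt_coeff.simps) simp
    also have "X * (E ^ (2 * (j - 1)) * g j) = E ^ (4 * h + 2 - 2 * j + 2 * (j - 1)) * g j"
      by (simp add: X_def power_add)
    also have "4 * h + 2 - 2 * j + 2 * (j - 1) = (2 * h) * 2" using j False by auto
    finally show ?thesis unfolding M power_mult[symmetric] .
  qed
  have sq: "coeff (T ^ 2) (2 * h - j) = (\<Sum>l\<le>j. c l * c (j - l))" if j: "j \<le> h" for j
  proof -
    have "coeff (T ^ 2) (2 * h - j) = (\<Sum>i\<le>2 * h - j. coeff T i * coeff T (2 * h - j - i))"
      by (simp add: power2_eq_square coeff_mult)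
    also have "\<dots> = (\<Sum>i\<in>{h - j..h}. coeff T i * coeff T (2 * h - j - i))"
      by (rule sum.mono_neutral_right) (use j in \<open>auto simp: coeff_T\<close>)
    also have "\<dots> = (\<Sum>l\<le>j. c l * c (j - l))"
    proof (rule sum.reindex_bij_witness[of _ "\<lambda>l. h - l" "\<lambda>i. h - i"])
      fix i assume i: "i \<in> {h - j..h}"
      have "h - (2 * h - j - i) = j - (h - i)" "2 * h - j - i \<le> h" using i j by auto
      thus "c (h - i) * c (j - (h - i)) = coeff T i * coeff T (2 * h - j - i)"
        using i by (simp add: coeff_T)
    qed (use j in auto)
    finally show ?thesis .
  qed
  have R0: "coeff R i = 0" if i: "i \<ge> h" for i
  proof (cases "i \<le> 2 * h")
    case True
    define j where "j = 2 * h - i"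
    have j: "j \<le> h" "i = 2 * h - j" using i True by (auto simp: j_def)
    show ?thesis unfolding R_def coeff_diff coeff_smult using sq[OF j(1)] conv[OF j(1)] by (simp add: j(2) g_def)
  next
    case False
    have "degree T \<le> h" by (rule degree_le) (simp add: coeff_T)
    hence "degree (T ^ 2) \<le> 2 * h" using degree_power_le[of T 2] by simp
    hence "coeff (T ^ 2) i = 0" "coeff H i = 0" using False deg by (auto intro: coeff_eq_0)
    thus ?thesis by (simp add: R_def)
  qed
  have lcT: "coeff T h = M * e0" by (simp add: coeff_T c_def)
  have degT: "degree T = h"
  proof (rule antisym)
    show "degree T \<le> h" by (rule degree_le) (simp add: coeff_T)
    show "h \<le> degree T" by (rule le_degree) (use lcT M0 e0 in simp)
  qed
  have c_bound: "\<bar>of_int (c j)\<bar> \<le> K ^ (2 * h + 1)" if j: "j \<le> h" for j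
  proof (cases "j = 0")
    case True
    have "\<bar>of_int e0 :: real\<bar> \<le> \<bar>of_int E\<bar>" by (simp add: E_def)
    hence "\<bar>of_int E :: real\<bar> ^ (2 * h) * \<bar>of_int e0\<bar> \<le> K ^ (2 * h) * K"
      using C(1) K1 by (intro mult_mono power_mono) auto
    thus ?thesis using True by (simp add: c_def M abs_mult power_abs mult.commute)
  next
    case False
    have "\<bar>of_int (t j)\<bar> * \<bar>of_int E\<bar> ^ (2 * h + 1 - 2 * j) \<le> K ^ (2 * j - 1) * K ^ (2 * h + 1 - 2 * j)"
      unfolding t_def using False j C K1 by (intro mult_mono power_mono sqrt_coeff_bound[OF K'(1) C(1,2,3)]) auto
    also have "\<dots> = K ^ (2 * j - 1 + (2 * h + 1 - 2 * j))" by (simp only: power_add)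
    also have "\<dots> \<le> K ^ (2 * h + 1)" using K1 False j by (intro power_increasing) auto
    finally show ?thesis using False by (simp add: c_def abs_mult power_abs)
  qed
  have "l1_norm T \<le> (\<Sum>j\<le>h. \<bar>of_int (c j)\<bar>)"
    unfolding T_def using l1_norm_sum[of "\<lambda>j. monom (c j) (h - j)" "{..h}"] by (simp add: l1_norm_monom)
  also have "\<dots> \<le> (\<Sum>j\<le>h. K ^ (2 * h + 1))" by (rule sum_mono) (use c_bound in auto)
  also have "\<dots> = (real h + 1) * K ^ (2 * h + 1)" by (simp add: algebra_simps)
  also have "\<dots> \<le> K * K ^ (2 * h + 1)" using K1 by (intro mult_right_mono) auto
  finally have T: "l1_norm T \<le> K ^ (2 * h + 2)" by simp
  have "l1_norm R \<le> l1_norm (smult (M ^ 2) H) + l1_norm (T ^ 2)" unfolding R_def by (rule l1_norm_diff)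
  also have "l1_norm (smult (M ^ 2) H) \<le> K ^ (4 * h) * K"
  proof -
    have "\<bar>of_int (M ^ 2) :: real\<bar> = \<bar>of_int E\<bar> ^ (4 * h)" by (simp add: M power_abs flip: power_mult)
    also have "\<dots> \<le> K ^ (4 * h)" using C(1) K1 by (intro power_mono) auto
    finally show ?thesis unfolding l1_norm_smult using C(4) K1 l1_norm_nonneg by (intro mult_mono) auto
  qed
  also have "l1_norm (T ^ 2) \<le> (K ^ (2 * h + 2)) ^ 2"
    by (rule order_trans[OF l1_norm_power power_mono[OF T l1_norm_nonneg]])
  also have "K ^ (4 * h) * K + (K ^ (2 * h + 2)) ^ 2 \<le> K ^ (4 * h + 5)"
  proof -
    have K2: "K \<ge> 2" using K' C(3) by simp
    have "K ^ (4 * h) * K \<le> K ^ (4 * h + 4)" using K1 power_increasing[of "4 * h + 1" "4 * h + 4" K] by (simp add: mult.commute)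
    moreover have "4 * h + 4 = (2 * h + 2) * 2" by simp
    hence "(K ^ (2 * h + 2)) ^ 2 = K ^ (4 * h + 4)" by (simp only: power_mult)
    moreover have "2 * K ^ (4 * h + 4) \<le> K * K ^ (4 * h + 4)" using K2 by (intro mult_right_mono) auto
    moreover have "K * K ^ (4 * h + 4) = K ^ (4 * h + 5)" by (simp add: eval_nat_numeral)
    ultimately show ?thesis by linarith
  qed
  finally have R: "l1_norm R \<le> K ^ (4 * h + 5)" by simp
  show ?thesis
    by (rule that[of T R]) (use R0 degT lcT T R in \<open>simp_all add: R_def\<close>)
qed

section \<open>Square classes along the critical orbit\<close>

lemma l1_norm_1: "l1_norm 1 = 1"
  by (simp add: l1_norm_def)

text \<open>In lowest terms p/q the denominator divides p^2 while being coprime to it. With powers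
  of \<open>a\<close> multiplied in, square roots of S-integers are S-integers.\<close>

lemma rat_square_int:
  assumes "(z::rat) ^ 2 \<in> \<int>"
  shows "z \<in> \<int>"
proof -
  obtain p q where pq: "quotient_of z = (p, q)" by force
  hence q: "q > 0" and z: "z = of_int p / of_int q" and cop: "coprime p q"
    by (auto simp: quotient_of_denom_pos quotient_of_div quotient_of_coprime)
  obtain n where "z ^ 2 = of_int n" using assms by (elim Ints_cases)
  hence "of_int (p ^ 2) = (of_int (n * q ^ 2) :: rat)"
    using q by (simp add: z power_divide field_simps)
  hence "p ^ 2 = n * q ^ 2" by (simp only: of_int_eq_iff)
  hence "q dvd p ^ 2" by (simp add: power2_eq_square)
  moreover have "coprime q (p ^ 2)" using cop by (simp add: ac_simps)
  ultimately have "q dvd 1" by (metis coprime_absorb_left)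
  hence "q = 1" using q by auto
  thus ?thesis by (simp add: z)
qed

lemma poly_iterate_map_poly:
  "poly (poly_iterate n (map_poly rat_of_int f)) y = eval_rat (poly_iterate n f) y"
  and eval_rat_pcompose: "eval_rat (pcompose P Q) y = eval_rat P (eval_rat Q y)"
proof -
  show pc: "eval_rat (pcompose P Q) y = eval_rat P (eval_rat Q y)" for P Q
    by (simp add: of_int_hom.map_poly_pcompose poly_pcompose)
  show "poly (poly_iterate n (map_poly rat_of_int f)) y = eval_rat (poly_iterate n f) y"
    by (induction n) (simp_all add: pc poly_pcompose of_int_hom.map_poly_pCons_hom)
qed

text \<open>The prime p0 is one at which f is dynamically irreducible. What Runge's method draws
  from it are the last two assumptions, together with p0 dividing neither 2 nor the leading
  coefficient.\<close>

locale critical_orbit =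
  fixes f :: "int poly" and a b p0 :: int
  assumes deg: "even (degree f)" "degree f \<ge> 2" and a: "a \<noteq> 0"
    and infinite_orbit: "\<not> pre_periodic (map_poly rat_of_int f) (- rat_of_int b / rat_of_int a)"
    and p0: "prime p0" "\<not> p0 dvd 2" "\<not> p0 dvd lead_coeff f"
    and not_square: "\<And>k M T. k \<ge> 1 \<Longrightarrow> \<not> p0 dvd M \<Longrightarrow> smult (M ^ 2) (f * poly_iterate (Suc k) f) \<noteq> T ^ 2"
    and orbit_nonzero: "\<And>m. m \<ge> 2 \<Longrightarrow> eval_rat (poly_iterate m f) (- rat_of_int b / rat_of_int a) \<noteq> 0"
begin

definition "D = degree f"
definition "h0 = D div 2"
definition "c = lead_coeff f"
definition "F k = poly_iterate k f"
definition "x m = eval_rat (F m) (- rat_of_int b / rat_of_int a)"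
definition "L = max 2 (l1_norm f)"
definition "V = places a"

lemma D: "D \<ge> 2" "D = 2 * h0" "h0 \<ge> 1"
  using deg by (auto simp: D_def h0_def)

lemma L: "L \<ge> 2" "l1_norm f \<le> L"
  by (auto simp: L_def)

lemma c: "c \<noteq> 0" "\<bar>of_int c\<bar> \<le> L"
  using deg L(2) abs_coeff_le_l1_norm[of f "degree f"] by (auto simp: c_def)

lemma f_nz: "f \<noteq> 0" using deg by auto

lemma degF: "degree (F k) = D ^ k"
  by (simp add: F_def D_def degree_poly_iterate)

lemma F_nz: "F k \<noteq> 0"
  using degF[of k] D(1) by (cases "k = 0") (auto simp: F_def)

lemma x_add: "x (m + k) = eval_rat (F k) (x m)"
  unfolding x_def F_def by (metis add.commute poly_iterate_add eval_rat_pcompose)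

lemma x_Suc: "x (Suc m) = eval_rat f (x m)"
  by (simp add: x_def F_def eval_rat_pcompose)

text \<open>The exponent D^k - 1 is the one that is stable under composition with f, because 1 +
  (D^k - 1) D \<le> D^(k+1) - 1.\<close>

lemma l1_norm_F: "l1_norm (F k) \<le> L ^ (D ^ k)"
proof -
  have "l1_norm (F k) \<le> L ^ (D ^ k - 1)"
  proof (induction k)
    case 0
    show ?case by (simp add: F_def l1_norm_1)
  next
    case (Suc k)
    have "l1_norm (F (Suc k)) \<le> l1_norm f * (L ^ (D ^ k - 1)) ^ degree f"
      unfolding F_def poly_iterate.simps using Suc L by (intro l1_norm_pcompose) (auto simp: F_def)
    also have "\<dots> \<le> L * (L ^ (D ^ k - 1)) ^ D"
      unfolding D_def using L by (intro mult_right_mono) auto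
    also have "\<dots> = L ^ Suc ((D ^ k - 1) * D)" by (simp add: power_mult)
    also have "\<dots> \<le> L ^ (D ^ Suc k - 1)"
    proof (rule power_increasing)
      have "D ^ k \<ge> 1" using D by simp
      hence "(D ^ k - 1) * D + D = D ^ Suc k" by (simp add: algebra_simps diff_mult_distrib)
      thus "Suc ((D ^ k - 1) * D) \<le> D ^ Suc k - 1" using D(1) by linarith
    qed (use L in simp)
    finally show ?case .
  qed
  also have "\<dots> \<le> L ^ (D ^ k)" using L by (intro power_increasing) auto
  finally show ?thesis .
qed

lemma lc_F: "\<not> p0 dvd lead_coeff (F k)"
  unfolding F_def using deg(2) by (intro lead_coeff_poly_iterate_not_dvd p0(1,3)) linarith

lemma absval_V: "v \<in> V \<Longrightarrow> absval (place v)"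
  unfolding V_def by (rule absval_place)

lemma finite_V: "finite V"
  unfolding V_def by (rule finite_places)

text \<open>Beyond 4 L^2 the leading term of f dominates, so N/(2L) is at least raised to the power
  D at each step, starting from 2L. The place escapes doubly exponentially.\<close>

lemma growth:
  assumes "absval N" and m: "N (x m) \<ge> 4 * L ^ 2"
  shows "N (x (m + j)) \<ge> 2 ^ (D ^ j)"
proof -
  interpret absval N by fact
  have step: "(N y / (2 * L)) ^ D \<le> N (eval_rat f y) / (2 * L)" if y: "N y \<ge> 4 * L ^ 2" for y
  proof -
    have L0: "L > 0" "4 * L ^ 2 \<ge> 1" using L power_mono[of 2 L 2] by auto
    have y1: "N y \<ge> 1" using y L0 by linarith
    define r where "r = eval_rat f y / (of_int c * y ^ D)"
    have "N (r - 1) \<le> 2 * l1_norm f ^ 2 / N y"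
      unfolding r_def c_def D_def by (rule N_leading_term[OF f_nz y1])
    also have "\<dots> \<le> 2 * L ^ 2 / (4 * L ^ 2)"
      using y L L0 l1_norm_nonneg by (intro frac_le mult_left_mono power_mono) auto
    also have "\<dots> = 1 / 2" using L0 by simp
    finally have "N r \<ge> 1 / 2" using N_lower[of 1 r] N_minus[of "r - 1"] by (simp add: N_1)
    hence "(1 / 2) * (N (of_int c) * N y ^ D) \<le> N r * (N (of_int c) * N y ^ D)"
      by (intro mult_right_mono mult_nonneg_nonneg zero_le_power N_nonneg)
    also have "\<dots> = N (eval_rat f y)"
      using c y1 N_0 by (auto simp: r_def simp flip: N_mult N_power)
    finally have 1: "(1 / 2) * (N (of_int c) * N y ^ D) \<le> N (eval_rat f y)" .
    have "1 / L \<le> 1 / \<bar>of_int c\<bar>" using c L0 by (intro divide_left_mono) auto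
    also have "\<dots> \<le> N (of_int c)" by (rule N_int_ge[OF c(1)])
    finally have "(1 / 2) * ((1 / L) * N y ^ D) \<le> (1 / 2) * (N (of_int c) * N y ^ D)"
      using y1 by (intro mult_left_mono mult_right_mono) auto
    with 1 have "N y ^ D / (2 * L) \<le> N (eval_rat f y)" by simp
    hence 2: "N y ^ D / (2 * L) / (2 * L) \<le> N (eval_rat f y) / (2 * L)" using L0 by (intro divide_right_mono) auto
    have "(2 * L) ^ 2 \<le> (2 * L) ^ D" using L D by (intro power_increasing) auto
    hence "N y ^ D / (2 * L) ^ D \<le> N y ^ D / (2 * L) ^ 2" using y1 L0 by (intro divide_left_mono) auto
    also have "\<dots> = N y ^ D / (2 * L) / (2 * L)" by (simp add: power2_eq_square)
    finally show ?thesis using 2 by (simp add: power_divide)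
  qed
  have L0: "2 * L \<ge> 2" "L > 0" using L by auto
  have "N (x (m + j)) / (2 * L) \<ge> (2 * L) ^ (D ^ j)"
  proof (induction j)
    case 0
    show ?case using m L0 by (simp add: field_simps power2_eq_square)
  next
    case (Suc j)
    have "(2 * L) ^ 1 \<le> (2 * L) ^ (D ^ j)" using L0 D by (intro power_increasing) auto
    hence "2 * L \<le> N (x (m + j)) / (2 * L)" using Suc by simp
    hence "4 * L ^ 2 \<le> N (x (m + j))" using L0 by (simp add: field_simps power2_eq_square)
    from step[OF this] have "(N (x (m + j)) / (2 * L)) ^ D \<le> N (x (m + Suc j)) / (2 * L)"
      by (simp add: x_Suc)
    moreover have "((2 * L) ^ (D ^ j)) ^ D \<le> (N (x (m + j)) / (2 * L)) ^ D"
      using Suc L0 by (intro power_mono) auto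
    moreover have "((2 * L) ^ (D ^ j)) ^ D = (2 * L) ^ (D ^ Suc j)"
      by (metis power_mult power_Suc mult.commute)
    ultimately show ?case by linarith
  qed
  moreover have "N (x (m + j)) / (2 * L) \<le> N (x (m + j)) / 1"
    using L0 N_nonneg by (intro divide_left_mono) auto
  moreover have "(2::real) ^ (D ^ j) \<le> (2 * L) ^ (D ^ j)" using L0 by (intro power_mono) auto
  ultimately show ?thesis by linarith
qed

section \<open>S-integers and the product formula along the orbit\<close>

definition "s_integer y \<longleftrightarrow> (\<exists>j. y * of_int a ^ j \<in> \<int>)" for y :: rat

lemma s_integer_of_int: "s_integer (of_int n)"
  unfolding s_integer_def by (rule exI[of _ 0]) simp

lemma s_integer_add:
  assumes "s_integer y" "s_integer z"
  shows "s_integer (y + z)"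
proof -
  from assms obtain i j where "y * of_int a ^ i \<in> \<int>" "z * of_int a ^ j \<in> \<int>" by (auto simp: s_integer_def)
  hence "y * of_int a ^ i * of_int a ^ j + z * of_int a ^ j * of_int a ^ i \<in> \<int>" by simp
  hence "(y + z) * of_int a ^ (i + j) \<in> \<int>" by (simp add: power_add algebra_simps)
  thus ?thesis by (auto simp: s_integer_def)
qed

lemma s_integer_mult:
  assumes "s_integer y" "s_integer z"
  shows "s_integer (y * z)"
proof -
  from assms obtain i j where "y * of_int a ^ i \<in> \<int>" "z * of_int a ^ j \<in> \<int>" by (auto simp: s_integer_def)
  hence "(y * of_int a ^ i) * (z * of_int a ^ j) \<in> \<int>" by (rule Ints_mult)
  hence "(y * z) * of_int a ^ (i + j) \<in> \<int>" by (simp add: power_add mult_ac)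
  thus ?thesis by (auto simp: s_integer_def)
qed

lemma s_integer_eval: "s_integer y \<Longrightarrow> s_integer (eval_rat P y)"
proof (induction P)
  case 0
  show ?case using s_integer_of_int[of 0] by simp
next
  case (pCons a' P)
  thus ?case using s_integer_add[OF s_integer_of_int s_integer_mult]
    by (simp add: of_int_hom.map_poly_pCons_hom)
qed

lemma s_integer_x: "s_integer (x m)"
proof -
  have "s_integer (- rat_of_int b / rat_of_int a)"
    unfolding s_integer_def using a by (intro exI[of _ 1]) simp
  thus ?thesis unfolding x_def by (rule s_integer_eval)
qed

lemma s_integer_sqrt:
  assumes "s_integer (z ^ 2)"
  shows "s_integer z"
proof -
  from assms obtain j where "z ^ 2 * of_int a ^ j \<in> \<int>" by (auto simp: s_integer_def)
  hence "z ^ 2 * of_int a ^ j * of_int a ^ j \<in> \<int>" by (rule Ints_mult[OF _ Ints_power[OF Ints_of_int]])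
  hence "(z * of_int a ^ j) ^ 2 \<in> \<int>" by (simp add: power2_eq_square mult_ac)
  thus ?thesis using rat_square_int unfolding s_integer_def by blast
qed

text \<open>A power of \<open>a\<close> makes the number an integer and has product 1 over the
  places in \<open>V\<close>. An S-integer that is too small at all places together is therefore
  0.\<close>

lemma prod_place_ge_1:
  assumes "s_integer y" "y \<noteq> 0"
  shows "(\<Prod>v\<in>V. place v y) \<ge> 1"
proof -
  from assms(1) obtain j n where n: "y * of_int a ^ j = of_int n"
    unfolding s_integer_def by (auto elim!: Ints_cases)
  hence n0: "n \<noteq> 0" using assms(2) a by auto
  have "(\<Prod>v\<in>V. place v (of_int n)) = (\<Prod>v\<in>V. place v y * place v (of_int a) ^ j)"
  proof (rule prod.cong[OF refl])
    fix v assume "v \<in> V"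
    then interpret absval "place v" by (rule absval_V)
    show "place v (of_int n) = place v y * place v (of_int a) ^ j"
      unfolding n[symmetric] by (simp only: N_mult N_power)
  qed
  also have "\<dots> = (\<Prod>v\<in>V. place v y) * (\<Prod>v\<in>V. place v (of_int a)) ^ j"
    by (simp only: prod.distrib prod_power_distrib)
  also have "(\<Prod>v\<in>V. place v (of_int a)) = 1" unfolding V_def by (rule prod_places_self[OF a])
  finally show ?thesis using prod_places_ge_1[OF n0, of a] by (simp add: V_def)
qed

text \<open>Northcott: a sequence of \<open>S\<close>-integers that is bounded at every place takes finitely many values.\<close>

lemma escaping_place_exists: "\<exists>v\<in>V. \<exists>m. place v (x m) \<ge> 4 * L ^ 2"
proof (rule ccontr)
  assume "\<not> ?thesis"
  hence small: "place v (x m) < 4 * L ^ 2" if "v \<in> V" for v m using that by (meson not_le)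
  define B where "B = 4 * L ^ 2"
  have B: "B \<ge> 1" unfolding B_def using L power_mono[of 2 L 2] by simp
  define S where "S = prime_factors (nat \<bar>a\<bar>)"
  \<comment> \<open>Bounds the denominator: each exact prime power in it is the absolute value of
    the point at that prime, at most B, and the primes involved lie in S.\<close>
  define X where "X = B ^ card S"
  have X1: "X \<ge> 1" using B by (simp add: X_def)
  have "x m \<in> (\<lambda>(p, q). of_int p / of_int q) ` ({- \<lceil>B * X\<rceil>..\<lceil>B * X\<rceil>} \<times> {0..\<lceil>X\<rceil>})" for m
  proof -
    obtain p q where pq: "quotient_of (x m) = (p, q)" by force
    hence q: "q > 0" and xm: "x m = of_int p / of_int q" and cop: "coprime p q"
      by (auto simp: quotient_of_denom_pos quotient_of_div quotient_of_coprime)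
    obtain j n where "x m * of_int a ^ j = of_int n"
      using s_integer_x[of m] unfolding s_integer_def by (auto elim!: Ints_cases)
    hence "of_int (p * a ^ j) = (of_int (n * q) :: rat)" using q by (simp add: xm field_simps)
    hence "p * a ^ j = n * q" by (simp only: of_int_eq_iff)
    hence "q dvd p * a ^ j" by simp
    hence q_dvd: "q dvd a ^ j" using cop by (simp add: coprime_dvd_mult_right_iff ac_simps)
    have sub: "prime_factors (nat q) \<subseteq> S"
    proof
      fix l assume "l \<in> prime_factors (nat q)"
      hence l: "prime l" "l dvd nat q" by auto
      hence "int l dvd q" using q by (metis int_dvd_int_iff int_nat_eq less_imp_le)
      hence "int l dvd a ^ j" using q_dvd dvd_trans by blast
      hence "int l dvd a" using l(1) prime_dvd_power[of "int l" a j] by simp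
      hence "l dvd nat \<bar>a\<bar>" by simp
      thus "l \<in> S" unfolding S_def using l(1) a by (simp add: in_prime_factors_iff)
    qed
    have "real (nat q) = real (\<Prod>l\<in>prime_factors (nat q). l ^ multiplicity l (nat q))"
      using prod_prime_factors[of "nat q"] q by simp
    also have "\<dots> = (\<Prod>l\<in>prime_factors (nat q). real l ^ multiplicity l (nat q))" by simp
    also have "\<dots> \<le> (\<Prod>l\<in>prime_factors (nat q). B)"
    proof (rule prod_mono, intro conjI)
      fix l assume l: "l \<in> prime_factors (nat q)"
      hence pl: "prime l" "l dvd nat q" by auto
      have lS: "l \<in> S" using l sub by blast
      hence lV: "l \<in> V" unfolding V_def places_def S_def by simp
      interpret absval "place l" by (rule absval_V[OF lV])
      have "\<not> int l dvd p"
      proof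
        assume "int l dvd p"
        moreover have "int l dvd q" using pl(2) q by (metis int_dvd_int_iff int_nat_eq less_imp_le)
        ultimately have "is_unit (int l)" using cop by (meson coprime_common_divisor)
        thus False using prime_gt_1_nat[OF pl(1)] by simp
      qed
      hence "\<not> l dvd nat \<bar>p\<bar>" by simp
      moreover have p0': "p \<noteq> 0" using \<open>\<not> int l dvd p\<close> by auto
      ultimately have "place l (of_int p) = 1"
        using lS place_of_int[of l a p] unfolding S_def by (simp add: not_dvd_imp_multiplicity_0)
      moreover have "place l (of_int q) = 1 / real (l ^ multiplicity l (nat q))"
        using lS place_of_int[of l a q] q unfolding S_def by simp
      ultimately have "place l (x m) = real l ^ multiplicity l (nat q)"
        unfolding xm N_divide by simp
      thus "real l ^ multiplicity l (nat q) \<le> B" using small[OF lV, of m] by (simp add: B_def)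
    qed simp
    also have "\<dots> = B ^ card (prime_factors (nat q))" by simp
    also have "\<dots> \<le> X" unfolding X_def using B sub by (intro power_increasing card_mono) (auto simp: S_def)
    finally have qX: "of_int q \<le> X" using q by simp
    have "\<bar>of_rat (x m)\<bar> < B" using small[of 0 m] by (simp add: V_def places_def place_def B_def)
    hence "\<bar>of_int p\<bar> / of_int q < B" using q unfolding xm of_rat_divide by (simp add: of_rat_of_int_eq)
    hence "\<bar>of_int p\<bar> < B * of_int q" using q by (simp add: divide_less_eq)
    also have "\<dots> \<le> B * X" using qX B by (intro mult_left_mono) auto
    finally have pX: "\<bar>of_int p\<bar> \<le> B * X" by simp
    have "q \<le> \<lceil>X\<rceil>" using qX by linarith
    moreover have "p \<le> \<lceil>B * X\<rceil>" "- \<lceil>B * X\<rceil> \<le> p" using pX by linarith+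
    ultimately show ?thesis using q xm by (intro image_eqI[of _ _ "(p, q)"]) auto
  qed
  hence "finite {x m | m. True}"
    by (rule_tac finite_subset[of _ "(\<lambda>(p, q). of_int p / of_int q) ` ({- \<lceil>B * X\<rceil>..\<lceil>B * X\<rceil>} \<times> {0..\<lceil>X\<rceil>})"]) auto
  hence "pre_periodic (map_poly rat_of_int f) (- rat_of_int b / rat_of_int a)"
    unfolding pre_periodic_def poly_iterate_map_poly x_def F_def .
  thus False using infinite_orbit by simp
qed

end

section \<open>Runge's method for pairs of orbit points\<close>

context critical_orbit
begin

lemma L_mono: "i \<le> j \<Longrightarrow> L ^ i \<le> L ^ j"
  using L by (intro power_increasing) auto

lemma L_pos: "L > 0" using L by simp

lemma eval_pieces:
  "eval_rat (smult s P) y = of_int s * eval_rat P y"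
  "eval_rat (P * P') y = eval_rat P y * eval_rat P' y"
  "eval_rat (P + P') y = eval_rat P y + eval_rat P' y"
  "eval_rat (P ^ n) y = eval_rat P y ^ n"
  "eval_rat (monom 1 n) y = y ^ n"
proof -
  show "eval_rat (P ^ n) y = eval_rat P y ^ n" by (induction n) (simp_all add: hom_distribs)
  show "eval_rat (monom 1 n) y = y ^ n" by (induction n) (simp_all add: monom_0 monom_Suc of_int_hom.map_poly_pCons_hom)
qed (simp_all add: hom_distribs)

text \<open>The sum is close to 2, whose absolute value may be as small as 1/2 when the place is
  2-adic; hence only 1/4.\<close>

lemma close_product:
  assumes "absval N" "N (\<omega> - 1) \<le> 1 / 16" "N (s - 1) \<le> 1 / 16" "N (t - 1) \<le> 1 / 16"
  shows "N (\<omega> * s + t) \<ge> 1 / 4"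
proof -
  interpret absval N by fact
  have "N \<omega> \<le> 1 + 1 / 16" using N_add[of 1 "\<omega> - 1"] assms(2) by (simp add: N_1)
  hence "N \<omega> * N (s - 1) \<le> (1 + 1 / 16) * (1 / 16)" using assms(3) N_nonneg by (intro mult_mono) auto
  hence "N (\<omega> * (s - 1)) \<le> (1 + 1 / 16) * (1 / 16)" by (simp only: N_mult)
  moreover have "N (\<omega> * (s - 1) + (\<omega> - 1)) \<le> N (\<omega> * (s - 1)) + N (\<omega> - 1)" by (rule N_add)
  moreover have "N (\<omega> * (s - 1) + (\<omega> - 1) + (t - 1)) \<le> N (\<omega> * (s - 1) + (\<omega> - 1)) + N (t - 1)" by (rule N_add)
  moreover have "N (\<omega> * (s - 1) + (\<omega> - 1) + (t - 1)) = N (\<omega> * s + t - 2)"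
    by (rule arg_cong[where f = N]) (simp add: algebra_simps)
  ultimately have "N (\<omega> * s + t - 2) \<le> (1 + 1 / 16) * (1 / 16) + 1 / 16 + 1 / 16" using assms by linarith
  moreover have "N (2 - (\<omega> * s + t)) = N (\<omega> * s + t - 2)" using N_minus[of "\<omega> * s + t - 2"] by simp
  ultimately show ?thesis using N_lower[of 2 "\<omega> * s + t"] N_2 by simp
qed

text \<open>Runge's method. With \<open>H = f * F (k + 1)\<close> one has \<open>z\<^sup>2 = H (x m)\<close>, and \<open>z\<close> is close to the polynomial
  part of \<open>sqrt H\<close> at every escaping place. Their difference is an \<open>S\<close>-integer that is too small to
  satisfy the product formula.\<close>

lemma no_square_pair:
  fixes k m :: nat and z :: rat
  assumes k: "k \<ge> 1" and z2: "z ^ 2 = x (Suc m) * x (Suc (m + k))"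
    and E: "E \<subseteq> V" "v0 \<in> E"
    and big: "\<And>v. v \<in> E \<Longrightarrow> place v (x m) > L ^ (60 * (D ^ Suc k) ^ 2 * (card V + 1))"
    and small: "\<And>v n. v \<in> V - E \<Longrightarrow> place v (x n) < 4 * L ^ 2"
    and close: "\<And>v. v \<in> E \<Longrightarrow> place v (z / (of_int c * x m ^ h0 * x (m + k) ^ h0) - 1) \<le> 1 / 16"
  shows False
proof -
  \<comment> \<open>w is the degree of the larger iterate. H has degree 2h with h \<le> w, so all
    sizes below are powers of L with exponents of order W = w^2.\<close>
  define w where "w = D ^ Suc k"
  define W where "W = w ^ 2"
  define h where "h = h0 * (1 + D ^ k)"
  define e0 where "e0 = c * lead_coeff (F k) ^ h0"
  define G where "G = smult c (monom 1 h0 * F k ^ h0)"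
  define H where "H = f * F (Suc k)"
  \<comment> \<open>K dominates h, 2 e0 and the coefficients of H. Its powers in the square-root
    lemma become L^(5W) for T and L^(11W) for R.\<close>
  define K where "K = L ^ (2 * w)"
  define M where "M = (2 * e0) ^ (2 * h)"
  define \<omega> where "\<omega> = z / (of_int c * x m ^ h0 * x (m + k) ^ h0)"
  have "D ^ 2 \<le> w" unfolding w_def using D k by (intro power_increasing) auto
  moreover have "2 ^ 2 \<le> D ^ 2" using D by (intro power_mono) auto
  ultimately have w4: "w \<ge> 4" by simp
  hence W: "4 * w \<le> W" "W \<ge> 16" unfolding W_def power2_eq_square using mult_mono[of 4 w 4 w] by auto
  have Dk: "D ^ k \<ge> 1" using D by simp
  have w_eq: "w = 2 * (h0 * D ^ k)" using D(2) by (simp add: w_def)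
  have hw: "h \<le> w" using Dk unfolding h_def w_eq by simp
  have h1: "h \<ge> 1" using D(3) by (simp add: h_def)
  have wh: "w * h \<le> W" using hw by (simp add: W_def power2_eq_square)
  have lcFk: "lead_coeff (F (Suc k)) = c * lead_coeff (F k) ^ D"
    unfolding F_def c_def D_def using deg by (intro lead_coeff_poly_iterate_Suc) simp
  have e0nz: "e0 \<noteq> 0" using c F_nz by (simp add: e0_def)
  have degH: "degree H = 2 * h"
  proof -
    have "degree H = degree f + degree (F (Suc k))" unfolding H_def by (rule degree_mult_eq[OF f_nz F_nz])
    also have "\<dots> = D + D * D ^ k" by (simp only: degF D_def power_Suc)
    also have "\<dots> = 2 * h" unfolding h_def by (subst (1 2) D(2)) (simp add: algebra_simps)
    finally show ?thesis .
  qed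
  have lcH: "coeff H (2 * h) = e0 ^ 2"
  proof -
    have "lead_coeff H = c * (c * lead_coeff (F k) ^ D)" unfolding H_def by (simp only: lead_coeff_mult lcFk c_def)
    also have "\<dots> = e0 ^ 2" unfolding e0_def D(2) by (simp add: power2_eq_square mult_ac flip: power_add mult_2)
    finally show ?thesis using degH by simp
  qed
  have l1Fk: "l1_norm (F k ^ h0) \<le> L ^ (h0 * D ^ k)"
  proof -
    have "l1_norm (F k ^ h0) \<le> l1_norm (F k) ^ h0" by (rule l1_norm_power)
    also have "\<dots> \<le> (L ^ (D ^ k)) ^ h0" using l1_norm_F l1_norm_nonneg by (intro power_mono)
    also have "\<dots> = L ^ (h0 * D ^ k)" by (metis power_mult mult.commute)
    finally show ?thesis .
  qed
  have l1G: "l1_norm G \<le> L ^ w"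
  proof -
    have "l1_norm G \<le> \<bar>of_int c\<bar> * (l1_norm (monom 1 h0 :: int poly) * l1_norm (F k ^ h0))"
      unfolding G_def l1_norm_smult by (intro mult_left_mono l1_norm_mult) auto
    also have "\<dots> \<le> L * (1 * L ^ (h0 * D ^ k))"
      using c l1Fk l1_norm_nonneg L_pos by (intro mult_mono) (auto simp: l1_norm_monom)
    also have "\<dots> = L ^ Suc (h0 * D ^ k)" by simp
    also have "\<dots> \<le> L ^ w" using w4 unfolding w_eq by (intro L_mono) linarith
    finally show ?thesis .
  qed
  have GF: "degree G = h" "lead_coeff G = e0"
  proof -
    have "degree (monom (1::int) h0 * F k ^ h0) = h"
      by (subst degree_mult_eq) (use F_nz in \<open>auto simp: degree_monom_eq degree_power_eq degF h_def\<close>)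
    thus "degree G = h" using c by (simp add: G_def)
    show "lead_coeff G = e0" unfolding G_def e0_def
      by (simp only: lead_coeff_smult lead_coeff_mult lead_coeff_power lead_coeff_monom mult_1_left)
  qed
  have G_nz: "G \<noteq> 0" using GF e0nz by auto
  have e0_le: "\<bar>of_int e0\<bar> \<le> L ^ (h0 * D ^ k + 1)"
  proof -
    have "\<bar>of_int (lead_coeff (F k)) :: real\<bar> \<le> L ^ (D ^ k)"
      using abs_coeff_le_l1_norm l1_norm_F by (rule order_trans)
    hence "\<bar>of_int (lead_coeff (F k)) :: real\<bar> ^ h0 \<le> (L ^ (D ^ k)) ^ h0" by (intro power_mono) auto
    also have "\<dots> = L ^ (h0 * D ^ k)" by (metis power_mult mult.commute)
    finally have "\<bar>of_int c\<bar> * \<bar>of_int (lead_coeff (F k)) :: real\<bar> ^ h0 \<le> L * L ^ (h0 * D ^ k)"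
      using c L_pos by (intro mult_mono) auto
    thus ?thesis by (simp add: e0_def abs_mult power_abs)
  qed
  have e0_2: "\<bar>of_int (2 * e0) :: real\<bar> \<le> L ^ w"
  proof -
    have "\<bar>of_int (2 * e0) :: real\<bar> \<le> L * L ^ (h0 * D ^ k + 1)"
      using e0_le L mult_mono[of 2 L "\<bar>of_int e0\<bar>" "L ^ (h0 * D ^ k + 1)"] by (simp add: abs_mult)
    also have "\<dots> = L ^ (h0 * D ^ k + 2)" by (simp add: power_add power2_eq_square)
    also have "\<dots> \<le> L ^ w" using w4 unfolding w_eq by (intro L_mono) linarith
    finally show ?thesis .
  qed
  have Kbound: "real h + 1 + max \<bar>of_int (2 * e0)\<bar> (l1_norm H) \<le> K"
  proof -
    have "w < 2 ^ w" by (rule less_exp)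
    hence "w + 1 \<le> 2 ^ w" by linarith
    hence "real (w + 1) \<le> real (2 ^ w)" by (rule of_nat_mono)
    hence "real w + 1 \<le> 2 ^ w" by simp
    also have "(2::real) ^ w \<le> L ^ w" using L by (intro power_mono) auto
    also have "L ^ w \<le> L ^ (w + 1)" by (rule L_mono) simp
    finally have 1: "real h + 1 \<le> L ^ (w + 1)" using hw by simp
    have "l1_norm H \<le> l1_norm f * l1_norm (F (Suc k))" unfolding H_def by (rule l1_norm_mult)
    also have "\<dots> \<le> L * L ^ w" unfolding w_def
      by (rule mult_mono[OF L(2) l1_norm_F _ l1_norm_nonneg]) (use L_pos in simp)
    finally have "l1_norm H \<le> L ^ (w + 1)" by simp
    moreover have "\<bar>of_int (2 * e0) :: real\<bar> \<le> L ^ (w + 1)" using e0_2 L_mono[of w "w + 1"] by linarith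
    ultimately have "real h + 1 + max \<bar>of_int (2 * e0)\<bar> (l1_norm H) \<le> 2 * L ^ (w + 1)" using 1 by linarith
    also have "\<dots> \<le> L * L ^ (w + 1)" using L by (intro mult_right_mono) auto
    also have "\<dots> = L ^ (w + 2)" by simp
    also have "\<dots> \<le> K" unfolding K_def using w4 by (intro L_mono) linarith
    finally show ?thesis .
  qed
  obtain T R where TR: "smult (M ^ 2) H = T ^ 2 + R" "\<And>i. i \<ge> h \<Longrightarrow> coeff R i = 0"
    "degree T = h" "lead_coeff T = M * e0" and T_le0: "l1_norm T \<le> K ^ (2 * h + 2)"
    and R_le0: "l1_norm R \<le> K ^ (4 * h + 5)"
    using polynomial_square_root[OF eq_imp_le[OF degH] lcH e0nz Kbound] unfolding M_def by blast
  have T_le: "l1_norm T \<le> L ^ (5 * W)"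
  proof -
    have "K ^ (2 * h + 2) = L ^ (2 * w * (2 * h + 2))" by (simp only: K_def power_mult)
    also have "\<dots> \<le> L ^ (5 * W)" using wh W by (intro L_mono) (simp add: algebra_simps)
    finally show ?thesis using T_le0 by linarith
  qed
  have R_le: "l1_norm R \<le> L ^ (11 * W)"
  proof -
    have "K ^ (4 * h + 5) = L ^ (2 * w * (4 * h + 5))" by (simp only: K_def power_mult)
    also have "\<dots> \<le> L ^ (11 * W)" using wh W by (intro L_mono) (simp add: algebra_simps)
    finally show ?thesis using R_le0 by linarith
  qed
  have M_nz: "M \<noteq> 0" using e0nz by (simp add: M_def)
  have M_le: "\<bar>of_int M :: real\<bar> \<le> L ^ (2 * W)"
  proof -
    have "\<bar>of_int M :: real\<bar> = \<bar>of_int (2 * e0)\<bar> ^ (2 * h)" by (simp only: M_def of_int_power power_abs)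
    also have "\<dots> \<le> (L ^ w) ^ (2 * h)" using e0_2 by (intro power_mono) auto
    also have "\<dots> = L ^ (w * (2 * h))" by (simp only: power_mult)
    also have "\<dots> \<le> L ^ (2 * W)" using wh by (intro L_mono) simp
    finally show ?thesis .
  qed
  have Me_le: "\<bar>of_int (M * e0) :: real\<bar> \<le> L ^ (3 * W)"
  proof -
    have "\<bar>of_int e0 :: real\<bar> \<le> \<bar>of_int (2 * e0)\<bar>" by simp
    also have "\<dots> \<le> L ^ w" by (rule e0_2)
    also have "\<dots> \<le> L ^ W" using W by (intro L_mono) linarith
    finally have "\<bar>of_int M\<bar> * \<bar>of_int e0\<bar> \<le> L ^ (2 * W) * L ^ W"
      using M_le L_pos by (intro mult_mono) auto
    thus ?thesis by (simp add: abs_mult flip: power_add)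
  qed
  \<comment> \<open>M is a power of twice a product of leading coefficients of iterates, all prime
    to p0; this is what makes the nonsquare assumption applicable and R nonzero.\<close>
  have "\<not> p0 dvd M" unfolding M_def e0_def c_def using p0 lc_F[of k]
    by (meson prime_dvd_mult_iff prime_dvd_power)
  hence R_nz: "R \<noteq> 0" using not_square[OF k, of M T] TR(1) by (auto simp: H_def F_def)
  have degR: "degree R \<le> h - 1"
    using TR(2) by (intro degree_le) auto
  \<comment> \<open>The factors of M^2 z^2 - T^2 at the orbit point; their product is R there, and y
    is the S-integer to be squeezed.\<close>
  define y where "y = of_int M * z - eval_rat T (x m)"
  define y' where "y' = of_int M * z + eval_rat T (x m)"
  have zH: "z ^ 2 = eval_rat H (x m)"
  proof -
    have "eval_rat H (x m) = eval_rat f (x m) * eval_rat (F (Suc k)) (x m)" unfolding H_def by (rule eval_pieces)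
    also have "\<dots> = x (Suc m) * x (m + Suc k)" by (simp only: x_Suc x_add)
    finally show ?thesis using z2 by simp
  qed
  have "eval_rat (smult (M ^ 2) H) (x m) = eval_rat (T ^ 2 + R) (x m)" by (simp only: TR(1))
  hence "of_int (M ^ 2) * z ^ 2 = eval_rat T (x m) ^ 2 + eval_rat R (x m)"
    by (simp only: eval_pieces zH)
  hence yy: "y * y' = eval_rat R (x m)"
    by (simp add: y_def y'_def power2_eq_square algebra_simps)
  have big': "place v (x m) > L ^ (60 * W * (card V + 1))" if "v \<in> E" for v
    using big[OF that] by (simp add: W_def w_def)
  have big1: "place v (x m) > L ^ (60 * W)" if "v \<in> E" for v
    using big'[OF that] L_mono[of "60 * W" "60 * W * (card V + 1)"] by simp
  have L1: "L ^ i \<ge> 1" for i using L by (intro one_le_power) auto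
  have leading: "2 * l1_norm P ^ 2 / place v (x m) \<le> 1 / 16" if "v \<in> E" "l1_norm P \<le> L ^ (11 * W)" for v P
  proof -
    have X: "place v (x m) > L ^ (60 * W)" "place v (x m) > 0" using big1[OF that(1)] L1[of "60 * W"] by auto
    have "l1_norm P ^ 2 \<le> (L ^ (11 * W)) ^ 2" using that l1_norm_nonneg by (intro power_mono)
    also have "\<dots> = L ^ (22 * W)" by (simp flip: power_mult)
    finally have "32 * l1_norm P ^ 2 \<le> L ^ 5 * L ^ (22 * W)"
      using L power_mono[of 2 L 5] L_pos by (intro mult_mono) auto
    also have "\<dots> = L ^ (5 + 22 * W)" by (simp only: power_add)
    also have "\<dots> \<le> L ^ (60 * W)" using W by (intro L_mono) linarith
    finally have "32 * l1_norm P ^ 2 \<le> place v (x m)" using X by linarith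
    thus ?thesis using X by (simp add: divide_le_eq)
  qed
  have R_x: "eval_rat R (x m) \<noteq> 0"
  proof
    assume 0: "eval_rat R (x m) = 0"
    have "v0 \<in> V" using E by blast
    then interpret absval "place v0" by (rule absval_V)
    have "place v0 (x m) \<ge> 1" using big1[OF E(2)] L1[of "60 * W"] by linarith
    from N_leading_term[OF R_nz this] have "1 \<le> 2 * l1_norm R ^ 2 / place v0 (x m)"
      unfolding 0 by (simp add: N_minus_1)
    with leading[OF E(2) R_le] show False by simp
  qed
  hence y_nz: "y \<noteq> 0" using yy by auto
  have "s_integer (z ^ 2)" unfolding z2 by (rule s_integer_mult[OF s_integer_x s_integer_x])
  hence "s_integer z" by (rule s_integer_sqrt)
  hence "s_integer (of_int M * z + of_int (- 1) * eval_rat T (x m))"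
    by (intro s_integer_add s_integer_mult s_integer_of_int s_integer_eval s_integer_x)
  hence sy: "s_integer y" by (simp add: y_def)
  define U where "U = L ^ (16 * W)"
  \<comment> \<open>At an escaping place both summands of y' have nearly the same leading term, so
    y' has order X^h while R has order at most X^(h-1). Dividing makes y as small as U/X.\<close>
  have on_E: "place v y \<le> U / place v (x m)" if v: "v \<in> E" for v
  proof -
    have "v \<in> V" using E v by blast
    then interpret absval "place v" by (rule absval_V)
    define X where "X = place v (x m)"
    have X1: "X \<ge> 1" using big1[OF v] L1[of "60 * W"] by (simp add: X_def)
    have x_nz: "x m \<noteq> 0" using X1 N_0 by (auto simp: X_def)
    have xk_nz: "\<omega> \<noteq> 0"
    proof
      assume "\<omega> = 0"
      hence "place v (0 - 1) \<le> 1 / 16" using close[OF v] unfolding \<omega>_def[symmetric] by simp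
      thus False by (simp add: N_minus_1)
    qed
    have T_nz: "T \<noteq> 0" using TR(4) M_nz e0nz by auto
    have tG: "place v (eval_rat G (x m) / (of_int e0 * x m ^ h) - 1) \<le> 1 / 16"
      using N_leading_term[OF G_nz, of "x m"] X1 leading[OF v, of G] l1G L_mono[of w "11 * W"] W
      unfolding GF(2) unfolding GF(1) X_def by linarith
    have tT: "place v (eval_rat T (x m) / (of_int (M * e0) * x m ^ h) - 1) \<le> 1 / 16"
      using N_leading_term[OF T_nz, of "x m"] X1 leading[OF v, of T] T_le L_mono[of "5 * W" "11 * W"]
      unfolding TR(4) unfolding TR(3) X_def by linarith
    have "eval_rat G (x m) = of_int c * x m ^ h0 * x (m + k) ^ h0"
      unfolding G_def by (simp only: eval_pieces x_add mult.assoc)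
    hence zG: "z = \<omega> * eval_rat G (x m)" using xk_nz by (auto simp: \<omega>_def)
    have y'_eq: "y' = of_int (M * e0) * x m ^ h * (\<omega> * (eval_rat G (x m) / (of_int e0 * x m ^ h)) + eval_rat T (x m) / (of_int (M * e0) * x m ^ h))"
      unfolding y'_def zG using x_nz e0nz M_nz by (simp add: algebra_simps)
    have "place v (\<omega> - 1) \<le> 1 / 16" using close[OF v] by (simp add: \<omega>_def)
    from close_product[OF absval_axioms this tG tT]
    have "place v (of_int (M * e0)) * X ^ h * (1 / 4) \<le> place v y'"
      unfolding y'_eq N_mult[of "of_int (M * e0) * x m ^ h"] N_mult[of "of_int (M * e0)"] N_power X_def
      using N_nonneg by (intro mult_left_mono mult_nonneg_nonneg zero_le_power) auto
    moreover have "1 / L ^ (3 * W) \<le> place v (of_int (M * e0))"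
    proof -
      have "M * e0 \<noteq> 0" using M_nz e0nz by simp
      hence "1 / L ^ (3 * W) \<le> 1 / \<bar>of_int (M * e0)\<bar>" using Me_le L_pos by (intro divide_left_mono) auto
      also have "\<dots> \<le> place v (of_int (M * e0))" by (rule N_int_ge) fact
      finally show ?thesis .
    qed
    hence "1 / L ^ (3 * W) * X ^ h * (1 / 4) \<le> place v (of_int (M * e0)) * X ^ h * (1 / 4)"
      using X1 by (intro mult_right_mono) auto
    ultimately have y'_ge: "1 / L ^ (3 * W) * X ^ h * (1 / 4) \<le> place v y'" by linarith
    have "place v y * place v y' = place v (eval_rat R (x m))" by (simp only: yy flip: N_mult)
    also have "\<dots> \<le> l1_norm R * X ^ (h - 1)"
      using X1 degR by (intro N_eval_le) (auto simp: X_def)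
    also have "\<dots> \<le> L ^ (11 * W) * X ^ (h - 1)" using R_le X1 by (intro mult_right_mono) auto
    finally have "place v y * place v y' \<le> L ^ (11 * W) * X ^ (h - 1)" .
    moreover have "place v y * (1 / L ^ (3 * W) * X ^ h * (1 / 4)) \<le> place v y * place v y'"
      using y'_ge N_nonneg by (intro mult_left_mono)
    ultimately have "place v y * (1 / L ^ (3 * W) * X ^ h * (1 / 4)) \<le> L ^ (11 * W) * X ^ (h - 1)" by linarith
    moreover have "X ^ h = X * X ^ (h - 1)" using h1 by (simp flip: power_Suc)
    ultimately have *: "place v y * (1 / L ^ (3 * W) * (X * X ^ (h - 1)) * (1 / 4)) \<le> L ^ (11 * W) * X ^ (h - 1)" by simp
    have "L ^ (3 * W) > 0" using L_pos by simp
    hence "(place v y * X) * X ^ (h - 1) = (4 * L ^ (3 * W)) * (place v y * (1 / L ^ (3 * W) * (X * X ^ (h - 1)) * (1 / 4)))"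
      using L_pos by simp
    also have "\<dots> \<le> (4 * L ^ (3 * W)) * (L ^ (11 * W) * X ^ (h - 1))"
      using L_pos by (intro mult_left_mono[OF *]) simp
    finally have "(place v y * X) * X ^ (h - 1) \<le> (4 * L ^ (3 * W) * L ^ (11 * W)) * X ^ (h - 1)"
      by (simp only: mult.assoc)
    moreover have "X ^ (h - 1) > 0" using X1 by simp
    ultimately have "place v y * X \<le> 4 * L ^ (3 * W) * L ^ (11 * W)" by (rule mult_right_le_imp_le)
    also have "\<dots> \<le> L ^ 2 * L ^ (3 * W) * L ^ (11 * W)"
      using power_mono[of 2 L 2] L by (intro mult_right_mono) auto
    also have "\<dots> = L ^ (2 + 3 * W + 11 * W)" by (simp only: power_add)
    also have "\<dots> \<le> U" unfolding U_def using W by (intro L_mono) linarith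
    finally show ?thesis using X1 by (simp add: X_def pos_le_divide_eq)
  qed
  \<comment> \<open>At the remaining places the whole orbit is bounded, so y is at most U without
    any cancellation.\<close>
  have off_E: "place v y \<le> U" if v: "v \<in> V - E" for v
  proof -
    have "v \<in> V" using v by blast
    then interpret absval "place v" by (rule absval_V)
    have B: "place v (x n) \<le> L ^ 4" for n
    proof -
      have "place v (x n) \<le> 2 ^ 2 * L ^ 2" using small[OF v, of n] by simp
      also have "\<dots> \<le> L ^ 2 * L ^ 2" using L power_mono[of 2 L 2] by (intro mult_right_mono) auto
      also have "\<dots> = L ^ 4" by (simp flip: power_add)
      finally show ?thesis .
    qed
    have "place v z ^ 2 = place v (x (Suc m)) * place v (x (Suc (m + k)))"
      by (simp only: z2 flip: N_mult N_power)
    also have "\<dots> \<le> L ^ 4 * L ^ 4" using B N_nonneg L_pos by (intro mult_mono) auto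
    also have "\<dots> = (L ^ 4) ^ 2" by (simp flip: power_add power_mult)
    finally have "place v z \<le> L ^ 4" using L_pos by (intro power2_le_imp_le[of "place v z"]) auto
    moreover have "place v (of_int M) \<le> L ^ (2 * W)" using N_int_le[of M] M_le by linarith
    ultimately have "place v (of_int M * z) \<le> L ^ (2 * W) * L ^ 4"
      unfolding N_mult using N_nonneg L_pos by (intro mult_mono) auto
    also have "\<dots> = L ^ (2 * W + 4)" by (simp only: power_add)
    also have "\<dots> \<le> L ^ (6 * W)" using W by (intro L_mono) linarith
    finally have 1: "place v (of_int M * z) \<le> L ^ (6 * W)" .
    have "place v (eval_rat T (x m)) \<le> l1_norm T * (L ^ 4) ^ h"
      using B TR(3) L1 by (intro N_eval_le) auto
    also have "\<dots> \<le> L ^ (5 * W) * (L ^ 4) ^ h" using T_le L_pos by (intro mult_right_mono) auto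
    also have "\<dots> = L ^ (5 * W + 4 * h)" by (simp only: power_add power_mult)
    also have "\<dots> \<le> L ^ (6 * W)" using W hw by (intro L_mono) linarith
    finally have "place v y \<le> 2 * L ^ (6 * W)"
      using 1 N_diff[of "of_int M * z" "eval_rat T (x m)"] unfolding y_def by linarith
    also have "\<dots> \<le> L * L ^ (6 * W)" using L by (intro mult_right_mono) auto
    also have "\<dots> = L ^ (6 * W + 1)" by simp
    also have "\<dots> \<le> U" unfolding U_def using W by (intro L_mono) linarith
    finally show ?thesis .
  qed
  have U1: "U \<ge> 1" unfolding U_def by (rule L1)
  have all: "place v y \<le> U \<and> 0 \<le> place v y" if v: "v \<in> V" for v
  proof
    interpret absval "place v" using v by (rule absval_V)
    show "0 \<le> place v y" by (rule N_nonneg)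
    show "place v y \<le> U"
    proof (cases "v \<in> E")
      case True
      have "place v (x m) \<ge> 1" using big1[OF True] L1[of "60 * W"] by linarith
      hence "U / place v (x m) \<le> U / 1" using U1 by (intro divide_left_mono) auto
      thus ?thesis using on_E[OF True] by simp
    qed (use off_E v in blast)
  qed
  have v0V: "v0 \<in> V" using E by blast
  have X0: "place v0 (x m) > 0" using big1[OF E(2)] L1[of "60 * W"] by linarith
  \<comment> \<open>One escaping place contributes U/X and every other place at most U, so the
    product formula bounds X by a power of U, against the assumed size.\<close>
  have "1 \<le> (\<Prod>v\<in>V. place v y)" by (rule prod_place_ge_1[OF sy y_nz])
  also have "\<dots> = place v0 y * (\<Prod>v\<in>V - {v0}. place v y)"
    by (rule prod.remove[OF finite_V v0V])
  also have "\<dots> \<le> (U / place v0 (x m)) * (\<Prod>v\<in>V - {v0}. U)"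
    using all on_E[OF E(2)] U1 X0 by (intro mult_mono prod_mono prod_nonneg) auto
  also have "\<dots> \<le> (U / place v0 (x m)) * U ^ card V"
    using U1 X0 finite_V v0V by (intro mult_left_mono) (auto simp: prod_constant intro!: power_increasing card_mono)
  also have "\<dots> = U ^ (card V + 1) / place v0 (x m)" by simp
  finally have "place v0 (x m) \<le> U ^ (card V + 1)" using X0 by (simp add: le_divide_eq)
  also have "\<dots> = L ^ (16 * W * (card V + 1))" by (simp only: U_def power_mult)
  also have "\<dots> \<le> L ^ (60 * W * (card V + 1))" by (intro L_mono mult_right_mono) auto
  finally show False using big'[OF E(2)] by simp
qed

end

section \<open>Signs of square roots at the escaping places\<close>

context absval
begin

lemma N_add_one: "N (w - 1) \<le> e \<Longrightarrow> N w \<le> 1 + e"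
  using N_add[of 1 "w - 1"] by (simp add: N_1)

lemma N_product_close:
  assumes "N (s - 1) \<le> d" "N (t - 1) \<le> e" "d \<ge> 0" "e \<ge> 0"
  shows "N (s * t - 1) \<le> d + e + d * e"
proof -
  have "N (s * t - 1) = N (s * (t - 1) + (s - 1))" by (simp add: algebra_simps)
  also have "\<dots> \<le> N (s * (t - 1)) + N (s - 1)" by (rule N_add)
  also have "N (s * (t - 1)) \<le> (1 + d) * e"
    unfolding N_mult using N_add_one[OF assms(1)] assms N_nonneg by (intro mult_mono) auto
  finally show ?thesis using assms(1) by (simp add: algebra_simps)
qed

text \<open>(w - 1)(w + 1) is within about 2/10000 of 0, less than 1/2500, so both factors cannot
  exceed 1/50.\<close>

lemma square_root_sign:
  assumes "N (s - 1) \<le> 1 / 10000" "N (t - 1) \<le> 1 / 10000" "w ^ 2 = s * t"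
  shows "N (w - 1) \<le> 1 / 50 \<or> N (w + 1) \<le> 1 / 50"
proof (rule ccontr)
  assume "\<not> ?thesis"
  hence "(1 / 50) * (1 / 50) \<le> N (w - 1) * N (w + 1)" by (intro mult_mono) auto
  also have "\<dots> = N (s * t - 1)"
    unfolding N_mult[symmetric] assms(3)[symmetric] by (simp add: power2_eq_square algebra_simps)
  also have "\<dots> \<le> 1 / 10000 + 1 / 10000 + 1 / 10000 * (1 / 10000)"
    using assms by (intro N_product_close) auto
  finally show False by simp
qed

lemma same_sign_quotient:
  assumes "N (s - 1) \<le> 1 / 10000"
    and "N (w - 1) \<le> 1 / 50 \<and> N (w' - 1) \<le> 1 / 50 \<or> N (w + 1) \<le> 1 / 50 \<and> N (w' + 1) \<le> 1 / 50"
  shows "N (w * w' / s - 1) \<le> 1 / 16"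
proof -
  have neg: "N (- y - 1) = N (y + 1)" for y using N_minus[of "y + 1"] by simp
  have p: "N (w * w' - 1) \<le> 1 / 50 + 1 / 50 + 1 / 50 * (1 / 50)"
  proof (cases "N (w - 1) \<le> 1 / 50 \<and> N (w' - 1) \<le> 1 / 50")
    case True
    thus ?thesis by (intro N_product_close) auto
  next
    case False
    hence "N ((- w) * (- w') - 1) \<le> 1 / 50 + 1 / 50 + 1 / 50 * (1 / 50)"
      using assms(2) by (intro N_product_close) (auto simp: neg)
    thus ?thesis by simp
  qed
  have s: "N s \<ge> 1 - 1 / 10000" using N_lower[of 1 s] N_minus[of "s - 1"] assms(1) by (simp add: N_1)
  hence s0: "s \<noteq> 0" using N_0 by auto
  have "N (w * w' / s - 1) = N (w * w' - s) / N s"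
    using s0 by (simp add: diff_divide_distrib flip: N_divide)
  also have "N (w * w' - s) \<le> N (w * w' - 1) + N (s - 1)"
    using N_diff[of "w * w' - 1" "s - 1"] by simp
  hence "N (w * w' - s) / N s \<le> (1 / 20) / (1 - 1 / 10000)"
    using p s assms(1) N_nonneg by (intro frac_le) auto
  finally show ?thesis by simp
qed

end

context critical_orbit
begin

text \<open>Each partner n of m carries a sign at every escaping place, namely whether the root
  divided by its expected leading term is near 1 or -1. Two partners with the same signs yield a
  root for their own pair with sign +1 everywhere, which Runge's method forbids. Hence there are at
  most as many partners as sign patterns.\<close>

lemma few_square_partners:
  "\<exists>N0. \<forall>N\<ge>N0. \<forall>m. N - N div 4 < m \<and> m \<le> N \<longrightarrow>
     card {n. N - N div 4 < n \<and> n \<le> N \<and> (\<exists>z. z ^ 2 = x (Suc m) * x (Suc n))} \<le> 2 ^ card V"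
proof -
  \<comment> \<open>The escaping places. Outside \<open>E\<close> the bound 4 L^2 holds along the
    entire orbit.\<close>
  define E where "E = {v \<in> V. \<exists>j. place v (x j) \<ge> 4 * L ^ 2}"
  have finE: "finite E" using finite_V by (simp add: E_def)
  have "\<forall>v\<in>E. \<exists>j. place v (x j) \<ge> 4 * L ^ 2" by (auto simp: E_def)
  then obtain j where "\<forall>v\<in>E. place v (x (j v)) \<ge> 4 * L ^ 2" by (rule bchoice[THEN exE])
  hence j: "\<And>v. v \<in> E \<Longrightarrow> place v (x (j v)) \<ge> 4 * L ^ 2" by blast
  have hpow: "y ^ D = (y ^ h0) ^ 2" for y :: rat
    by (subst D(2)) (simp only: power_mult mult.commute[of 2])
  define M0 where "M0 = (\<Sum>v\<in>E. j v)"
  have M0: "j v \<le> M0" if "v \<in> E" for v unfolding M0_def using finE that by (intro member_le_sum) auto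
  obtain \<Lambda> :: nat where "real \<Lambda> \<ge> L" using real_arch_simple by blast
  moreover have "real \<Lambda> < 2 ^ \<Lambda>" by (rule of_nat_less_two_power)
  ultimately have \<Lambda>: "L \<le> 2 ^ \<Lambda>" by linarith
  \<comment> \<open>The size demanded at gap k is at most 2^(C0 D^(2k + 2)), and C0 < D^C0; so C0 +
    2k + 2 steps after the first escape are enough.\<close>
  define C0 where "C0 = \<Lambda> * 60 * (card V + 1)"
  have big: "place v (x n) > L ^ (60 * (D ^ Suc k) ^ 2 * (card V + 1))"
    if v: "v \<in> E" and n: "C0 + (2 * k + 2) + M0 \<le> n" for v n k
  proof -
    have vV: "v \<in> V" using v by (simp add: E_def)
    have "L ^ (60 * (D ^ Suc k) ^ 2 * (card V + 1)) \<le> (2 ^ \<Lambda>) ^ (60 * (D ^ Suc k) ^ 2 * (card V + 1))"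
      using \<Lambda> L_pos by (intro power_mono) auto
    also have "\<dots> = 2 ^ (C0 * (D ^ Suc k) ^ 2)"
      unfolding power_mult[symmetric] C0_def by (rule arg_cong[where f = "power 2"]) (simp add: algebra_simps)
    also have "C0 * (D ^ Suc k) ^ 2 < D ^ (n - j v)"
    proof -
      have "C0 < 2 ^ C0" by (rule less_exp)
      also have "(2::nat) ^ C0 \<le> D ^ C0" using D by (intro power_mono) auto
      finally have "C0 * (D ^ Suc k) ^ 2 < D ^ C0 * (D ^ Suc k) ^ 2" using D by (intro mult_strict_right_mono) auto
      also have "\<dots> = D ^ (C0 + (2 * k + 2))"
        unfolding power_mult[symmetric] power_add[symmetric] by (rule arg_cong[where f = "power D"]) simp
      also have "\<dots> \<le> D ^ (n - j v)" using n M0[OF v] D by (intro power_increasing) auto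
      finally show ?thesis .
    qed
    hence "(2::real) ^ (C0 * (D ^ Suc k) ^ 2) < 2 ^ (D ^ (n - j v))" by (intro power_strict_increasing) auto
    also have "\<dots> \<le> place v (x (j v + (n - j v)))" by (rule growth[OF absval_V[OF vV] j[OF v]])
    also have "j v + (n - j v) = n" using n M0[OF v] by simp
    finally show ?thesis .
  qed
  obtain v0 where v0: "v0 \<in> E" using escaping_place_exists by (auto simp: E_def)
  define \<eta> where "\<eta> n = x (Suc n) / (of_int c * x n ^ D)" for n
  have \<eta>: "place v (\<eta> n - 1) \<le> 1 / 10000" if v: "v \<in> E" and n: "C0 + 2 + M0 \<le> n" for v n
  proof -
    have "v \<in> V" using v by (simp add: E_def)
    then interpret absval "place v" by (rule absval_V)
    have "20000 * L ^ 2 \<le> L ^ 58 * L ^ 2"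
      using power_mono[of 2 L 58] L by (intro mult_right_mono) auto
    also have "\<dots> = L ^ 60" by (simp flip: power_add)
    also have "\<dots> \<le> L ^ (60 * (D ^ Suc 0) ^ 2 * (card V + 1))"
      using mult_le_mono[OF mult_le_mono[OF order_refl[of 60] one_le_power[of "D ^ Suc 0" 2]], of 1 "card V + 1"] D
      by (intro L_mono) simp
    also have "\<dots> < place v (x n)" using n by (intro big[OF v]) simp
    finally have X: "20000 * L ^ 2 < place v (x n)" .
    have L2: "L ^ 2 \<ge> 4" using power_mono[of 2 L 2] L by simp
    have "place v (\<eta> n - 1) \<le> 2 * l1_norm f ^ 2 / place v (x n)"
      unfolding \<eta>_def x_Suc c_def D_def using X L2 by (intro N_leading_term f_nz) linarith
    also have "\<dots> \<le> 2 * L ^ 2 / (20000 * L ^ 2)"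
      using X L L2 l1_norm_nonneg L_pos by (intro frac_le mult_left_mono power_mono) auto
    also have "\<dots> = 1 / 10000" using L_pos by simp
    finally show ?thesis .
  qed
  have nz: "x n \<noteq> 0" if "n \<ge> 2" for n using orbit_nonzero[OF that] by (simp add: x_def F_def)
  have main: "card {n. N - N div 4 < n \<and> n \<le> N \<and> (\<exists>z. z ^ 2 = x (Suc m) * x (Suc n))} \<le> 2 ^ card V"
    if N: "N \<ge> 4 * (C0 + M0 + 8)" and m: "N - N div 4 < m" "m \<le> N" for N m
  proof -
    define A where "A = {n. N - N div 4 < n \<and> n \<le> N \<and> (\<exists>z. z ^ 2 = x (Suc m) * x (Suc n))}"
    \<comment> \<open>Inside the window gaps are below N div 4 and indices exceed 3 (N div 4), so
      every index is at least C0 + M0 + 2k + 2.\<close>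
    have q: "4 * (N div 4) \<le> N" "C0 + M0 + 8 \<le> N div 4" using N by auto
    have I2: "n \<ge> 2 \<and> C0 + 2 + M0 \<le> n" if "N - N div 4 < n" for n using that q by linarith
    define zz where "zz n = (SOME z. z ^ 2 = x (Suc m) * x (Suc n))" for n
    have zz: "zz n ^ 2 = x (Suc m) * x (Suc n)" if "n \<in> A" for n
      using that unfolding A_def zz_def mem_Collect_eq by (elim conjE) (rule someI_ex)
    define \<omega> where "\<omega> n = zz n / (of_int c * x m ^ h0 * x n ^ h0)" for n
    have \<omega>2: "\<omega> n ^ 2 = \<eta> m * \<eta> n" if n: "n \<in> A" for n
    proof -
      have "\<omega> n ^ 2 = (x (Suc m) * x (Suc n)) / (of_int c ^ 2 * (x m ^ h0) ^ 2 * (x n ^ h0) ^ 2)"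
        unfolding \<omega>_def by (simp only: power_divide power_mult_distrib zz[OF n])
      also have "\<dots> = \<eta> m * \<eta> n"
        unfolding \<eta>_def hpow by (simp add: power2_eq_square)
      finally show ?thesis .
    qed
    define s where "s n = {v \<in> E. place v (\<omega> n - 1) \<le> 1 / 50}" for n
    have no: "s n \<noteq> s (n + k)" if n: "n \<in> A" "n + k \<in> A" "k \<ge> 1" for n k
    proof
      assume eq: "s n = s (n + k)"
      \<comment> \<open>The roots for (m, n) and (m, n + k) multiply to a root for (n, n + k) after
        dividing by the common point.\<close>
      define z where "z = zz n * zz (n + k) / x (Suc m)"
      have nI: "N - N div 4 < n" "n + k \<le> N" using n by (auto simp: A_def)
      have xm: "x (Suc m) \<noteq> 0" "x m \<noteq> 0" using I2[OF m(1)] by (auto intro!: nz)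
      have "z ^ 2 = (zz n ^ 2) * (zz (n + k) ^ 2) / x (Suc m) ^ 2"
        by (simp add: z_def power_mult_distrib power_divide)
      also have "\<dots> = x (Suc n) * x (Suc (n + k))"
        unfolding zz[OF n(1)] zz[OF n(2)] using xm by (simp add: power2_eq_square)
      finally have z2: "z ^ 2 = x (Suc n) * x (Suc (n + k))" .
      show False
      proof (rule no_square_pair[OF n(3) z2, of E v0])
        show "E \<subseteq> V" by (auto simp: E_def)
        show "v0 \<in> E" by (rule v0)
        show "place v (x n) > L ^ (60 * (D ^ Suc k) ^ 2 * (card V + 1))" if "v \<in> E" for v
          using nI q by (intro big[OF that]) linarith
        show "place v (x n) < 4 * L ^ 2" if "v \<in> V - E" for v n
          using that by (auto simp: E_def not_le)
        fix v assume v: "v \<in> E"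
        hence "v \<in> V" by (simp add: E_def)
        then interpret absval "place v" by (rule absval_V)
        have sg: "place v (\<omega> i - 1) \<le> 1 / 50 \<or> place v (\<omega> i + 1) \<le> 1 / 50" if "i \<in> A" for i
        proof (rule square_root_sign)
          show "\<omega> i ^ 2 = \<eta> m * \<eta> i" by (rule \<omega>2) fact
          show "place v (\<eta> m - 1) \<le> 1 / 10000" using I2[OF m(1)] by (intro \<eta>[OF v]) simp
          have "N - N div 4 < i" using that by (simp add: A_def)
          from I2[OF this] show "place v (\<eta> i - 1) \<le> 1 / 10000" by (intro \<eta>[OF v]) simp
        qed
        have "v \<in> s n \<longleftrightarrow> v \<in> s (n + k)" by (simp only: eq)
        hence "place v (\<omega> n - 1) \<le> 1 / 50 \<and> place v (\<omega> (n + k) - 1) \<le> 1 / 50 \<or>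
               place v (\<omega> n + 1) \<le> 1 / 50 \<and> place v (\<omega> (n + k) + 1) \<le> 1 / 50"
          using v sg[OF n(1)] sg[OF n(2)] by (auto simp: s_def)
        moreover have "place v (\<eta> m - 1) \<le> 1 / 10000" using I2[OF m(1)] by (intro \<eta>[OF v]) simp
        ultimately have "place v (\<omega> n * \<omega> (n + k) / \<eta> m - 1) \<le> 1 / 16" by (intro same_sign_quotient)
        moreover have "\<omega> n * \<omega> (n + k) / \<eta> m = z / (of_int c * x n ^ h0 * x (n + k) ^ h0)"
          unfolding \<omega>_def \<eta>_def z_def using xm c(1) unfolding hpow by (simp add: power2_eq_square)
        ultimately show "place v (z / (of_int c * x n ^ h0 * x (n + k) ^ h0) - 1) \<le> 1 / 16" by simp
      qed
    qed
    have "inj_on s A"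
    proof (rule linorder_inj_onI)
      fix n n' assume n: "n < n'" "n \<in> A" "n' \<in> A"
      thus "s n \<noteq> s n'" using no[of n "n' - n"] by simp
    qed auto
    moreover have "s ` A \<subseteq> Pow V" by (auto simp: s_def E_def)
    ultimately have "card A \<le> card (Pow V)" using finite_V by (intro card_inj_on_le) auto
    thus ?thesis using finite_V by (simp add: A_def card_Pow)
  qed
  show ?thesis by (rule exI[of _ "4 * (C0 + M0 + 8)"]) (use main in blast)
qed

end

section \<open>What dynamical irreducibility modulo one prime provides\<close>

lemma homogeneous_eval_rat:
  assumes "s \<noteq> 0"
  shows "of_int (homogeneous_eval P r s) = of_int s ^ degree P * eval_rat P (of_int r / of_int s)"
proof -
  have "of_int s ^ degree P * eval_rat P (of_int r / of_int s) =
      (\<Sum>i\<le>degree P. of_int s ^ degree P * (of_int (coeff P i) * (of_int r / of_int s) ^ i))"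
    by (simp add: poly_altdef sum_distrib_left)
  also have "\<dots> = (\<Sum>i\<le>degree P. of_int (coeff P i * r ^ i * s ^ (degree P - i)))"
  proof (intro sum.cong refl)
    fix i assume "i \<in> {..degree P}"
    hence "rat_of_int s ^ degree P = rat_of_int s ^ (degree P - i) * rat_of_int s ^ i" by (simp flip: power_add)
    thus "of_int s ^ degree P * (of_int (coeff P i) * (of_int r / of_int s) ^ i) =
        rat_of_int (coeff P i * r ^ i * s ^ (degree P - i))"
      using assms by (simp add: power_divide)
  qed
  finally show ?thesis by (simp add: homogeneous_eval_def)
qed

text \<open>The irreducible \<Phi> would divide T modulo p, hence \<Phi>^2 would divide M^2 f
  \<Phi>, and \<Phi> would divide M^2 f. That is nonzero modulo p and has smaller degree.\<close>

lemma dynamically_irreducible_not_square: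
  fixes f T :: "int poly" and M :: int
  assumes p: "prime p" and lc: "\<not> int p dvd lead_coeff f" and deg: "degree f \<ge> 2"
    and irr: "dynamically_irreducible_mod p f" and k: "k \<ge> 1" and M: "\<not> int p dvd M"
  shows "smult (M ^ 2) (f * poly_iterate (Suc k) f) \<noteq> T ^ 2"
proof
  define \<Phi> where "\<Phi> = poly_iterate (Suc k) f"
  assume "smult (M ^ 2) (f * poly_iterate (Suc k) f) = T ^ 2"
  hence eq: "smult (M ^ 2) f * \<Phi> = T * T" by (simp add: \<Phi>_def power2_eq_square)
  have pp: "prime (int p)" using p by simp
  have pelem: "prime_elem (of_nat p :: int poly)"
    using pp by (simp only: of_nat_poly prime_elem_const_poly_iff prime_imp_prime_elem)
  have lc\<Phi>: "\<not> int p dvd lead_coeff \<Phi>"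
    unfolding \<Phi>_def using deg by (intro lead_coeff_poly_iterate_not_dvd pp lc) simp
  interpret prime_ideal_mod "mod_ideal p \<Phi>"
    unfolding \<Phi>_def by (intro mod_ideal_prime p dynamically_irreducible_modD[OF irr]) simp
  have "T * T \<in> mod_ideal p \<Phi>" unfolding eq[symmetric] mod_ideal_def by (auto intro: exI[of _ "smult (M ^ 2) f"])
  hence "T \<in> mod_ideal p \<Phi>" using prime_mem by blast
  then obtain A where "of_nat p dvd T - A * \<Phi>" by (auto simp: mod_ideal_def)
  hence "of_nat p dvd (T - A * \<Phi>) * (T + A * \<Phi>)" by (rule dvd_mult2)
  also have "(T - A * \<Phi>) * (T + A * \<Phi>) = T * T - A * A * \<Phi> * \<Phi>" by (simp add: algebra_simps)
  also have "\<dots> = \<Phi> * (smult (M ^ 2) f - A * A * \<Phi>)" unfolding eq[symmetric] by (simp add: algebra_simps)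
  finally have "of_nat p dvd \<Phi> \<or> of_nat p dvd smult (M ^ 2) f - A * A * \<Phi>"
    using pelem by (rule prime_elem_dvd_multD[rotated])
  moreover have "\<not> of_nat p dvd \<Phi>" using lc\<Phi> by (auto simp: of_nat_dvd_int_poly_iff)
  ultimately have mem: "smult (M ^ 2) f \<in> mod_ideal p \<Phi>" by (auto simp: mod_ideal_def)
  have "degree (smult (M ^ 2) f) \<le> degree f ^ 1" by simp
  also have "degree f ^ 1 < degree f ^ Suc k" using deg k by (intro power_strict_increasing) auto
  also have "\<dots> = degree \<Phi>" unfolding \<Phi>_def by (rule degree_poly_iterate[symmetric])
  finally have "of_nat p dvd smult (M ^ 2) f" by (intro mod_ideal_degree_less[OF p lc\<Phi> mem]) simp
  hence "int p dvd M ^ 2 * lead_coeff f" by (auto simp: of_nat_dvd_int_poly_iff)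
  hence "int p dvd M ^ 2 \<or> int p dvd lead_coeff f" using prime_dvd_mult_iff[OF pp] by blast
  thus False using lc M prime_dvd_power[OF pp] by blast
qed

text \<open>The orbit avoids 0 because the corresponding Legendre symbols at p are -1 and not
  0.\<close>

lemma critical_orbit_dynamically_irreducible:
  fixes f g :: "int poly" and a b :: int
  assumes deriv: "pderiv f = g ^ 2 * [:b, a:]" and deg: "even (degree f)" "degree f \<ge> 2" and a: "a \<noteq> 0"
    and gamma: "\<not> pre_periodic (map_poly rat_of_int f) (- rat_of_int b / rat_of_int a)"
    and p: "prime p" "odd p" "\<not> int p dvd a" "\<not> int p dvd lead_coeff f"
    and irr: "dynamically_irreducible_mod p f"
  shows "critical_orbit f a b (int p)"
proof
  show "prime (int p)" using p by simp
  show "\<not> int p dvd 2"   proof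
    assume "int p dvd 2"
    hence "int p \<le> 2" by (rule zdvd_imp_le) simp
    hence "p = 2" using prime_gt_1_nat[OF p(1)] by linarith
    thus False using p(2) by simp
  qed
  show "smult (M ^ 2) (f * poly_iterate (Suc k) f) \<noteq> T ^ 2" if "k \<ge> 1" "\<not> int p dvd M" for k M T
    by (rule dynamically_irreducible_not_square[OF p(1,4) deg(2) irr that])
  show "eval_rat (poly_iterate m f) (- rat_of_int b / rat_of_int a) \<noteq> 0" if "m \<ge> 2" for m
  proof
    assume "eval_rat (poly_iterate m f) (- rat_of_int b / rat_of_int a) = 0"
    hence "homogeneous_eval (poly_iterate m f) (- b) a = 0"
      using homogeneous_eval_rat[OF a, of "poly_iterate m f" "- b"] by simp
    moreover have "Legendre (lead_coeff f * homogeneous_eval (poly_iterate m f) (- b) a) (int p) = - 1"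
      using deg by (intro Legendre_iterate_critical_point[OF deriv] p irr that) linarith+
    ultimately show False by (simp add: Legendre_def)
  qed
qed (use deg a gamma p in auto)

section \<open>The second moment of Legendre symbols\<close>

text \<open>The Legendre symbol in the modulus and the character \<kappa> agree at all primes: at 2
  and at the divisors of d both sides are 0. The conductor is 8 |d|, whence ln 8 + B.\<close>

lemma nonsquare_Legendre_sum_bound:
  fixes d :: int
  assumes GRH: generalised_riemann_hypothesis and Q: "Q \<ge> 3"
    and d: "d \<noteq> 0" "\<not> (\<exists>y. d = y ^ 2)" and B: "\<bar>real_of_int d\<bar> \<le> exp B"
  shows "(\<Sum>n. of_int (if odd n then Legendre d (int n) else 0) * prime_weight Q n)
    \<le> 2432 * (ln 8 + B + \<bar>analytic_const\<bar> + 2)"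
proof -
  obtain \<kappa> n where \<kappa>: "quadratic_character d \<kappa>" "\<kappa> n = - 1"
    using nonprincipal_quadratic_character[OF d] by blast
  define q where "q = 8 * nat \<bar>d\<bar>"
  have char: "real_character q \<kappa>" using \<kappa>(1) by (simp add: quadratic_character_def q_def)
  interpret nonprincipal_real_character q \<kappa>
    by unfold_locales (use char \<kappa>(2) in auto)
  have "of_int (if odd p then Legendre d (int p) else 0) * prime_weight Q p = of_int (\<kappa> p) * prime_weight Q p" for p
  proof (cases "prime p")
    case p: True
    have 0: "\<kappa> p \<noteq> 0 \<longleftrightarrow> coprime p q" using char unfolding real_character_def by blast
    show ?thesis
    proof (cases "even p \<or> int p dvd d")
      case True
      have "p dvd q"
      proof (cases "even p")
        case True
        hence "p = 2" using p primes_dvd_imp_eq[of 2 p] by auto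
        thus ?thesis by (simp add: q_def)
      next
        case False
        with True have "p dvd nat \<bar>d\<bar>" by simp
        thus ?thesis unfolding q_def by (rule dvd_mult)
      qed
      hence "\<not> coprime p q" using prime_gt_1_nat[OF p] coprime_common_divisor[of p q p] by auto
      hence "\<kappa> p = 0" using 0 by simp
      moreover have "(if odd p then Legendre d (int p) else 0) = 0"
        using True by (auto simp only: Legendre_0_iff split: if_split)
      ultimately show ?thesis by simp
    next
      case False
      hence "\<kappa> p = Legendre d (int p)" using \<kappa>(1) p unfolding quadratic_character_def by blast
      thus ?thesis using False by simp
    qed
  qed (simp add: prime_weight_def)
  hence "(\<Sum>n. of_int (if odd n then Legendre d (int n) else 0) * prime_weight Q n) = (\<Sum>n. of_int (\<kappa> n) * prime_weight Q n)"
    by presburger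
  also have "\<dots> \<le> 2432 * (ln (real q) + analytic_const + 2)"
    using weighted_character_sum_bound[OF GRH Q] by linarith
  also have "ln (real q) \<le> ln 8 + B"
  proof -
    have d1: "\<bar>real_of_int d\<bar> > 0" using d(1) by simp
    have "real q = 8 * \<bar>real_of_int d\<bar>" by (simp add: q_def)
    hence "ln (real q) = ln 8 + ln \<bar>real_of_int d\<bar>" using d1 by (simp add: ln_mult)
    also have "ln \<bar>real_of_int d\<bar> \<le> B" using d1 B ln_le_cancel_iff[of "\<bar>real_of_int d\<bar>" "exp B"] by simp
    finally show ?thesis by simp
  qed
  finally show ?thesis by simp
qed

text \<open>For a counted prime all symbols are -1, so the square of their sum is |J|^2. The
  remaining primes can be added by nonnegativity. After expansion each row has at most s square
  products, bounded by the diagonal estimate, and all other pairs fall under GRH.\<close>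

theorem second_moment_bound:
  fixes u :: "nat \<Rightarrow> int" and J X :: "nat set" and s :: nat
  assumes GRH: generalised_riemann_hypothesis and Q: "Q \<ge> 3" and J: "finite J" and X: "finite X"
    and u: "\<And>n. n \<in> J \<Longrightarrow> u n \<noteq> 0" "\<And>n. n \<in> J \<Longrightarrow> \<bar>real_of_int (u n)\<bar> \<le> exp B" and B: "B \<ge> 0"
    and squares: "\<And>m. m \<in> J \<Longrightarrow> card {n \<in> J. \<exists>y. u m * u n = y ^ 2} \<le> s"
    and prim: "\<And>p. p \<in> X \<Longrightarrow> prime p \<and> odd p \<and> Q \<le> real p \<and> real p \<le> 2 * Q"
    and Leg: "\<And>p n. p \<in> X \<Longrightarrow> n \<in> J \<Longrightarrow> Legendre (u n) (int p) = - 1"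
  shows "real (card X) * real (card J) ^ 2 * (exp (- 3) * (ln Q ^ 2 / Q))
    \<le> real (card J) * (real s * (diagonal_const * ln Q))
      + real (card J) ^ 2 * (2432 * (ln 8 + 2 * B + \<bar>analytic_const\<bar> + 2))"
proof -
  define W where "W = prime_weight Q"
  define t where "t m n p = of_int (if odd p then Legendre (u m * u n) (int p) else 0) * W p" for m n p
  define b where "b = 2432 * (ln 8 + 2 * B + \<bar>analytic_const\<bar> + 2)"
  define a where "a = diagonal_const * ln Q"
  have W0: "W p \<ge> 0" for p by (simp add: W_def prime_weight_nonneg)
  have sW: "summable W" unfolding W_def by (rule summable_prime_weight[OF Q])
  have t_le: "\<bar>t m n p\<bar> \<le> W p" for m n p
    using W0[of p] Legendre_values[of "u m * u n" "int p"] by (auto simp: t_def)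
  have st: "summable (t m n)" for m n
    by (rule summable_comparison_test'[OF sW]) (use t_le in auto)
  have t_any: "(\<Sum>p. t m n p) \<le> a" for m n
  proof -
    have "(\<Sum>p. t m n p) \<le> (\<Sum>p. W p)"
      by (rule suminf_le[OF _ st sW]) (use t_le abs_le_D1 in blast)
    thus ?thesis using prime_weight_sum_bound[OF Q] by (simp add: W_def a_def)
  qed
  have a0: "a \<ge> 0" using ln_ge_1[OF Q] by (simp add: a_def diagonal_const_def)
  have b0: "b \<ge> 0" using B by (simp add: b_def)
  have t_nonsquare: "(\<Sum>p. t m n p) \<le> b" if mn: "m \<in> J" "n \<in> J" "\<not> (\<exists>y. u m * u n = y ^ 2)" for m n
  proof -
    have "\<bar>real_of_int (u m)\<bar> * \<bar>real_of_int (u n)\<bar> \<le> exp B * exp B"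
      using u(2) mn by (intro mult_mono) auto
    hence "\<bar>real_of_int (u m * u n)\<bar> \<le> exp (2 * B)" by (simp add: abs_mult flip: exp_add)
    thus ?thesis unfolding t_def W_def b_def
      using u(1) mn by (intro nonsquare_Legendre_sum_bound[OF GRH Q]) auto
  qed
  have row: "(\<Sum>n\<in>J. \<Sum>p. t m n p) \<le> real s * a + real (card J) * b" if m: "m \<in> J" for m
  proof -
    let ?S = "{n \<in> J. \<exists>y. u m * u n = y ^ 2}"
    have "(\<Sum>n\<in>J. \<Sum>p. t m n p) \<le> (\<Sum>n\<in>J. (if n \<in> ?S then a else 0) + b)"
      using t_any t_nonsquare[OF m] a0 b0 by (intro sum_mono) (auto intro: add_increasing2)
    also have "\<dots> = real (card ?S) * a + real (card J) * b"
      using J by (simp add: sum.distrib sum.If_cases Int_def)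
    also have "real (card ?S) * a \<le> real s * a" using squares[OF m] a0 by (intro mult_right_mono) auto
    finally show ?thesis by simp
  qed
  have sumsq: "(\<Sum>m\<in>J. \<Sum>n\<in>J. t m n p) = (if prime p \<and> odd p then of_int (\<Sum>m\<in>J. Legendre (u m) (int p)) ^ 2 * W p else 0)" for p
  proof (cases "prime p \<and> odd p")
    case True
    hence "t m n p = of_int (Legendre (u m) (int p)) * of_int (Legendre (u n) (int p)) * W p" for m n
      by (simp add: t_def Legendre_mult)
    hence "(\<Sum>m\<in>J. \<Sum>n\<in>J. t m n p) =
        (\<Sum>m\<in>J. \<Sum>n\<in>J. of_int (Legendre (u m) (int p)) * of_int (Legendre (u n) (int p))) * W p"
      by (simp add: sum_distrib_right)
    thus ?thesis using True by (simp add: power2_eq_square sum_product)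
  next
    case False
    hence "t m n p = 0" for m n by (auto simp: t_def W_def prime_weight_def)
    thus ?thesis unfolding if_not_P[OF False] by simp
  qed
  have "real (card X) * real (card J) ^ 2 * (exp (- 3) * (ln Q ^ 2 / Q))
      = (\<Sum>p\<in>X. real (card J) ^ 2 * (exp (- 3) * (ln Q ^ 2 / Q)))" by simp
  also have "\<dots> \<le> (\<Sum>p\<in>X. \<Sum>m\<in>J. \<Sum>n\<in>J. t m n p)"
  proof (rule sum_mono)
    fix p assume p: "p \<in> X"
    have "exp (- 3) * (ln Q ^ 2 / Q) \<le> W p"
      unfolding W_def using prim[OF p] by (intro prime_weight_lower Q) auto
    moreover have "(\<Sum>m\<in>J. Legendre (u m) (int p)) = - int (card J)" using Leg[OF p] by simp
    hence "(\<Sum>m\<in>J. \<Sum>n\<in>J. t m n p) = real (card J) ^ 2 * W p"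
      unfolding sumsq using prim[OF p] by simp
    ultimately show "real (card J) ^ 2 * (exp (- 3) * (ln Q ^ 2 / Q)) \<le> (\<Sum>m\<in>J. \<Sum>n\<in>J. t m n p)"
      by (simp only: mult_left_mono[OF _ zero_le_power2])
  qed
  also have "\<dots> \<le> (\<Sum>p. \<Sum>m\<in>J. \<Sum>n\<in>J. t m n p)"
    using X W0 by (intro sum_le_suminf summable_sum st) (auto simp: sumsq)
  also have "\<dots> = (\<Sum>m\<in>J. \<Sum>n\<in>J. \<Sum>p. t m n p)"
    by (simp add: suminf_sum summable_sum st)
  also have "\<dots> \<le> (\<Sum>m\<in>J. real s * a + real (card J) * b)" by (intro sum_mono row)
  also have "\<dots> = real (card J) * (real s * a) + real (card J) ^ 2 * b"
    by (simp add: algebra_simps power2_eq_square)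
  finally show ?thesis by (simp add: a_def b_def)
qed

section \<open>Optimising the length of the orbit segment\<close>

text \<open>e < 3 because e^(1/4) \<le> 21/16 and (21/16)^4 < 3. Strictness makes ln ln Q positive
  on the whole range.\<close>

lemma ln_gt_1:
  assumes "Q \<ge> (3::real)"
  shows "ln Q > 1"
proof -
  have "exp (1 / 4 :: real) \<le> 1 + 1 / 4 + (1 / 4) ^ 2" by (rule exp_bound) auto
  hence "exp (1 / 4 :: real) ^ 4 \<le> (1 + 1 / 4 + (1 / 4) ^ 2) ^ 4" by (intro power_mono) auto
  moreover have "exp (1 / 4 :: real) ^ 4 = exp 1" by (simp flip: exp_of_nat_mult)
  ultimately have "exp 1 < (3::real)" by (simp add: power_divide field_simps)
  hence "exp 1 < Q" using assms by linarith
  thus ?thesis using assms ln_less_cancel_iff[of "exp 1" Q] by simp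
qed

text \<open>Both logarithms are at most sqrt Q. So the comparison function is at least 1, which lets
  a constant absorb bounded Q.\<close>

lemma ln_times_ln_ln_le:
  assumes "Q \<ge> (3::real)"
  shows "ln Q * ln (ln Q) \<le> Q"
proof -
  define y where "y = sqrt Q"
  have y: "y > 0" "Q = y ^ 2" using assms by (auto simp: y_def)
  have "ln y = ln (y / 2) + ln 2" using y by (simp add: ln_div)
  moreover have "ln (y / 2) \<le> y / 2 - 1" using y by (intro ln_le_minus_one) simp
  ultimately have "2 * ln y \<le> y" using ln_le_minus_one[of "2::real"] by simp
  moreover have "ln Q = 2 * ln y" using y by (simp add: ln_realpow)
  ultimately have l: "ln Q \<le> y" by simp
  have "ln (ln Q) \<le> ln Q - 1" using ln_gt_1[OF assms] by (intro ln_le_minus_one) simp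
  hence "ln (ln Q) \<le> y" using l by linarith
  hence "ln Q * ln (ln Q) \<le> y * y" using l ln_gt_1[OF assms] y by (intro mult_mono) auto
  thus ?thesis using y by (simp add: power2_eq_square)
qed

text \<open>With N about ln ln Q / (2 ln D) the conductor term D^N is at most sqrt (ln Q),
  negligible against the diagonal term ln Q / N. Dividing by the weight (ln Q)^2/Q of a single prime
  leaves Q/(ln Q ln ln Q).\<close>

lemma orbit_length_optimisation:
  fixes D N0 :: nat and A c1 c2 :: real
  assumes D: "D \<ge> 2" and A: "A \<ge> 0" and c: "c1 \<ge> 0" "c2 \<ge> 0"
  shows "\<exists>C Q1. \<forall>Q P::real. Q \<ge> Q1 \<longrightarrow> Q \<ge> 3 \<longrightarrow>
     (\<forall>N\<ge>N0. P * real (N div 4) ^ 2 * (exp (- 3) * (ln Q ^ 2 / Q))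
        \<le> real (N div 4) * (A * ln Q) + real (N div 4) ^ 2 * (c1 + c2 * real D ^ (N + 1))) \<longrightarrow>
     P \<le> C * (Q / (ln Q * ln (ln Q)))"
proof -
  define lD where "lD = ln (real D)"
  have lD: "lD > 0" using D by (simp add: lD_def)
  define C where "C = exp 3 * (A * (32 * lD) + 2 * (c1 + c2 * real D))"
  \<comment> \<open>Makes ln ln Q / (2 ln D) at least N0 + 8, so that N \<ge> N0 and N div 4 \<ge>
    2.\<close>
  define Q1 where "Q1 = exp (exp (2 * lD * (real N0 + 8)))"
  have "P \<le> C * (Q / (ln Q * ln (ln Q)))"
    if Q: "Q \<ge> Q1" "Q \<ge> 3" and P: "\<And>N. N \<ge> N0 \<Longrightarrow> P * real (N div 4) ^ 2 * (exp (- 3) * (ln Q ^ 2 / Q))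
        \<le> real (N div 4) * (A * ln Q) + real (N div 4) ^ 2 * (c1 + c2 * real D ^ (N + 1))" for Q P :: real
  proof -
    define y where "y = ln Q"
    define l where "l = ln y"
    have y1: "y > 1" unfolding y_def by (rule ln_gt_1[OF Q(2)])
    have l0: "l > 0" using y1 by (simp add: l_def)
    have "exp (2 * lD * (real N0 + 8)) \<le> y"
      unfolding y_def using Q by (subst ln_ge_iff) (auto simp: Q1_def)
    hence l_ge: "2 * lD * (real N0 + 8) \<le> l"
      unfolding l_def using y1 by (subst ln_ge_iff) auto
    define r where "r = l / (2 * lD)"
    have r: "real N0 + 8 \<le> r" unfolding r_def using l_ge lD by (subst pos_le_divide_eq) (auto simp: mult_ac)
    define N where "N = nat \<lfloor>r\<rfloor>"
    have N: "real N \<le> r" "r < real N + 1" using r by (auto simp: N_def)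
    have N_ge: "N \<ge> N0" "N \<ge> 8" using N r by linarith+
    define K where "K = real (N div 4)"
    have "N < 4 * (N div 4) + 4" "N div 4 \<ge> 2" using N_ge by auto
    hence "real N < 4 * K + 4" "K \<ge> 2" unfolding K_def by linarith+
    hence K: "r \<le> 8 * K" "K > 0" using N by linarith+
    hence "l \<le> 16 * lD * K" using lD by (simp add: r_def divide_le_eq mult_ac)
    hence lK: "1 / K \<le> 16 * lD / l" using K l0 lD by (simp add: pos_divide_le_eq pos_le_divide_eq mult_ac)
    have "real D ^ N = exp (real N * lD)" using D by (simp add: lD_def exp_of_nat_mult)
    also have "\<dots> \<le> exp (r * lD)" using N lD by (simp add: mult_right_mono)
    also have "r * lD = l / 2" using lD by (simp add: r_def)
    also have "exp (l / 2) = sqrt y"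
    proof -
      have "exp (l / 2) ^ 2 = y" using y1 by (simp add: l_def flip: exp_of_nat_mult)
      thus ?thesis using real_sqrt_unique by fastforce
    qed
    finally have DN: "real D ^ N \<le> sqrt y" .
    have sq: "sqrt y * sqrt y = y" "sqrt y \<ge> 1" using y1 by auto
    have "ln (sqrt y) \<le> sqrt y - 1" using sq by (intro ln_le_minus_one) linarith
    hence "l \<le> 2 * sqrt y" using y1 by (simp add: l_def ln_sqrt)
    hence "sqrt y * l \<le> sqrt y * (2 * sqrt y)" using sq by (intro mult_left_mono) auto
    also have "\<dots> = 2 * y" by (simp only: mult.left_commute[of "sqrt y"] sq(1))
    finally have sqy: "sqrt y \<le> 2 * y / l" using l0 by (subst pos_le_divide_eq)
    define G where "G = exp (- 3) * (y ^ 2 / Q)"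
    have G: "G > 0" using y1 Q by (simp add: G_def)
    have "P * G * K ^ 2 \<le> K * (A * y) + K ^ 2 * (c1 + c2 * real D ^ (N + 1))"
      using P[OF N_ge(1)] by (simp add: G_def K_def y_def mult_ac)
    also have "\<dots> = (A * y * (1 / K) + (c1 + c2 * real D ^ (N + 1))) * K ^ 2"
    proof -
      have "K * (A * y) = A * y * (1 / K) * K ^ 2" using K by (simp add: power2_eq_square)
      thus ?thesis by (simp only: distrib_right mult.commute[of "K ^ 2"])
    qed
    finally have "P * G \<le> A * y * (1 / K) + (c1 + c2 * real D ^ (N + 1))"
      using K by (intro mult_right_le_imp_le[of "P * G" "K ^ 2"]) auto
    also have "\<dots> \<le> A * y * (16 * lD / l) + (c1 + c2 * real D) * sqrt y"
    proof (rule add_mono)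
      show "A * y * (1 / K) \<le> A * y * (16 * lD / l)" using A y1 lK by (intro mult_left_mono) auto
      have "c2 * real D ^ (N + 1) = c2 * real D * real D ^ N" by simp
      also have "\<dots> \<le> c2 * real D * sqrt y" using DN c by (intro mult_left_mono) auto
      finally show "c1 + c2 * real D ^ (N + 1) \<le> (c1 + c2 * real D) * sqrt y"
        using mult_left_mono[OF sq(2) c(1)] by (simp add: algebra_simps)
    qed
    also have "\<dots> \<le> A * y * (16 * lD / l) + (c1 + c2 * real D) * (2 * y / l)"
      using sqy c by (intro add_left_mono mult_left_mono) auto
    also have "\<dots> = (A * (16 * lD) + 2 * (c1 + c2 * real D)) * (y / l)"
      by (simp add: algebra_simps add_divide_distrib)
    also have "\<dots> \<le> (A * (32 * lD) + 2 * (c1 + c2 * real D)) * (y / l)"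
      using A lD y1 l0 by (intro mult_right_mono add_right_mono mult_left_mono) auto
    also have "\<dots> = (C * exp (- 3)) * (y / l)" by (simp add: C_def exp_minus)
    also have "\<dots> = C * (Q / (y * l)) * G"
      using y1 Q l0 by (simp add: G_def power2_eq_square)
    finally have "P \<le> C * (Q / (y * l))" by (rule mult_right_le_imp_le[OF _ G])
    thus ?thesis by (simp only: y_def l_def)
  qed
  thus ?thesis by blast
qed

section \<open>The integers whose Legendre symbols are summed\<close>

lemma l1_norm_eq_sum: "l1_norm P = (\<Sum>i\<le>degree P. \<bar>of_int (coeff P i)\<bar>)"
proof (cases "P = 0")
  case False
  thus ?thesis
    by (simp add: l1_norm_def coeffs_def interv_sum_list_conv_sum_set_nat comp_def atLeast0LessThan lessThan_Suc_atMost
        del: upt_Suc)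
qed simp

lemma abs_homogeneous_eval_le:
  fixes r s :: int
  assumes B: "\<bar>real_of_int r\<bar> \<le> B" "\<bar>real_of_int s\<bar> \<le> B"
  shows "\<bar>real_of_int (homogeneous_eval P r s)\<bar> \<le> l1_norm P * B ^ degree P"
proof -
  have "\<bar>real_of_int (homogeneous_eval P r s)\<bar> \<le>
      (\<Sum>i\<le>degree P. \<bar>of_int (coeff P i) * of_int r ^ i * of_int s ^ (degree P - i)\<bar>)"
    unfolding homogeneous_eval_def of_int_sum of_int_mult of_int_power by (rule sum_abs)
  also have "\<dots> \<le> (\<Sum>i\<le>degree P. \<bar>of_int (coeff P i)\<bar> * B ^ degree P)"
  proof (rule sum_mono)
    fix i assume i: "i \<in> {..degree P}"
    have "\<bar>real_of_int r\<bar> ^ i * \<bar>real_of_int s\<bar> ^ (degree P - i) \<le> B ^ i * B ^ (degree P - i)"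
      using B by (intro mult_mono power_mono) auto
    also have "\<dots> = B ^ degree P" using i by (simp flip: power_add)
    finally show "\<bar>of_int (coeff P i) * of_int r ^ i * of_int s ^ (degree P - i)\<bar> \<le> \<bar>of_int (coeff P i)\<bar> * B ^ degree P"
      unfolding abs_mult power_abs mult.assoc by (intro mult_left_mono) auto
  qed
  also have "\<dots> = l1_norm P * B ^ degree P" by (simp add: l1_norm_eq_sum sum_distrib_right)
  finally show ?thesis .
qed

context critical_orbit
begin

text \<open>The index is shifted so that i \<ge> 1 corresponds to the iterates of index at least 2,
  for which the symbol is known to be -1.\<close>

definition "u i = lead_coeff f * homogeneous_eval (F (Suc i)) (- b) a"

lemma u_rat: "rat_of_int (u i) = of_int c * of_int a ^ (D ^ Suc i) * x (Suc i)"
  unfolding u_def c_def x_def of_int_mult homogeneous_eval_rat[OF a] by (simp add: degF)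

lemma u_nonzero: "i \<ge> 1 \<Longrightarrow> u i \<noteq> 0"
  using u_rat[of i] orbit_nonzero[of "Suc i"] c(1) a by (auto simp: x_def F_def)

lemma u_bound: "\<exists>C\<ge>0. \<forall>i. \<bar>real_of_int (u i)\<bar> \<le> exp (C * real D ^ Suc i)"
proof -
  define B where "B = \<bar>real_of_int a\<bar> + \<bar>real_of_int b\<bar>"
  have B1: "B \<ge> 1" using a by (simp add: B_def)
  define Y where "Y = L * L * B"
  have Y1: "Y \<ge> 1"
  proof -
    have "1 * 1 * 1 \<le> Y" unfolding Y_def using L B1 by (intro mult_mono) auto
    thus ?thesis by simp
  qed
  have "\<bar>real_of_int (u i)\<bar> \<le> exp (ln Y * real D ^ Suc i)" for i
  proof -
    define e where "e = D ^ Suc i"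
    have "e \<ge> 1" using D by (simp add: e_def)
    hence "\<bar>of_int c\<bar> \<le> L ^ e" using c L_mono[of 1 e] by simp
    moreover have "\<bar>real_of_int (homogeneous_eval (F (Suc i)) (- b) a)\<bar> \<le> l1_norm (F (Suc i)) * B ^ e"
      using abs_homogeneous_eval_le[of "- b" B a "F (Suc i)"] by (simp add: B_def e_def degF)
    moreover have "l1_norm (F (Suc i)) * B ^ e \<le> L ^ e * B ^ e"
      unfolding e_def by (rule mult_right_mono[OF l1_norm_F]) (use B1 in simp)
    ultimately have "\<bar>of_int c\<bar> * \<bar>real_of_int (homogeneous_eval (F (Suc i)) (- b) a)\<bar> \<le> L ^ e * (L ^ e * B ^ e)"
      using L_pos by (intro mult_mono) auto
    hence "\<bar>real_of_int (u i)\<bar> \<le> Y ^ e"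
      by (simp add: u_def c_def[symmetric] abs_mult Y_def power_mult_distrib mult_ac)
    also have "\<dots> = exp (real e * ln Y)" using Y1 by (simp add: exp_of_nat_mult)
    finally show ?thesis by (simp add: e_def mult_ac)
  qed
  thus ?thesis using Y1 by (intro exI[of _ "ln Y"]) auto
qed

text \<open>The powers of \<open>a\<close> that clear denominators have even exponent, and the
  leading coefficient occurs twice, so square classes of products of the u i are those of products
  of orbit points.\<close>

lemma square_product_orbit:
  assumes "u i * u j = y ^ 2"
  shows "\<exists>z. z ^ 2 = x (Suc i) * x (Suc j)"
proof -
  have even: "\<exists>e. D ^ Suc n = 2 * e" for n using D(2) by (intro exI[of _ "h0 * D ^ n"]) simp
  obtain e e' where e: "D ^ Suc i = 2 * e" "D ^ Suc j = 2 * e'" using even by blast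
  define w where "w = rat_of_int c * of_int a ^ e * of_int a ^ e'"
  have w: "w \<noteq> 0" using c(1) a by (simp add: w_def)
  have "rat_of_int (u i) * rat_of_int (u j) = of_int y ^ 2" using assms by (metis of_int_mult of_int_power)
  moreover have "rat_of_int (u i) * rat_of_int (u j) = w ^ 2 * (x (Suc i) * x (Suc j))"
    unfolding u_rat e w_def by (simp add: power_mult power2_eq_square power_mult_distrib mult_ac)
  ultimately have "(of_int y / w) ^ 2 = w ^ 2 * (x (Suc i) * x (Suc j)) / w ^ 2"
    by (simp only: power_divide)
  hence "(of_int y / w) ^ 2 = x (Suc i) * x (Suc j)" using w by simp
  thus ?thesis by blast
qed

end

section \<open>The degree of f and the final count\<close>

lemma pre_periodic_degree_0:
  fixes f :: "rat poly"
  assumes "degree f = 0"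
  shows "pre_periodic f y"
proof -
  obtain c where f: "f = [:c:]" using assms by (rule degree_eq_zeroE)
  have "poly (poly_iterate n f) y \<in> {y, c}" for n by (cases n) (simp_all add: f)
  hence "{poly (poly_iterate n f) y | n. True} \<subseteq> {y, c}" by blast
  thus ?thesis unfolding pre_periodic_def by (rule finite_subset) simp
qed

text \<open>A square times a linear form has odd degree, so f has even degree; this parity is what
  the nonresidue argument rests on.\<close>

lemma degree_from_pderiv:
  fixes f g :: "int poly"
  assumes "pderiv f = g ^ 2 * [:b, a:]" "a \<noteq> 0" "degree f \<noteq> 0"
  shows "even (degree f)" "degree f \<ge> 2"
proof -
  have g: "g \<noteq> 0" using assms pderiv_eq_0_iff[of f] by auto
  have "degree f - 1 = degree (g ^ 2 * [:b, a:])" unfolding assms(1)[symmetric] by (rule degree_pderiv[symmetric])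
  also have "\<dots> = degree (g ^ 2) + degree [:b, a:]" using g assms(2) by (intro degree_mult_eq) auto
  also have "\<dots> = 2 * degree g + 1" using g assms(2) by (simp add: degree_power_eq)
  finally have "degree f - 1 = 2 * degree g + 1" .
  hence "degree f = 2 * (degree g + 1)" using assms(3) by (cases "degree f") simp_all
  thus "even (degree f)" "degree f \<ge> 2" by auto
qed

theorem theorem1p4:
  fixes f g :: "int poly" and a b :: int
  assumes GRH: "generalised_riemann_hypothesis"
    and deriv: "pderiv f = g ^ 2 * [:b, a:]"
    and a: "a \<noteq> 0"
    and gamma: "\<not> pre_periodic (map_poly rat_of_int f) (- rat_of_int b / rat_of_int a)"
  shows "\<exists>C::real. \<forall>Q::real. Q \<ge> 3 \<longrightarrow>
           real (dyn_irred_prime_count f Q) \<le> C * (Q / (ln Q * ln (ln Q)))"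
proof -
  have "degree f \<noteq> 0"
    using gamma pre_periodic_degree_0[of "map_poly rat_of_int f"] by auto
  note deg = degree_from_pderiv[OF deriv a this]
  define X where "X Q = {p::nat. prime p \<and> Q \<le> real p \<and> real p \<le> 2 * Q \<and> dynamically_irreducible_mod p f}" for Q :: real
  have count: "dyn_irred_prime_count f Q = card (X Q)" for Q by (simp add: dyn_irred_prime_count_def X_def)
  have X_sub: "X Q \<subseteq> {..nat \<lfloor>2 * Q\<rfloor>}" for Q by (auto simp: X_def le_nat_floor)
  hence finX: "finite (X Q)" for Q by (rule finite_subset) simp
  \<comment> \<open>Primes of this size are odd and divide neither \<open>a\<close> nor the leading
    coefficient.\<close>
  define Q2 where "Q2 = 3 + \<bar>real_of_int a\<bar> + \<bar>real_of_int (lead_coeff f)\<bar>"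
  have good: "prime p \<and> odd p \<and> \<not> int p dvd a \<and> \<not> int p dvd lead_coeff f"
    if p: "p \<in> X Q" and Q: "Q \<ge> Q2" for p Q
  proof -
    have pp: "prime p" and Qp: "Q \<le> real p" using p by (auto simp: X_def)
    have nd: "\<not> int p dvd n" if "n \<noteq> 0" "real_of_int \<bar>n\<bar> < real p" for n
      using dvd_imp_le_int[of n "int p"] that by auto
    have "real p \<ge> 3 + \<bar>real_of_int a\<bar> + \<bar>real_of_int (lead_coeff f)\<bar>" using Q Qp by (simp add: Q2_def)
    hence "real_of_int \<bar>a\<bar> < real p" "real_of_int \<bar>lead_coeff f\<bar> < real p" "p > 2" by auto
    moreover have "lead_coeff f \<noteq> 0" using \<open>degree f \<noteq> 0\<close> by auto
    ultimately show ?thesis using nd a pp prime_odd_nat[OF pp] by blast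
  qed
  have "\<exists>C Q1. \<forall>Q. Q \<ge> Q1 \<longrightarrow> Q \<ge> 3 \<longrightarrow> real (card (X Q)) \<le> C * (Q / (ln Q * ln (ln Q)))"
  \<comment> \<open>Without any suitable prime beyond Q2 the count vanishes there. Otherwise one
    such prime supplies the nonsquare condition, and the resulting constants do not depend on
    Q.\<close>
  proof (cases "\<exists>Q\<ge>Q2. X Q \<noteq> {}")
    case False
    hence "card (X Q) = 0" if "Q \<ge> Q2" for Q using that by simp
    thus ?thesis by (intro exI[of _ 0] exI[of _ Q2]) simp
  next
    case True
    then obtain Q0 p0 where p0: "p0 \<in> X Q0" "Q0 \<ge> Q2" by blast
    interpret critical_orbit f a b "int p0"
      using good[OF p0] p0(1)
      by (intro critical_orbit_dynamically_irreducible[OF deriv deg a gamma]) (auto simp: X_def)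
    obtain N0 where N0: "\<And>N m. N \<ge> N0 \<Longrightarrow> N - N div 4 < m \<Longrightarrow> m \<le> N \<Longrightarrow>
        card {n. N - N div 4 < n \<and> n \<le> N \<and> (\<exists>z. z ^ 2 = x (Suc m) * x (Suc n))} \<le> 2 ^ card V"
      using few_square_partners by blast
    obtain c where c: "c \<ge> 0" "\<And>i. \<bar>real_of_int (u i)\<bar> \<le> exp (c * real D ^ Suc i)"
      using u_bound by blast
    define A where "A = real (2 ^ card V) * diagonal_const"
    define c1 where "c1 = 2432 * (ln 8 + \<bar>analytic_const\<bar> + 2)"
    define c2 where "c2 = 2432 * (2 * c)"
    have "A \<ge> 0" "c1 \<ge> 0" "c2 \<ge> 0" using c(1) by (auto simp: A_def c1_def c2_def diagonal_const_def)
    from orbit_length_optimisation[OF D(1) this, of N0] obtain C Q1 where CQ: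
      "\<And>Q P. Q \<ge> Q1 \<Longrightarrow> Q \<ge> 3 \<Longrightarrow> (\<And>N. N \<ge> N0 \<Longrightarrow>
         P * real (N div 4) ^ 2 * (exp (- 3) * (ln Q ^ 2 / Q))
           \<le> real (N div 4) * (A * ln Q) + real (N div 4) ^ 2 * (c1 + c2 * real D ^ (N + 1))) \<Longrightarrow>
         P \<le> C * (Q / (ln Q * ln (ln Q)))" by blast
    have "real (card (X Q)) \<le> C * (Q / (ln Q * ln (ln Q)))" if Q: "Q \<ge> max Q1 Q2" "Q \<ge> 3" for Q
    proof (rule CQ)
      show "Q \<ge> Q1" "Q \<ge> 3" using Q by auto
      fix N assume N: "N \<ge> N0"
      define J where "J = {N - N div 4<..N}"
      have cardJ: "card J = N div 4" by (simp add: J_def)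
      have J1: "n \<ge> 1" if "n \<in> J" for n using that by (simp add: J_def)
      have "real (card (X Q)) * real (card J) ^ 2 * (exp (- 3) * (ln Q ^ 2 / Q))
          \<le> real (card J) * (real (2 ^ card V) * (diagonal_const * ln Q))
            + real (card J) ^ 2 * (2432 * (ln 8 + 2 * (c * real D ^ (N + 1)) + \<bar>analytic_const\<bar> + 2))"
      proof (rule second_moment_bound[OF GRH Q(2)])
        show "finite J" "finite (X Q)" by (auto simp: J_def finX)
        show "u n \<noteq> 0" if "n \<in> J" for n by (rule u_nonzero[OF J1[OF that]])
        show "\<bar>real_of_int (u n)\<bar> \<le> exp (c * real D ^ (N + 1))" if "n \<in> J" for n
        proof -
          have "c * real D ^ Suc n \<le> c * real D ^ (N + 1)"
            using that c(1) D(1) by (intro mult_left_mono power_increasing) (auto simp: J_def)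
          hence "exp (c * real D ^ Suc n) \<le> exp (c * real D ^ (N + 1))" by (subst exp_le_cancel_iff)
          thus ?thesis using c(2)[of n] by linarith
        qed
        show "c * real D ^ (N + 1) \<ge> 0" using c(1) by simp
        show "card {n \<in> J. \<exists>y. u m * u n = y ^ 2} \<le> 2 ^ card V" if m: "m \<in> J" for m
        proof -
          have "card {n \<in> J. \<exists>y. u m * u n = y ^ 2} \<le>
              card {n. N - N div 4 < n \<and> n \<le> N \<and> (\<exists>z. z ^ 2 = x (Suc m) * x (Suc n))}"
            using square_product_orbit by (intro card_mono finite_subset[OF _ finite_atMost[of N]]) (auto simp: J_def)
          also have "\<dots> \<le> 2 ^ card V" using m by (intro N0[OF N]) (auto simp: J_def)
          finally show ?thesis .
        qed
        show "prime p \<and> odd p \<and> Q \<le> real p \<and> real p \<le> 2 * Q" if "p \<in> X Q" for p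
          using good[OF that] that Q by (auto simp: X_def)
        show "Legendre (u n) (int p) = - 1" if p: "p \<in> X Q" and n: "n \<in> J" for p n
        proof -
          have "dynamically_irreducible_mod p f" using p by (simp add: X_def)
          moreover have "Suc n \<ge> 2" using J1[OF n] by simp
          moreover have "degree f > 0" using deg(2) by linarith
          ultimately show ?thesis
            unfolding u_def F_def using good[OF p] Q deg(1)
            by (intro Legendre_iterate_critical_point[OF deriv]) auto
        qed
      qed
      moreover have "2432 * (l + 2 * (c * d) + k + 2) = 2432 * (l + k + 2) + 2432 * (2 * c) * d" for l d k :: real
        by (simp add: algebra_simps)
      ultimately show "real (card (X Q)) * real (N div 4) ^ 2 * (exp (- 3) * (ln Q ^ 2 / Q))
          \<le> real (N div 4) * (A * ln Q) + real (N div 4) ^ 2 * (c1 + c2 * real D ^ (N + 1))"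
        unfolding cardJ A_def c1_def c2_def by (simp only: mult.assoc)
    qed
    thus ?thesis by (intro exI[of _ C] exI[of _ "max Q1 Q2"] allI impI)
  qed
  then obtain C Q1 where CQ: "\<And>Q. Q \<ge> Q1 \<Longrightarrow> Q \<ge> 3 \<Longrightarrow> real (card (X Q)) \<le> C * (Q / (ln Q * ln (ln Q)))"
    by blast
  \<comment> \<open>For Q < Q1 the trivial count 2Q + 1 is at most 2 |Q1| + 1, and the comparison
    function is at least 1.\<close>
  define C' where "C' = max C (2 * \<bar>Q1\<bar> + 1)"
  have "real (dyn_irred_prime_count f Q) \<le> C' * (Q / (ln Q * ln (ln Q)))" if Q: "Q \<ge> 3" for Q
  proof -
    have pos: "ln Q * ln (ln Q) > 0" using ln_gt_1[OF Q] by simp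
    hence ge_1: "Q / (ln Q * ln (ln Q)) \<ge> 1" using ln_times_ln_ln_le[OF Q] by simp
    show ?thesis
    proof (cases "Q \<ge> Q1")
      case True
      have "C * (Q / (ln Q * ln (ln Q))) \<le> C' * (Q / (ln Q * ln (ln Q)))"
        using ge_1 by (intro mult_right_mono) (auto simp: C'_def)
      thus ?thesis using CQ[OF True Q] by (simp add: count)
    next
      case False
      have "card (X Q) \<le> card {..nat \<lfloor>2 * Q\<rfloor>}" by (intro card_mono X_sub) simp
      hence "card (X Q) \<le> Suc (nat \<lfloor>2 * Q\<rfloor>)" by simp
      hence "real (card (X Q)) \<le> 1 + real (nat \<lfloor>2 * Q\<rfloor>)" by linarith
      also have "\<dots> \<le> 1 + 2 * Q" using Q by simp
      also have "\<dots> \<le> 2 * \<bar>Q1\<bar> + 1" using False by linarith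
      also have "\<dots> \<le> C' * 1" by (simp add: C'_def)
      finally have "real (card (X Q)) \<le> C' * 1" .
      also have "\<dots> \<le> C' * (Q / (ln Q * ln (ln Q)))"
        using ge_1 by (intro mult_left_mono) (auto simp: C'_def)
      finally show ?thesis by (simp add: count)
    qed
  qed
  thus ?thesis by (intro exI[of _ C'] allI impI)
qed

end
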